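(* Let $k$ be a field. If $\Lambda$ is a finite dimensional selfinjective $k$-algebra, and $B$ is a finitely generated $\Lambda$-$\Lambda$-bimodule, then there are isomorphisms of vector spaces $$\widehat{\mathrm{HH}}_n(\Lambda,B) \cong \widehat{\mathrm{Tor}}^{\Lambda^{e}}_{-(n+1)}(\Lambda^*, D(B)),$$ $$\widehat{\mathrm{HH}}^n(\Lambda,B) \cong \widehat{\mathrm{Ext}}_{\Lambda^{e}}^{-(n+1)}\left(B, D(\Lambda^* )\right)$$ for all $n\in\mathbb{Z}$, where $(-)^*=\mathrm{Hom}_{\Lambda^{e}}(-,\Lambda^{e})$. In particular, there are isomorphisms $$\widehat{\mathrm{HH}}_n(\Lambda,\Lambda) \cong \widehat{\mathrm{Tor}}^{\Lambda^{e}}_{-(n+1)}(\Lambda^*, D(\Lambda)),$$ $$\widehat{\mathrm{HH}}^n(\Lambda,\Lambda) \cong \widehat{\mathrm{HH}}^{-(n+1)}\left(\Lambda, D(\Lambda^* )\right)$$ for all $n\in\mathbb{Z}$.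
   Context: $D(-)=\mathrm{Hom}_k(-,k)$. $\Lambda^e=\Lambda\otimes_k\Lambda^{op}$ is the enveloping algebra (selfinjective when $\Lambda$ is); a bimodule $B$ is a left $\Lambda^e$-module via $(\lambda\otimes\lambda')b=\lambda b\lambda'$ and a right $\Lambda^e$-module via $b(\lambda\otimes\lambda')=\lambda'b\lambda$. Over a finite dimensional selfinjective algebra $\Gamma$, every finitely generated left module $M$ has a complete resolution: an acyclic complex $\mathbb{T}$ of finitely generated projective modules, indexed by $\mathbb{Z}$, such that $\mathrm{Hom}_\Gamma(\mathbb{T},\Gamma)$ is acyclic and such that there are a projective resolution $\mathbb{P}$ of $M$ and a chain map $f\colon\mathbb{T}\to\mathbb{P}$ with $f_n$ bijective for $n\ge 0$. For $n\in\mathbb{Z}$ one sets $\widehat{\mathrm{Ext}}^n_\Gamma(M,N)=H^n(\mathrm{Hom}_\Gamma(\mathbb{T},N))$ for left modules $N$ and $\widehat{\mathrm{Tor}}^\Gamma_n(N,M)=H_n(N\otimes_\Gamma\mathbb{T})$ for right modules $N$. The Tate-Hochschild groups are $\widehat{\mathrm{HH}}^n(\Lambda,B)=\widehat{\mathrm{Ext}}^n_{\Lambda^e}(\Lambda,B)$ and $\widehat{\mathrm{HH}}_n(\Lambda,B)=\widehat{\mathrm{Tor}}^{\Lambda^e}_n(B,\Lambda)$. *)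

theory Defs
  imports "HOL-Algebra.Module" "HOL-Algebra.AbelCoset"
begin

section \<open>Modules over arbitrary rings, algebras over a field\<close>

text \<open>
  The library locale \<open>module\<close> only covers commutative base rings, so modules over an arbitrary
  ring are introduced here, on the same record.  A right \<open>R\<close>-module is a left module over
  \<open>opp R\<close>: in its record the field \<open>smult\<close> is the right action, \<open>r \<odot> x\<close> standing for \<open>x r\<close>.
\<close>

locale left_module = R?: ring R + M?: abelian_group M
  for R :: "('a, 'z) ring_scheme" (structure) and M :: "('a, 'm, 'w) module_scheme" (structure) +
  assumes smult_closed:
      "\<lbrakk>a \<in> carrier R; x \<in> carrier M\<rbrakk> \<Longrightarrow> a \<odot>\<^bsub>M\<^esub> x \<in> carrier M"
    and smult_l_distr:
      "\<lbrakk>a \<in> carrier R; b \<in> carrier R; x \<in> carrier M\<rbrakk> \<Longrightarrow>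
        (a \<oplus> b) \<odot>\<^bsub>M\<^esub> x = a \<odot>\<^bsub>M\<^esub> x \<oplus>\<^bsub>M\<^esub> b \<odot>\<^bsub>M\<^esub> x"
    and smult_r_distr:
      "\<lbrakk>a \<in> carrier R; x \<in> carrier M; y \<in> carrier M\<rbrakk> \<Longrightarrow>
        a \<odot>\<^bsub>M\<^esub> (x \<oplus>\<^bsub>M\<^esub> y) = a \<odot>\<^bsub>M\<^esub> x \<oplus>\<^bsub>M\<^esub> a \<odot>\<^bsub>M\<^esub> y"
    and smult_assoc1:
      "\<lbrakk>a \<in> carrier R; b \<in> carrier R; x \<in> carrier M\<rbrakk> \<Longrightarrow>
        (a \<otimes> b) \<odot>\<^bsub>M\<^esub> x = a \<odot>\<^bsub>M\<^esub> (b \<odot>\<^bsub>M\<^esub> x)"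
    and smult_one: "x \<in> carrier M \<Longrightarrow> \<one> \<odot>\<^bsub>M\<^esub> x = x"

definition opp :: "('a, 'z) ring_scheme \<Rightarrow> ('a, 'z) ring_scheme" where
  "opp R = R\<lparr>mult := (\<lambda>x y. y \<otimes>\<^bsub>R\<^esub> x)\<rparr>"

text \<open>The unused multiplicative fields of a module record are left unspecified.\<close>

definition mk_module ::
  "'m set \<Rightarrow> 'm \<Rightarrow> ('m \<Rightarrow> 'm \<Rightarrow> 'm) \<Rightarrow> ('r \<Rightarrow> 'm \<Rightarrow> 'm) \<Rightarrow> ('r, 'm) module" where
  "mk_module C z a s =
     \<lparr>carrier = C, mult = (\<lambda>_ _. undefined), one = undefined, zero = z, add = a, smult = s\<rparr>"

definition self_module :: "('a, 'z) ring_scheme \<Rightarrow> ('a, 'a) module" where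
  "self_module R =
     \<lparr>carrier = carrier R, mult = mult R, one = one R, zero = zero R, add = add R, smult = mult R\<rparr>"

definition mod_hom ::
  "('r, 'z) ring_scheme \<Rightarrow> ('r, 'm) module \<Rightarrow> ('r, 'n) module \<Rightarrow> ('m \<Rightarrow> 'n) set" where
  "mod_hom R M N = {f \<in> carrier M \<rightarrow>\<^sub>E carrier N.
     (\<forall>x\<in>carrier M. \<forall>y\<in>carrier M. f (x \<oplus>\<^bsub>M\<^esub> y) = f x \<oplus>\<^bsub>N\<^esub> f y) \<and>
     (\<forall>r\<in>carrier R. \<forall>x\<in>carrier M. f (r \<odot>\<^bsub>M\<^esub> x) = r \<odot>\<^bsub>N\<^esub> f x)}"

definition mod_iso :: "('r, 'z) ring_scheme \<Rightarrow> ('r, 'm) module \<Rightarrow> ('r, 'n) module \<Rightarrow> bool" where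
  "mod_iso R M N \<longleftrightarrow> left_module R M \<and> left_module R N \<and>
     (\<exists>f\<in>mod_hom R M N. bij_betw f (carrier M) (carrier N))"

definition fin_gen :: "('r, 'z) ring_scheme \<Rightarrow> ('r, 'm) module \<Rightarrow> bool" where
  "fin_gen R M \<longleftrightarrow> (\<exists>S. finite S \<and> S \<subseteq> carrier M \<and>
     (\<forall>x\<in>carrier M. \<exists>c\<in>S \<rightarrow> carrier R. x = (\<Oplus>\<^bsub>M\<^esub>s\<in>S. c s \<odot>\<^bsub>M\<^esub> s)))"

text \<open>
  Injectivity and projectivity are the usual extension and lifting properties.  HOL requires a
  carrier type for the test modules; \<open>nat \<Rightarrow> 'r\<close> contains a copy of every finitely generated module
  over a ring with elements in \<open>'r\<close>, and of all its submodules.  This makes \<open>injective\<close>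
  equivalent to unrestricted injectivity (Baer's criterion) and \<open>projective\<close> equivalent to
  unrestricted projectivity for finitely generated modules, the only ones it is applied to.
\<close>

definition injective :: "('r, 'z) ring_scheme \<Rightarrow> ('r, 'm) module \<Rightarrow> bool" where
  "injective R I \<longleftrightarrow> left_module R I \<and>
     (\<forall>(M :: ('r, nat \<Rightarrow> 'r) module) (N :: ('r, nat \<Rightarrow> 'r) module).
        left_module R M \<longrightarrow> left_module R N \<longrightarrow>
        (\<forall>g\<in>mod_hom R M N. \<forall>f\<in>mod_hom R M I. inj_on g (carrier M) \<longrightarrow>
           (\<exists>h\<in>mod_hom R N I. \<forall>x\<in>carrier M. h (g x) = f x)))"

definition projective :: "('r, 'z) ring_scheme \<Rightarrow> ('r, 'm) module \<Rightarrow> bool" where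
  "projective R P \<longleftrightarrow> left_module R P \<and>
     (\<forall>(M :: ('r, nat \<Rightarrow> 'r) module) (N :: ('r, nat \<Rightarrow> 'r) module).
        left_module R M \<longrightarrow> left_module R N \<longrightarrow>
        (\<forall>g\<in>mod_hom R M N. \<forall>f\<in>mod_hom R P N. g ` carrier M = carrier N \<longrightarrow>
           (\<exists>h\<in>mod_hom R P M. \<forall>x\<in>carrier P. g (h x) = f x)))"

text \<open>For finite dimensional algebras injectivity on either side implies the other.\<close>

definition selfinjective :: "('a, 'z) ring_scheme \<Rightarrow> bool" where
  "selfinjective R \<longleftrightarrow> injective R (self_module R) \<and> injective (opp R) (self_module (opp R))"

text \<open>The library locale \<open>algebra\<close> with the commutativity of the algebra dropped.\<close>

locale k_algebra = module R M + ring M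
  for R :: "('a, 'z) ring_scheme" (structure) and M :: "('a, 'm, 'w) module_scheme" (structure) +
  assumes smult_mult_left:
      "\<lbrakk>a \<in> carrier R; x \<in> carrier M; y \<in> carrier M\<rbrakk> \<Longrightarrow>
        (a \<odot>\<^bsub>M\<^esub> x) \<otimes>\<^bsub>M\<^esub> y = a \<odot>\<^bsub>M\<^esub> (x \<otimes>\<^bsub>M\<^esub> y)"
    and smult_mult_right:
      "\<lbrakk>a \<in> carrier R; x \<in> carrier M; y \<in> carrier M\<rbrakk> \<Longrightarrow>
        x \<otimes>\<^bsub>M\<^esub> (a \<odot>\<^bsub>M\<^esub> y) = a \<odot>\<^bsub>M\<^esub> (x \<otimes>\<^bsub>M\<^esub> y)"

text \<open>The \<open>k\<close>-vector space underlying a (left or right) module over a \<open>k\<close>-algebra.\<close>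

definition scalars :: "('k, 'a) module \<Rightarrow> ('a, 'm) module \<Rightarrow> ('k, 'm) module" where
  "scalars A M = mk_module (carrier M) (zero M) (add M) (\<lambda>c x. (c \<odot>\<^bsub>A\<^esub> \<one>\<^bsub>A\<^esub>) \<odot>\<^bsub>M\<^esub> x)"


section \<open>Hom spaces and duals\<close>

definition hom_space ::
  "('k, 'a) module \<Rightarrow> ('a, 'm) module \<Rightarrow> ('a, 'n) module \<Rightarrow> ('k, 'm \<Rightarrow> 'n) module" where
  "hom_space A M N = mk_module (mod_hom A M N)
     (\<lambda>x\<in>carrier M. \<zero>\<^bsub>N\<^esub>)
     (\<lambda>f g. \<lambda>x\<in>carrier M. f x \<oplus>\<^bsub>N\<^esub> g x)
     (\<lambda>c f. \<lambda>x\<in>carrier M. c \<odot>\<^bsub>scalars A N\<^esub> f x)"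

text \<open>
  \<open>Hom\<^sub>k(M, k)\<close> for an \<open>A\<close>-module \<open>M\<close>, with the action transposed from \<open>M\<close>: the dual of a left
  module is a right module and conversely.
\<close>

definition k_dual ::
  "('k, 'z) ring_scheme \<Rightarrow> ('k, 'a) module \<Rightarrow> ('a, 'm) module \<Rightarrow> ('a, 'm \<Rightarrow> 'k) module" where
  "k_dual K A M = mk_module (mod_hom K (scalars A M) (self_module K))
     (\<lambda>x\<in>carrier M. \<zero>\<^bsub>K\<^esub>)
     (\<lambda>f g. \<lambda>x\<in>carrier M. f x \<oplus>\<^bsub>K\<^esub> g x)
     (\<lambda>a f. \<lambda>x\<in>carrier M. f (a \<odot>\<^bsub>M\<^esub> x))"

text \<open>\<open>Hom\<^sub>A(M, A)\<close> for a left \<open>A\<close>-module \<open>M\<close>, a right \<open>A\<close>-module via \<open>(f a)(x) = f(x) a\<close>.\<close>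

definition ring_dual :: "('k, 'a) module \<Rightarrow> ('a, 'm) module \<Rightarrow> ('a, 'm \<Rightarrow> 'a) module" where
  "ring_dual A M = mk_module (mod_hom A M (self_module A))
     (\<lambda>x\<in>carrier M. \<zero>\<^bsub>A\<^esub>)
     (\<lambda>f g. \<lambda>x\<in>carrier M. f x \<oplus>\<^bsub>A\<^esub> g x)
     (\<lambda>a f. \<lambda>x\<in>carrier M. f x \<otimes>\<^bsub>A\<^esub> a)"


section \<open>Quotients and tensor products\<close>

definition quot_module :: "('r, 'm) module \<Rightarrow> 'm set \<Rightarrow> ('r, 'm set) module" where
  "quot_module M W = mk_module (a_rcosets\<^bsub>M\<^esub> W) W (\<lambda>X Y. X <+>\<^bsub>M\<^esub> Y)
     (\<lambda>r X. W <+>\<^bsub>M\<^esub> ((\<lambda>x. r \<odot>\<^bsub>M\<^esub> x) ` X))"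

definition mod_span :: "('r, 'z) ring_scheme \<Rightarrow> ('r, 'm) module \<Rightarrow> 'm set \<Rightarrow> 'm set" where
  "mod_span R M S = \<Inter>{W. submodule W R M \<and> S \<subseteq> W}"

definition free_module :: "('k, 'z) ring_scheme \<Rightarrow> 'x set \<Rightarrow> ('k, 'x \<Rightarrow> 'k) module" where
  "free_module K X = mk_module
     {f. (\<forall>x\<in>X. f x \<in> carrier K) \<and> (\<forall>x. x \<notin> X \<longrightarrow> f x = \<zero>\<^bsub>K\<^esub>) \<and> finite {x. f x \<noteq> \<zero>\<^bsub>K\<^esub>}}
     (\<lambda>x. \<zero>\<^bsub>K\<^esub>)
     (\<lambda>f g x. f x \<oplus>\<^bsub>K\<^esub> g x)
     (\<lambda>c f x. c \<otimes>\<^bsub>K\<^esub> f x)"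

definition free_gen :: "('k, 'z) ring_scheme \<Rightarrow> 'x \<Rightarrow> 'x \<Rightarrow> 'k" where
  "free_gen K x = (\<lambda>y. if y = x then \<one>\<^bsub>K\<^esub> else \<zero>\<^bsub>K\<^esub>)"

text \<open>
  \<open>N \<otimes>\<^sub>A M\<close> for a right \<open>A\<close>-module \<open>N\<close> and a left \<open>A\<close>-module \<open>M\<close>: the free vector space on
  \<open>N \<times> M\<close> modulo the subspace expressing biadditivity, \<open>A\<close>-balancedness and \<open>k\<close>-linearity.
\<close>

definition tensor_rels :: "('k, 'z) ring_scheme \<Rightarrow> ('k, 'a) module \<Rightarrow> ('a, 'n) module \<Rightarrow>
    ('a, 'm) module \<Rightarrow> ('n \<times> 'm \<Rightarrow> 'k) set" where
  "tensor_rels K A N M =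
    (let F = free_module K (carrier N \<times> carrier M) in
     {free_gen K (x \<oplus>\<^bsub>N\<^esub> x', y) \<ominus>\<^bsub>F\<^esub> (free_gen K (x, y) \<oplus>\<^bsub>F\<^esub> free_gen K (x', y)) | x x' y.
        x \<in> carrier N \<and> x' \<in> carrier N \<and> y \<in> carrier M} \<union>
     {free_gen K (x, y \<oplus>\<^bsub>M\<^esub> y') \<ominus>\<^bsub>F\<^esub> (free_gen K (x, y) \<oplus>\<^bsub>F\<^esub> free_gen K (x, y')) | x y y'.
        x \<in> carrier N \<and> y \<in> carrier M \<and> y' \<in> carrier M} \<union>
     {free_gen K (a \<odot>\<^bsub>N\<^esub> x, y) \<ominus>\<^bsub>F\<^esub> free_gen K (x, a \<odot>\<^bsub>M\<^esub> y) | a x y.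
        a \<in> carrier A \<and> x \<in> carrier N \<and> y \<in> carrier M} \<union>
     {free_gen K (c \<odot>\<^bsub>scalars A N\<^esub> x, y) \<ominus>\<^bsub>F\<^esub> (c \<odot>\<^bsub>F\<^esub> free_gen K (x, y)) | c x y.
        c \<in> carrier K \<and> x \<in> carrier N \<and> y \<in> carrier M})"

definition tensor_null :: "('k, 'z) ring_scheme \<Rightarrow> ('k, 'a) module \<Rightarrow> ('a, 'n) module \<Rightarrow>
    ('a, 'm) module \<Rightarrow> ('n \<times> 'm \<Rightarrow> 'k) set" where
  "tensor_null K A N M =
     mod_span K (free_module K (carrier N \<times> carrier M)) (tensor_rels K A N M)"

definition tensor :: "('k, 'z) ring_scheme \<Rightarrow> ('k, 'a) module \<Rightarrow> ('a, 'n) module \<Rightarrow>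
    ('a, 'm) module \<Rightarrow> ('k, ('n \<times> 'm \<Rightarrow> 'k) set) module" where
  "tensor K A N M =
     quot_module (free_module K (carrier N \<times> carrier M)) (tensor_null K A N M)"

definition pure_tensor :: "('k, 'z) ring_scheme \<Rightarrow> ('k, 'a) module \<Rightarrow> ('a, 'n) module \<Rightarrow>
    ('a, 'm) module \<Rightarrow> 'n \<Rightarrow> 'm \<Rightarrow> ('n \<times> 'm \<Rightarrow> 'k) set" where
  "pure_tensor K A N M x y =
     tensor_null K A N M +>\<^bsub>free_module K (carrier N \<times> carrier M)\<^esub> free_gen K (x, y)"

text \<open>
  The value at a tensor of the linear map with \<open>x \<otimes> y \<mapsto> \<phi> x y\<close>, computed on a representative;
  for a balanced bilinear \<open>\<phi>\<close> the choice of the representative is immaterial.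
\<close>

definition tensor_lift :: "('k, 'z) ring_scheme \<Rightarrow> ('k, 'v) module \<Rightarrow> ('n \<Rightarrow> 'm \<Rightarrow> 'v) \<Rightarrow>
    ('n \<times> 'm \<Rightarrow> 'k) set \<Rightarrow> 'v" where
  "tensor_lift K V \<phi> X =
     (let f = (SOME f. f \<in> X)
      in \<Oplus>\<^bsub>V\<^esub>p\<in>{p. f p \<noteq> \<zero>\<^bsub>K\<^esub>}. f p \<odot>\<^bsub>V\<^esub> \<phi> (fst p) (snd p))"

text \<open>The map \<open>N \<otimes>\<^sub>A M \<rightarrow> N \<otimes>\<^sub>A M'\<close> induced by \<open>d\<close>.\<close>

definition tensor_map :: "('k, 'z) ring_scheme \<Rightarrow> ('k, 'a) module \<Rightarrow> ('a, 'n) module \<Rightarrow>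
    ('a, 'm') module \<Rightarrow> ('m \<Rightarrow> 'm') \<Rightarrow> ('n \<times> 'm \<Rightarrow> 'k) set \<Rightarrow> ('n \<times> 'm' \<Rightarrow> 'k) set" where
  "tensor_map K A N M' d =
     tensor_lift K (tensor K A N M') (\<lambda>x y. pure_tensor K A N M' x (d y))"

text \<open>The tensor product over \<open>k\<close> is the case of the algebra \<open>self_module K\<close>.\<close>

definition alg_tensor :: "('k, 'z) ring_scheme \<Rightarrow> ('k, 'a) module \<Rightarrow> ('k, 'b) module \<Rightarrow>
    ('k, ('a \<times> 'b \<Rightarrow> 'k) set) module" where
  "alg_tensor K A B =
    (let T = tensor K (self_module K) A B; pt = pure_tensor K (self_module K) A B in
     T\<lparr>mult := (\<lambda>s t. tensor_lift K T (\<lambda>a b.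
                   tensor_lift K T (\<lambda>a' b'. pt (a \<otimes>\<^bsub>A\<^esub> a') (b \<otimes>\<^bsub>B\<^esub> b')) t) s),
       one := pt \<one>\<^bsub>A\<^esub> \<one>\<^bsub>B\<^esub>\<rparr>)"

definition env_algebra ::
  "('k, 'z) ring_scheme \<Rightarrow> ('k, 'a) module \<Rightarrow> ('k, ('a \<times> 'a \<Rightarrow> 'k) set) module" where
  "env_algebra K A = alg_tensor K A (opp A)"


section \<open>Bimodules\<close>

record ('a, 'b) bimodule = "'b ring" +
  lact :: "'a \<Rightarrow> 'b \<Rightarrow> 'b"
  ract :: "'b \<Rightarrow> 'a \<Rightarrow> 'b"

definition bimod_l :: "('a, 'b) bimodule \<Rightarrow> ('a, 'b) module" where
  "bimod_l B = mk_module (carrier B) (zero B) (add B) (lact B)"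

definition bimod_r :: "('a, 'b) bimodule \<Rightarrow> ('a, 'b) module" where
  "bimod_r B = mk_module (carrier B) (zero B) (add B) (\<lambda>a x. ract B x a)"

text \<open>Both actions are required to induce the same \<open>k\<close>-structure.\<close>

definition is_bimodule :: "('k, 'z) ring_scheme \<Rightarrow> ('k, 'a) module \<Rightarrow> ('a, 'b) bimodule \<Rightarrow> bool" where
  "is_bimodule K A B \<longleftrightarrow>
     left_module A (bimod_l B) \<and> left_module (opp A) (bimod_r B) \<and>
     (\<forall>a\<in>carrier A. \<forall>a'\<in>carrier A. \<forall>x\<in>carrier B.
        ract B (lact B a x) a' = lact B a (ract B x a')) \<and>
     (\<forall>c\<in>carrier K. \<forall>x\<in>carrier B.
        lact B (c \<odot>\<^bsub>A\<^esub> \<one>\<^bsub>A\<^esub>) x = ract B x (c \<odot>\<^bsub>A\<^esub> \<one>\<^bsub>A\<^esub>))"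

definition regular_bimodule :: "('k, 'a) module \<Rightarrow> ('a, 'a) bimodule" where
  "regular_bimodule A =
     \<lparr>carrier = carrier A, mult = mult A, one = one A, zero = zero A, add = add A,
      lact = mult A, ract = mult A\<rparr>"

text \<open>The left and the right module over the enveloping algebra given by a bimodule.\<close>

definition env_left :: "('k, 'z) ring_scheme \<Rightarrow> ('k, 'a) module \<Rightarrow> ('a, 'b) bimodule \<Rightarrow>
    (('a \<times> 'a \<Rightarrow> 'k) set, 'b) module" where
  "env_left K A B = mk_module (carrier B) (zero B) (add B)
     (\<lambda>t x. tensor_lift K (scalars A (bimod_l B)) (\<lambda>a a'. ract B (lact B a x) a') t)"

definition env_right :: "('k, 'z) ring_scheme \<Rightarrow> ('k, 'a) module \<Rightarrow> ('a, 'b) bimodule \<Rightarrow>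
    (('a \<times> 'a \<Rightarrow> 'k) set, 'b) module" where
  "env_right K A B = mk_module (carrier B) (zero B) (add B)
     (\<lambda>t x. tensor_lift K (scalars A (bimod_l B)) (\<lambda>a a'. ract B (lact B a' x) a) t)"

text \<open>The inverse of \<open>env_left\<close>: \<open>a x = (a \<otimes> 1) x\<close> and \<open>x a = (1 \<otimes> a) x\<close>.\<close>

definition env_bimodule :: "('k, 'z) ring_scheme \<Rightarrow> ('k, 'a) module \<Rightarrow>
    (('a \<times> 'a \<Rightarrow> 'k) set, 'b) module \<Rightarrow> ('a, 'b) bimodule" where
  "env_bimodule K A M =
    (let pt = pure_tensor K (self_module K) A (opp A) in
     \<lparr>carrier = carrier M, mult = (\<lambda>_ _. undefined), one = undefined,
      zero = zero M, add = add M,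
      lact = (\<lambda>a x. pt a \<one>\<^bsub>A\<^esub> \<odot>\<^bsub>M\<^esub> x), ract = (\<lambda>x a. pt \<one>\<^bsub>A\<^esub> a \<odot>\<^bsub>M\<^esub> x)\<rparr>)"

text \<open>The right module \<open>\<Lambda>\<^sup>* = Hom(\<Lambda>, \<Lambda>\<^sup>e)\<close> over the enveloping algebra \<open>\<Lambda>\<^sup>e\<close>.\<close>

definition env_star :: "('k, 'z) ring_scheme \<Rightarrow> ('k, 'a) module \<Rightarrow>
    (('a \<times> 'a \<Rightarrow> 'k) set, 'a \<Rightarrow> ('a \<times> 'a \<Rightarrow> 'k) set) module" where
  "env_star K A = ring_dual (env_algebra K A) (env_left K A (regular_bimodule A))"


section \<open>Complete resolutions\<close>

definition exact_at ::
  "('r, 'l) module \<Rightarrow> ('l \<Rightarrow> 'm) \<Rightarrow> ('r, 'm) module \<Rightarrow> ('m \<Rightarrow> 'n) \<Rightarrow> ('r, 'n) module \<Rightarrow> bool" where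
  "exact_at L f M g N \<longleftrightarrow> f ` carrier L = {x \<in> carrier M. g x = \<zero>\<^bsub>N\<^esub>}"

definition homology_at :: "('r, 'l) module \<Rightarrow> ('l \<Rightarrow> 'm) \<Rightarrow> ('r, 'm) module \<Rightarrow> ('m \<Rightarrow> 'n) \<Rightarrow>
    ('r, 'n) module \<Rightarrow> ('r, 'm set) module" where
  "homology_at L f M g N =
     quot_module (M\<lparr>carrier := {x \<in> carrier M. g x = \<zero>\<^bsub>N\<^esub>}\<rparr>) (f ` carrier L)"

text \<open>
  Complexes are graded homologically, \<open>d n : T n \<rightarrow> T (n - 1)\<close>.  Resolutions are indexed by the
  integers as well, and vanish in negative degrees.
\<close>

definition proj_resolution :: "('r, 'z) ring_scheme \<Rightarrow> ('r, 'm) module \<Rightarrow>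
    (int \<Rightarrow> ('r, 'p) module) \<Rightarrow> (int \<Rightarrow> 'p \<Rightarrow> 'p) \<Rightarrow> bool" where
  "proj_resolution R M P d \<longleftrightarrow>
     (\<forall>n. projective R (P n)) \<and>
     (\<forall>n. d n \<in> mod_hom R (P n) (P (n - 1))) \<and>
     (\<forall>n<0. carrier (P n) = {\<zero>\<^bsub>P n\<^esub>}) \<and>
     (\<forall>n\<ge>1. exact_at (P (n + 1)) (d (n + 1)) (P n) (d n) (P (n - 1))) \<and>
     (\<exists>\<epsilon>\<in>mod_hom R (P 0) M.
        exact_at (P 1) (d 1) (P 0) \<epsilon> M \<and> \<epsilon> ` carrier (P 0) = carrier M)"

definition hom_map ::
  "('a, 'l) module \<Rightarrow> ('l \<Rightarrow> 'm) \<Rightarrow> ('m \<Rightarrow> 'n) \<Rightarrow> 'l \<Rightarrow> 'n" where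
  "hom_map L d f = (\<lambda>x\<in>carrier L. f (d x))"

definition complete_resolution :: "('k, 'a) module \<Rightarrow> ('a, 'm) module \<Rightarrow>
    (int \<Rightarrow> ('a, 't) module) \<Rightarrow> (int \<Rightarrow> 't \<Rightarrow> 't) \<Rightarrow> bool" where
  "complete_resolution A M T d \<longleftrightarrow>
     (\<forall>n. projective A (T n) \<and> fin_gen A (T n)) \<and>
     (\<forall>n. d n \<in> mod_hom A (T n) (T (n - 1))) \<and>
     (\<forall>n. exact_at (T (n + 1)) (d (n + 1)) (T n) (d n) (T (n - 1))) \<and>
     (\<forall>n. exact_at
        (hom_space A (T (n - 1)) (self_module A)) (hom_map (T n) (d n))
        (hom_space A (T n) (self_module A)) (hom_map (T (n + 1)) (d (n + 1)))
        (hom_space A (T (n + 1)) (self_module A))) \<and>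
     (\<exists>(P :: int \<Rightarrow> ('a, 't) module) e f. proj_resolution A M P e \<and>
        (\<forall>n. f n \<in> mod_hom A (T n) (P n)) \<and>
        (\<forall>n. \<forall>x\<in>carrier (T n). f (n - 1) (d n x) = e n (f n x)) \<and>
        (\<forall>n\<ge>0. bij_betw (f n) (carrier (T n)) (carrier (P n))))"

text \<open>
  A fixed but arbitrary complete resolution.  Finitely generated projective modules are direct
  summands of finite powers of \<open>A\<close>, so carriers in \<open>nat \<Rightarrow> 'a\<close> are no restriction.
\<close>

definition chosen_resolution :: "('k, 'a) module \<Rightarrow> ('a, 'm) module \<Rightarrow>
    (int \<Rightarrow> ('a, nat \<Rightarrow> 'a) module) \<times> (int \<Rightarrow> (nat \<Rightarrow> 'a) \<Rightarrow> nat \<Rightarrow> 'a)" where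
  "chosen_resolution A M = (SOME C. complete_resolution A M (fst C) (snd C))"


section \<open>Tate and Tate-Hochschild (co)homology\<close>

definition tate_Ext :: "('k, 'a) module \<Rightarrow> int \<Rightarrow> ('a, 'm) module \<Rightarrow> ('a, 'n) module \<Rightarrow>
    ('k, ((nat \<Rightarrow> 'a) \<Rightarrow> 'n) set) module" where
  "tate_Ext A n M N =
    (let (T, d) = chosen_resolution A M in
     homology_at
       (hom_space A (T (n - 1)) N) (hom_map (T n) (d n))
       (hom_space A (T n) N) (hom_map (T (n + 1)) (d (n + 1)))
       (hom_space A (T (n + 1)) N))"

definition tate_Tor :: "('k, 'z) ring_scheme \<Rightarrow> ('k, 'a) module \<Rightarrow> int \<Rightarrow> ('a, 'n) module \<Rightarrow>
    ('a, 'm) module \<Rightarrow> ('k, ('n \<times> (nat \<Rightarrow> 'a) \<Rightarrow> 'k) set set) module" where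
  "tate_Tor K A n N M =
    (let (T, d) = chosen_resolution A M in
     homology_at
       (tensor K A N (T (n + 1))) (tensor_map K A N (T n) (d (n + 1)))
       (tensor K A N (T n)) (tensor_map K A N (T (n - 1)) (d n))
       (tensor K A N (T (n - 1))))"

definition tate_HH_cohomology :: "('k, 'z) ring_scheme \<Rightarrow> ('k, 'a) module \<Rightarrow> int \<Rightarrow>
    ('a, 'b) bimodule \<Rightarrow> ('k, ((nat \<Rightarrow> ('a \<times> 'a \<Rightarrow> 'k) set) \<Rightarrow> 'b) set) module" where
  "tate_HH_cohomology K A n B =
     tate_Ext (env_algebra K A) n (env_left K A (regular_bimodule A)) (env_left K A B)"

definition tate_HH_homology :: "('k, 'z) ring_scheme \<Rightarrow> ('k, 'a) module \<Rightarrow> int \<Rightarrow>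
    ('a, 'b) bimodule \<Rightarrow> ('k, ('b \<times> (nat \<Rightarrow> ('a \<times> 'a \<Rightarrow> 'k) set) \<Rightarrow> 'k) set set) module" where
  "tate_HH_homology K A n B =
     tate_Tor K (env_algebra K A) n (env_right K A B) (env_left K A (regular_bimodule A))"

end

theory Submission
  imports Defs
begin

text \<open>
  Over a finite dimensional algebra \<open>\<Gamma>\<close> let \<open>T\<close> and \<open>S\<close> be complete resolutions of \<open>M\<close> and \<open>N\<close>.
  The double complex \<open>Hom(T\<^sub>i, S\<^sub>j)\<close> has exact rows and columns, so Tate cohomology is balanced:
  \<open>H\<^sup>n(Hom(T, N))\<close> is isomorphic to the homology of \<open>Hom(M, S)\<close> in degree \<open>-(n + 1)\<close>. For a finitely
  generated projective module \<open>P\<close> there is a perfect natural pairing of \<open>Hom(P, D(M\<^sup>*))\<close> with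
  \<open>Hom(M, P)\<close>, so \<open>Hom(S, D(M\<^sup>*))\<close> is the dual complex of \<open>Hom(M, S)\<close>, and by finite dimensionality
  both have isomorphic homology. This is the statement on \<open>Ext\<close>; the one on \<open>Tor\<close> follows because
  \<open>Hom(T, D(N))\<close> is the dual complex of \<open>N \<otimes> T\<close>.

  Complete resolutions exist as soon as \<open>\<Gamma>\<close> and its opposite admit an averaging operator: an additive
  map \<open>\<rho> : End\<^sub>k(\<Gamma>) \<rightarrow> \<Gamma>\<close> with \<open>\<rho>(f(- a)) = a \<rho>(f)\<close> and \<open>\<rho>(id) = 1\<close>. Such an operator is a
  retraction of the embedding of \<open>\<Gamma>\<close> into \<open>End\<^sub>k(\<Gamma>)\<close> by right multiplications, so it exists for
  selfinjective algebras, and applying the operators of the two factors one after the other yields one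
  for the enveloping algebra.
\<close>

section \<open>Modules and linear maps\<close>

text \<open>The Tate groups are read off one arbitrarily chosen complete resolution of each module.
  Balance therefore compares the chosen resolutions of \<open>M\<close> and \<open>N\<close>
  directly, and each duality stays within a single complex. A finite dimensional homology space is
  identified with its dual through a basis, so the isomorphisms are not canonical.

  The obstacle is the passage from \<open>\<Lambda>\<close> to its enveloping algebra: the extension
  property in \<open>injective\<close> quantifies over modules and does not multiply. An averaging
  operator turns it into data. It makes \<open>\<Gamma>\<close> a summand of the coinduced module
  \<open>End\<^sub>k(\<Gamma>)\<close>, and maps into a coinduced module extend as soon as they
  extend linearly over the field. Such data can be tensored. The operator of \<open>\<Gamma>\<close>
  extends maps into \<open>\<Gamma>\<close> and makes \<open>Hom(T, \<Gamma>)\<close> acyclic; the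
  operator of the opposite algebra embeds finitely generated modules into free ones and lets a
  resolution run on to the right.

  All resolutions consist of functions on \<open>nat\<close>, so the double complex lives in one
  type although \<open>M\<close> and \<open>N\<close> do not.\<close>

lemma mk_module_simps [simp]:
  "carrier (mk_module C z a s) = C" "zero (mk_module C z a s) = z"
  "add (mk_module C z a s) = a" "smult (mk_module C z a s) = s"
  by (simp_all add: mk_module_def)

lemma self_module_simps [simp]:
  "carrier (self_module R) = carrier R" "zero (self_module R) = zero R"
  "add (self_module R) = add R" "smult (self_module R) = mult R"
  by (simp_all add: self_module_def)

lemma opp_simps [simp]:
  "carrier (opp R) = carrier R" "zero (opp R) = zero R" "add (opp R) = add R"
  "one (opp R) = one R" "mult (opp R) = (\<lambda>x y. y \<otimes>\<^bsub>R\<^esub> x)"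
  by (simp_all add: opp_def)

lemma opp_smult [simp]: "smult (opp (A :: ('k, 'a) module)) = smult A"
  by (simp add: opp_def)

lemma scalars_simps [simp]:
  "carrier (scalars A M) = carrier M" "zero (scalars A M) = zero M"
  "add (scalars A M) = add M" "c \<odot>\<^bsub>scalars A M\<^esub> x = (c \<odot>\<^bsub>A\<^esub> \<one>\<^bsub>A\<^esub>) \<odot>\<^bsub>M\<^esub> x"
  by (simp_all add: scalars_def)

text \<open>These operations are computed from carrier, zero and addition alone. In this way a
  difference formed in \<open>self_module K\<close> is read as a difference in
  \<open>K\<close>.\<close>

lemma a_inv_cong:
  assumes "carrier M = carrier N" "zero M = zero N" "add M = add N"
  shows "a_inv M = a_inv N" "a_minus M = a_minus N"
  by (intro ext; simp add: a_inv_def m_inv_def a_minus_def assms)+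

lemma (in abelian_group) diff_eq_zero_iff:
  assumes "x \<in> carrier G" "y \<in> carrier G"
  shows "x \<ominus> y = \<zero> \<longleftrightarrow> x = y"
proof
  assume "x \<ominus> y = \<zero>"
  then have "(x \<ominus> y) \<oplus> y = y" using assms by simp
  then show "x = y" using assms by (simp add: a_minus_def a_assoc l_neg)
qed (use assms in \<open>simp add: a_minus_def r_neg\<close>)

lemma (in abelian_group) minus_zero_eq [simp]: "\<ominus> \<zero> = \<zero>"
  using minus_equality[of \<zero> \<zero>] by simp

lemma (in abelian_group) add_diff_cancel:
  assumes "x \<in> carrier G" "z \<in> carrier G"
  shows "x \<oplus> (z \<ominus> x) = z"
  using assms by (simp add: a_minus_def a_lcomm[of x z] r_neg)

section \<open>Scalar arithmetic and linear maps\<close>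

context left_module
begin

lemmas sm_closed [simp, intro] = smult_closed

lemma sm_l_null [simp]:
  assumes "x \<in> carrier M" shows "\<zero> \<odot>\<^bsub>M\<^esub> x = \<zero>\<^bsub>M\<^esub>"
  using smult_l_distr[of \<zero> \<zero> x] assms by (metis M.add.l_cancel_one R.l_zero R.zero_closed smult_closed)

lemma sm_r_null [simp]:
  assumes "a \<in> carrier R" shows "a \<odot>\<^bsub>M\<^esub> \<zero>\<^bsub>M\<^esub> = \<zero>\<^bsub>M\<^esub>"
  using smult_r_distr[of a "\<zero>\<^bsub>M\<^esub>" "\<zero>\<^bsub>M\<^esub>"] assms
  by (metis M.add.l_cancel_one M.l_zero M.zero_closed smult_closed)

lemma sm_l_minus:
  assumes "a \<in> carrier R" "x \<in> carrier M" shows "(\<ominus> a) \<odot>\<^bsub>M\<^esub> x = \<ominus>\<^bsub>M\<^esub> (a \<odot>\<^bsub>M\<^esub> x)"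
  using smult_l_distr[of "\<ominus> a" a x] assms by (metis M.minus_equality R.a_inv_closed R.l_neg sm_l_null smult_closed)

lemma sm_r_minus:
  assumes "a \<in> carrier R" "x \<in> carrier M" shows "a \<odot>\<^bsub>M\<^esub> (\<ominus>\<^bsub>M\<^esub> x) = \<ominus>\<^bsub>M\<^esub> (a \<odot>\<^bsub>M\<^esub> x)"
  using smult_r_distr[of a "\<ominus>\<^bsub>M\<^esub> x" x] assms by (metis M.minus_equality M.a_inv_closed M.l_neg sm_r_null smult_closed)

lemma minus_eq_sm: "x \<in> carrier M \<Longrightarrow> \<ominus>\<^bsub>M\<^esub> x = (\<ominus> \<one>) \<odot>\<^bsub>M\<^esub> x"
  by (simp add: sm_l_minus smult_one)

end

lemma left_moduleI:
  assumes "ring R"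
    and "\<And>x y. \<lbrakk>x \<in> carrier M; y \<in> carrier M\<rbrakk> \<Longrightarrow> x \<oplus>\<^bsub>M\<^esub> y \<in> carrier M"
    and "\<zero>\<^bsub>M\<^esub> \<in> carrier M"
    and "\<And>x y z. \<lbrakk>x \<in> carrier M; y \<in> carrier M; z \<in> carrier M\<rbrakk> \<Longrightarrow> (x \<oplus>\<^bsub>M\<^esub> y) \<oplus>\<^bsub>M\<^esub> z = x \<oplus>\<^bsub>M\<^esub> (y \<oplus>\<^bsub>M\<^esub> z)"
    and "\<And>x y. \<lbrakk>x \<in> carrier M; y \<in> carrier M\<rbrakk> \<Longrightarrow> x \<oplus>\<^bsub>M\<^esub> y = y \<oplus>\<^bsub>M\<^esub> x"
    and "\<And>x. x \<in> carrier M \<Longrightarrow> \<zero>\<^bsub>M\<^esub> \<oplus>\<^bsub>M\<^esub> x = x"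
    and "\<And>x. x \<in> carrier M \<Longrightarrow> \<exists>y\<in>carrier M. y \<oplus>\<^bsub>M\<^esub> x = \<zero>\<^bsub>M\<^esub>"
    and "\<And>a x. \<lbrakk>a \<in> carrier R; x \<in> carrier M\<rbrakk> \<Longrightarrow> a \<odot>\<^bsub>M\<^esub> x \<in> carrier M"
    and "\<And>a b x. \<lbrakk>a \<in> carrier R; b \<in> carrier R; x \<in> carrier M\<rbrakk> \<Longrightarrow> (a \<oplus>\<^bsub>R\<^esub> b) \<odot>\<^bsub>M\<^esub> x = a \<odot>\<^bsub>M\<^esub> x \<oplus>\<^bsub>M\<^esub> b \<odot>\<^bsub>M\<^esub> x"
    and "\<And>a x y. \<lbrakk>a \<in> carrier R; x \<in> carrier M; y \<in> carrier M\<rbrakk> \<Longrightarrow> a \<odot>\<^bsub>M\<^esub> (x \<oplus>\<^bsub>M\<^esub> y) = a \<odot>\<^bsub>M\<^esub> x \<oplus>\<^bsub>M\<^esub> a \<odot>\<^bsub>M\<^esub> y"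
    and "\<And>a b x. \<lbrakk>a \<in> carrier R; b \<in> carrier R; x \<in> carrier M\<rbrakk> \<Longrightarrow> (a \<otimes>\<^bsub>R\<^esub> b) \<odot>\<^bsub>M\<^esub> x = a \<odot>\<^bsub>M\<^esub> (b \<odot>\<^bsub>M\<^esub> x)"
    and "\<And>x. x \<in> carrier M \<Longrightarrow> \<one>\<^bsub>R\<^esub> \<odot>\<^bsub>M\<^esub> x = x"
  shows "left_module R M"
  unfolding left_module_def left_module_axioms_def
  by (intro conjI allI impI abelian_groupI assms) auto

lemma left_module_cong:
  assumes "left_module R M" "carrier N = carrier M" "zero N = zero M" "add N = add M"
    and "\<And>a x. \<lbrakk>a \<in> carrier R; x \<in> carrier M\<rbrakk> \<Longrightarrow> a \<odot>\<^bsub>N\<^esub> x = a \<odot>\<^bsub>M\<^esub> x"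
  shows "left_module R N"
proof -
  interpret M: left_module R M by fact
  show ?thesis
    by (rule left_moduleI)
      (auto simp: assms(2-) M.R.ring_axioms M.a_ac M.smult_l_distr M.smult_r_distr M.smult_assoc1 M.smult_one
        intro!: M.l_neg)
qed

lemma left_module_self: "ring R \<Longrightarrow> left_module R (self_module R)"
proof -
  assume "ring R"
  then interpret ring R .
  show ?thesis
    by (rule left_moduleI) (auto simp: ring_axioms a_assoc l_distr r_distr m_assoc intro: l_neg a_comm)
qed

text \<open>\<open>mod_hom\<close> consists of extensional functions. This predicate drops that
  condition, so that composites and pointwise sums qualify as they stand;
  \<open>lin_restrict\<close> leads back to \<open>mod_hom\<close> when a Hom space is
  involved.\<close>

definition lin :: "('r, 'z) ring_scheme \<Rightarrow> ('r, 'm, 'v) module_scheme \<Rightarrow> ('r, 'n, 'w) module_scheme \<Rightarrow> ('m \<Rightarrow> 'n) \<Rightarrow> bool" where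
  "lin R M N f \<longleftrightarrow> f \<in> carrier M \<rightarrow> carrier N \<and>
     (\<forall>x\<in>carrier M. \<forall>y\<in>carrier M. f (x \<oplus>\<^bsub>M\<^esub> y) = f x \<oplus>\<^bsub>N\<^esub> f y) \<and>
     (\<forall>r\<in>carrier R. \<forall>x\<in>carrier M. f (r \<odot>\<^bsub>M\<^esub> x) = r \<odot>\<^bsub>N\<^esub> f x)"

lemma linI:
  assumes "\<And>x. x \<in> carrier M \<Longrightarrow> f x \<in> carrier N"
    and "\<And>x y. \<lbrakk>x \<in> carrier M; y \<in> carrier M\<rbrakk> \<Longrightarrow> f (x \<oplus>\<^bsub>M\<^esub> y) = f x \<oplus>\<^bsub>N\<^esub> f y"
    and "\<And>r x. \<lbrakk>r \<in> carrier R; x \<in> carrier M\<rbrakk> \<Longrightarrow> f (r \<odot>\<^bsub>M\<^esub> x) = r \<odot>\<^bsub>N\<^esub> f x"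
  shows "lin R M N f"
  using assms by (auto simp: lin_def)

lemma linD:
  assumes "lin R M N f"
  shows "x \<in> carrier M \<Longrightarrow> f x \<in> carrier N"
    and "\<lbrakk>x \<in> carrier M; y \<in> carrier M\<rbrakk> \<Longrightarrow> f (x \<oplus>\<^bsub>M\<^esub> y) = f x \<oplus>\<^bsub>N\<^esub> f y"
    and "\<lbrakk>r \<in> carrier R; x \<in> carrier M\<rbrakk> \<Longrightarrow> f (r \<odot>\<^bsub>M\<^esub> x) = r \<odot>\<^bsub>N\<^esub> f x"
  using assms by (auto simp: lin_def)

lemma mod_hom_iff: "f \<in> mod_hom R M N \<longleftrightarrow> lin R M N f \<and> f \<in> extensional (carrier M)"
  by (auto simp: mod_hom_def lin_def PiE_def)

lemma mod_hom_lin: "f \<in> mod_hom R M N \<Longrightarrow> lin R M N f"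
  by (simp add: mod_hom_iff)

lemma mod_hom_ext:
  assumes "f \<in> mod_hom R M N" "g \<in> mod_hom R M N'" "\<And>x. x \<in> carrier M \<Longrightarrow> f x = g x"
  shows "f = g"
  using assms by (auto simp: mod_hom_iff intro: extensionalityI)

lemma lin_cong:
  assumes "lin R M N f" "left_module R M" "\<And>x. x \<in> carrier M \<Longrightarrow> g x = f x"
  shows "lin R M N g"
proof -
  interpret left_module R M by fact
  show ?thesis by (rule linI) (simp_all add: assms(3) linD[OF assms(1)])
qed

lemma lin_restrict:
  assumes "lin R M N f" "left_module R M"
  shows "restrict f (carrier M) \<in> mod_hom R M N"
  unfolding mod_hom_iff by (auto intro: lin_cong[OF assms])

lemma lin_id: "lin R M M (\<lambda>x. x)"
  by (rule linI) simp_all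

lemma lin_comp: "lin R M N f \<Longrightarrow> lin R N L g \<Longrightarrow> lin R M L (\<lambda>x. g (f x))"
  by (rule linI) (auto simp: linD[of R M N f] linD[of R N L g])

lemma lin_zero:
  assumes "lin R M N f" "left_module R M" "left_module R N"
  shows "f \<zero>\<^bsub>M\<^esub> = \<zero>\<^bsub>N\<^esub>"
proof -
  interpret M: left_module R M by fact
  interpret N: left_module R N by fact
  have "f (\<zero>\<^bsub>R\<^esub> \<odot>\<^bsub>M\<^esub> \<zero>\<^bsub>M\<^esub>) = \<zero>\<^bsub>R\<^esub> \<odot>\<^bsub>N\<^esub> f \<zero>\<^bsub>M\<^esub>" by (simp add: linD[OF assms(1)] del: M.sm_l_null M.sm_r_null)
  then show ?thesis using linD[OF assms(1)] by simp
qed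

lemma lin_minus:
  assumes "lin R M N f" "left_module R M" "left_module R N" "x \<in> carrier M"
  shows "f (\<ominus>\<^bsub>M\<^esub> x) = \<ominus>\<^bsub>N\<^esub> f x"
proof -
  interpret M: left_module R M by fact
  interpret N: left_module R N by fact
  show ?thesis using assms(4) by (simp add: M.minus_eq_sm N.minus_eq_sm linD[OF assms(1)])
qed

lemma lin_diff:
  assumes "lin R M N f" "left_module R M" "left_module R N" "x \<in> carrier M" "y \<in> carrier M"
  shows "f (x \<ominus>\<^bsub>M\<^esub> y) = f x \<ominus>\<^bsub>N\<^esub> f y"
proof -
  interpret M: left_module R M by fact
  interpret N: left_module R N by fact
  show ?thesis using assms(4,5)
    by (simp add: a_minus_def linD[OF assms(1)] lin_minus[OF assms(1-3)])
qed

lemma lin_finsum: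
  assumes "lin R M N f" "left_module R M" "left_module R N" "finite I" "g \<in> I \<rightarrow> carrier M"
  shows "f (\<Oplus>\<^bsub>M\<^esub>i\<in>I. g i) = (\<Oplus>\<^bsub>N\<^esub>i\<in>I. f (g i))"
proof -
  interpret M: left_module R M by fact
  interpret N: left_module R N by fact
  show ?thesis using assms(4,5)
  proof (induction I)
    case empty
    then show ?case by (simp add: lin_zero[OF assms(1-3)])
  next
    case (insert i I)
    then have "(\<lambda>i. f (g i)) \<in> insert i I \<rightarrow> carrier N" by (auto intro!: linD[OF assms(1)])
    with insert show ?case by (simp add: linD[OF assms(1)] Pi_def M.finsum_insert N.finsum_insert)
  qed
qed

lemma lin_inj_on:
  assumes "lin R M N f" "left_module R M" "left_module R N"
    and "\<And>x. \<lbrakk>x \<in> carrier M; f x = \<zero>\<^bsub>N\<^esub>\<rbrakk> \<Longrightarrow> x = \<zero>\<^bsub>M\<^esub>"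
  shows "inj_on f (carrier M)"
proof (rule inj_onI)
  interpret M: left_module R M by fact
  interpret N: left_module R N by fact
  fix x y assume xy: "x \<in> carrier M" "y \<in> carrier M" "f x = f y"
  then have "f (x \<ominus>\<^bsub>M\<^esub> y) = \<zero>\<^bsub>N\<^esub>" using linD(1)[OF assms(1)] lin_diff[OF assms(1-3) xy(1,2)]
    by (simp add: N.r_neg N.minus_eq)
  with xy assms(4) have "x \<ominus>\<^bsub>M\<^esub> y = \<zero>\<^bsub>M\<^esub>" by simp
  then show "x = y" using xy by (simp add: M.diff_eq_zero_iff)
qed

lemma lin_add:
  assumes "lin R M N f" "lin R M N g" "left_module R N"
  shows "lin R M N (\<lambda>x. f x \<oplus>\<^bsub>N\<^esub> g x)"
proof -
  interpret N: left_module R N by fact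
  show ?thesis
    by (rule linI) (simp_all add: linD[OF assms(1)] linD[OF assms(2)] N.smult_r_distr N.a_ac)
qed

lemma lin_const_zero: "left_module R N \<Longrightarrow> lin R M N (\<lambda>x. \<zero>\<^bsub>N\<^esub>)"
proof -
  assume "left_module R N"
  then interpret N: left_module R N .
  show ?thesis by (rule linI) auto
qed

lemma lin_sum:
  assumes "finite I" "\<And>i. i \<in> I \<Longrightarrow> lin R M N (f i)" "left_module R M" "left_module R N"
  shows "lin R M N (\<lambda>x. \<Oplus>\<^bsub>N\<^esub>i\<in>I. f i x)"
  using assms(1,2)
proof (induction I)
  interpret N: left_module R N by fact
  case empty
  then show ?case by (simp add: lin_const_zero assms)
next
  interpret N: left_module R N by fact
  case (insert i I)
  show ?case
    by (rule lin_cong[OF lin_add[OF insert.prems[of i] insert.IH] assms(3)])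
      (use insert assms linD(1)[OF insert.prems] in \<open>auto simp: Pi_def N.finsum_insert\<close>)
qed

text \<open>The homomorphism theorem without quotient modules: \<open>f\<close> is evaluated at a
  chosen preimage, and two preimages differ by an element of the kernel of \<open>e\<close>, on
  which \<open>g\<close> vanishes.\<close>

lemma lin_factor:
  assumes "lin R M N e" "left_module R M" "left_module R N" "left_module R L" "e ` carrier M = carrier N"
    and "lin R M L g" "\<And>x. \<lbrakk>x \<in> carrier M; e x = \<zero>\<^bsub>N\<^esub>\<rbrakk> \<Longrightarrow> g x = \<zero>\<^bsub>L\<^esub>"
  obtains f where "lin R N L f" "\<And>x. x \<in> carrier M \<Longrightarrow> f (e x) = g x"
proof -
  interpret M: left_module R M by fact
  interpret N: left_module R N by fact
  interpret L: left_module R L by fact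
  define f where "f y = g (SOME x. x \<in> carrier M \<and> e x = y)" for y
  have f: "f (e x) = g x" if x: "x \<in> carrier M" for x
  proof -
    define y where "y = (SOME y. y \<in> carrier M \<and> e y = e x)"
    have y: "y \<in> carrier M" "e y = e x" unfolding y_def by (rule someI2[of _ x]; use x in simp)+
    then have "e (y \<ominus>\<^bsub>M\<^esub> x) = \<zero>\<^bsub>N\<^esub>" using linD(1)[OF assms(1)] x lin_diff[OF assms(1-3) y(1) x]
      by (simp add: N.diff_eq_zero_iff)
    then have "g (y \<ominus>\<^bsub>M\<^esub> x) = \<zero>\<^bsub>L\<^esub>" using assms(7) x y by simp
    then have "g y = g x" using linD(1)[OF assms(6)] x y lin_diff[OF assms(6,2,4) y(1) x]
      by (simp add: L.diff_eq_zero_iff)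
    then show ?thesis by (simp add: f_def y_def)
  qed
  have ex: "\<exists>x\<in>carrier M. y = e x" if "y \<in> carrier N" for y using that assms(5) by auto
  have "lin R N L f"
  proof (rule linI)
    fix y assume "y \<in> carrier N"
    then show "f y \<in> carrier L" using ex f linD(1)[OF assms(6)] by metis
  next
    fix y z assume "y \<in> carrier N" "z \<in> carrier N"
    then obtain a b where "a \<in> carrier M" "b \<in> carrier M" "y = e a" "z = e b" using ex by metis
    then show "f (y \<oplus>\<^bsub>N\<^esub> z) = f y \<oplus>\<^bsub>L\<^esub> f z"
      using f linD(2)[OF assms(1)] linD(2)[OF assms(6)] by (metis M.a_closed)
  next
    fix r y assume "r \<in> carrier R" "y \<in> carrier N"
    then obtain a where "a \<in> carrier M" "y = e a" using ex by metis
    then show "f (r \<odot>\<^bsub>N\<^esub> y) = r \<odot>\<^bsub>L\<^esub> f y"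
      using f linD(3)[OF assms(1)] linD(3)[OF assms(6)] \<open>r \<in> carrier R\<close> by (metis M.smult_closed)
  qed
  then show ?thesis using that f by blast
qed

text \<open>Closure under negation comes from multiplication by \<open>\<ominus> \<one>\<close>, see
  \<open>subm_minus\<close>; \<open>subm_iff_submodule\<close> connects the predicate with the
  notion through which \<open>mod_span\<close> is defined.\<close>

definition subm :: "('r, 'z) ring_scheme \<Rightarrow> ('r, 'm, 'w) module_scheme \<Rightarrow> 'm set \<Rightarrow> bool" where
  "subm R M W \<longleftrightarrow> W \<subseteq> carrier M \<and> \<zero>\<^bsub>M\<^esub> \<in> W \<and> (\<forall>x\<in>W. \<forall>y\<in>W. x \<oplus>\<^bsub>M\<^esub> y \<in> W) \<and>
     (\<forall>r\<in>carrier R. \<forall>x\<in>W. r \<odot>\<^bsub>M\<^esub> x \<in> W)"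

lemma submI:
  assumes "W \<subseteq> carrier M" "\<zero>\<^bsub>M\<^esub> \<in> W" "\<And>x y. \<lbrakk>x \<in> W; y \<in> W\<rbrakk> \<Longrightarrow> x \<oplus>\<^bsub>M\<^esub> y \<in> W"
    "\<And>r x. \<lbrakk>r \<in> carrier R; x \<in> W\<rbrakk> \<Longrightarrow> r \<odot>\<^bsub>M\<^esub> x \<in> W"
  shows "subm R M W"
  using assms by (auto simp: subm_def)

lemma submD:
  assumes "subm R M W"
  shows "W \<subseteq> carrier M" "x \<in> W \<Longrightarrow> x \<in> carrier M" "\<zero>\<^bsub>M\<^esub> \<in> W" "\<lbrakk>x \<in> W; y \<in> W\<rbrakk> \<Longrightarrow> x \<oplus>\<^bsub>M\<^esub> y \<in> W"
    "\<lbrakk>r \<in> carrier R; x \<in> W\<rbrakk> \<Longrightarrow> r \<odot>\<^bsub>M\<^esub> x \<in> W"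
  using assms by (auto simp: subm_def)

context left_module
begin

lemma subm_minus:
  assumes "subm R M W" "x \<in> W" shows "\<ominus>\<^bsub>M\<^esub> x \<in> W"
  using assms submD[OF assms(1)] by (simp add: minus_eq_sm)

lemma subm_diff:
  assumes "subm R M W" "x \<in> W" "y \<in> W" shows "x \<ominus>\<^bsub>M\<^esub> y \<in> W"
  using assms submD[OF assms(1)] subm_minus[OF assms(1)] by (simp add: a_minus_def)

lemma subm_finsum:
  assumes "subm R M W" "finite I" "f \<in> I \<rightarrow> W" shows "(\<Oplus>\<^bsub>M\<^esub>i\<in>I. f i) \<in> W"
  using assms(2,3)
proof (induction I)
  case empty then show ?case using submD[OF assms(1)] by simp
next
  case (insert i I)
  then have "f \<in> I \<rightarrow> carrier M" "f i \<in> carrier M" using submD[OF assms(1)] by auto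
  with insert show ?case using submD[OF assms(1)] by (simp add: M.finsum_insert Pi_def)
qed

lemma subm_carrier: "subm R M (carrier M)"
  by (rule submI) auto

lemma subm_zero: "subm R M {\<zero>\<^bsub>M\<^esub>}"
  by (rule submI) auto

lemma subm_left_module:
  assumes "subm R M W" shows "left_module R (M\<lparr>carrier := W\<rparr>)"
proof (rule left_moduleI, goal_cases)
  case (7 x)
  then show ?case using subm_minus[OF assms] submD[OF assms] by (auto intro!: bexI[of _ "\<ominus>\<^bsub>M\<^esub> x"] M.l_neg)
qed (use submD[OF assms] in \<open>auto simp: M.a_assoc smult_one smult_assoc1 smult_r_distr smult_l_distr R.ring_axioms intro: M.a_comm\<close>)

lemma subm_iff_submodule: "submodule W R M \<longleftrightarrow> subm R M W"
proof
  assume "submodule W R M"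
  then interpret submodule W R M .
  show "subm R M W"
    by (rule submI) (use subset one_closed m_closed smult_closed in auto)
next
  assume W: "subm R M W"
  show "submodule W R M"
    unfolding submodule_def submodule_axioms_def
    by (intro conjI subgroup.intro) (use submD[OF W] subm_minus[OF W] in \<open>auto simp: a_inv_def[symmetric]\<close>)
qed

lemma subm_coset_trans:
  assumes "subm R M W" "x \<in> carrier M" "y \<in> carrier M" "z \<in> carrier M" "x \<ominus>\<^bsub>M\<^esub> y \<in> W" "y \<ominus>\<^bsub>M\<^esub> z \<in> W"
  shows "x \<ominus>\<^bsub>M\<^esub> z \<in> W"
proof -
  have "x \<ominus>\<^bsub>M\<^esub> z = (x \<ominus>\<^bsub>M\<^esub> y) \<oplus>\<^bsub>M\<^esub> (y \<ominus>\<^bsub>M\<^esub> z)"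
    using assms(2-4) M.r_neg1[of y "\<ominus>\<^bsub>M\<^esub> z"] M.r_neg2[of y "\<ominus>\<^bsub>M\<^esub> z"] by (simp add: a_minus_def M.a_assoc M.r_neg1 M.r_neg2)
  then show ?thesis using assms submD(4)[OF assms(1)] by simp
qed

lemma subm_coset_sym:
  assumes "subm R M W" "x \<in> carrier M" "y \<in> carrier M" "x \<ominus>\<^bsub>M\<^esub> y \<in> W"
  shows "y \<ominus>\<^bsub>M\<^esub> x \<in> W"
proof -
  have "y \<ominus>\<^bsub>M\<^esub> x = \<ominus>\<^bsub>M\<^esub> (x \<ominus>\<^bsub>M\<^esub> y)"
    using assms(2-3) by (simp add: a_minus_def M.a_ac M.minus_add)
  then show ?thesis using subm_minus[OF assms(1,4)] by simp
qed

end

section \<open>Submodules under linear maps\<close>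

lemma subm_preimage:
  assumes "lin R M N f" "left_module R M" "left_module R N" "subm R N W"
  shows "subm R M {x \<in> carrier M. f x \<in> W}"
proof -
  interpret M: left_module R M by fact
  interpret N: left_module R N by fact
  show ?thesis
    by (rule submI) (auto simp: linD[OF assms(1)] lin_zero[OF assms(1-3)] submD[OF assms(4)])
qed

lemma subm_ker:
  assumes "lin R M N f" "left_module R M" "left_module R N"
  shows "subm R M {x \<in> carrier M. f x = \<zero>\<^bsub>N\<^esub>}"
  using subm_preimage[OF assms left_module.subm_zero[OF assms(3)]] by simp

lemma subm_image:
  assumes "lin R M N f" "left_module R M" "left_module R N" "subm R M W"
  shows "subm R N (f ` W)"
proof -
  interpret M: left_module R M by fact
  interpret N: left_module R N by fact
  note W = submD[OF assms(4)] and f = linD[OF assms(1)]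
  show ?thesis
  proof (rule submI)
    show "f ` W \<subseteq> carrier N" using W f by auto
    show "\<zero>\<^bsub>N\<^esub> \<in> f ` W" using lin_zero[OF assms(1-3)] W(3) by force
  next
    fix x y assume "x \<in> f ` W" "y \<in> f ` W"
    then obtain a b where "a \<in> W" "b \<in> W" "x = f a" "y = f b" by auto
    then show "x \<oplus>\<^bsub>N\<^esub> y \<in> f ` W" using W f by (auto intro!: image_eqI[of _ f "a \<oplus>\<^bsub>M\<^esub> b"])
  next
    fix r x assume "r \<in> carrier R" "x \<in> f ` W"
    then obtain a where "a \<in> W" "x = f a" by auto
    then show "r \<odot>\<^bsub>N\<^esub> x \<in> f ` W" using W f \<open>r \<in> carrier R\<close> by (auto intro!: image_eqI[of _ f "r \<odot>\<^bsub>M\<^esub> a"])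
  qed
qed

lemma subm_range:
  assumes "lin R M N f" "left_module R M" "left_module R N"
  shows "subm R N (f ` carrier M)"
  using subm_image[OF assms left_module.subm_carrier[OF assms(2)]] .

lemma subm_Int: "subm R M W \<Longrightarrow> subm R M W' \<Longrightarrow> subm R M (W \<inter> W')"
  by (auto simp: subm_def)

lemma subm_upd: "subm R M W \<Longrightarrow> W \<subseteq> Z \<Longrightarrow> subm R (M\<lparr>carrier := Z\<rparr>) W"
  by (auto simp: subm_def)

lemma lin_upd_dom: "lin R M N f \<Longrightarrow> Z \<subseteq> carrier M \<Longrightarrow> lin R (M\<lparr>carrier := Z\<rparr>) N f"
  unfolding lin_def by (auto simp: subset_iff Pi_def)

lemma lin_upd_cod: "lin R M N f \<Longrightarrow> f ` carrier M \<subseteq> Z \<Longrightarrow> lin R M (N\<lparr>carrier := Z\<rparr>) f"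
  by (auto simp: lin_def)

lemma lin_upd_cod_weaken: "lin R M (N\<lparr>carrier := Z\<rparr>) f \<Longrightarrow> Z \<subseteq> carrier N \<Longrightarrow> lin R M N f"
  by (auto simp: lin_def)

section \<open>Finitely generated modules\<close>

definition lspan :: "('r, 'z) ring_scheme \<Rightarrow> ('r, 'm, 'w) module_scheme \<Rightarrow> 'm set \<Rightarrow> 'm set" where
  "lspan R M S = {\<Oplus>\<^bsub>M\<^esub>s\<in>S. c s \<odot>\<^bsub>M\<^esub> s | c. c \<in> S \<rightarrow> carrier R}"

context left_module
begin

lemma lc_closed: "c \<in> I \<rightarrow> carrier R \<Longrightarrow> e \<in> I \<rightarrow> carrier M \<Longrightarrow> (\<Oplus>\<^bsub>M\<^esub>i\<in>I. c i \<odot>\<^bsub>M\<^esub> e i) \<in> carrier M"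
  by (rule M.finsum_closed) auto

lemma lc_add:
  assumes "c \<in> I \<rightarrow> carrier R" "d \<in> I \<rightarrow> carrier R" "e \<in> I \<rightarrow> carrier M"
  shows "(\<Oplus>\<^bsub>M\<^esub>i\<in>I. (c i \<oplus> d i) \<odot>\<^bsub>M\<^esub> e i) = (\<Oplus>\<^bsub>M\<^esub>i\<in>I. c i \<odot>\<^bsub>M\<^esub> e i) \<oplus>\<^bsub>M\<^esub> (\<Oplus>\<^bsub>M\<^esub>i\<in>I. d i \<odot>\<^bsub>M\<^esub> e i)"
proof -
  have "(\<Oplus>\<^bsub>M\<^esub>i\<in>I. (c i \<oplus> d i) \<odot>\<^bsub>M\<^esub> e i) = (\<Oplus>\<^bsub>M\<^esub>i\<in>I. c i \<odot>\<^bsub>M\<^esub> e i \<oplus>\<^bsub>M\<^esub> d i \<odot>\<^bsub>M\<^esub> e i)"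
    by (rule M.finsum_cong') (use assms in \<open>auto simp: smult_l_distr Pi_def\<close>)
  also have "\<dots> = (\<Oplus>\<^bsub>M\<^esub>i\<in>I. c i \<odot>\<^bsub>M\<^esub> e i) \<oplus>\<^bsub>M\<^esub> (\<Oplus>\<^bsub>M\<^esub>i\<in>I. d i \<odot>\<^bsub>M\<^esub> e i)"
    by (rule M.finsum_addf) (use assms in auto)
  finally show ?thesis .
qed

lemma smult_finsum:
  assumes "finite I" "r \<in> carrier R" "g \<in> I \<rightarrow> carrier M"
  shows "r \<odot>\<^bsub>M\<^esub> (\<Oplus>\<^bsub>M\<^esub>i\<in>I. g i) = (\<Oplus>\<^bsub>M\<^esub>i\<in>I. r \<odot>\<^bsub>M\<^esub> g i)"
  using assms(1,3)
proof (induction I)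
  case empty then show ?case using assms by simp
next
  case (insert i I)
  then have "g \<in> I \<rightarrow> carrier M" "(\<lambda>i. r \<odot>\<^bsub>M\<^esub> g i) \<in> I \<rightarrow> carrier M" using assms(2) by auto
  with insert assms(2) show ?case by (simp add: M.finsum_insert smult_r_distr)
qed

lemma lc_smult:
  assumes "finite I" "r \<in> carrier R" "c \<in> I \<rightarrow> carrier R" "e \<in> I \<rightarrow> carrier M"
  shows "(\<Oplus>\<^bsub>M\<^esub>i\<in>I. (r \<otimes> c i) \<odot>\<^bsub>M\<^esub> e i) = r \<odot>\<^bsub>M\<^esub> (\<Oplus>\<^bsub>M\<^esub>i\<in>I. c i \<odot>\<^bsub>M\<^esub> e i)"
proof -
  have "(\<Oplus>\<^bsub>M\<^esub>i\<in>I. (r \<otimes> c i) \<odot>\<^bsub>M\<^esub> e i) = (\<Oplus>\<^bsub>M\<^esub>i\<in>I. r \<odot>\<^bsub>M\<^esub> (c i \<odot>\<^bsub>M\<^esub> e i))"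
    by (rule M.finsum_cong') (use assms in \<open>auto simp: smult_assoc1 Pi_def\<close>)
  also have "\<dots> = r \<odot>\<^bsub>M\<^esub> (\<Oplus>\<^bsub>M\<^esub>i\<in>I. c i \<odot>\<^bsub>M\<^esub> e i)"
    by (rule smult_finsum[symmetric]) (use assms in auto)
  finally show ?thesis .
qed

lemma lspan_subm:
  assumes "finite S" "S \<subseteq> carrier M"
  shows "subm R M (lspan R M S)"
proof -
  have e: "(\<lambda>s. s) \<in> S \<rightarrow> carrier M" using assms by auto
  show ?thesis
proof (rule submI)
  show "lspan R M S \<subseteq> carrier M" unfolding lspan_def using lc_closed[OF _ e] by auto
  show "\<zero>\<^bsub>M\<^esub> \<in> lspan R M S" unfolding lspan_def mem_Collect_eq
    by (intro exI[of _ "\<lambda>_. \<zero>"]) (use assms in \<open>auto intro!: M.add.finprod_one_eqI[symmetric]\<close>)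
  fix x y assume "x \<in> lspan R M S" "y \<in> lspan R M S"
  then obtain c d where c: "c \<in> S \<rightarrow> carrier R" "x = (\<Oplus>\<^bsub>M\<^esub>s\<in>S. c s \<odot>\<^bsub>M\<^esub> s)"
    and d: "d \<in> S \<rightarrow> carrier R" "y = (\<Oplus>\<^bsub>M\<^esub>s\<in>S. d s \<odot>\<^bsub>M\<^esub> s)" by (auto simp: lspan_def)
  then show "x \<oplus>\<^bsub>M\<^esub> y \<in> lspan R M S" unfolding lspan_def
    using lc_add[OF c(1) d(1) e] by (auto intro!: exI[of _ "\<lambda>s. c s \<oplus> d s"])
next
  fix r x assume r: "r \<in> carrier R" and "x \<in> lspan R M S"
  then obtain c where c: "c \<in> S \<rightarrow> carrier R" "x = (\<Oplus>\<^bsub>M\<^esub>s\<in>S. c s \<odot>\<^bsub>M\<^esub> s)" by (auto simp: lspan_def)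
  then show "r \<odot>\<^bsub>M\<^esub> x \<in> lspan R M S" unfolding lspan_def
    using lc_smult[OF assms(1) r c(1) e] r by (auto intro!: exI[of _ "\<lambda>s. r \<otimes> c s"])
qed
qed

lemma lspan_incl:
  assumes "finite S" "S \<subseteq> carrier M" "s \<in> S"
  shows "s \<in> lspan R M S"
proof -
  have "(\<Oplus>\<^bsub>M\<^esub>t\<in>S. (if t = s then \<one> else \<zero>) \<odot>\<^bsub>M\<^esub> t) = (\<Oplus>\<^bsub>M\<^esub>t\<in>S. if s = t then t else \<zero>\<^bsub>M\<^esub>)"
    by (rule M.finsum_cong') (use assms in \<open>auto simp: smult_one\<close>)
  also have "\<dots> = s" using assms by (subst M.finsum_singleton) auto
  finally show ?thesis unfolding lspan_def
    by (auto intro!: exI[of _ "\<lambda>t. if t = s then \<one> else \<zero>"])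
qed

lemma lspan_least:
  assumes "subm R M W" "S \<subseteq> W" "finite S"
  shows "lspan R M S \<subseteq> W"
proof
  fix x assume "x \<in> lspan R M S"
  then obtain c where c: "c \<in> S \<rightarrow> carrier R" "x = (\<Oplus>\<^bsub>M\<^esub>s\<in>S. c s \<odot>\<^bsub>M\<^esub> s)" by (auto simp: lspan_def)
  show "x \<in> W" unfolding c(2)
    by (rule subm_finsum[OF assms(1,3)]) (use c(1) assms(2) submD(5)[OF assms(1)] in \<open>auto simp: Pi_def subset_iff\<close>)
qed

end

locale lmod = left_module R M
  for R :: "('a, 'z) ring_scheme" (structure) and M :: "('a, 'm) module" (structure)
begin

text \<open>Finite generation phrased without linear combinations: a submodule that contains
  \<open>S\<close> is everything. In this form it passes to images by pulling submodules back, and a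
  property that defines a submodule need only be tested on \<open>S\<close>.\<close>

lemma fin_gen_iff:
  "fin_gen R M \<longleftrightarrow> (\<exists>S. finite S \<and> S \<subseteq> carrier M \<and> (\<forall>W. subm R M W \<longrightarrow> S \<subseteq> W \<longrightarrow> carrier M \<subseteq> W))"
proof
  assume "fin_gen R M"
  then obtain S where S: "finite S" "S \<subseteq> carrier M"
    and sp: "\<forall>x\<in>carrier M. \<exists>c\<in>S \<rightarrow> carrier R. x = (\<Oplus>\<^bsub>M\<^esub>s\<in>S. c s \<odot>\<^bsub>M\<^esub> s)"
    unfolding fin_gen_def by auto
  have S3: "carrier M \<subseteq> lspan R M S"
  proof
    fix x assume "x \<in> carrier M"
    with sp obtain c where "c \<in> S \<rightarrow> carrier R" "x = (\<Oplus>\<^bsub>M\<^esub>s\<in>S. c s \<odot>\<^bsub>M\<^esub> s)" by metis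
    then show "x \<in> lspan R M S" unfolding lspan_def by auto
  qed
  then show "\<exists>S. finite S \<and> S \<subseteq> carrier M \<and> (\<forall>W. subm R M W \<longrightarrow> S \<subseteq> W \<longrightarrow> carrier M \<subseteq> W)"
    using S S3 lspan_least[OF _ _ S(1)] by (intro exI[of _ S]) (meson order_trans)
next
  assume "\<exists>S. finite S \<and> S \<subseteq> carrier M \<and> (\<forall>W. subm R M W \<longrightarrow> S \<subseteq> W \<longrightarrow> carrier M \<subseteq> W)"
  then obtain S where S: "finite S" "S \<subseteq> carrier M" "\<And>W. subm R M W \<Longrightarrow> S \<subseteq> W \<Longrightarrow> carrier M \<subseteq> W" by auto
  have "carrier M \<subseteq> lspan R M S"
    using S(3)[OF lspan_subm[OF S(1,2)]] lspan_incl[OF S(1,2)] by (simp add: subsetI)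
  then have "\<exists>c\<in>S \<rightarrow> carrier R. x = (\<Oplus>\<^bsub>M\<^esub>s\<in>S. c s \<odot>\<^bsub>M\<^esub> s)" if "x \<in> carrier M" for x
    using that unfolding lspan_def by auto
  then show "fin_gen R M" unfolding fin_gen_def using S(1,2) by auto
qed

end

lemma fin_genE:
  assumes "fin_gen R M" "left_module R M"
  obtains S where "finite S" "S \<subseteq> carrier M" "\<And>W. subm R M W \<Longrightarrow> S \<subseteq> W \<Longrightarrow> carrier M \<subseteq> W"
  using assms(1) unfolding lmod.fin_gen_iff[unfolded lmod_def, OF assms(2)] by auto

lemma fin_genI:
  assumes "left_module R M" "finite S" "S \<subseteq> carrier M" "\<And>W. subm R M W \<Longrightarrow> S \<subseteq> W \<Longrightarrow> carrier M \<subseteq> W"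
  shows "fin_gen R M"
  unfolding lmod.fin_gen_iff[unfolded lmod_def, OF assms(1)] using assms(2-) by auto

lemma fin_gen_surj:
  assumes "fin_gen R M" "lin R M N f" "left_module R M" "left_module R N" "carrier N \<subseteq> f ` carrier M"
  shows "fin_gen R N"
proof -
  obtain S where S: "finite S" "S \<subseteq> carrier M" "\<And>W. subm R M W \<Longrightarrow> S \<subseteq> W \<Longrightarrow> carrier M \<subseteq> W"
    using fin_genE[OF assms(1,3)] by blast
  show ?thesis
  proof (rule fin_genI[OF assms(4), of "f ` S"])
    fix W assume W: "subm R N W" "f ` S \<subseteq> W"
    have "carrier M \<subseteq> {x \<in> carrier M. f x \<in> W}"
      by (rule S(3)[OF subm_preimage[OF assms(2-4) W(1)]]) (use S W in auto)
    then show "carrier N \<subseteq> W" using assms(5) by auto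
  qed (use S linD(1)[OF assms(2)] in auto)
qed

section \<open>Quotients and isomorphisms\<close>

context lmod
begin

lemma mem_coset_iff:
  assumes "subm R M W" "x \<in> carrier M"
  shows "y \<in> W +>\<^bsub>M\<^esub> x \<longleftrightarrow> y \<in> carrier M \<and> y \<ominus>\<^bsub>M\<^esub> x \<in> W"
proof
  assume "y \<in> W +>\<^bsub>M\<^esub> x"
  then obtain w where w: "w \<in> W" "y = w \<oplus>\<^bsub>M\<^esub> x" by (auto simp: a_r_coset_def')
  then have "w \<in> carrier M" using submD[OF assms(1)] by blast
  with w assms show "y \<in> carrier M \<and> y \<ominus>\<^bsub>M\<^esub> x \<in> W" by (simp add: a_minus_def M.a_assoc M.r_neg)
next
  assume y: "y \<in> carrier M \<and> y \<ominus>\<^bsub>M\<^esub> x \<in> W"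
  then have "y = (y \<ominus>\<^bsub>M\<^esub> x) \<oplus>\<^bsub>M\<^esub> x" using assms(2) by (simp add: a_minus_def M.a_assoc M.l_neg)
  with y show "y \<in> W +>\<^bsub>M\<^esub> x" by (auto simp: a_r_coset_def')
qed

lemma coset_self: "subm R M W \<Longrightarrow> x \<in> carrier M \<Longrightarrow> x \<in> W +>\<^bsub>M\<^esub> x"
  by (simp add: mem_coset_iff submD a_minus_def M.r_neg)

lemma coset_eq_iff:
  assumes "subm R M W" "x \<in> carrier M" "y \<in> carrier M"
  shows "W +>\<^bsub>M\<^esub> x = W +>\<^bsub>M\<^esub> y \<longleftrightarrow> x \<ominus>\<^bsub>M\<^esub> y \<in> W"
proof
  assume "W +>\<^bsub>M\<^esub> x = W +>\<^bsub>M\<^esub> y"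
  then show "x \<ominus>\<^bsub>M\<^esub> y \<in> W" using coset_self[OF assms(1,2)] mem_coset_iff[OF assms(1,3)] by auto
next
  assume xy: "x \<ominus>\<^bsub>M\<^esub> y \<in> W"
  show "W +>\<^bsub>M\<^esub> x = W +>\<^bsub>M\<^esub> y"
    using mem_coset_iff[OF assms(1,2)] mem_coset_iff[OF assms(1,3)]
      subm_coset_trans[OF assms(1)] xy subm_coset_sym[OF assms(1)] assms by blast
qed

lemma coset_add:
  assumes "subm R M W" "x \<in> carrier M" "y \<in> carrier M"
  shows "(W +>\<^bsub>M\<^esub> x) <+>\<^bsub>M\<^esub> (W +>\<^bsub>M\<^esub> y) = W +>\<^bsub>M\<^esub> (x \<oplus>\<^bsub>M\<^esub> y)"
proof (rule Set.set_eqI, rule iffI)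
  fix z assume "z \<in> (W +>\<^bsub>M\<^esub> x) <+>\<^bsub>M\<^esub> (W +>\<^bsub>M\<^esub> y)"
  then obtain v w where vw: "v \<in> W" "w \<in> W" "z = (v \<oplus>\<^bsub>M\<^esub> x) \<oplus>\<^bsub>M\<^esub> (w \<oplus>\<^bsub>M\<^esub> y)"
    by (auto simp: a_r_coset_def' set_add_def')
  then have "v \<in> carrier M" "w \<in> carrier M" using submD[OF assms(1)] by blast+
  then have "z = (v \<oplus>\<^bsub>M\<^esub> w) \<oplus>\<^bsub>M\<^esub> (x \<oplus>\<^bsub>M\<^esub> y)" using assms vw by (simp add: M.a_ac)
  then show "z \<in> W +>\<^bsub>M\<^esub> (x \<oplus>\<^bsub>M\<^esub> y)" using submD(4)[OF assms(1)] vw by (auto simp: a_r_coset_def')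
next
  fix z assume "z \<in> W +>\<^bsub>M\<^esub> (x \<oplus>\<^bsub>M\<^esub> y)"
  then obtain w where w: "w \<in> W" "z = w \<oplus>\<^bsub>M\<^esub> (x \<oplus>\<^bsub>M\<^esub> y)" by (auto simp: a_r_coset_def')
  then have "w \<in> carrier M" using submD[OF assms(1)] by blast
  then have "z = (w \<oplus>\<^bsub>M\<^esub> x) \<oplus>\<^bsub>M\<^esub> (\<zero>\<^bsub>M\<^esub> \<oplus>\<^bsub>M\<^esub> y)" using assms w by (simp add: M.a_ac)
  then show "z \<in> (W +>\<^bsub>M\<^esub> x) <+>\<^bsub>M\<^esub> (W +>\<^bsub>M\<^esub> y)" using submD(3)[OF assms(1)] w
    by (auto simp: a_r_coset_def' set_add_def')
qed

lemma coset_smult: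
  assumes "subm R M W" "r \<in> carrier R" "x \<in> carrier M"
  shows "W <+>\<^bsub>M\<^esub> ((\<lambda>x. r \<odot>\<^bsub>M\<^esub> x) ` (W +>\<^bsub>M\<^esub> x)) = W +>\<^bsub>M\<^esub> (r \<odot>\<^bsub>M\<^esub> x)"
proof (rule Set.set_eqI, rule iffI)
  fix z assume "z \<in> W <+>\<^bsub>M\<^esub> ((\<lambda>x. r \<odot>\<^bsub>M\<^esub> x) ` (W +>\<^bsub>M\<^esub> x))"
  then obtain v w where vw: "v \<in> W" "w \<in> W" "z = v \<oplus>\<^bsub>M\<^esub> (r \<odot>\<^bsub>M\<^esub> (w \<oplus>\<^bsub>M\<^esub> x))"
    by (auto simp: a_r_coset_def' set_add_def')
  then have "v \<in> carrier M" "w \<in> carrier M" using submD[OF assms(1)] by blast+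
  then have "z = (v \<oplus>\<^bsub>M\<^esub> (r \<odot>\<^bsub>M\<^esub> w)) \<oplus>\<^bsub>M\<^esub> (r \<odot>\<^bsub>M\<^esub> x)" using assms vw by (simp add: smult_r_distr M.a_ac)
  then show "z \<in> W +>\<^bsub>M\<^esub> (r \<odot>\<^bsub>M\<^esub> x)" using submD(4,5)[OF assms(1)] vw assms(2) by (auto simp: a_r_coset_def')
next
  fix z assume "z \<in> W +>\<^bsub>M\<^esub> (r \<odot>\<^bsub>M\<^esub> x)"
  then obtain w where w: "w \<in> W" "z = w \<oplus>\<^bsub>M\<^esub> (r \<odot>\<^bsub>M\<^esub> x)" by (auto simp: a_r_coset_def')
  then show "z \<in> W <+>\<^bsub>M\<^esub> ((\<lambda>x. r \<odot>\<^bsub>M\<^esub> x) ` (W +>\<^bsub>M\<^esub> x))"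
    using coset_self[OF assms(1,3)] by (auto simp: set_add_def')
qed

lemma quot_carrier: "carrier (quot_module M W) = (\<lambda>x. W +>\<^bsub>M\<^esub> x) ` carrier M"
  by (auto simp: quot_module_def A_RCOSETS_def')

lemma quot_zero: "subm R M W \<Longrightarrow> zero (quot_module M W) = W +>\<^bsub>M\<^esub> \<zero>\<^bsub>M\<^esub>"
  by (simp add: quot_module_def M.a_coset_add_zero submD(1))

lemma quot_ops:
  assumes "subm R M W"
  shows "\<lbrakk>x \<in> carrier M; y \<in> carrier M\<rbrakk> \<Longrightarrow>
      (W +>\<^bsub>M\<^esub> x) \<oplus>\<^bsub>quot_module M W\<^esub> (W +>\<^bsub>M\<^esub> y) = W +>\<^bsub>M\<^esub> (x \<oplus>\<^bsub>M\<^esub> y)"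
    and "\<lbrakk>r \<in> carrier R; x \<in> carrier M\<rbrakk> \<Longrightarrow> r \<odot>\<^bsub>quot_module M W\<^esub> (W +>\<^bsub>M\<^esub> x) = W +>\<^bsub>M\<^esub> (r \<odot>\<^bsub>M\<^esub> x)"
  by (simp_all add: quot_module_def coset_add[OF assms] coset_smult[OF assms])

lemma quot_left_module:
  assumes "subm R M W" shows "left_module R (quot_module M W)"
proof (rule left_moduleI, goal_cases)
  case (7 x)
  then obtain y where "y \<in> carrier M" "x = W +>\<^bsub>M\<^esub> y" by (auto simp: quot_carrier)
  then show ?case
    by (intro bexI[of _ "W +>\<^bsub>M\<^esub> (\<ominus>\<^bsub>M\<^esub> y)"]) (auto simp: quot_carrier quot_zero[OF assms] quot_ops[OF assms] M.l_neg)
qed (auto simp: quot_carrier quot_zero[OF assms] quot_ops[OF assms] R.ring_axioms M.a_ac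
        smult_l_distr smult_r_distr smult_assoc1 smult_one)

lemma quot_lin: "subm R M W \<Longrightarrow> lin R M (quot_module M W) (\<lambda>x. W +>\<^bsub>M\<^esub> x)"
  by (rule linI) (auto simp: quot_ops quot_carrier)

end

lemma mod_isoI:
  assumes "left_module R M" "left_module R N" "lin R M N f" "bij_betw f (carrier M) (carrier N)"
  shows "mod_iso R M N"
  unfolding mod_iso_def using assms(1,2,4) bij_betw_cong[of "carrier M" "restrict f (carrier M)" f]
  by (auto intro!: bexI[OF _ lin_restrict[OF assms(3,1)]])

lemma mod_isoE:
  assumes "mod_iso R M N"
  obtains f where "left_module R M" "left_module R N" "lin R M N f" "bij_betw f (carrier M) (carrier N)"
  using assms unfolding mod_iso_def by (auto simp: mod_hom_iff)

lemma mod_iso_trans: "mod_iso R M N \<Longrightarrow> mod_iso R N L \<Longrightarrow> mod_iso R M L"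
proof (elim mod_isoE)
  fix f g assume "left_module R M" "left_module R L" "lin R M N f" "bij_betw f (carrier M) (carrier N)"
    "lin R N L g" "bij_betw g (carrier N) (carrier L)"
  then show "mod_iso R M L"
    using bij_betw_trans[of f _ _ g] by (intro mod_isoI[OF _ _ lin_comp[of R M N f L g]]) (auto simp: o_def)
qed

lemma lin_inv:
  assumes "left_module R M" "left_module R N" "lin R M N f" "bij_betw f (carrier M) (carrier N)"
  shows "lin R N M (inv_into (carrier M) f)"
proof -
  interpret M: left_module R M by fact
  let ?g = "inv_into (carrier M) f"
  have g: "?g y \<in> carrier M" "f (?g y) = y" if "y \<in> carrier N" for y
    using assms(4) that by (auto simp: bij_betw_def inv_into_into f_inv_into_f)
  have gf: "?g (f x) = x" if "x \<in> carrier M" for x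
    using assms(4) that by (auto simp: bij_betw_def)
  show ?thesis
  proof (rule linI)
    fix x y assume "x \<in> carrier N" "y \<in> carrier N"
    then have "f (?g x \<oplus>\<^bsub>M\<^esub> ?g y) = x \<oplus>\<^bsub>N\<^esub> y" by (simp add: linD[OF assms(3)] g)
    then show "?g (x \<oplus>\<^bsub>N\<^esub> y) = ?g x \<oplus>\<^bsub>M\<^esub> ?g y"
      using gf[of "?g x \<oplus>\<^bsub>M\<^esub> ?g y"] g \<open>x \<in> carrier N\<close> \<open>y \<in> carrier N\<close> by simp
  next
    fix r y assume "r \<in> carrier R" "y \<in> carrier N"
    then have "f (r \<odot>\<^bsub>M\<^esub> ?g y) = r \<odot>\<^bsub>N\<^esub> y" by (simp add: linD[OF assms(3)] g)
    then show "?g (r \<odot>\<^bsub>N\<^esub> y) = r \<odot>\<^bsub>M\<^esub> ?g y"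
      using gf[of "r \<odot>\<^bsub>M\<^esub> ?g y"] g \<open>r \<in> carrier R\<close> \<open>y \<in> carrier N\<close> by simp
  qed (rule g)
qed

lemma mod_iso_sym: "mod_iso R M N \<Longrightarrow> mod_iso R N M"
  by (elim mod_isoE, rule mod_isoI[OF _ _ lin_inv]) (auto intro: bij_betw_inv_into)

text \<open>The map on cosets is computed from a chosen representative. The hypothesis
  \<open>iff\<close> makes the value well defined and the map injective at once, and
  \<open>surj\<close> asks for surjectivity only modulo \<open>W'\<close>.\<close>

lemma quot_mod_iso:
  assumes "left_module R M" "left_module R N" "subm R M W" "subm R N W'" "lin R M N f"
    and surj: "\<And>y. y \<in> carrier N \<Longrightarrow> \<exists>x\<in>carrier M. y \<ominus>\<^bsub>N\<^esub> f x \<in> W'"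
    and iff: "\<And>x. x \<in> carrier M \<Longrightarrow> f x \<in> W' \<longleftrightarrow> x \<in> W"
  shows "mod_iso R (quot_module M W) (quot_module N W')"
proof -
  interpret M: lmod R M unfolding lmod_def by fact
  interpret N: lmod R N unfolding lmod_def by fact
  note f = linD[OF assms(5)]
  define h where "h X = W' +>\<^bsub>N\<^esub> f (SOME x. x \<in> X)" for X
  have h: "h (W +>\<^bsub>M\<^esub> x) = W' +>\<^bsub>N\<^esub> f x" if x: "x \<in> carrier M" for x
  proof -
    define y where "y = (SOME y. y \<in> W +>\<^bsub>M\<^esub> x)"
    have "y \<in> W +>\<^bsub>M\<^esub> x" unfolding y_def using M.coset_self[OF assms(3) x] by (rule someI)
    then have y: "y \<in> carrier M" "y \<ominus>\<^bsub>M\<^esub> x \<in> W" using M.mem_coset_iff[OF assms(3) x] by auto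
    then have "f (y \<ominus>\<^bsub>M\<^esub> x) \<in> W'" using iff x by simp
    then have "W' +>\<^bsub>N\<^esub> f y = W' +>\<^bsub>N\<^esub> f x" using x y f
      by (simp add: N.coset_eq_iff[OF assms(4)] lin_diff[OF assms(5,1,2)])
    then show ?thesis by (simp add: h_def y_def)
  qed
  show ?thesis
  proof (rule mod_isoI)
    show "left_module R (quot_module M W)" "left_module R (quot_module N W')"
      using M.quot_left_module N.quot_left_module assms by auto
    show "lin R (quot_module M W) (quot_module N W') h"
      by (rule linI) (auto simp: M.quot_carrier N.quot_carrier M.quot_ops[OF assms(3)] N.quot_ops[OF assms(4)] h f)
    have "inj_on h (carrier (quot_module M W))"
    proof (rule inj_onI)
      fix X Y assume "X \<in> carrier (quot_module M W)" "Y \<in> carrier (quot_module M W)" and hXY: "h X = h Y"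
      then obtain x y where xy: "x \<in> carrier M" "X = W +>\<^bsub>M\<^esub> x" "y \<in> carrier M" "Y = W +>\<^bsub>M\<^esub> y"
        by (auto simp: M.quot_carrier)
      with hXY have "f (x \<ominus>\<^bsub>M\<^esub> y) \<in> W'"
        by (simp add: h N.coset_eq_iff[OF assms(4)] f lin_diff[OF assms(5,1,2)])
      then show "X = Y" using xy iff by (simp add: M.coset_eq_iff[OF assms(3)])
    qed
    moreover have "h ` carrier (quot_module M W) = carrier (quot_module N W')"
    proof
      show "h ` carrier (quot_module M W) \<subseteq> carrier (quot_module N W')"
        by (auto simp: M.quot_carrier N.quot_carrier h f)
      show "carrier (quot_module N W') \<subseteq> h ` carrier (quot_module M W)"
      proof
        fix Y assume "Y \<in> carrier (quot_module N W')"
        then obtain y where y: "y \<in> carrier N" "Y = W' +>\<^bsub>N\<^esub> y" by (auto simp: N.quot_carrier)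
        then obtain x where x: "x \<in> carrier M" "y \<ominus>\<^bsub>N\<^esub> f x \<in> W'" using surj by blast
        then have "Y = h (W +>\<^bsub>M\<^esub> x)" using y f by (simp add: h N.coset_eq_iff[OF assms(4)])
        then show "Y \<in> h ` carrier (quot_module M W)" using x by (auto simp: M.quot_carrier)
      qed
    qed
    ultimately show "bij_betw h (carrier (quot_module M W)) (carrier (quot_module N W'))"
      by (simp add: bij_betw_def)
  qed
qed

text \<open>Cycles \<open>Z\<close> modulo boundaries \<open>W\<close>, both kept as subsets of one
  ambient module, so that comparing homology becomes a matter of comparing subsets.\<close>

definition subquot :: "('r, 'm) module \<Rightarrow> 'm set \<Rightarrow> 'm set \<Rightarrow> ('r, 'm set) module" where
  "subquot M Z W = quot_module (M\<lparr>carrier := Z\<rparr>) W"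

lemma homology_at_subquot:
  "homology_at L f M g N = subquot M {x \<in> carrier M. g x = \<zero>\<^bsub>N\<^esub>} (f ` carrier L)"
  by (simp add: homology_at_def subquot_def)

text \<open>The map is controlled on cycles only; boundaries enter through \<open>surj\<close>,
  surjectivity up to a boundary, and through \<open>iff\<close>, which says that boundaries are
  preserved and reflected.\<close>

lemma subquot_iso:
  assumes "left_module R M" "left_module R N" "subm R M Z" "subm R M W" "W \<subseteq> Z"
    "subm R N Z'" "subm R N W'" "W' \<subseteq> Z'"
    and "\<And>x. x \<in> Z \<Longrightarrow> f x \<in> Z'"
    and "\<And>x y. \<lbrakk>x \<in> Z; y \<in> Z\<rbrakk> \<Longrightarrow> f (x \<oplus>\<^bsub>M\<^esub> y) = f x \<oplus>\<^bsub>N\<^esub> f y"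
    and "\<And>r x. \<lbrakk>r \<in> carrier R; x \<in> Z\<rbrakk> \<Longrightarrow> f (r \<odot>\<^bsub>M\<^esub> x) = r \<odot>\<^bsub>N\<^esub> f x"
    and surj: "\<And>y. y \<in> Z' \<Longrightarrow> \<exists>x\<in>Z. \<exists>w\<in>W'. y = f x \<oplus>\<^bsub>N\<^esub> w"
    and iff: "\<And>x. x \<in> Z \<Longrightarrow> f x \<in> W' \<longleftrightarrow> x \<in> W"
  shows "mod_iso R (subquot M Z W) (subquot N Z' W')"
  unfolding subquot_def
proof (rule quot_mod_iso[where f = f])
  interpret N: left_module R N by fact
  show M: "left_module R (M\<lparr>carrier := Z\<rparr>)" and N: "left_module R (N\<lparr>carrier := Z'\<rparr>)"
    using left_module.subm_left_module assms by blast+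
  interpret N': left_module R "N\<lparr>carrier := Z'\<rparr>" by fact
  show "subm R (M\<lparr>carrier := Z\<rparr>) W" "subm R (N\<lparr>carrier := Z'\<rparr>) W'" by (simp_all add: subm_upd assms)
  show "lin R (M\<lparr>carrier := Z\<rparr>) (N\<lparr>carrier := Z'\<rparr>) f" by (rule linI) (simp_all add: assms)
  fix y assume "y \<in> carrier (N\<lparr>carrier := Z'\<rparr>)"
  then have y: "y \<in> Z'" by simp
  then obtain x w where xw: "x \<in> Z" "w \<in> W'" "y = f x \<oplus>\<^bsub>N\<^esub> w" using surj by blast
  have "f x \<in> Z'" "w \<in> Z'" using xw assms by auto
  then have "y \<ominus>\<^bsub>N\<lparr>carrier := Z'\<rparr>\<^esub> f x = w"
    using N'.add.m_assoc[of w "f x" "\<ominus>\<^bsub>N\<lparr>carrier := Z'\<rparr>\<^esub> f x"] N'.a_comm[of "f x" w] N'.r_neg[of "f x"] xw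
      N'.r_zero[of w] N'.a_inv_closed[of "f x"]
    by (simp add: a_minus_def)
  then show "\<exists>x\<in>carrier (M\<lparr>carrier := Z\<rparr>). y \<ominus>\<^bsub>N\<lparr>carrier := Z'\<rparr>\<^esub> f x \<in> W'"
    using xw by (intro bexI[of _ x]) auto
qed (use iff in auto)

section \<open>Vector spaces\<close>

abbreviation functional :: "('k, 'z) ring_scheme \<Rightarrow> ('k, 'v) module \<Rightarrow> ('v \<Rightarrow> 'k) \<Rightarrow> bool" where
  "functional K V u \<equiv> lin K V (self_module K) u"

lemma self_finsum: "ring R \<Longrightarrow> finsum (self_module R) f I = finsum R f I"
  by (simp add: finsum_def finprod_def)

text \<open>A set that spans \<open>V\<close> together with \<open>X\<close> and has least
  cardinality is a basis of a complement of \<open>X\<close>; \<open>co\<close> gives the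
  coordinates along it, and they vanish on \<open>X\<close>. Projections, extensions, separating
  functionals and dual bases are all read off from this one statement.\<close>

lemma rel_basis:
  assumes "field K" "left_module K V" "fin_gen K V" "subm K V X"
  obtains A co where "finite A" "A \<subseteq> carrier V"
    "\<And>s. s \<in> A \<Longrightarrow> functional K V (co s)"
    "\<And>s x. \<lbrakk>s \<in> A; x \<in> X\<rbrakk> \<Longrightarrow> co s x = \<zero>\<^bsub>K\<^esub>"
    "\<And>s t. \<lbrakk>s \<in> A; t \<in> A\<rbrakk> \<Longrightarrow> co s t = (if s = t then \<one>\<^bsub>K\<^esub> else \<zero>\<^bsub>K\<^esub>)"
    "\<And>v. v \<in> carrier V \<Longrightarrow> v \<ominus>\<^bsub>V\<^esub> (\<Oplus>\<^bsub>V\<^esub>s\<in>A. co s v \<odot>\<^bsub>V\<^esub> s) \<in> X"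
proof -
  interpret K: field K by fact
  interpret V: lmod K V unfolding lmod_def by fact
  note X = submD[OF assms(4)]
  obtain S where S: "finite S" "S \<subseteq> carrier V" "\<And>W. subm K V W \<Longrightarrow> S \<subseteq> W \<Longrightarrow> carrier V \<subseteq> W"
    using fin_genE[OF assms(3,2)] by blast
  define good where "good A \<longleftrightarrow> A \<subseteq> S \<and> (\<forall>v\<in>carrier V. \<exists>x\<in>X. \<exists>c\<in>A \<rightarrow> carrier K. v = x \<oplus>\<^bsub>V\<^esub> (\<Oplus>\<^bsub>V\<^esub>s\<in>A. c s \<odot>\<^bsub>V\<^esub> s))" for A
  have "good S" unfolding good_def
  proof (intro conjI ballI)
    fix v assume "v \<in> carrier V"
    moreover have "carrier V \<subseteq> lspan K V S"
      by (rule S(3)[OF V.lspan_subm[OF S(1,2)]]) (auto intro: V.lspan_incl[OF S(1,2)])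
    ultimately obtain c where c: "c \<in> S \<rightarrow> carrier K" "v = (\<Oplus>\<^bsub>V\<^esub>s\<in>S. c s \<odot>\<^bsub>V\<^esub> s)"
      unfolding lspan_def by auto
    show "\<exists>x\<in>X. \<exists>c\<in>S \<rightarrow> carrier K. v = x \<oplus>\<^bsub>V\<^esub> (\<Oplus>\<^bsub>V\<^esub>s\<in>S. c s \<odot>\<^bsub>V\<^esub> s)"
      by (rule bexI[of _ "\<zero>\<^bsub>V\<^esub>"], rule bexI[of _ c]) (use c X \<open>v \<in> carrier V\<close> in auto)
  qed auto
  then obtain A where A: "good A" "\<And>B. good B \<Longrightarrow> card A \<le> card B"
    using ex_has_least_nat[of good S card] by blast
  have AS: "A \<subseteq> S" "finite A" and AV: "A \<subseteq> carrier V" using A(1) S finite_subset unfolding good_def by auto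
  have e: "(\<lambda>s. s) \<in> A \<rightarrow> carrier V" using AV by auto
  define lc where "lc c = (\<Oplus>\<^bsub>V\<^esub>s\<in>A. c s \<odot>\<^bsub>V\<^esub> s)" for c
  have lc_cl: "lc c \<in> carrier V" if "c \<in> A \<rightarrow> carrier K" for c
    unfolding lc_def using V.lc_closed[OF that e] .
  have lc_add: "lc (\<lambda>s. c s \<oplus>\<^bsub>K\<^esub> d s) = lc c \<oplus>\<^bsub>V\<^esub> lc d" if "c \<in> A \<rightarrow> carrier K" "d \<in> A \<rightarrow> carrier K" for c d
    unfolding lc_def using V.lc_add[OF that e] .
  have lc_smult: "lc (\<lambda>s. r \<otimes>\<^bsub>K\<^esub> c s) = r \<odot>\<^bsub>V\<^esub> lc c" if "r \<in> carrier K" "c \<in> A \<rightarrow> carrier K" for r c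
    unfolding lc_def using V.lc_smult[OF AS(2) that e] .
  have lc_diff: "lc (\<lambda>s. c s \<oplus>\<^bsub>K\<^esub> (r \<otimes>\<^bsub>K\<^esub> d s)) = lc c \<oplus>\<^bsub>V\<^esub> r \<odot>\<^bsub>V\<^esub> lc d"
    if "r \<in> carrier K" "c \<in> A \<rightarrow> carrier K" "d \<in> A \<rightarrow> carrier K" for r c d
    using lc_add[of c "\<lambda>s. r \<otimes>\<^bsub>K\<^esub> d s"] lc_smult that by (auto simp: Pi_def)
  have ex: "\<exists>x\<in>X. \<exists>c\<in>A \<rightarrow> carrier K. v = x \<oplus>\<^bsub>V\<^esub> lc c" if "v \<in> carrier V" for v
    using A(1) that unfolding good_def lc_def by auto
  have indep: "c j = \<zero>\<^bsub>K\<^esub>" if x: "x \<in> X" and c: "c \<in> A \<rightarrow> carrier K" and z: "x \<oplus>\<^bsub>V\<^esub> lc c = \<zero>\<^bsub>V\<^esub>" and j: "j \<in> A" for x c j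
  proof (rule ccontr)
    assume nz: "c j \<noteq> \<zero>\<^bsub>K\<^esub>"
    have cj: "c j \<in> carrier K" using c j by auto
    have "good (A - {j})" unfolding good_def
    proof (intro conjI ballI)
      fix v assume v: "v \<in> carrier V"
      obtain y d where yd: "y \<in> X" "d \<in> A \<rightarrow> carrier K" "v = y \<oplus>\<^bsub>V\<^esub> lc d" using ex[OF v] by auto
      define t where "t = \<ominus>\<^bsub>K\<^esub> (d j \<otimes>\<^bsub>K\<^esub> inv\<^bsub>K\<^esub> (c j))"
      have dj: "d j \<in> carrier K" using yd j by auto
      have ic: "inv\<^bsub>K\<^esub> (c j) \<in> carrier K" "inv\<^bsub>K\<^esub> (c j) \<otimes>\<^bsub>K\<^esub> c j = \<one>\<^bsub>K\<^esub>"
        using cj nz K.field_Units by auto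
      have t: "t \<in> carrier K" using dj ic by (simp add: t_def)
      have tj: "d j \<oplus>\<^bsub>K\<^esub> (t \<otimes>\<^bsub>K\<^esub> c j) = \<zero>\<^bsub>K\<^esub>"
        using dj ic cj by (simp add: t_def K.l_minus K.m_assoc K.r_neg)
      define c' where "c' = (\<lambda>s. d s \<oplus>\<^bsub>K\<^esub> (t \<otimes>\<^bsub>K\<^esub> c s))"
      have c': "c' \<in> A \<rightarrow> carrier K" using c yd(2) t by (auto simp: c'_def)
      have y': "y \<oplus>\<^bsub>V\<^esub> t \<odot>\<^bsub>V\<^esub> x \<in> X" using X x yd(1) t by auto
      have cl: "x \<in> carrier V" "y \<in> carrier V" "lc c \<in> carrier V" "lc d \<in> carrier V"
        using x yd X lc_cl c by auto
      have "v = v \<oplus>\<^bsub>V\<^esub> t \<odot>\<^bsub>V\<^esub> (x \<oplus>\<^bsub>V\<^esub> lc c)" using v t by (simp add: z)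
      also have "\<dots> = (y \<oplus>\<^bsub>V\<^esub> t \<odot>\<^bsub>V\<^esub> x) \<oplus>\<^bsub>V\<^esub> lc c'"
        unfolding c'_def lc_diff[OF t yd(2) c] using cl t by (simp add: yd(3) V.smult_r_distr V.a_ac)
      also have "lc c' = (\<Oplus>\<^bsub>V\<^esub>s\<in>A - {j}. c' s \<odot>\<^bsub>V\<^esub> s)" unfolding lc_def
        by (rule V.add.finprod_mono_neutral_cong_right) (use AS c' AV j tj in \<open>auto simp: c'_def\<close>)
      finally show "\<exists>x\<in>X. \<exists>c\<in>A - {j} \<rightarrow> carrier K. v = x \<oplus>\<^bsub>V\<^esub> (\<Oplus>\<^bsub>V\<^esub>s\<in>A - {j}. c s \<odot>\<^bsub>V\<^esub> s)"
        using y' c' by (intro bexI[of _ "y \<oplus>\<^bsub>V\<^esub> t \<odot>\<^bsub>V\<^esub> x"] bexI[of _ c']) auto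
    qed (use AS in auto)
    then have "card A \<le> card (A - {j})" by (rule A(2))
    then show False using j AS(2) by (metis card_Diff1_less not_le)
  qed
  have uniq: "c j = d j" if xy: "x \<in> X" "y \<in> X" and cd: "c \<in> A \<rightarrow> carrier K" "d \<in> A \<rightarrow> carrier K"
    and eq: "x \<oplus>\<^bsub>V\<^esub> lc c = y \<oplus>\<^bsub>V\<^esub> lc d" and j: "j \<in> A" for x y c d j
  proof -
    have t: "\<ominus>\<^bsub>K\<^esub> \<one>\<^bsub>K\<^esub> \<in> carrier K" by simp
    have cl: "x \<in> carrier V" "y \<in> carrier V" "lc c \<in> carrier V" "lc d \<in> carrier V" using xy cd X lc_cl by auto
    have "(x \<ominus>\<^bsub>V\<^esub> y) \<oplus>\<^bsub>V\<^esub> lc (\<lambda>s. c s \<oplus>\<^bsub>K\<^esub> (\<ominus>\<^bsub>K\<^esub> \<one>\<^bsub>K\<^esub> \<otimes>\<^bsub>K\<^esub> d s)) = (x \<oplus>\<^bsub>V\<^esub> lc c) \<ominus>\<^bsub>V\<^esub> (y \<oplus>\<^bsub>V\<^esub> lc d)"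
      unfolding lc_diff[OF t cd] using cl by (simp add: a_minus_def V.sm_l_minus V.smult_one V.minus_add V.a_ac)
    also have "\<dots> = \<zero>\<^bsub>V\<^esub>" using cl eq by (simp add: V.diff_eq_zero_iff)
    finally have "c j \<oplus>\<^bsub>K\<^esub> (\<ominus>\<^bsub>K\<^esub> \<one>\<^bsub>K\<^esub> \<otimes>\<^bsub>K\<^esub> d j) = \<zero>\<^bsub>K\<^esub>"
      by (rule indep[rotated 2]) (use xy cd j V.subm_diff[OF assms(4)] in auto)
    moreover have "c j \<in> carrier K" "d j \<in> carrier K" using cd j by auto
    ultimately show ?thesis using K.diff_eq_zero_iff[of "c j" "d j"] by (simp add: K.l_minus a_minus_def)
  qed
  \<comment> \<open>Coordinates modulo \<open>X\<close>, chosen for each vector. By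
    \<open>uniq\<close> their values on \<open>A\<close> do not depend on the choice, which is what
    makes them linear.\<close>
  define cf where "cf v = (SOME c. c \<in> A \<rightarrow> carrier K \<and> (\<exists>x\<in>X. v = x \<oplus>\<^bsub>V\<^esub> lc c))" for v
  have cf: "cf v \<in> A \<rightarrow> carrier K" "\<exists>x\<in>X. v = x \<oplus>\<^bsub>V\<^esub> lc (cf v)" if "v \<in> carrier V" for v
  proof -
    have "\<exists>c. c \<in> A \<rightarrow> carrier K \<and> (\<exists>x\<in>X. v = x \<oplus>\<^bsub>V\<^esub> lc c)" using ex[OF that] by blast
    from someI_ex[OF this] show "cf v \<in> A \<rightarrow> carrier K" "\<exists>x\<in>X. v = x \<oplus>\<^bsub>V\<^esub> lc (cf v)"
      unfolding cf_def by blast+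
  qed
  have cf_eq: "cf (x \<oplus>\<^bsub>V\<^esub> lc c) s = c s" if "x \<in> X" "c \<in> A \<rightarrow> carrier K" "s \<in> A" for x c s
  proof -
    have "x \<oplus>\<^bsub>V\<^esub> lc c \<in> carrier V" using that X lc_cl by auto
    from cf[OF this] that uniq show ?thesis by metis
  qed
  show ?thesis
  proof (rule that[of A "\<lambda>s v. cf v s"])
    fix s assume s: "s \<in> A"
    show "functional K V (\<lambda>v. cf v s)"
    proof (rule linI)
      fix v assume "v \<in> carrier V"
      then show "cf v s \<in> carrier (self_module K)" using cf s by auto
    next
      fix v w assume vw: "v \<in> carrier V" "w \<in> carrier V"
      obtain x y where xy: "x \<in> X" "v = x \<oplus>\<^bsub>V\<^esub> lc (cf v)" "y \<in> X" "w = y \<oplus>\<^bsub>V\<^esub> lc (cf w)" using cf vw by metis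
      note c = cf(1)[OF vw(1)] cf(1)[OF vw(2)]
      have "v \<oplus>\<^bsub>V\<^esub> w = (x \<oplus>\<^bsub>V\<^esub> lc (cf v)) \<oplus>\<^bsub>V\<^esub> (y \<oplus>\<^bsub>V\<^esub> lc (cf w))" using xy(2,4) by simp
      also have "\<dots> = (x \<oplus>\<^bsub>V\<^esub> y) \<oplus>\<^bsub>V\<^esub> lc (\<lambda>s. cf v s \<oplus>\<^bsub>K\<^esub> cf w s)"
        unfolding lc_add[OF c] using X(2)[OF xy(1)] X(2)[OF xy(3)] lc_cl[OF c(1)] lc_cl[OF c(2)] by (simp add: V.a_ac)
      finally show "cf (v \<oplus>\<^bsub>V\<^esub> w) s = cf v s \<oplus>\<^bsub>self_module K\<^esub> cf w s"
        using cf_eq[of "x \<oplus>\<^bsub>V\<^esub> y" "\<lambda>s. cf v s \<oplus>\<^bsub>K\<^esub> cf w s" s] X xy c s by (auto simp: Pi_def)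
    next
      fix r v assume rv: "r \<in> carrier K" "v \<in> carrier V"
      obtain x where x: "x \<in> X" "v = x \<oplus>\<^bsub>V\<^esub> lc (cf v)" using cf rv by metis
      note c = cf(1)[OF rv(2)]
      have "r \<odot>\<^bsub>V\<^esub> v = r \<odot>\<^bsub>V\<^esub> (x \<oplus>\<^bsub>V\<^esub> lc (cf v))" using x(2) by simp
      also have "\<dots> = (r \<odot>\<^bsub>V\<^esub> x) \<oplus>\<^bsub>V\<^esub> lc (\<lambda>s. r \<otimes>\<^bsub>K\<^esub> cf v s)"
        unfolding lc_smult[OF rv(1) c] using X(2)[OF x(1)] lc_cl[OF c] rv by (simp add: V.smult_r_distr)
      finally show "cf (r \<odot>\<^bsub>V\<^esub> v) s = r \<odot>\<^bsub>self_module K\<^esub> cf v s"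
        using cf_eq[of "r \<odot>\<^bsub>V\<^esub> x" "\<lambda>s. r \<otimes>\<^bsub>K\<^esub> cf v s" s] X x c s rv by (auto simp: Pi_def)
    qed
    fix x assume x: "x \<in> X"
    have "lc (\<lambda>_. \<zero>\<^bsub>K\<^esub>) = \<zero>\<^bsub>V\<^esub>" unfolding lc_def by (rule V.add.finprod_one_eqI) (use AV in auto)
    then show "cf x s = \<zero>\<^bsub>K\<^esub>" using cf_eq[OF x, of "\<lambda>_. \<zero>\<^bsub>K\<^esub>" s] s X(2)[OF x] by auto
  next
    fix s t assume st: "s \<in> A" "t \<in> A"
    have tV: "t \<in> carrier V" using st AV by auto
    have "lc (\<lambda>s. if s = t then \<one>\<^bsub>K\<^esub> else \<zero>\<^bsub>K\<^esub>) = (\<Oplus>\<^bsub>V\<^esub>s\<in>A. if t = s then s else \<zero>\<^bsub>V\<^esub>)" unfolding lc_def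
      by (rule V.finsum_cong') (use AV in \<open>auto simp: V.smult_one\<close>)
    also have "\<dots> = t" using AS AV st by (subst V.finsum_singleton) auto
    finally show "cf t s = (if s = t then \<one>\<^bsub>K\<^esub> else \<zero>\<^bsub>K\<^esub>)"
      using cf_eq[OF X(3), of "\<lambda>s. if s = t then \<one>\<^bsub>K\<^esub> else \<zero>\<^bsub>K\<^esub>" s] st tV by auto
  next
    fix v assume v: "v \<in> carrier V"
    obtain x where x: "x \<in> X" "v = x \<oplus>\<^bsub>V\<^esub> lc (cf v)" using cf v by metis
    have "v \<ominus>\<^bsub>V\<^esub> lc (cf v) = x" using X(2)[OF x(1)] lc_cl[OF cf(1)[OF v]] x(2)
      by (metis V.add.m_assoc V.a_inv_closed V.minus_eq V.r_neg V.r_zero)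
    then show "v \<ominus>\<^bsub>V\<^esub> (\<Oplus>\<^bsub>V\<^esub>s\<in>A. cf v s \<odot>\<^bsub>V\<^esub> s) \<in> X" using x(1) by (simp add: lc_def)
  qed (use AS AV in auto)
qed

section \<open>Projections, extensions and separation in finite dimension\<close>

lemma lin_smult_const:
  assumes "left_module K V" "functional K U u" "v \<in> carrier V"
  shows "lin K U V (\<lambda>x. u x \<odot>\<^bsub>V\<^esub> v)"
proof -
  interpret V: left_module K V by fact
  show ?thesis by (rule linI) (use linD[OF assms(2)] assms(3) in \<open>auto simp: V.smult_l_distr V.smult_assoc1\<close>)
qed

text \<open>Subtracting the component along the complement of \<open>X\<close> leaves the component
  in \<open>X\<close>.\<close>

lemma subspace_projection:
  assumes "field K" "left_module K V" "fin_gen K V" "subm K V X"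
  obtains p where "lin K V V p" "\<And>v. v \<in> carrier V \<Longrightarrow> p v \<in> X" "\<And>x. x \<in> X \<Longrightarrow> p x = x"
proof -
  interpret K: field K by fact
  interpret V: lmod K V unfolding lmod_def by fact
  note X = submD[OF assms(4)]
  obtain A co where A: "finite A" "A \<subseteq> carrier V" "\<And>s. s \<in> A \<Longrightarrow> functional K V (co s)"
    "\<And>s x. \<lbrakk>s \<in> A; x \<in> X\<rbrakk> \<Longrightarrow> co s x = \<zero>\<^bsub>K\<^esub>" "\<And>v. v \<in> carrier V \<Longrightarrow> v \<ominus>\<^bsub>V\<^esub> (\<Oplus>\<^bsub>V\<^esub>s\<in>A. co s v \<odot>\<^bsub>V\<^esub> s) \<in> X"
    by (rule rel_basis[OF assms]) blast
  have l: "lin K V V (\<lambda>v. \<Oplus>\<^bsub>V\<^esub>s\<in>A. co s v \<odot>\<^bsub>V\<^esub> s)"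
    by (rule lin_sum[OF A(1) _ assms(2,2)], rule lin_smult_const[OF assms(2)]) (use A in auto)
  have "lin K V V (\<lambda>v. v \<oplus>\<^bsub>V\<^esub> (\<ominus>\<^bsub>K\<^esub> \<one>\<^bsub>K\<^esub>) \<odot>\<^bsub>V\<^esub> (\<Oplus>\<^bsub>V\<^esub>s\<in>A. co s v \<odot>\<^bsub>V\<^esub> s))"
    by (rule linI) (use linD[OF l] in \<open>auto simp: V.smult_r_distr V.a_ac V.smult_assoc1[symmetric] K.m_comm\<close>)
  from lin_cong[OF this assms(2), of "\<lambda>v. v \<ominus>\<^bsub>V\<^esub> (\<Oplus>\<^bsub>V\<^esub>s\<in>A. co s v \<odot>\<^bsub>V\<^esub> s)"]
  have p: "lin K V V (\<lambda>v. v \<ominus>\<^bsub>V\<^esub> (\<Oplus>\<^bsub>V\<^esub>s\<in>A. co s v \<odot>\<^bsub>V\<^esub> s))"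
    using linD(1)[OF l] by (simp add: a_minus_def V.minus_eq_sm)
  show ?thesis
  proof (rule that[OF p A(5)])
    fix x assume x: "x \<in> X"
    have "(\<Oplus>\<^bsub>V\<^esub>s\<in>A. co s x \<odot>\<^bsub>V\<^esub> s) = \<zero>\<^bsub>V\<^esub>"
      by (rule V.add.finprod_one_eqI) (use A x in auto)
    then show "x \<ominus>\<^bsub>V\<^esub> (\<Oplus>\<^bsub>V\<^esub>s\<in>A. co s x \<odot>\<^bsub>V\<^esub> s) = x" using x X by (simp add: a_minus_def)
  qed
qed

lemma lin_extend:
  assumes "field K" "left_module K V" "fin_gen K V" "subm K V X" "lin K (V\<lparr>carrier := X\<rparr>) U f"
  obtains F where "lin K V U F" "\<And>x. x \<in> X \<Longrightarrow> F x = f x"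
proof -
  obtain p where p: "lin K V V p" "\<And>v. v \<in> carrier V \<Longrightarrow> p v \<in> X" "\<And>x. x \<in> X \<Longrightarrow> p x = x"
    by (rule subspace_projection[OF assms(1-4)]) blast
  have "lin K V (V\<lparr>carrier := X\<rparr>) p" by (rule lin_upd_cod[OF p(1)]) (use p(2) in auto)
  from lin_comp[OF this assms(5)] show ?thesis by (rule that) (simp add: p)
qed

lemma fin_gen_subm:
  assumes "field K" "left_module K V" "fin_gen K V" "subm K V X"
  shows "fin_gen K (V\<lparr>carrier := X\<rparr>)"
proof -
  obtain p where p: "lin K V V p" "\<And>v. v \<in> carrier V \<Longrightarrow> p v \<in> X" "\<And>x. x \<in> X \<Longrightarrow> p x = x"
    by (rule subspace_projection[OF assms]) blast
  show ?thesis
  proof (rule fin_gen_surj[OF assms(3) lin_upd_cod[OF p(1)] assms(2) left_module.subm_left_module[OF assms(2,4)]])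
    show "carrier (V\<lparr>carrier := X\<rparr>) \<subseteq> p ` carrier V"
      using p(3) submD(2)[OF assms(4)] by force
  qed (use p(2) in auto)
qed

lemma fin_gen_inj:
  assumes "field K" "left_module K U" "left_module K V" "fin_gen K V" "lin K U V f" "inj_on f (carrier U)"
  shows "fin_gen K U"
proof -
  let ?X = "f ` carrier U"
  have X: "subm K V ?X" by (rule subm_range) fact+
  have lm: "left_module K (V\<lparr>carrier := ?X\<rparr>)" by (rule left_module.subm_left_module) fact+
  have b: "bij_betw f (carrier U) (carrier (V\<lparr>carrier := ?X\<rparr>))" using assms(6) by (simp add: bij_betw_def)
  have "lin K (V\<lparr>carrier := ?X\<rparr>) U (inv_into (carrier U) f)"
    by (rule lin_inv[OF assms(2) lm lin_upd_cod[OF assms(5)] b]) auto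
  then show ?thesis
    by (rule fin_gen_surj[OF fin_gen_subm[OF assms(1,3,4) X] _ lm assms(2)])
      (use b in \<open>auto simp: bij_betw_def image_iff intro!: bexI[of _ "f _"]\<close>)
qed

lemma separating_functional:
  assumes "field K" "left_module K V" "fin_gen K V" "subm K V X" "v \<in> carrier V" "v \<notin> X"
  obtains u where "functional K V u" "\<And>x. x \<in> X \<Longrightarrow> u x = \<zero>\<^bsub>K\<^esub>" "u v \<noteq> \<zero>\<^bsub>K\<^esub>"
proof -
  interpret K: field K by fact
  interpret V: lmod K V unfolding lmod_def by fact
  obtain A co where A: "finite A" "A \<subseteq> carrier V" "\<And>s. s \<in> A \<Longrightarrow> functional K V (co s)"
    "\<And>s x. \<lbrakk>s \<in> A; x \<in> X\<rbrakk> \<Longrightarrow> co s x = \<zero>\<^bsub>K\<^esub>" "\<And>v. v \<in> carrier V \<Longrightarrow> v \<ominus>\<^bsub>V\<^esub> (\<Oplus>\<^bsub>V\<^esub>s\<in>A. co s v \<odot>\<^bsub>V\<^esub> s) \<in> X"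
    by (rule rel_basis[OF assms(1-4)]) blast
  have "\<exists>s\<in>A. co s v \<noteq> \<zero>\<^bsub>K\<^esub>"
  proof (rule ccontr)
    assume "\<not> (\<exists>s\<in>A. co s v \<noteq> \<zero>\<^bsub>K\<^esub>)"
    then have "(\<Oplus>\<^bsub>V\<^esub>s\<in>A. co s v \<odot>\<^bsub>V\<^esub> s) = \<zero>\<^bsub>V\<^esub>"
      by (intro V.add.finprod_one_eqI) (use A in auto)
    with A(5)[OF assms(5)] assms(5,6) show False by (simp add: a_minus_def)
  qed
  then obtain s where "s \<in> A" "co s v \<noteq> \<zero>\<^bsub>K\<^esub>" by blast
  then show ?thesis using that[of "co s"] A by blast
qed

lemma dual_basis:
  assumes "field K" "left_module K V" "fin_gen K V"
  obtains A co where "finite A" "A \<subseteq> carrier V" "\<And>s. s \<in> A \<Longrightarrow> functional K V (co s)"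
    "\<And>v. v \<in> carrier V \<Longrightarrow> (\<Oplus>\<^bsub>V\<^esub>s\<in>A. co s v \<odot>\<^bsub>V\<^esub> s) = v"
proof -
  interpret V: lmod K V unfolding lmod_def by fact
  obtain A co where A: "finite A" "A \<subseteq> carrier V" "\<And>s. s \<in> A \<Longrightarrow> functional K V (co s)"
    "\<And>v. v \<in> carrier V \<Longrightarrow> v \<ominus>\<^bsub>V\<^esub> (\<Oplus>\<^bsub>V\<^esub>s\<in>A. co s v \<odot>\<^bsub>V\<^esub> s) \<in> {\<zero>\<^bsub>V\<^esub>}"
    by (rule rel_basis[OF assms V.subm_zero]) blast
  have "(\<lambda>s. co s v \<odot>\<^bsub>V\<^esub> s) \<in> A \<rightarrow> carrier V" if "v \<in> carrier V" for v
    using A(2) linD(1)[OF A(3) that] by auto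
  then show ?thesis using A by (intro that[of A co]) (auto simp: V.diff_eq_zero_iff)
qed

section \<open>Homology of dual complexes\<close>

definition dual_pair ::
  "('k, 'z) ring_scheme \<Rightarrow> ('k, 'u) module \<Rightarrow> ('k, 'v) module \<Rightarrow> ('u \<Rightarrow> 'v \<Rightarrow> 'k) \<Rightarrow> bool" where
  "dual_pair K V' V \<beta> \<longleftrightarrow> left_module K V' \<and> left_module K V \<and>
     (\<forall>v'\<in>carrier V'. functional K V (\<beta> v')) \<and>
     (\<forall>v\<in>carrier V. functional K V' (\<lambda>v'. \<beta> v' v)) \<and>
     (\<forall>u. functional K V u \<longrightarrow> (\<exists>v'\<in>carrier V'. \<forall>v\<in>carrier V. \<beta> v' v = u v)) \<and>
     (\<forall>v'\<in>carrier V'. (\<forall>v\<in>carrier V. \<beta> v' v = \<zero>\<^bsub>K\<^esub>) \<longrightarrow> v' = \<zero>\<^bsub>V'\<^esub>)"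

lemma dual_pairD:
  assumes "dual_pair K V' V \<beta>"
  shows "left_module K V'" "left_module K V" "v' \<in> carrier V' \<Longrightarrow> functional K V (\<beta> v')"
    "v \<in> carrier V \<Longrightarrow> functional K V' (\<lambda>v'. \<beta> v' v)"
    "functional K V u \<Longrightarrow> \<exists>v'\<in>carrier V'. \<forall>v\<in>carrier V. \<beta> v' v = u v"
    "v' \<in> carrier V' \<Longrightarrow> (\<And>v. v \<in> carrier V \<Longrightarrow> \<beta> v' v = \<zero>\<^bsub>K\<^esub>) \<Longrightarrow> v' = \<zero>\<^bsub>V'\<^esub>"
  using assms unfolding dual_pair_def by blast+

text \<open>The cycles \<open>Z'\<close> of the dual complex are the annihilator of the boundaries
  \<open>B\<close>, and its boundaries \<open>B'\<close> are the annihilator of the cycles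
  \<open>Z\<close>. The first is formal; the second extends a functional from the image of
  \<open>b\<close> to all of \<open>W\<close>. Hence \<open>Z'\<close> modulo \<open>B'\<close> is
  the dual space of \<open>Z\<close> modulo \<open>B\<close>, and a basis of the latter turns this
  dual into \<open>Z\<close> modulo \<open>B\<close> itself.\<close>

lemma dual_homology:
  assumes K: "field K" and fg: "fin_gen K V" "fin_gen K W"
    and dU: "dual_pair K U' U \<beta>U" and dV: "dual_pair K V' V \<beta>V" and dW: "dual_pair K W' W \<beta>W"
    and a: "lin K U V a" and b: "lin K V W b" and a': "lin K V' U' a'" and b': "lin K W' V' b'"
    and ba: "\<And>u. u \<in> carrier U \<Longrightarrow> b (a u) = \<zero>\<^bsub>W\<^esub>"
    and adb: "\<And>w' v. \<lbrakk>w' \<in> carrier W'; v \<in> carrier V\<rbrakk> \<Longrightarrow> \<beta>V (b' w') v = \<beta>W w' (b v)"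
    and ada: "\<And>v' u. \<lbrakk>v' \<in> carrier V'; u \<in> carrier U\<rbrakk> \<Longrightarrow> \<beta>U (a' v') u = \<beta>V v' (a u)"
  shows "mod_iso K (homology_at W' b' V' a' U') (homology_at U a V b W)"
proof -
  interpret K: field K by fact
  have Ks: "left_module K (self_module K)" by (rule left_module_self[OF K.ring_axioms])
  note dU = dual_pairD[OF dU] and dV = dual_pairD[OF dV] and dW = dual_pairD[OF dW]
  interpret V: lmod K V unfolding lmod_def by fact
  interpret V': lmod K V' unfolding lmod_def by fact
  interpret W: lmod K W unfolding lmod_def by fact
  define Z where "Z = {v \<in> carrier V. b v = \<zero>\<^bsub>W\<^esub>}"
  define B where "B = a ` carrier U"
  define Z' where "Z' = {v' \<in> carrier V'. a' v' = \<zero>\<^bsub>U'\<^esub>}"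
  define B' where "B' = b' ` carrier W'"
  have Z: "subm K V Z" unfolding Z_def by (rule subm_ker[OF b dV(2) dW(2)])
  have B: "subm K V B" unfolding B_def by (rule subm_range[OF a dU(2) dV(2)])
  have Z': "subm K V' Z'" unfolding Z'_def by (rule subm_ker[OF a' dV(1) dU(1)])
  have B': "subm K V' B'" unfolding B'_def by (rule subm_range[OF b' dW(1) dV(1)])
  have BZ: "B \<subseteq> Z" using ba linD(1)[OF a] by (auto simp: B_def Z_def)
  have Z'_iff: "v' \<in> Z' \<longleftrightarrow> (\<forall>v\<in>B. \<beta>V v' v = \<zero>\<^bsub>K\<^esub>)" if v': "v' \<in> carrier V'" for v'
  proof
    assume "v' \<in> Z'"
    then have "\<beta>V v' (a u) = \<zero>\<^bsub>K\<^esub>" if "u \<in> carrier U" for u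
      using ada[OF v' that] lin_zero[OF dU(4)[OF that] dU(1) Ks] by (simp add: Z'_def)
    then show "\<forall>v\<in>B. \<beta>V v' v = \<zero>\<^bsub>K\<^esub>" by (auto simp: B_def)
  next
    assume "\<forall>v\<in>B. \<beta>V v' v = \<zero>\<^bsub>K\<^esub>"
    then have "a' v' = \<zero>\<^bsub>U'\<^esub>" using linD(1)[OF a' v'] ada[OF v'] by (intro dU(6)) (auto simp: B_def)
    then show "v' \<in> Z'" using v' by (simp add: Z'_def)
  qed
  have B'_iff: "v' \<in> B' \<longleftrightarrow> (\<forall>v\<in>Z. \<beta>V v' v = \<zero>\<^bsub>K\<^esub>)" if v': "v' \<in> carrier V'" for v'
  proof
    assume "v' \<in> B'"
    then obtain w' where w': "w' \<in> carrier W'" "v' = b' w'" by (auto simp: B'_def)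
    then show "\<forall>v\<in>Z. \<beta>V v' v = \<zero>\<^bsub>K\<^esub>"
      using adb[OF w'(1)] lin_zero[OF dW(3)[OF w'(1)] dW(2) Ks] by (auto simp: Z_def)
  next
    assume van: "\<forall>v\<in>Z. \<beta>V v' v = \<zero>\<^bsub>K\<^esub>"
    note bl = dV(3)[OF v']
    let ?I = "b ` carrier V"
    have I: "subm K W ?I" by (rule subm_range[OF b dV(2) dW(2)])
    \<comment> \<open>The pairing with \<open>v'\<close> kills the kernel of \<open>b\<close>, so it
      descends to a functional \<open>u\<close> on the image of \<open>b\<close>. An extension of
      \<open>u\<close> to \<open>W\<close> is represented by the \<open>w'\<close> that is
      sought.\<close>
    define u where "u w = \<beta>V v' (SOME v. v \<in> carrier V \<and> b v = w)" for w
    have u: "u (b v) = \<beta>V v' v" if v: "v \<in> carrier V" for v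
    proof -
      define y where "y = (SOME y. y \<in> carrier V \<and> b y = b v)"
      have y: "y \<in> carrier V" "b y = b v" unfolding y_def by (rule someI2[of _ v]; use v in simp)+
      then have "y \<ominus>\<^bsub>V\<^esub> v \<in> Z" using v linD(1)[OF b] unfolding Z_def
        by (simp add: lin_diff[OF b dV(2) dW(2)] W.diff_eq_zero_iff)
      then have "\<beta>V v' (y \<ominus>\<^bsub>V\<^esub> v) = \<zero>\<^bsub>K\<^esub>" using van by auto
      then show ?thesis using y v linD(1)[OF bl]
        unfolding lin_diff[OF bl dV(2) Ks y(1) v] u_def y_def[symmetric]
        by (simp add: a_inv_cong[of "self_module K" K] K.diff_eq_zero_iff)
    qed
    have "lin K (W\<lparr>carrier := ?I\<rparr>) (self_module K) u"
    proof (rule linI)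
      fix x assume "x \<in> carrier (W\<lparr>carrier := ?I\<rparr>)"
      then show "u x \<in> carrier (self_module K)" using u linD(1)[OF bl] by auto
    next
      fix x y assume "x \<in> carrier (W\<lparr>carrier := ?I\<rparr>)" "y \<in> carrier (W\<lparr>carrier := ?I\<rparr>)"
      then obtain v w where vw: "v \<in> carrier V" "w \<in> carrier V" "x = b v" "y = b w" by auto
      then have "x \<oplus>\<^bsub>W\<^esub> y = b (v \<oplus>\<^bsub>V\<^esub> w)" using linD(2)[OF b] by simp
      then show "u (x \<oplus>\<^bsub>W\<lparr>carrier := ?I\<rparr>\<^esub> y) = u x \<oplus>\<^bsub>self_module K\<^esub> u y"
        using vw linD(2)[OF bl] by (simp add: u)
    next
      fix r x assume "r \<in> carrier K" "x \<in> carrier (W\<lparr>carrier := ?I\<rparr>)"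
      then obtain v where v: "r \<in> carrier K" "v \<in> carrier V" "x = b v" by auto
      then have "r \<odot>\<^bsub>W\<^esub> x = b (r \<odot>\<^bsub>V\<^esub> v)" using linD(3)[OF b] by simp
      then show "u (r \<odot>\<^bsub>W\<lparr>carrier := ?I\<rparr>\<^esub> x) = r \<odot>\<^bsub>self_module K\<^esub> u x"
        using v linD(3)[OF bl] by (simp add: u)
    qed
    then obtain F where F: "functional K W F" "\<And>x. x \<in> ?I \<Longrightarrow> F x = u x"
      using lin_extend[OF K dW(2) fg(2) I] by blast
    obtain w' where w': "w' \<in> carrier W'" "\<forall>w\<in>carrier W. \<beta>W w' w = F w" using dW(5)[OF F(1)] by blast
    have bw: "b' w' \<in> carrier V'" using linD(1)[OF b' w'(1)] .
    have "v' \<ominus>\<^bsub>V'\<^esub> b' w' = \<zero>\<^bsub>V'\<^esub>"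
    proof (rule dV(6))
      fix v assume v: "v \<in> carrier V"
      have "\<beta>V (b' w') v = \<beta>V v' v" using adb[OF w'(1) v] w'(2) F(2) u v linD(1)[OF b v] by simp
      then show "\<beta>V (v' \<ominus>\<^bsub>V'\<^esub> b' w') v = \<zero>\<^bsub>K\<^esub>"
        using lin_diff[OF dV(4)[OF v] dV(1) Ks v' bw] linD(1)[OF bl v]
        by (simp add: a_inv_cong[of "self_module K" K] K.diff_eq_zero_iff)
    qed (use v' bw in auto)
    then have "v' = b' w'" using v' bw by (simp add: V'.diff_eq_zero_iff)
    then show "v' \<in> B'" using w' by (simp add: B'_def)
  qed
  have B'Z': "B' \<subseteq> Z'" using Z'_iff B'_iff BZ submD(1)[OF B'] by blast
  let ?VZ = "V\<lparr>carrier := Z\<rparr>"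
  have VZ: "left_module K ?VZ" by (rule V.subm_left_module[OF Z])
  interpret VZ: lmod K ?VZ unfolding lmod_def by fact
  obtain A co where A: "finite A" "A \<subseteq> Z" "\<And>s. s \<in> A \<Longrightarrow> functional K ?VZ (co s)"
    "\<And>s x. \<lbrakk>s \<in> A; x \<in> B\<rbrakk> \<Longrightarrow> co s x = \<zero>\<^bsub>K\<^esub>"
    "\<And>s t. \<lbrakk>s \<in> A; t \<in> A\<rbrakk> \<Longrightarrow> co s t = (if s = t then \<one>\<^bsub>K\<^esub> else \<zero>\<^bsub>K\<^esub>)"
    "\<And>v. v \<in> Z \<Longrightarrow> v \<ominus>\<^bsub>?VZ\<^esub> (\<Oplus>\<^bsub>?VZ\<^esub>s\<in>A. co s v \<odot>\<^bsub>V\<^esub> s) \<in> B"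
    using rel_basis[OF K VZ fin_gen_subm[OF K dV(2) fg(1) Z] subm_upd[OF B BZ]] by (simp, blast)
  \<comment> \<open>\<open>A\<close> is a basis of a complement of \<open>B\<close> in
    \<open>Z\<close>. Sending \<open>v'\<close> to the vector with coordinates
    \<open>\<beta>V v' s\<close> restricts the functional of \<open>v'\<close> to \<open>Z\<close>
    and then identifies functionals with vectors through that basis.\<close>
  define g where "g v' = (\<Oplus>\<^bsub>?VZ\<^esub>s\<in>A. \<beta>V v' s \<odot>\<^bsub>V\<^esub> s)" for v'
  have sV: "s \<in> carrier V" if "s \<in> A" for s using that A(2) submD(2)[OF Z] by auto
  have l1: "lin K V' ?VZ (\<lambda>v'. \<beta>V v' s \<odot>\<^bsub>?VZ\<^esub> s)" if "s \<in> A" for s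
    by (rule lin_smult_const[OF VZ dV(4)]) (use that A sV in auto)
  have gl: "lin K V' ?VZ g" unfolding g_def
    using lin_sum[OF A(1) l1 dV(1) VZ] by simp
  have cog: "co s (g v') = \<beta>V v' s" if s: "s \<in> A" and v': "v' \<in> carrier V'" for s v'
  proof -
    have fn: "(\<lambda>s. \<beta>V v' s \<odot>\<^bsub>V\<^esub> s) \<in> A \<rightarrow> carrier ?VZ"
      using linD(1)[OF l1 v'] by auto
    have "co s (g v') = (\<Oplus>\<^bsub>self_module K\<^esub>t\<in>A. co s (\<beta>V v' t \<odot>\<^bsub>?VZ\<^esub> t))"
      unfolding g_def using lin_finsum[OF A(3)[OF s] VZ Ks A(1) fn] by simp
    also have "\<dots> = (\<Oplus>\<^bsub>K\<^esub>t\<in>A. if s = t then \<beta>V v' t else \<zero>\<^bsub>K\<^esub>)"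
      unfolding self_finsum[OF K.ring_axioms]
      by (rule K.finsum_cong') (use linD(3)[OF A(3)[OF s]] linD(1)[OF dV(3)[OF v']] sV A(2,5) s in \<open>auto simp: subset_iff\<close>)
    also have "\<dots> = \<beta>V v' s" using s A(1) linD(1)[OF dV(3)[OF v']] sV by (subst K.finsum_singleton) auto
    finally show ?thesis .
  qed
  show ?thesis
    unfolding homology_at_subquot Z_def[symmetric] Z'_def[symmetric] B_def[symmetric] B'_def[symmetric]
  proof (rule subquot_iso[OF dV(1,2) Z' B' B'Z' Z B BZ, where f = g])
    have Z'V: "Z' \<subseteq> carrier V'" by (auto simp: Z'_def)
    show "g x \<in> Z" if "x \<in> Z'" for x using linD(1)[OF gl, of x] that Z'V by auto
    show "g (x \<oplus>\<^bsub>V'\<^esub> y) = g x \<oplus>\<^bsub>V\<^esub> g y" if "x \<in> Z'" "y \<in> Z'" for x y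
      using linD(2)[OF gl, of x y] that Z'V by auto
    show "g (r \<odot>\<^bsub>V'\<^esub> x) = r \<odot>\<^bsub>V\<^esub> g x" if "r \<in> carrier K" "x \<in> Z'" for r x
      using linD(3)[OF gl, of r x] that Z'V by auto
    show "g x \<in> B \<longleftrightarrow> x \<in> B'" if x: "x \<in> Z'" for x
    proof -
      have xV: "x \<in> carrier V'" using x Z'V by auto
      have "x \<in> B'" if gB: "g x \<in> B"
      proof -
        have bs: "\<beta>V x s = \<zero>\<^bsub>K\<^esub>" if "s \<in> A" for s using cog[OF that xV] A(4)[OF that gB] by simp
        have "\<beta>V x v = \<zero>\<^bsub>K\<^esub>" if v: "v \<in> Z" for v
        proof -
          note bl = dV(3)[OF xV]
          have blZ: "functional K ?VZ (\<beta>V x)" by (rule lin_upd_dom[OF bl]) (rule submD(1)[OF Z])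
          let ?y = "\<Oplus>\<^bsub>?VZ\<^esub>s\<in>A. co s v \<odot>\<^bsub>V\<^esub> s"
          have fn: "(\<lambda>s. co s v \<odot>\<^bsub>V\<^esub> s) \<in> A \<rightarrow> Z" using linD(1)[OF A(3)] v A(2) submD(5)[OF Z] by auto
          have yZ: "?y \<in> Z" using VZ.finsum_closed[of "\<lambda>s. co s v \<odot>\<^bsub>V\<^esub> s" A] fn by simp
          have "\<beta>V x ?y = (\<Oplus>\<^bsub>self_module K\<^esub>s\<in>A. \<beta>V x (co s v \<odot>\<^bsub>V\<^esub> s))"
            by (rule lin_finsum[OF blZ VZ Ks A(1)]) (use fn in auto)
          also have "\<dots> = \<zero>\<^bsub>K\<^esub>" unfolding self_finsum[OF K.ring_axioms]
            by (rule K.add.finprod_one_eqI) (use linD(3)[OF bl] linD(1)[OF A(3)] v sV bs in auto)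
          finally have "\<beta>V x ?y = \<zero>\<^bsub>K\<^esub>" .
          moreover have "\<beta>V x (v \<ominus>\<^bsub>?VZ\<^esub> ?y) = \<zero>\<^bsub>K\<^esub>" using A(6)[OF v] Z'_iff[OF xV] x by auto
          ultimately show ?thesis
            using lin_diff[OF blZ VZ Ks, of v ?y] v yZ linD(1)[OF bl, of v] submD(2)[OF Z v]
            by (simp add: a_inv_cong[of "self_module K" K] K.minus_eq)
        qed
        then show ?thesis using B'_iff[OF xV] by auto
      qed
      moreover have "g x \<in> B" if "x \<in> B'"
      proof -
        have "g x = \<zero>\<^bsub>?VZ\<^esub>" unfolding g_def
          by (rule VZ.add.finprod_one_eqI) (use that B'_iff[OF xV] A(2) sV in auto)
        then show ?thesis using submD(3)[OF B] by simp
      qed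
      ultimately show ?thesis by blast
    qed
    fix z assume z: "z \<in> Z"
    \<comment> \<open>To reach \<open>z\<close> modulo \<open>B\<close>, a functional has to vanish
      on \<open>B\<close> and take the value \<open>co s z\<close> at each \<open>s\<close>. This
      combination of coordinates does so, because \<open>co\<close> is dual to
      \<open>A\<close>.\<close>
    define u where "u v = (\<Oplus>\<^bsub>self_module K\<^esub>s\<in>A. co s v \<odot>\<^bsub>self_module K\<^esub> co s z)" for v
    have cK: "co s z \<in> carrier K" if "s \<in> A" for s using linD(1)[OF A(3)[OF that], of z] z by simp
    have "functional K ?VZ u" unfolding u_def
      by (rule lin_sum[OF A(1) _ VZ Ks], rule lin_smult_const[OF Ks]) (use A(3) cK in auto)
    then obtain F where F: "functional K V F" "\<And>x. x \<in> Z \<Longrightarrow> F x = u x"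
      using lin_extend[OF K dV(2) fg(1) Z] by blast
    obtain x where x: "x \<in> carrier V'" "\<forall>v\<in>carrier V. \<beta>V x v = F v" using dV(5)[OF F(1)] by blast
    have uB: "u v = \<zero>\<^bsub>K\<^esub>" if "v \<in> B" for v unfolding u_def self_finsum[OF K.ring_axioms]
      by (rule K.add.finprod_one_eqI) (use A(4) that cK in auto)
    have us: "u s = co s z" if "s \<in> A" for s
    proof -
      have "u s = (\<Oplus>\<^bsub>K\<^esub>t\<in>A. if s = t then co t z else \<zero>\<^bsub>K\<^esub>)"
        unfolding u_def self_finsum[OF K.ring_axioms]
        by (rule K.finsum_cong') (use A(5) that cK in auto)
      then show ?thesis using that A(1) cK by (subst (asm) K.finsum_singleton) auto
    qed
    have "\<beta>V x v = \<zero>\<^bsub>K\<^esub>" if "v \<in> B" for v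
      using x(2) F(2)[of v] uB[OF that] that BZ submD(2)[OF B that] by auto
    then have xZ: "x \<in> Z'" using Z'_iff[OF x(1)] by auto
    have "g x = (\<Oplus>\<^bsub>?VZ\<^esub>s\<in>A. co s z \<odot>\<^bsub>V\<^esub> s)" unfolding g_def
      by (rule VZ.finsum_cong') (use x(2) F(2) us sV A(2) cK submD(5)[OF Z] in \<open>auto simp: subset_iff\<close>)
    then have w: "z \<ominus>\<^bsub>?VZ\<^esub> g x \<in> B" using A(6)[OF z] by simp
    have gx: "g x \<in> carrier ?VZ" using linD(1)[OF gl x(1)] .
    have "z = g x \<oplus>\<^bsub>?VZ\<^esub> (z \<ominus>\<^bsub>?VZ\<^esub> g x)" using gx z VZ.add_diff_cancel[of "g x" z] by simp
    then show "\<exists>x\<in>Z'. \<exists>w\<in>B. z = g x \<oplus>\<^bsub>V\<^esub> w" using xZ w by (intro bexI[of _ x] bexI[of _ "z \<ominus>\<^bsub>?VZ\<^esub> g x"]) auto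
  qed
qed

section \<open>Finite powers of a module\<close>

text \<open>Sequences that vanish from \<open>r\<close> on. For \<open>N = self_module R\<close> the
  carrier type is \<open>nat \<Rightarrow> 'r\<close>, the one in which \<open>projective\<close>,
  \<open>injective\<close> and \<open>chosen_resolution\<close> look for modules, and all ranks
  \<open>r\<close> share it.\<close>

definition pow_module :: "('r, 'n) module \<Rightarrow> nat \<Rightarrow> ('r, nat \<Rightarrow> 'n) module" where
  "pow_module N r = mk_module {v. (\<forall>i<r. v i \<in> carrier N) \<and> (\<forall>i\<ge>r. v i = \<zero>\<^bsub>N\<^esub>)}
     (\<lambda>_. \<zero>\<^bsub>N\<^esub>) (\<lambda>v w i. v i \<oplus>\<^bsub>N\<^esub> w i) (\<lambda>a v i. a \<odot>\<^bsub>N\<^esub> v i)"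

lemma pow_module_simps [simp]:
  "zero (pow_module N r) = (\<lambda>_. \<zero>\<^bsub>N\<^esub>)" "add (pow_module N r) = (\<lambda>v w i. v i \<oplus>\<^bsub>N\<^esub> w i)"
  "smult (pow_module N r) = (\<lambda>a v i. a \<odot>\<^bsub>N\<^esub> v i)"
  by (simp_all add: pow_module_def)

lemma pow_carrier: "v \<in> carrier (pow_module N r) \<longleftrightarrow> (\<forall>i<r. v i \<in> carrier N) \<and> (\<forall>i\<ge>r. v i = \<zero>\<^bsub>N\<^esub>)"
  by (simp add: pow_module_def)

lemma pow_comp: "left_module R N \<Longrightarrow> v \<in> carrier (pow_module N r) \<Longrightarrow> v i \<in> carrier N"
proof -
  assume "left_module R N" and v: "v \<in> carrier (pow_module N r)"
  then interpret N: left_module R N by simp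
  show ?thesis using v by (cases "i < r") (auto simp: pow_carrier)
qed

lemma pow_left_module:
  assumes "left_module R N" shows "left_module R (pow_module N r)"
proof -
  interpret N: left_module R N by fact
  note c = pow_comp[OF assms, of _ r]
  show ?thesis
  proof (rule left_moduleI, goal_cases)
    case (7 v)
    then show ?case
      by (intro bexI[of _ "\<lambda>i. \<ominus>\<^bsub>N\<^esub> v i"]) (auto simp: pow_carrier intro!: ext N.l_neg c)
  next
    case (2 v w) then show ?case by (auto simp: pow_carrier)
  next
    case 3 show ?case by (auto simp: pow_carrier)
  next
    case (8 a v) then show ?case by (auto simp: pow_carrier)
  qed (auto simp: c N.R.ring_axioms N.a_assoc N.smult_l_distr N.smult_r_distr N.smult_assoc1 N.smult_one
      intro!: ext intro: N.a_comm)
qed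

lemma pow_proj: "left_module R N \<Longrightarrow> lin R (pow_module N r) N (\<lambda>v. v i)"
  by (rule linI) (auto intro: pow_comp)

lemma pow_tuple:
  assumes "\<And>i. i < r \<Longrightarrow> lin R M N (g i)" "left_module R N"
  shows "lin R M (pow_module N r) (\<lambda>x i. if i < r then g i x else \<zero>\<^bsub>N\<^esub>)"
proof -
  interpret N: left_module R N by fact
  show ?thesis by (rule linI) (auto simp: pow_carrier linD[OF assms(1)])
qed

lemma pow_inj:
  assumes "left_module R N" "i < r"
  shows "lin R N (pow_module N r) (\<lambda>x j. if j = i then x else \<zero>\<^bsub>N\<^esub>)"
proof -
  interpret N: left_module R N by fact
  show ?thesis by (rule linI) (use assms(2) in \<open>auto simp: pow_carrier\<close>)
qed

text \<open>A tuple is assembled by adding one coordinate at a time, so statements about a power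
  reduce to the coordinate copies of \<open>N\<close>.\<close>

lemma pow_generated:
  assumes "left_module R N" "subm R (pow_module N r) W"
    and "\<And>i x. \<lbrakk>i < r; x \<in> carrier N\<rbrakk> \<Longrightarrow> (\<lambda>j. if j = i then x else \<zero>\<^bsub>N\<^esub>) \<in> W"
  shows "carrier (pow_module N r) \<subseteq> W"
proof
  interpret N: left_module R N by fact
  fix v assume v: "v \<in> carrier (pow_module N r)"
  have "(\<lambda>i. if i < k then v i else \<zero>\<^bsub>N\<^esub>) \<in> W" if "k \<le> r" for k
    using that
  proof (induction k)
    case 0
    then show ?case using submD(3)[OF assms(2)] by simp
  next
    case (Suc k)
    have "(\<lambda>i. if i < Suc k then v i else \<zero>\<^bsub>N\<^esub>) =
      (\<lambda>i. if i < k then v i else \<zero>\<^bsub>N\<^esub>) \<oplus>\<^bsub>pow_module N r\<^esub> (\<lambda>j. if j = k then v k else \<zero>\<^bsub>N\<^esub>)"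
      using pow_comp[OF assms(1) v] by (auto simp: less_Suc_eq)
    then show ?case using Suc submD(4)[OF assms(2)] assms(3) pow_comp[OF assms(1) v] by simp
  qed
  moreover have "(\<lambda>i. if i < r then v i else \<zero>\<^bsub>N\<^esub>) = v" using v by (auto simp: pow_carrier)
  ultimately show "v \<in> W" by (metis order_refl)
qed

lemma pow_fin_gen:
  assumes "left_module R N" "fin_gen R N"
  shows "fin_gen R (pow_module N r)"
proof -
  interpret N: left_module R N by fact
  obtain S where S: "finite S" "S \<subseteq> carrier N" "\<And>W. subm R N W \<Longrightarrow> S \<subseteq> W \<Longrightarrow> carrier N \<subseteq> W"
    using fin_genE[OF assms(2,1)] by blast
  let ?e = "\<lambda>(i, x) j. if j = i then x else \<zero>\<^bsub>N\<^esub>"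
  show ?thesis
  proof (rule fin_genI[OF pow_left_module[OF assms(1)]])
    show "finite (?e ` ({..<r} \<times> S))" using S by auto
    show "?e ` ({..<r} \<times> S) \<subseteq> carrier (pow_module N r)" using S by (auto simp: pow_carrier)
    fix W assume W: "subm R (pow_module N r) W" "?e ` ({..<r} \<times> S) \<subseteq> W"
    show "carrier (pow_module N r) \<subseteq> W"
    proof (rule pow_generated[OF assms(1) W(1)])
      fix i x assume i: "i < r" and x: "x \<in> carrier N"
      have "carrier N \<subseteq> {x \<in> carrier N. ?e (i, x) \<in> W}"
        using subm_preimage[OF pow_inj[OF assms(1) i] assms(1) pow_left_module[OF assms(1)] W(1)]
        by (intro S(3)) (use S(2) W(2) i in auto)
      then show "(\<lambda>j. if j = i then x else \<zero>\<^bsub>N\<^esub>) \<in> W" using x by auto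
    qed
  qed
qed

section \<open>Free modules: covers, splittings, projectivity\<close>

lemma pow_lift:
  assumes "left_module R M" "\<And>i. i < r \<Longrightarrow> m i \<in> carrier M"
  shows "lin R (pow_module (self_module R) r) M (\<lambda>v. \<Oplus>\<^bsub>M\<^esub>i\<in>{..<r}. v i \<odot>\<^bsub>M\<^esub> m i)"
proof -
  interpret M: left_module R M by fact
  have s: "left_module R (self_module R)" by (rule left_module_self[OF M.R.ring_axioms])
  show ?thesis
    by (rule lin_sum[OF _ _ pow_left_module[OF s] assms(1)], simp,
        rule lin_smult_const[OF assms(1) pow_proj[OF s]]) (use assms(2) in auto)
qed

lemma pow_lift_unit:
  fixes k r :: nat
  assumes "left_module R M" "\<And>i. i < r \<Longrightarrow> m i \<in> carrier M" "k < r"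
  shows "(\<Oplus>\<^bsub>M\<^esub>i\<in>{..<r}. (if i = k then \<one>\<^bsub>R\<^esub> else \<zero>\<^bsub>R\<^esub>) \<odot>\<^bsub>M\<^esub> m i) = m k"
proof -
  interpret M: left_module R M by fact
  have "(\<Oplus>\<^bsub>M\<^esub>i\<in>{..<r}. (if i = k then \<one>\<^bsub>R\<^esub> else \<zero>\<^bsub>R\<^esub>) \<odot>\<^bsub>M\<^esub> m i) = (\<Oplus>\<^bsub>M\<^esub>i\<in>{..<r}. if k = i then m i else \<zero>\<^bsub>M\<^esub>)"
    by (rule M.finsum_cong') (use assms in \<open>auto simp: M.smult_one\<close>)
  also have "\<dots> = m k" using assms(2,3) by (subst M.finsum_singleton) auto
  finally show ?thesis .
qed

lemma free_cover:
  assumes "left_module R M" "fin_gen R M"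
  obtains r p where "lin R (pow_module (self_module R) r) M p"
    "p ` carrier (pow_module (self_module R) r) = carrier M"
proof -
  interpret M: left_module R M by fact
  have s: "left_module R (self_module R)" by (rule left_module_self[OF M.R.ring_axioms])
  obtain S where S: "finite S" "S \<subseteq> carrier M" "\<And>W. subm R M W \<Longrightarrow> S \<subseteq> W \<Longrightarrow> carrier M \<subseteq> W"
    using fin_genE[OF assms(2,1)] by blast
  obtain m where m: "bij_betw m {..<card S} S"
    using ex_bij_betw_nat_finite[OF S(1)] by (auto simp: atLeast0LessThan)
  have mS: "m i \<in> carrier M" if "i < card S" for i using m S(2) that by (auto simp: bij_betw_def)
  let ?F = "pow_module (self_module R) (card S)"
  let ?p = "\<lambda>v. \<Oplus>\<^bsub>M\<^esub>i\<in>{..<card S}. v i \<odot>\<^bsub>M\<^esub> m i"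
  have l: "lin R ?F M ?p" by (rule pow_lift[OF assms(1) mS])
  have "S \<subseteq> ?p ` carrier ?F"
  proof
    fix s assume "s \<in> S"
    then obtain k where k: "k < card S" "s = m k" using m by (auto simp: bij_betw_def)
    then have "?p (\<lambda>i. if i = k then \<one>\<^bsub>R\<^esub> else \<zero>\<^bsub>R\<^esub>) = s" using pow_lift_unit[OF assms(1) mS k(1)] by simp
    moreover have "(\<lambda>i. if i = k then \<one>\<^bsub>R\<^esub> else \<zero>\<^bsub>R\<^esub>) \<in> carrier ?F" using k by (auto simp: pow_carrier)
    ultimately show "s \<in> ?p ` carrier ?F" by (intro image_eqI) auto
  qed
  then have "carrier M \<subseteq> ?p ` carrier ?F" by (rule S(3)[OF subm_range[OF l pow_left_module[OF s] assms(1)]])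
  moreover have "?p ` carrier ?F \<subseteq> carrier M" using linD(1)[OF l] by auto
  ultimately show ?thesis using that[OF l] by blast
qed

lemma self_fin_gen:
  assumes "ring R" shows "fin_gen R (self_module R)"
proof (rule fin_genI[OF left_module_self[OF assms], of "{\<one>\<^bsub>R\<^esub>}"])
  interpret ring R by fact
  fix W assume W: "subm R (self_module R) W" "{\<one>\<^bsub>R\<^esub>} \<subseteq> W"
  show "carrier (self_module R) \<subseteq> W"
  proof
    fix x assume "x \<in> carrier (self_module R)"
    then show "x \<in> W" using submD(5)[OF W(1), of x "\<one>\<^bsub>R\<^esub>"] W(2) by simp
  qed
qed (use assms in \<open>auto simp: ring.ring_simprules\<close>)

lemma projective_lift:
  fixes M N :: "('r, nat \<Rightarrow> 'r) module"
  assumes "projective R P" "left_module R M" "left_module R N"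
    and "lin R M N g" "g ` carrier M = carrier N" "lin R P N f"
  obtains h where "lin R P M h" "\<And>x. x \<in> carrier P \<Longrightarrow> g (h x) = f x"
proof -
  have P: "left_module R P" using assms(1) by (simp add: projective_def)
  have g: "restrict g (carrier M) \<in> mod_hom R M N" and f: "restrict f (carrier P) \<in> mod_hom R P N"
    using lin_restrict assms P by blast+
  have "restrict g (carrier M) ` carrier M = carrier N" using assms(5) by simp
  then obtain h where h: "h \<in> mod_hom R P M"
      "\<forall>x\<in>carrier P. restrict g (carrier M) (h x) = restrict f (carrier P) x"
    using assms(1-3) g f unfolding projective_def by blast
  then show ?thesis using that[OF mod_hom_lin[OF h(1)]] linD(1)[OF mod_hom_lin[OF h(1)]] by auto
qed

text \<open>Lifting the identity along a free cover exhibits \<open>P\<close> as a direct summand of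
  a free module. The pair \<open>p\<close>, \<open>s\<close> later serves as a dual basis of
  \<open>P\<close>: the coordinates of \<open>s\<close> are the functionals, the images under
  \<open>p\<close> of the unit vectors are the generators.\<close>

lemma projective_split:
  fixes P :: "('r, nat \<Rightarrow> 'r) module"
  assumes "projective R P" "fin_gen R P"
  obtains r p s where "lin R (pow_module (self_module R) r) P p" "lin R P (pow_module (self_module R) r) s"
    "\<And>x. x \<in> carrier P \<Longrightarrow> p (s x) = x"
proof -
  have P: "left_module R P" using assms(1) by (simp add: projective_def)
  interpret P: left_module R P by fact
  have sl: "left_module R (self_module R)" by (rule left_module_self[OF P.R.ring_axioms])
  obtain r p where p: "lin R (pow_module (self_module R) r) P p"
    "p ` carrier (pow_module (self_module R) r) = carrier P" using free_cover[OF P assms(2)] .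
  obtain s where "lin R P (pow_module (self_module R) r) s" "\<And>x. x \<in> carrier P \<Longrightarrow> p (s x) = x"
    using projective_lift[OF assms(1) pow_left_module[OF sl] P p lin_id] by blast
  then show ?thesis using that p by blast
qed

lemma free_projective:
  assumes "ring R" shows "projective R (pow_module (self_module R) r)"
  unfolding projective_def
proof (intro conjI allI impI ballI)
  interpret ring R by fact
  have sl: "left_module R (self_module R)" by (rule left_module_self[OF assms])
  show lF: "left_module R (pow_module (self_module R) r)" by (rule pow_left_module[OF sl])
  interpret F: left_module R "pow_module (self_module R) r" by fact
  fix M N :: "('a, nat \<Rightarrow> 'a) module" and g f
  assume M: "left_module R M" and N: "left_module R N" and g: "g \<in> mod_hom R M N"
    and f: "f \<in> mod_hom R (pow_module (self_module R) r) N" and sur: "g ` carrier M = carrier N"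
  interpret M: left_module R M by fact
  interpret N: left_module R N by fact
  let ?F = "pow_module (self_module R) r"
  let ?e = "\<lambda>k i. if i = k then \<one>\<^bsub>R\<^esub> else \<zero>\<^bsub>R\<^esub>"
  note gl = mod_hom_lin[OF g] and fl = mod_hom_lin[OF f]
  have e: "?e k \<in> carrier ?F" if "k < r" for k using that by (auto simp: pow_carrier)
  define m where "m k = (SOME m. m \<in> carrier M \<and> g m = f (?e k))" for k
  have m: "m k \<in> carrier M" "g (m k) = f (?e k)" if "k < r" for k
  proof -
    have "f (?e k) \<in> g ` carrier M" using linD(1)[OF fl e[OF that]] sur by simp
    then have "\<exists>m. m \<in> carrier M \<and> g m = f (?e k)" by force
    from someI_ex[OF this] show "m k \<in> carrier M" "g (m k) = f (?e k)" by (simp_all add: m_def)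
  qed
  let ?h = "\<lambda>v. \<Oplus>\<^bsub>M\<^esub>i\<in>{..<r}. v i \<odot>\<^bsub>M\<^esub> m i"
  have h: "lin R ?F M ?h" by (rule pow_lift[OF M m(1)])
  \<comment> \<open>The vectors on which the lift followed by \<open>g\<close> agrees with
    \<open>f\<close> form a submodule, and the unit vectors belong to it by the choice of
    \<open>m\<close>.\<close>
  have W: "subm R ?F {v \<in> carrier ?F. g (?h v) \<ominus>\<^bsub>N\<^esub> f v \<in> {\<zero>\<^bsub>N\<^esub>}}"
  proof (rule subm_preimage[OF _ lF N N.subm_zero])
    show "lin R ?F N (\<lambda>v. g (?h v) \<ominus>\<^bsub>N\<^esub> f v)"
    proof (rule lin_cong[OF lin_add[OF lin_comp[OF h gl] _ N] lF])
      show "lin R ?F N (\<lambda>v. \<ominus>\<^bsub>N\<^esub> f v)"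
        by (rule linI) (use linD[OF fl] in \<open>auto simp: N.minus_add N.sm_r_minus\<close>)
    qed (simp add: a_minus_def)
  qed
  have "carrier ?F \<subseteq> {v \<in> carrier ?F. g (?h v) \<ominus>\<^bsub>N\<^esub> f v \<in> {\<zero>\<^bsub>N\<^esub>}}"
  proof (rule pow_generated[OF sl W])
    fix k x assume k: "k < r" and x: "x \<in> carrier (self_module R)"
    have eq: "(\<lambda>j. if j = k then x else \<zero>\<^bsub>self_module R\<^esub>) = x \<odot>\<^bsub>?F\<^esub> ?e k" using x by auto
    have "x \<odot>\<^bsub>?F\<^esub> ?e k \<in> {v \<in> carrier ?F. g (?h v) \<ominus>\<^bsub>N\<^esub> f v \<in> {\<zero>\<^bsub>N\<^esub>}}"
    proof (rule submD(5)[OF W])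
      show "x \<in> carrier R" using x by simp
      have "?h (?e k) = m k" by (rule pow_lift_unit[OF M m(1) k])
      then have "g (?h (?e k)) = f (?e k)" using m(2)[OF k] by simp
      then show "?e k \<in> {v \<in> carrier ?F. g (?h v) \<ominus>\<^bsub>N\<^esub> f v \<in> {\<zero>\<^bsub>N\<^esub>}}"
        using e[OF k] linD(1)[OF fl e[OF k]] by (simp add: N.diff_eq_zero_iff)
    qed
    then show "(\<lambda>j. if j = k then x else \<zero>\<^bsub>self_module R\<^esub>) \<in> {v \<in> carrier ?F. g (?h v) \<ominus>\<^bsub>N\<^esub> f v \<in> {\<zero>\<^bsub>N\<^esub>}}"
      unfolding eq .
  qed
  then have "g (?h v) = f v" if "v \<in> carrier ?F" for v
    using that linD(1)[OF lin_comp[OF h gl] that] linD(1)[OF fl that] by (auto simp: N.diff_eq_zero_iff)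
  then show "\<exists>h\<in>mod_hom R ?F M. \<forall>x\<in>carrier ?F. g (h x) = f x"
    by (intro bexI[OF _ lin_restrict[OF h lF]]) auto
qed

section \<open>Finite dimensional algebras\<close>

locale fd_algebra =
  fixes K :: "('k, 'z) ring_scheme" and A :: "('k, 'a) module"
  assumes K_field: "field K" and A_alg: "k_algebra K A" and A_fg: "fin_gen K A"
begin

sublocale K: field K by (rule K_field)
sublocale A: k_algebra K A by (rule A_alg)

lemma A_ring: "ring A" by (rule A.ring_axioms)

lemma K_self: "left_module K (self_module K)" by (rule left_module_self[OF K.ring_axioms])
lemma A_self: "left_module A (self_module A)" by (rule left_module_self[OF A_ring])

lemma A_left_module: "left_module K A"
  by (intro left_module.intro left_module_axioms.intro K.ring_axioms A.abelian_group_axioms)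
    (simp_all add: A.smult_l_distr A.smult_r_distr A.smult_assoc1)

definition sc :: "'k \<Rightarrow> 'a" where "sc c = c \<odot>\<^bsub>A\<^esub> \<one>\<^bsub>A\<^esub>"

lemma sc_closed [simp, intro]: "c \<in> carrier K \<Longrightarrow> sc c \<in> carrier A" by (simp add: sc_def)
lemma sc_one [simp]: "sc \<one>\<^bsub>K\<^esub> = \<one>\<^bsub>A\<^esub>" by (simp add: sc_def)
lemma sc_add: "c \<in> carrier K \<Longrightarrow> d \<in> carrier K \<Longrightarrow> sc (c \<oplus>\<^bsub>K\<^esub> d) = sc c \<oplus>\<^bsub>A\<^esub> sc d"
  by (simp add: sc_def A.smult_l_distr)
lemma sc_smult: "c \<in> carrier K \<Longrightarrow> a \<in> carrier A \<Longrightarrow> sc c \<otimes>\<^bsub>A\<^esub> a = c \<odot>\<^bsub>A\<^esub> a"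
  by (simp add: sc_def A.smult_mult_left)
lemma sc_smult': "c \<in> carrier K \<Longrightarrow> a \<in> carrier A \<Longrightarrow> a \<otimes>\<^bsub>A\<^esub> sc c = c \<odot>\<^bsub>A\<^esub> a"
  by (simp add: sc_def A.smult_mult_right)
lemma sc_mult: "c \<in> carrier K \<Longrightarrow> d \<in> carrier K \<Longrightarrow> sc (c \<otimes>\<^bsub>K\<^esub> d) = sc c \<otimes>\<^bsub>A\<^esub> sc d"
  by (simp add: sc_smult) (simp add: sc_def A.smult_assoc1)
lemma sc_central: "c \<in> carrier K \<Longrightarrow> a \<in> carrier A \<Longrightarrow> a \<otimes>\<^bsub>A\<^esub> sc c = sc c \<otimes>\<^bsub>A\<^esub> a"
  by (simp add: sc_smult sc_smult')

lemma scalars_smult [simp]: "smult (scalars A M) = (\<lambda>c x. sc c \<odot>\<^bsub>M\<^esub> x)"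
  by (simp add: scalars_def sc_def)

lemma scalars_left_module:
  assumes "left_module A M" shows "left_module K (scalars A M)"
proof -
  interpret M: left_module A M by fact
  show ?thesis
    by (rule left_moduleI)
      (auto simp: K.ring_axioms M.a_assoc M.smult_r_distr M.smult_l_distr M.smult_assoc1 M.smult_one sc_mult sc_add
        intro: M.a_comm M.l_neg)
qed

lemma scalars_subm: "subm A M W \<Longrightarrow> subm K (scalars A M) W"
  by (auto simp: subm_def)

lemma scalars_lin: "lin A M N f \<Longrightarrow> lin K (scalars A M) (scalars A N) f"
  by (auto simp: lin_def)

lemma scalars_self: "fin_gen K (scalars A (self_module A))"
proof -
  have "lin K A (scalars A (self_module A)) (\<lambda>x. x)"
    by (rule linI) (auto simp: sc_smult)
  then show ?thesis
    by (rule fin_gen_surj[OF A_fg _ A_left_module scalars_left_module[OF A_self]]) auto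
qed

text \<open>A finitely generated module is a quotient of some \<open>A\<^sup>r\<close>, which is
  finite dimensional; conversely a finite spanning set over the field generates over
  \<open>A\<close>.\<close>

lemma fin_gen_scalars_iff:
  assumes "left_module A M"
  shows "fin_gen A M \<longleftrightarrow> fin_gen K (scalars A M)"
proof
  interpret M: left_module A M by fact
  note sM = scalars_left_module[OF assms]
  assume "fin_gen K (scalars A M)"
  then obtain S where S: "finite S" "S \<subseteq> carrier (scalars A M)"
    "\<And>W. subm K (scalars A M) W \<Longrightarrow> S \<subseteq> W \<Longrightarrow> carrier (scalars A M) \<subseteq> W"
    using fin_genE[OF _ sM] by blast
  show "fin_gen A M"
  proof (rule fin_genI[OF assms S(1)])
    fix W assume "subm A M W" "S \<subseteq> W"
    then show "carrier M \<subseteq> W" using S(3)[OF scalars_subm] by simp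
  qed (use S(2) in simp)
next
  interpret M: left_module A M by fact
  assume "fin_gen A M"
  then obtain r p where p: "lin A (pow_module (self_module A) r) M p"
    "p ` carrier (pow_module (self_module A) r) = carrier M" using free_cover[OF assms] by blast
  have "scalars A (pow_module (self_module A) r) = pow_module (scalars A (self_module A)) r"
    by (simp add: scalars_def pow_module_def)
  then have "fin_gen K (scalars A (pow_module (self_module A) r))"
    using pow_fin_gen[OF scalars_left_module[OF A_self] scalars_self] by simp
  then show "fin_gen K (scalars A M)"
    by (rule fin_gen_surj[OF _ scalars_lin[OF p(1)]])
      (use p(2) scalars_left_module pow_left_module[OF A_self] assms in auto)
qed

text \<open>Subspaces of finite dimensional spaces are finite dimensional. This is the Noetherian
  property that lets kernels be covered by free modules of finite rank.\<close>

lemma fin_gen_sub: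
  assumes "left_module A M" "fin_gen A M" "subm A M W"
  shows "fin_gen A (M\<lparr>carrier := W\<rparr>)"
proof -
  have "scalars A (M\<lparr>carrier := W\<rparr>) = (scalars A M)\<lparr>carrier := W\<rparr>"
    by (simp add: scalars_def mk_module_def)
  then show ?thesis
    using fin_gen_subm[OF K_field scalars_left_module[OF assms(1)] _ scalars_subm[OF assms(3)]]
      fin_gen_scalars_iff assms left_module.subm_left_module by metis
qed

subsection \<open>Hom spaces\<close>

lemma hom_space_simps [simp]:
  "carrier (hom_space A M N) = mod_hom A M N" "zero (hom_space A M N) = (\<lambda>x\<in>carrier M. \<zero>\<^bsub>N\<^esub>)"
  "add (hom_space A M N) = (\<lambda>f g. \<lambda>x\<in>carrier M. f x \<oplus>\<^bsub>N\<^esub> g x)"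
  "smult (hom_space A M N) = (\<lambda>c f. \<lambda>x\<in>carrier M. sc c \<odot>\<^bsub>N\<^esub> f x)"
  by (simp_all add: hom_space_def)

lemma lin_scale:
  assumes "left_module A N" "lin A M N f" "c \<in> carrier K"
  shows "lin A M N (\<lambda>x. sc c \<odot>\<^bsub>N\<^esub> f x)"
proof -
  interpret N: left_module A N by fact
  show ?thesis
    by (rule linI) (use linD[OF assms(2)] assms(3) in \<open>auto simp: N.smult_r_distr N.smult_assoc1[symmetric] sc_central\<close>)
qed

lemma hom_space_left_module:
  assumes "left_module A M" "left_module A N"
  shows "left_module K (hom_space A M N)"
proof -
  interpret M: left_module A M by fact
  interpret N: left_module A N by fact
  have cl: "f x \<in> carrier N" if "f \<in> mod_hom A M N" "x \<in> carrier M" for f x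
    using linD(1)[OF mod_hom_lin[OF that(1)] that(2)] .
  have ex: "f x = undefined" if "f \<in> mod_hom A M N" "x \<notin> carrier M" for f x
    using that by (auto simp: mod_hom_iff extensional_def)
  show ?thesis
  proof (rule left_moduleI, goal_cases)
    case (2 f g)
    then have "lin A M N f" "lin A M N g" using mod_hom_lin by auto
    from lin_restrict[OF lin_add[OF this assms(2)] assms(1)] show ?case by simp
  next
    case 3
    show ?case using lin_restrict[OF lin_const_zero[OF assms(2)] assms(1)] by simp
  next
    case (7 f)
    then have "lin A M N f" using mod_hom_lin by auto
    then have "lin A M N (\<lambda>x. \<ominus>\<^bsub>N\<^esub> f x)"
      by (intro linI) (auto simp: linD N.minus_add N.sm_r_minus)
    from lin_restrict[OF this assms(1)] show ?case
      by (intro bexI[of _ "\<lambda>x\<in>carrier M. \<ominus>\<^bsub>N\<^esub> f x"]) (use 7 cl in \<open>auto simp: N.l_neg\<close>)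
  next
    case (8 c f)
    then have "lin A M N f" using mod_hom_lin by auto
    from lin_restrict[OF lin_scale[OF assms(2) this 8(1)] assms(1)] show ?case by simp
  qed (auto simp: cl ex K.ring_axioms N.a_assoc N.smult_l_distr N.smult_r_distr N.smult_assoc1 N.smult_one sc_add sc_mult
      intro!: ext N.a_comm simp: restrict_def)
qed

lemma hom_map_lin:
  assumes "left_module A L" "left_module A M" "left_module A N" "lin A L M d"
  shows "lin K (hom_space A M N) (hom_space A L N) (hom_map L d)"
proof -
  interpret L: left_module A L by fact
  show ?thesis
  proof (rule linI)
    fix f assume "f \<in> carrier (hom_space A M N)"
    then have "lin A M N f" using mod_hom_lin by auto
    from lin_restrict[OF lin_comp[OF assms(4) this] assms(1)]
    show "hom_map L d f \<in> carrier (hom_space A L N)" by (simp add: hom_map_def)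
  qed (use linD(1)[OF assms(4)] in \<open>auto simp: hom_map_def intro!: ext simp: restrict_def\<close>)
qed

text \<open>Postcomposition, the covariant counterpart of \<open>hom_map\<close>; the domain
  \<open>L\<close> is a parameter because the result is extensional on it.\<close>

definition post :: "('a, 'l) module \<Rightarrow> ('m \<Rightarrow> 'n) \<Rightarrow> ('l \<Rightarrow> 'm) \<Rightarrow> 'l \<Rightarrow> 'n" where
  "post L d f = (\<lambda>x\<in>carrier L. d (f x))"

lemma post_lin:
  assumes "left_module A L" "left_module A M" "left_module A N" "lin A M N d"
  shows "lin K (hom_space A L M) (hom_space A L N) (post L d)"
proof -
  interpret L: left_module A L by fact
  show ?thesis
  proof (rule linI)
    fix f assume "f \<in> carrier (hom_space A L M)"
    then have "lin A L M f" using mod_hom_lin by auto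
    from lin_restrict[OF lin_comp[OF this assms(4)] assms(1)]
    show "post L d f \<in> carrier (hom_space A L N)" by (simp add: post_def)
  next
    fix f g assume "f \<in> carrier (hom_space A L M)" "g \<in> carrier (hom_space A L M)"
    then have "f x \<in> carrier M" "g x \<in> carrier M" if "x \<in> carrier L" for x
      using that linD(1)[OF mod_hom_lin] by auto
    then show "post L d (f \<oplus>\<^bsub>hom_space A L M\<^esub> g) = post L d f \<oplus>\<^bsub>hom_space A L N\<^esub> post L d g"
      using linD(2)[OF assms(4)] by (auto simp: post_def)
  next
    fix c f assume "c \<in> carrier K" "f \<in> carrier (hom_space A L M)"
    then have "f x \<in> carrier M" if "x \<in> carrier L" for x
      using that linD(1)[OF mod_hom_lin] by auto
    then show "post L d (c \<odot>\<^bsub>hom_space A L M\<^esub> f) = c \<odot>\<^bsub>hom_space A L N\<^esub> post L d f"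
      using linD(3)[OF assms(4)] \<open>c \<in> carrier K\<close> by (auto simp: post_def)
  qed
qed

text \<open>Evaluation at the images of the unit vectors of a free cover embeds
  \<open>Hom(M, N)\<close> into a power of \<open>N\<close>.\<close>

lemma hom_space_fin_gen:
  assumes "left_module A M" "left_module A N" "fin_gen A M" "fin_gen A N"
  shows "fin_gen K (hom_space A M N)"
proof -
  interpret M: left_module A M by fact
  interpret N: left_module A N by fact
  obtain r p where p: "lin A (pow_module (self_module A) r) M p"
    "p ` carrier (pow_module (self_module A) r) = carrier M" using free_cover[OF assms(1,3)] .
  let ?F = "pow_module (self_module A) r"
  let ?e = "\<lambda>k i. if i = k then \<one>\<^bsub>A\<^esub> else \<zero>\<^bsub>A\<^esub>"
  have e: "?e k \<in> carrier ?F" if "k < r" for k using that by (auto simp: pow_carrier)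
  have pe: "p (?e k) \<in> carrier M" if "k < r" for k using linD(1)[OF p(1) e[OF that]] .
  let ?P = "pow_module (scalars A N) r"
  let ?ev = "\<lambda>f i. if i < r then f (p (?e i)) else \<zero>\<^bsub>scalars A N\<^esub>"
  have sN: "left_module K (scalars A N)" by (rule scalars_left_module) fact
  have hl: "left_module K (hom_space A M N)" by (rule hom_space_left_module) fact+
  have ev: "lin K (hom_space A M N) ?P ?ev"
    by (rule pow_tuple[OF _ sN], rule linI) (auto simp: pe linD(1)[OF mod_hom_lin])
  have F: "left_module A ?F" by (rule pow_left_module[OF A_self])
  have "inj_on ?ev (carrier (hom_space A M N))"
  proof (rule lin_inj_on[OF ev hl pow_left_module[OF sN]])
    fix f assume f: "f \<in> carrier (hom_space A M N)" and z: "?ev f = \<zero>\<^bsub>?P\<^esub>"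
    have fl: "lin A M N f" using f mod_hom_lin by simp
    have fz: "f (p (?e k)) = \<zero>\<^bsub>N\<^esub>" if "k < r" for k using fun_cong[OF z, of k] that by simp
    have W: "subm A ?F {v \<in> carrier ?F. f (p v) = \<zero>\<^bsub>N\<^esub>}"
      by (rule subm_ker[OF lin_comp[OF p(1) fl] F assms(2)])
    have "carrier ?F \<subseteq> {v \<in> carrier ?F. f (p v) = \<zero>\<^bsub>N\<^esub>}"
    proof (rule pow_generated[OF A_self W])
      fix k x assume k: "k < r" and x: "x \<in> carrier (self_module A)"
      have eq: "(\<lambda>j. if j = k then x else \<zero>\<^bsub>self_module A\<^esub>) = x \<odot>\<^bsub>?F\<^esub> ?e k" using x by auto
      show "(\<lambda>j. if j = k then x else \<zero>\<^bsub>self_module A\<^esub>) \<in> {v \<in> carrier ?F. f (p v) = \<zero>\<^bsub>N\<^esub>}"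
        unfolding eq by (rule submD(5)[OF W]) (use x k e fz in auto)
    qed
    then have "f m = \<zero>\<^bsub>N\<^esub>" if "m \<in> carrier M" for m using that unfolding p(2)[symmetric] by auto
    then show "f = \<zero>\<^bsub>hom_space A M N\<^esub>" using f by (auto simp: mod_hom_iff intro!: extensionalityI)
  qed
  then show ?thesis
    using fin_gen_inj[OF K_field hl pow_left_module[OF sN] _ ev] pow_fin_gen[OF sN]
      fin_gen_scalars_iff[OF assms(2)] assms(4) by blast
qed

end

section \<open>Exact double complexes\<close>

text \<open>
  The subquotient \<open>E i j\<close> is symmetric in the two directions, which makes it invariant under
  diagonal shifts. This is the balance of Tate cohomology.
\<close>

locale double_complex =
  fixes K :: "('k, 'z) ring_scheme" and D :: "int \<Rightarrow> int \<Rightarrow> ('k, 'd) module"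
    and dv dh :: "int \<Rightarrow> int \<Rightarrow> 'd \<Rightarrow> 'd"
  assumes mod: "left_module K (D i j)"
    and dv: "lin K (D i j) (D (i + 1) j) (dv i j)"
    and dh: "lin K (D i j) (D i (j - 1)) (dh i j)"
    and comm: "x \<in> carrier (D i j) \<Longrightarrow> dh (i + 1) j (dv i j x) = dv i (j - 1) (dh i j x)"
    and vexact: "{x \<in> carrier (D i j). dv i j x = \<zero>\<^bsub>D (i + 1) j\<^esub>} = dv (i - 1) j ` carrier (D (i - 1) j)"
    and hexact: "{x \<in> carrier (D i j). dh i j x = \<zero>\<^bsub>D i (j - 1)\<^esub>} = dh i (j + 1) ` carrier (D i (j + 1))"
begin

lemma dv': "lin K (D (i - 1) j) (D i j) (dv (i - 1) j)" using dv[of "i - 1" j] by simp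
lemma dh': "lin K (D i (j + 1)) (D i j) (dh i (j + 1))" using dh[of i "j + 1"] by simp

lemma comm': "x \<in> carrier (D (i - 1) j) \<Longrightarrow> dh i j (dv (i - 1) j x) = dv (i - 1) (j - 1) (dh (i - 1) j x)"
  using comm[of x "i - 1" j] by simp

lemma dvdv: "x \<in> carrier (D (i - 1) j) \<Longrightarrow> dv i j (dv (i - 1) j x) = \<zero>\<^bsub>D (i + 1) j\<^esub>"
  using vexact[of i j] by blast
lemma dhdh: "x \<in> carrier (D i (j + 1)) \<Longrightarrow> dh i j (dh i (j + 1) x) = \<zero>\<^bsub>D i (j - 1)\<^esub>"
  using hexact[of i j] by blast

definition Z where "Z i j = {x \<in> carrier (D i j). dv i j x = \<zero>\<^bsub>D (i + 1) j\<^esub> \<and> dh i j x = \<zero>\<^bsub>D i (j - 1)\<^esub>}"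
definition B where "B i j = (\<lambda>x. dv (i - 1) j (dh (i - 1) (j + 1) x)) ` carrier (D (i - 1) (j + 1))"
definition E where "E i j = subquot (D i j) (Z i j) (B i j)"

lemma Z_subm: "subm K (D i j) (Z i j)"
proof -
  have "Z i j = {x \<in> carrier (D i j). dv i j x = \<zero>\<^bsub>D (i + 1) j\<^esub>} \<inter> {x \<in> carrier (D i j). dh i j x = \<zero>\<^bsub>D i (j - 1)\<^esub>}"
    by (auto simp: Z_def)
  then show ?thesis using subm_Int[OF subm_ker[OF dv mod mod] subm_ker[OF dh mod mod]] by simp
qed

lemma B_subm: "subm K (D i j) (B i j)"
  unfolding B_def by (rule subm_range[OF lin_comp[OF dh' dv'] mod mod])

lemma B_sub_Z: "B i j \<subseteq> Z i j"
proof
  fix x assume "x \<in> B i j"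
  then obtain k where k: "k \<in> carrier (D (i - 1) (j + 1))" "x = dv (i - 1) j (dh (i - 1) (j + 1) k)"
    by (auto simp: B_def)
  have 1: "dh (i - 1) (j + 1) k \<in> carrier (D (i - 1) j)" using linD(1)[OF dh' k(1)] .
  have "dh i j x = dv (i - 1) (j - 1) \<zero>\<^bsub>D (i - 1) (j - 1)\<^esub>" using comm'[OF 1] dhdh[OF k(1)] k(2) by simp
  then show "x \<in> Z i j" unfolding Z_def
    using dvdv[OF 1] k(2) linD(1)[OF dv' 1] lin_zero[OF dv' mod mod] by simp
qed

text \<open>\<open>dh\<close> carries \<open>Gd i m\<close> onto \<open>Z i (m - 1)\<close> and
  \<open>dv\<close> carries it onto \<open>Z (i + 1) m\<close>; under both maps the preimage of
  \<open>B\<close> is \<open>Nd i m\<close>, the sum of the incoming images. The quotient of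
  \<open>Gd\<close> by \<open>Nd\<close> is thus the bridge between two neighbouring subquotients on
  a diagonal.\<close>

definition Gd where "Gd i m = {x \<in> carrier (D i m). dv i (m - 1) (dh i m x) = \<zero>\<^bsub>D (i + 1) (m - 1)\<^esub>}"
definition Nd where "Nd i m = {x \<in> carrier (D i m).
   \<exists>a\<in>carrier (D (i - 1) m). \<exists>b\<in>carrier (D i (m + 1)). x = dv (i - 1) m a \<oplus>\<^bsub>D i m\<^esub> dh i (m + 1) b}"

lemma Gd_subm: "subm K (D i m) (Gd i m)"
  unfolding Gd_def by (rule subm_ker[OF lin_comp[OF dh dv] mod mod])

lemma Nd_subm: "subm K (D i m) (Nd i m)"
proof -
  interpret D: left_module K "D i m" by (rule mod)
  let ?V = "dv (i - 1) m ` carrier (D (i - 1) m)" and ?H = "dh i (m + 1) ` carrier (D i (m + 1))"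
  have V: "subm K (D i m) (?V)" by (rule subm_range[OF dv' mod mod])
  have H: "subm K (D i m) (?H)" by (rule subm_range[OF dh' mod mod])
  note V = submD[OF V] and H = submD[OF H]
  let ?S = "{v \<oplus>\<^bsub>D i m\<^esub> h | v h. v \<in> ?V \<and> h \<in> ?H}"
  have eq: "Nd i m = ?S"
    unfolding Nd_def using linD(1)[OF dv'] linD(1)[OF dh'] by auto
  show ?thesis unfolding eq
  proof (rule submI)
    fix x y assume "x \<in> ?S"
      "y \<in> ?S"
    then obtain v h v' h' where *: "x = v \<oplus>\<^bsub>D i m\<^esub> h" "y = v' \<oplus>\<^bsub>D i m\<^esub> h'"
      "v \<in> ?V" "h \<in> ?H"
      "v' \<in> ?V" "h' \<in> ?H" by auto
    then have "x \<oplus>\<^bsub>D i m\<^esub> y = (v \<oplus>\<^bsub>D i m\<^esub> v') \<oplus>\<^bsub>D i m\<^esub> (h \<oplus>\<^bsub>D i m\<^esub> h')"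
      using V(2) H(2) by (simp add: D.M.a_ac)
    then show "x \<oplus>\<^bsub>D i m\<^esub> y \<in> ?S"
      using V(4)[OF *(3,5)] H(4)[OF *(4,6)] by blast
  next
    fix r x assume r: "r \<in> carrier K" "x \<in> ?S"
    then obtain v h where *: "x = v \<oplus>\<^bsub>D i m\<^esub> h"
      "v \<in> ?V" "h \<in> ?H" by auto
    then have "r \<odot>\<^bsub>D i m\<^esub> x = (r \<odot>\<^bsub>D i m\<^esub> v) \<oplus>\<^bsub>D i m\<^esub> (r \<odot>\<^bsub>D i m\<^esub> h)"
      using V(2) H(2) r(1) by (simp add: D.smult_r_distr)
    then show "r \<odot>\<^bsub>D i m\<^esub> x \<in> ?S"
      using V(5)[OF r(1) *(2)] H(5)[OF r(1) *(3)] by blast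
  next
    show "\<zero>\<^bsub>D i m\<^esub> \<in> ?S"
      using V(3) H(3) D.M.l_zero[of "\<zero>\<^bsub>D i m\<^esub>"] by (metis (mono_tags, lifting) D.M.zero_closed mem_Collect_eq)
  qed (use V(2) H(2) in auto)
qed

text \<open>If \<open>dh x\<close> equals \<open>dv (dh k)\<close>, it equals
  \<open>dh (dv k)\<close> by commutativity, so \<open>x\<close> differs from \<open>dv k\<close> by
  an element of the kernel of \<open>dh\<close>, which is an incoming horizontal image by
  exactness.\<close>

lemma Nd_iff_h:
  assumes x: "x \<in> carrier (D i m)"
  shows "dh i m x \<in> B i (m - 1) \<longleftrightarrow> x \<in> Nd i m"
proof
  interpret D: left_module K "D i m" by (rule mod)
  interpret D': left_module K "D i (m - 1)" by (rule mod)
  assume "dh i m x \<in> B i (m - 1)"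
  then obtain k where k: "k \<in> carrier (D (i - 1) m)" "dh i m x = dv (i - 1) (m - 1) (dh (i - 1) m k)"
    by (auto simp: B_def)
  have vk: "dv (i - 1) m k \<in> carrier (D i m)" using linD(1)[OF dv' k(1)] .
  have "dh i m (x \<ominus>\<^bsub>D i m\<^esub> dv (i - 1) m k) = \<zero>\<^bsub>D i (m - 1)\<^esub>"
    using comm'[OF k(1)] k(2) linD(1)[OF dh x] lin_diff[OF dh mod mod x vk] by (simp add: D'.diff_eq_zero_iff)
  then have "x \<ominus>\<^bsub>D i m\<^esub> dv (i - 1) m k \<in> {x \<in> carrier (D i m). dh i m x = \<zero>\<^bsub>D i (m - 1)\<^esub>}" using x vk by simp
  then have "x \<ominus>\<^bsub>D i m\<^esub> dv (i - 1) m k \<in> dh i (m + 1) ` carrier (D i (m + 1))" by (simp only: hexact)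
  then obtain b where b: "b \<in> carrier (D i (m + 1))" "x \<ominus>\<^bsub>D i m\<^esub> dv (i - 1) m k = dh i (m + 1) b" by auto
  then have "x = dv (i - 1) m k \<oplus>\<^bsub>D i m\<^esub> dh i (m + 1) b" using D.M.add_diff_cancel[OF vk x] by simp
  then show "x \<in> Nd i m" using k b x by (auto simp: Nd_def)
next
  interpret D: left_module K "D i m" by (rule mod)
  interpret D': left_module K "D i (m - 1)" by (rule mod)
  assume "x \<in> Nd i m"
  then obtain a b where ab: "a \<in> carrier (D (i - 1) m)" "b \<in> carrier (D i (m + 1))"
    "x = dv (i - 1) m a \<oplus>\<^bsub>D i m\<^esub> dh i (m + 1) b" by (auto simp: Nd_def)
  then have "dh i m x = dv (i - 1) (m - 1) (dh (i - 1) m a)"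
    using linD(2)[OF dh linD(1)[OF dv'] linD(1)[OF dh']] dhdh linD(1)[OF dh linD(1)[OF dv']] comm' by simp
  then show "dh i m x \<in> B i (m - 1)" using ab by (auto simp: B_def)
qed

lemma Nd_iff_v:
  assumes x: "x \<in> carrier (D i m)"
  shows "dv i m x \<in> B (i + 1) m \<longleftrightarrow> x \<in> Nd i m"
proof
  interpret D: left_module K "D i m" by (rule mod)
  interpret D': left_module K "D (i + 1) m" by (rule mod)
  assume "dv i m x \<in> B (i + 1) m"
  then obtain k where k: "k \<in> carrier (D i (m + 1))" "dv i m x = dv i m (dh i (m + 1) k)"
    by (auto simp: B_def)
  have hk: "dh i (m + 1) k \<in> carrier (D i m)" using linD(1)[OF dh' k(1)] .
  have "dv i m (x \<ominus>\<^bsub>D i m\<^esub> dh i (m + 1) k) = \<zero>\<^bsub>D (i + 1) m\<^esub>"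
    using k(2) linD(1)[OF dv hk] lin_diff[OF dv mod mod x hk] by (simp add: D'.diff_eq_zero_iff)
  then have "x \<ominus>\<^bsub>D i m\<^esub> dh i (m + 1) k \<in> {x \<in> carrier (D i m). dv i m x = \<zero>\<^bsub>D (i + 1) m\<^esub>}" using x hk by simp
  then have "x \<ominus>\<^bsub>D i m\<^esub> dh i (m + 1) k \<in> dv (i - 1) m ` carrier (D (i - 1) m)" by (simp only: vexact)
  then obtain a where a: "a \<in> carrier (D (i - 1) m)" "x \<ominus>\<^bsub>D i m\<^esub> dh i (m + 1) k = dv (i - 1) m a" by auto
  then have "x = dv (i - 1) m a \<oplus>\<^bsub>D i m\<^esub> dh i (m + 1) k"
    using D.M.add_diff_cancel[OF hk x] D.M.a_comm[OF hk linD(1)[OF dv' a(1)]] by simp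
  then show "x \<in> Nd i m" using k a x by (auto simp: Nd_def)
next
  interpret D: left_module K "D i m" by (rule mod)
  interpret D': left_module K "D (i + 1) m" by (rule mod)
  assume "x \<in> Nd i m"
  then obtain a b where ab: "a \<in> carrier (D (i - 1) m)" "b \<in> carrier (D i (m + 1))"
    "x = dv (i - 1) m a \<oplus>\<^bsub>D i m\<^esub> dh i (m + 1) b" by (auto simp: Nd_def)
  then have "dv i m x = dv i m (dh i (m + 1) b)"
    using linD(2)[OF dv linD(1)[OF dv'] linD(1)[OF dh']] dvdv linD(1)[OF dv linD(1)[OF dh']] by simp
  then show "dv i m x \<in> B (i + 1) m" using ab by (auto simp: B_def)
qed

lemma Nd_sub_Gd: "Nd i m \<subseteq> Gd i m"
proof
  fix x assume x: "x \<in> Nd i m"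
  then have xc: "x \<in> carrier (D i m)" by (simp add: Nd_def)
  then show "x \<in> Gd i m" using Nd_iff_h[OF xc] x B_sub_Z[of i "m - 1"] by (auto simp: Gd_def Z_def)
qed

text \<open>Both sides are isomorphic to \<open>Gd i m\<close> modulo \<open>Nd i m\<close>, one by
  \<open>dh\<close> and the other by \<open>dv\<close>. An element of \<open>Z\<close> is a cycle in
  either direction, so exactness supplies the preimage that surjectivity requires.\<close>

lemma E_shift1: "mod_iso K (E i (m - 1)) (E (i + 1) m)"
proof -
  have "mod_iso K (subquot (D i m) (Gd i m) (Nd i m)) (E i (m - 1))"
    unfolding E_def
  proof (rule subquot_iso[OF mod mod Gd_subm Nd_subm Nd_sub_Gd Z_subm B_subm B_sub_Z, where f = "dh i m"])
    interpret D': left_module K "D i (m - 1)" by (rule mod)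
    fix y assume y: "y \<in> Z i (m - 1)"
    then obtain x where "x \<in> carrier (D i m)" "y = dh i m x"
      using hexact[of i "m - 1"] by (auto simp: Z_def)
    then show "\<exists>x\<in>Gd i m. \<exists>w\<in>B i (m - 1). y = dh i m x \<oplus>\<^bsub>D i (m - 1)\<^esub> w"
      using y submD(3)[OF B_subm, of i "m - 1"] linD(1)[OF dh, of x i m]
      by (intro bexI[of _ x] bexI[of _ "\<zero>\<^bsub>D i (m - 1)\<^esub>"]) (auto simp: Gd_def Z_def)
  next
    fix x assume "x \<in> Gd i m"
    then show "dh i m x \<in> Z i (m - 1)"
      using linD(1)[OF dh, of x i m] dhdh[of x i "m - 1"] by (auto simp: Gd_def Z_def)
  next
    fix x assume "x \<in> Gd i m"
    then show "dh i m x \<in> B i (m - 1) \<longleftrightarrow> x \<in> Nd i m" by (intro Nd_iff_h) (simp add: Gd_def)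
  qed (auto simp: Gd_def linD[OF dh])
  moreover have "mod_iso K (subquot (D i m) (Gd i m) (Nd i m)) (E (i + 1) m)"
    unfolding E_def
  proof (rule subquot_iso[OF mod mod Gd_subm Nd_subm Nd_sub_Gd Z_subm B_subm B_sub_Z, where f = "dv i m"])
    interpret D': left_module K "D (i + 1) m" by (rule mod)
    fix y assume y: "y \<in> Z (i + 1) m"
    then obtain x where x: "x \<in> carrier (D i m)" "y = dv i m x"
      using vexact[of "i + 1" m] by (auto simp: Z_def)
    then show "\<exists>x\<in>Gd i m. \<exists>w\<in>B (i + 1) m. y = dv i m x \<oplus>\<^bsub>D (i + 1) m\<^esub> w"
      using y submD(3)[OF B_subm, of "i + 1" m] linD(1)[OF dv, of x i m] comm[OF x(1)]
      by (intro bexI[of _ x] bexI[of _ "\<zero>\<^bsub>D (i + 1) m\<^esub>"]) (auto simp: Gd_def Z_def)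
  next
    fix x assume "x \<in> Gd i m"
    then show "dv i m x \<in> Z (i + 1) m"
      using linD(1)[OF dv, of x i m] dvdv[of x "i + 1" m] comm[of x i m] by (auto simp: Gd_def Z_def)
  next
    fix x assume "x \<in> Gd i m"
    then show "dv i m x \<in> B (i + 1) m \<longleftrightarrow> x \<in> Nd i m" by (intro Nd_iff_v) (simp add: Gd_def)
  qed (auto simp: Gd_def linD[OF dv])
  ultimately show ?thesis using mod_iso_sym mod_iso_trans by blast
qed

text \<open>One step along the diagonal and back, so that symmetry and transitivity give
  reflexivity.\<close>

lemma E_refl: "mod_iso K (E i j) (E i j)"
  using E_shift1[of i "j + 1"] mod_iso_sym mod_iso_trans by fastforce

lemma E_shift: "mod_iso K (E i j) (E (i + n) (j + n))"
proof (induction n rule: int_induct[of _ 0])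
  case base
  then show ?case using E_refl by simp
next
  case (step1 n)
  then show ?case using E_shift1[of "i + n" "j + n + 1"] mod_iso_trans[of K "E i j"] by (simp add: add.assoc)
next
  case (step2 n)
  have "mod_iso K (E (i + (n - 1)) (j + (n - 1))) (E (i + n) (j + n))"
    using E_shift1[of "i + (n - 1)" "j + n"] by (simp add: algebra_simps)
  then show ?case using step2 mod_iso_sym mod_iso_trans by blast
qed

end

section \<open>Balance of Tate cohomology\<close>

text \<open>The content of \<open>complete_resolution\<close>, with the auxiliary projective
  resolution reduced to its trace on \<open>M\<close>: the augmentation \<open>\<eta>\<close>, whose
  kernel is the image of \<open>d 1\<close>. Acyclicity of the dual complex is stated as a
  factorisation property of linear maps, free of extensionality.\<close>

locale complete_res = fd_algebra K A
  for K :: "('k, 'z) ring_scheme" and A :: "('k, 'a) module" +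
  fixes M :: "('a, 'm) module" and T :: "int \<Rightarrow> ('a, nat \<Rightarrow> 'a) module"
    and d :: "int \<Rightarrow> (nat \<Rightarrow> 'a) \<Rightarrow> nat \<Rightarrow> 'a" and \<eta> :: "(nat \<Rightarrow> 'a) \<Rightarrow> 'm"
  assumes M: "left_module A M"
    and T_proj: "projective A (T n)" and T_fg: "fin_gen A (T n)"
    and d: "lin A (T n) (T (n - 1)) (d n)"
    and exact: "d (n + 1) ` carrier (T (n + 1)) = {x \<in> carrier (T n). d n x = \<zero>\<^bsub>T (n - 1)\<^esub>}"
    and dual_exact: "\<lbrakk>lin A (T n) (self_module A) f; \<And>x. x \<in> carrier (T (n + 1)) \<Longrightarrow> f (d (n + 1) x) = \<zero>\<^bsub>A\<^esub>\<rbrakk> \<Longrightarrow>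
        \<exists>g. lin A (T (n - 1)) (self_module A) g \<and> (\<forall>x\<in>carrier (T n). f x = g (d n x))"
    and \<eta>: "lin A (T 0) M \<eta>" and \<eta>_surj: "\<eta> ` carrier (T 0) = carrier M"
    and \<eta>_ker: "{x \<in> carrier (T 0). \<eta> x = \<zero>\<^bsub>M\<^esub>} = d 1 ` carrier (T 1)"
begin

lemma T: "left_module A (T n)" using T_proj[of n] by (simp add: projective_def)

lemma d': "lin A (T (n + 1)) (T n) (d (n + 1))" using d[of "n + 1"] by simp

lemma dd: "x \<in> carrier (T (n + 1)) \<Longrightarrow> d n (d (n + 1) x) = \<zero>\<^bsub>T (n - 1)\<^esub>" using exact[of n] by blast

lemma M_fg: "fin_gen A M" by (rule fin_gen_surj[OF T_fg \<eta> T M]) (simp add: \<eta>_surj)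

lemma \<eta>_d: "x \<in> carrier (T 1) \<Longrightarrow> \<eta> (d 1 x) = \<zero>\<^bsub>M\<^esub>"
  using \<eta>_ker by blast

lemma \<eta>_ker_d: "x \<in> carrier (T 0) \<Longrightarrow> \<eta> x = \<zero>\<^bsub>M\<^esub> \<longleftrightarrow> d 0 x = \<zero>\<^bsub>T (-1)\<^esub>"
  using \<eta>_ker exact[of 0] by auto

text \<open>\<open>d 0\<close> and \<open>\<eta>\<close> have the same kernel, so \<open>d 0\<close>
  is \<open>\<eta>\<close> followed by an injective map \<open>\<iota>\<close>. Thus
  \<open>M\<close> is the kernel of \<open>d (-1)\<close> and at the same time the cokernel of
  \<open>d 1\<close>; the two descriptions serve the two sides of the balance.\<close>

definition \<iota> where "\<iota> = (SOME f. lin A M (T (-1)) f \<and> (\<forall>x\<in>carrier (T 0). f (\<eta> x) = d 0 x))"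

lemma \<iota>_lin: "lin A M (T (-1)) \<iota>" and \<iota>_\<eta>: "x \<in> carrier (T 0) \<Longrightarrow> \<iota> (\<eta> x) = d 0 x"
proof -
  have d0: "lin A (T 0) (T (-1)) (d 0)" using d[of 0] by simp
  obtain f where "lin A M (T (-1)) f" "\<And>x. x \<in> carrier (T 0) \<Longrightarrow> f (\<eta> x) = d 0 x"
    using lin_factor[OF \<eta> T M T \<eta>_surj d0] \<eta>_ker_d by blast
  then have "\<exists>f. lin A M (T (-1)) f \<and> (\<forall>x\<in>carrier (T 0). f (\<eta> x) = d 0 x)" by blast
  from someI_ex[OF this] show "lin A M (T (-1)) \<iota>" "x \<in> carrier (T 0) \<Longrightarrow> \<iota> (\<eta> x) = d 0 x"
    unfolding \<iota>_def by blast+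
qed

lemma \<eta>_ex: "m \<in> carrier M \<Longrightarrow> \<exists>x\<in>carrier (T 0). m = \<eta> x" using \<eta>_surj by auto

lemma \<iota>_inj: "inj_on \<iota> (carrier M)"
proof (rule lin_inj_on[OF \<iota>_lin M T])
  fix x assume "x \<in> carrier M" "\<iota> x = \<zero>\<^bsub>T (-1)\<^esub>"
  then show "x = \<zero>\<^bsub>M\<^esub>" using \<eta>_ex \<iota>_\<eta> \<eta>_ker_d by metis
qed

lemma \<iota>_range: "\<iota> ` carrier M = {x \<in> carrier (T (-1)). d (-1) x = \<zero>\<^bsub>T (-2)\<^esub>}"
proof -
  have "\<iota> ` carrier M = d 0 ` carrier (T 0)" unfolding \<eta>_surj[symmetric] by (auto simp: \<iota>_\<eta> image_iff)
  then show ?thesis using exact[of "-1"] by simp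
qed

text \<open>Exactness of \<open>Hom(T, A)\<close> passes to \<open>Hom(T, P)\<close> because
  \<open>P\<close> is a summand of a free module: \<open>s \<circ> f\<close> is factored coordinate
  by coordinate, and \<open>p\<close> brings the result back to \<open>P\<close>.\<close>

lemma dual_exact':
  fixes P :: "('a, nat \<Rightarrow> 'a) module"
  assumes P: "projective A P" "fin_gen A P" and f: "lin A (T n) P f"
    and z: "\<And>x. x \<in> carrier (T (n + 1)) \<Longrightarrow> f (d (n + 1) x) = \<zero>\<^bsub>P\<^esub>"
  shows "\<exists>g. lin A (T (n - 1)) P g \<and> (\<forall>x\<in>carrier (T n). f x = g (d n x))"
proof -
  have lP: "left_module A P" using P(1) by (simp add: projective_def)
  obtain r p s where p: "lin A (pow_module (self_module A) r) P p"
    and s: "lin A P (pow_module (self_module A) r) s" and ps: "\<And>x. x \<in> carrier P \<Longrightarrow> p (s x) = x"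
    using projective_split[OF P] by blast
  note F = pow_left_module[OF A_self, of r]
  have "\<exists>g. lin A (T (n - 1)) (self_module A) g \<and> (\<forall>x\<in>carrier (T n). s (f x) i = g (d n x))" if "i < r" for i
  proof (rule dual_exact)
    show "lin A (T n) (self_module A) (\<lambda>x. s (f x) i)"
      by (rule lin_comp[OF lin_comp[OF f s] pow_proj[OF A_self]])
    show "s (f (d (n + 1) x)) i = \<zero>\<^bsub>A\<^esub>" if "x \<in> carrier (T (n + 1))" for x
      using z[OF that] lin_zero[OF s lP F] by simp
  qed
  then obtain g where g: "\<And>i. i < r \<Longrightarrow> lin A (T (n - 1)) (self_module A) (g i)"
    "\<And>i x. i < r \<Longrightarrow> x \<in> carrier (T n) \<Longrightarrow> s (f x) i = g i (d n x)" by metis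
  let ?g = "\<lambda>x i. if i < r then g i x else \<zero>\<^bsub>self_module A\<^esub>"
  have gl: "lin A (T (n - 1)) (pow_module (self_module A) r) ?g" by (rule pow_tuple[OF g(1) A_self])
  have "p (?g (d n x)) = f x" if x: "x \<in> carrier (T n)" for x
  proof -
    have "s (f x) \<in> carrier (pow_module (self_module A) r)" using linD(1)[OF s linD(1)[OF f x]] .
    then have "?g (d n x) = s (f x)" using g(2) x by (auto simp: pow_carrier)
    then show ?thesis using ps linD(1)[OF f x] by simp
  qed
  then show ?thesis by (intro exI[of _ "\<lambda>x. p (?g x)"]) (auto intro: lin_comp[OF gl p])
qed

text \<open>Exactness makes \<open>d (n + 1)\<close> a surjection onto the kernel of
  \<open>d n\<close>, where \<open>f\<close> takes its values; projectivity of \<open>P\<close> then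
  lifts \<open>f\<close>.\<close>

lemma lift_exact:
  fixes P :: "('a, nat \<Rightarrow> 'a) module"
  assumes P: "projective A P" and f: "lin A P (T n) f" and z: "\<And>x. x \<in> carrier P \<Longrightarrow> d n (f x) = \<zero>\<^bsub>T (n - 1)\<^esub>"
  shows "\<exists>g. lin A P (T (n + 1)) g \<and> (\<forall>x\<in>carrier P. f x = d (n + 1) (g x))"
proof -
  let ?Z = "{x \<in> carrier (T n). d n x = \<zero>\<^bsub>T (n - 1)\<^esub>}"
  have N: "left_module A ((T n)\<lparr>carrier := ?Z\<rparr>)"
    by (rule left_module.subm_left_module[OF T subm_ker[OF d T T]])
  have d1: "lin A (T (n + 1)) ((T n)\<lparr>carrier := ?Z\<rparr>) (d (n + 1))"
    by (rule lin_upd_cod[OF d']) (simp add: exact)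
  have f1: "lin A P ((T n)\<lparr>carrier := ?Z\<rparr>) f"
    by (rule lin_upd_cod[OF f]) (use z linD(1)[OF f] in auto)
  obtain g where "lin A P (T (n + 1)) g" "\<And>x. x \<in> carrier P \<Longrightarrow> d (n + 1) (g x) = f x"
    using projective_lift[OF P T N d1 _ f1] exact by auto
  then show ?thesis by auto
qed

end

section \<open>The double complex of two complete resolutions\<close>

locale two_complete_res =
  T: complete_res K A M T d \<eta> + S: complete_res K A N S dS \<eta>S
  for K :: "('k, 'z) ring_scheme" and A :: "('k, 'a) module"
  and M :: "('a, 'm) module" and T d \<eta> and N :: "('a, 'n) module" and S dS \<eta>S
begin

text \<open>\<open>T\<close> is the contravariant argument, so the first index rises under
  \<open>hom_map\<close> while the second falls under \<open>post\<close>. Exactness in the first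
  index holds because each \<open>S j\<close> is a summand of a free module, in the second because
  each \<open>T i\<close> is projective.\<close>

abbreviation "DD \<equiv> \<lambda>i j. hom_space A (T i) (S j)"
abbreviation "Dv \<equiv> \<lambda>(i :: int) (j :: int). hom_map (T (i + 1)) (d (i + 1)) :: ((nat \<Rightarrow> 'a) \<Rightarrow> nat \<Rightarrow> 'a) \<Rightarrow> (nat \<Rightarrow> 'a) \<Rightarrow> nat \<Rightarrow> 'a"
abbreviation "Dh \<equiv> \<lambda>(i :: int) (j :: int). T.post (T i) (dS j) :: ((nat \<Rightarrow> 'a) \<Rightarrow> nat \<Rightarrow> 'a) \<Rightarrow> (nat \<Rightarrow> 'a) \<Rightarrow> nat \<Rightarrow> 'a"

sublocale D: double_complex K DD Dv Dh
proof (rule double_complex.intro)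
  fix i j :: int
  show "left_module K (DD i j)" by (rule T.hom_space_left_module[OF T.T S.T])
  show "lin K (DD i j) (DD (i + 1) j) (Dv i j)" by (rule T.hom_map_lin[OF T.T T.T S.T T.d'])
  show "lin K (DD i j) (DD i (j - 1)) (Dh i j)" by (rule T.post_lin[OF T.T S.T S.T S.d])
  show "Dh (i + 1) j (Dv i j f) = Dv i (j - 1) (Dh i j f)" if "f \<in> carrier (DD i j)" for f
    using linD(1)[OF T.d'] by (auto simp: T.post_def hom_map_def)
  show "{f \<in> carrier (DD i j). Dv i j f = \<zero>\<^bsub>DD (i + 1) j\<^esub>} = Dv (i - 1) j ` carrier (DD (i - 1) j)"
  proof (intro equalityI subsetI)
    fix f assume "f \<in> {f \<in> carrier (DD i j). Dv i j f = \<zero>\<^bsub>DD (i + 1) j\<^esub>}"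
    then have f: "f \<in> mod_hom A (T i) (S j)" "f (d (i + 1) x) = \<zero>\<^bsub>S j\<^esub>" if "x \<in> carrier (T (i + 1))" for x
      using that by (auto simp: hom_map_def fun_eq_iff restrict_def split: if_splits)
    have f0: "f \<in> mod_hom A (T i) (S j)" using \<open>f \<in> _\<close> by simp
    obtain g where g: "lin A (T (i - 1)) (S j) g" "\<forall>x\<in>carrier (T i). f x = g (d i x)"
      using T.dual_exact'[OF S.T_proj S.T_fg mod_hom_lin[OF f0] f(2)] by blast
    let ?g = "restrict g (carrier (T (i - 1)))"
    have "?g \<in> carrier (DD (i - 1) j)" using lin_restrict[OF g(1) T.T] by simp
    moreover have "f = Dv (i - 1) j ?g"
      by (rule extensionalityI[of _ "carrier (T i)"])
        (use f0 g(2) linD(1)[OF T.d] in \<open>auto simp: hom_map_def mod_hom_iff\<close>)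
    ultimately show "f \<in> Dv (i - 1) j ` carrier (DD (i - 1) j)" by blast
  next
    fix f assume "f \<in> Dv (i - 1) j ` carrier (DD (i - 1) j)"
    then obtain g where g: "g \<in> mod_hom A (T (i - 1)) (S j)" "f = Dv (i - 1) j g" by auto
    have "f \<in> carrier (DD i j)"
      using linD(1)[OF T.hom_map_lin[OF T.T T.T S.T T.d], of g i j] g by simp
    moreover have "g \<zero>\<^bsub>T (i - 1)\<^esub> = \<zero>\<^bsub>S j\<^esub>" using lin_zero[OF mod_hom_lin[OF g(1)] T.T S.T] .
    ultimately show "f \<in> {f \<in> carrier (DD i j). Dv i j f = \<zero>\<^bsub>DD (i + 1) j\<^esub>}"
      using linD(1)[OF T.d'] T.dd by (auto simp: g(2) hom_map_def)
  qed
  show "{f \<in> carrier (DD i j). Dh i j f = \<zero>\<^bsub>DD i (j - 1)\<^esub>} = Dh i (j + 1) ` carrier (DD i (j + 1))"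
  proof (intro equalityI subsetI)
    fix f assume f: "f \<in> {f \<in> carrier (DD i j). Dh i j f = \<zero>\<^bsub>DD i (j - 1)\<^esub>}"
    then have z: "dS j (f x) = \<zero>\<^bsub>S (j - 1)\<^esub>" if "x \<in> carrier (T i)" for x
      using that by (auto simp: T.post_def fun_eq_iff restrict_def split: if_splits)
    have f0: "f \<in> mod_hom A (T i) (S j)" using f by simp
    obtain g where g: "lin A (T i) (S (j + 1)) g" "\<forall>x\<in>carrier (T i). f x = dS (j + 1) (g x)"
      using S.lift_exact[OF T.T_proj mod_hom_lin[OF f0] z] by blast
    let ?g = "restrict g (carrier (T i))"
    have "?g \<in> carrier (DD i (j + 1))" using lin_restrict[OF g(1) T.T] by simp
    moreover have "f = Dh i (j + 1) ?g"
      by (rule extensionalityI[of _ "carrier (T i)"])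
        (use f0 g(2) in \<open>auto simp: T.post_def mod_hom_iff\<close>)
    ultimately show "f \<in> Dh i (j + 1) ` carrier (DD i (j + 1))" by blast
  next
    fix f assume "f \<in> Dh i (j + 1) ` carrier (DD i (j + 1))"
    then obtain g where g: "g \<in> mod_hom A (T i) (S (j + 1))" "f = Dh i (j + 1) g" by auto
    have "f \<in> carrier (DD i j)"
      using linD(1)[OF T.post_lin[OF T.T S.T S.T S.d'], of g i j] g by simp
    then show "f \<in> {f \<in> carrier (DD i j). Dh i j f = \<zero>\<^bsub>DD i (j - 1)\<^esub>}"
      using S.dd linD(1)[OF mod_hom_lin[OF g(1)]] by (auto simp: g(2) T.post_def)
  qed
qed

text \<open>Postcomposition with \<open>\<iota>\<close> identifies \<open>Hom(T n, N)\<close> with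
  the kernel of \<open>Dh n (-1)\<close>, since \<open>\<iota>\<close> is the kernel of
  \<open>dS (-1)\<close>. Cycles for the remaining differential are then the elements of
  \<open>D.Z n (-1)\<close>, and boundaries match because exactness turns horizontal images from
  \<open>S 0\<close> into maps through \<open>\<iota>\<close>. This fixes the second index at
  \<open>-1\<close>.\<close>

lemma left_iso:
  "mod_iso K
     (homology_at (hom_space A (T (n - 1)) N) (hom_map (T n) (d n)) (hom_space A (T n) N)
        (hom_map (T (n + 1)) (d (n + 1))) (hom_space A (T (n + 1)) N))
     (D.E n (-1))"
proof -
  let ?H = "\<lambda>n. hom_space A (T n) N"
  have H: "left_module K (?H n)" for n by (rule T.hom_space_left_module[OF T.T S.M])
  have a: "lin K (?H (n - 1)) (?H n) (hom_map (T n) (d n))" for n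
    by (rule T.hom_map_lin[OF T.T T.T S.M T.d])
  have a': "lin K (?H n) (?H (n + 1)) (hom_map (T (n + 1)) (d (n + 1)))"
    by (rule T.hom_map_lin[OF T.T T.T S.M T.d'])
  let ?f = "T.post (T n) S.\<iota>"
  have f: "lin K (?H n) (DD n (-1)) ?f" by (rule T.post_lin[OF T.T S.M S.T S.\<iota>_lin])
  interpret S: left_module A "S (-1)" by (rule S.T)
  interpret N: left_module A N by (rule S.M)
  \<comment> \<open>A map into \<open>S (-1)\<close> that is annihilated by \<open>dS (-1)\<close>
    takes values in the image of \<open>\<iota>\<close>, where \<open>\<iota>\<close> can be
    inverted.\<close>
  have lift: "\<exists>f\<in>mod_hom A (T m) N. g = T.post (T m) S.\<iota> f"
    if g: "g \<in> mod_hom A (T m) (S (-1))" and z: "\<And>x. x \<in> carrier (T m) \<Longrightarrow> dS (-1) (g x) = \<zero>\<^bsub>S (-2)\<^esub>" for m g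
  proof -
    have gx: "g x \<in> S.\<iota> ` carrier N" if "x \<in> carrier (T m)" for x
      unfolding S.\<iota>_range using linD(1)[OF mod_hom_lin[OF g] that] z[OF that] by simp
    let ?X = "S.\<iota> ` carrier N"
    have X: "left_module A ((S (-1))\<lparr>carrier := ?X\<rparr>)"
      by (rule S.subm_left_module[OF subm_range[OF S.\<iota>_lin S.M S.T]])
    have inv: "lin A ((S (-1))\<lparr>carrier := ?X\<rparr>) N (inv_into (carrier N) S.\<iota>)"
      by (rule lin_inv[OF S.M X lin_upd_cod[OF S.\<iota>_lin]]) (use S.\<iota>_inj in \<open>auto simp: bij_betw_def\<close>)
    have "lin A (T m) ((S (-1))\<lparr>carrier := ?X\<rparr>) g"
      by (rule lin_upd_cod[OF mod_hom_lin[OF g]]) (use gx in auto)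
    from lin_restrict[OF lin_comp[OF this inv] T.T]
    have "(\<lambda>x\<in>carrier (T m). inv_into (carrier N) S.\<iota> (g x)) \<in> mod_hom A (T m) N" .
    moreover have "g = T.post (T m) S.\<iota> (\<lambda>x\<in>carrier (T m). inv_into (carrier N) S.\<iota> (g x))"
      by (rule extensionalityI[of _ "carrier (T m)"])
        (use g gx in \<open>auto simp: mod_hom_iff T.post_def f_inv_into_f\<close>)
    ultimately show ?thesis by blast
  qed
  have \<iota>z: "dS (-1) (S.\<iota> x) = \<zero>\<^bsub>S (-2)\<^esub>" if "x \<in> carrier N" for x
    using S.\<iota>_range that by auto
  have \<iota>0: "S.\<iota> x = \<zero>\<^bsub>S (-1)\<^esub> \<longleftrightarrow> x = \<zero>\<^bsub>N\<^esub>" if "x \<in> carrier N" for x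
    using lin_zero[OF S.\<iota>_lin S.M S.T] S.\<iota>_inj that by (metis N.M.zero_closed inj_on_def)
  have cl: "f x \<in> carrier N" if "f \<in> mod_hom A (T m) N" "x \<in> carrier (T m)" for f x m
    using linD(1)[OF mod_hom_lin[OF that(1)] that(2)] .
  have post_inj: "f = g" if "f \<in> mod_hom A (T m) N" "g \<in> mod_hom A (T m) N"
    "T.post (T m) S.\<iota> f = T.post (T m) S.\<iota> g" for f g m
  proof (rule mod_hom_ext[OF that(1,2)])
    fix x assume x: "x \<in> carrier (T m)"
    have "S.\<iota> (f x) = S.\<iota> (g x)" using fun_cong[OF that(3), of x] x by (simp add: T.post_def)
    then show "f x = g x" using S.\<iota>_inj cl that(1,2) x by (metis inj_on_def)
  qed
  have comm: "hom_map (T m) (d m) (T.post (T (m - 1)) S.\<iota> f) = T.post (T m) S.\<iota> (hom_map (T m) (d m) f)" for f m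
    using linD(1)[OF T.d] by (auto simp: hom_map_def T.post_def)
  have B_eq: "D.B n (-1) = ?f ` (hom_map (T n) (d n) ` mod_hom A (T (n - 1)) N)"
  proof -
    \<comment> \<open>Both sets are the kernel of \<open>Dh (n - 1) (-1)\<close>: the left one by
      exactness, the right one because \<open>\<iota>\<close> is the kernel of
      \<open>dS (-1)\<close>.\<close>
    have "Dh (n - 1) 0 ` mod_hom A (T (n - 1)) (S 0) = T.post (T (n - 1)) S.\<iota> ` mod_hom A (T (n - 1)) N"
    proof (intro equalityI subsetI)
      fix g assume "g \<in> Dh (n - 1) 0 ` mod_hom A (T (n - 1)) (S 0)"
      then obtain h where h: "h \<in> mod_hom A (T (n - 1)) (S 0)" "g = Dh (n - 1) 0 h" by auto
      have "lin A (T (n - 1)) (S (-1)) (\<lambda>x. dS 0 (h x))"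
        using lin_comp[OF mod_hom_lin[OF h(1)] S.d[of 0]] by simp
      then have g: "g \<in> mod_hom A (T (n - 1)) (S (-1))" using lin_restrict[OF _ T.T] by (simp add: h(2) T.post_def)
      have "dS (-1) (g x) = \<zero>\<^bsub>S (-2)\<^esub>" if "x \<in> carrier (T (n - 1))" for x
        using S.dd[of "h x" "-1"] linD(1)[OF mod_hom_lin[OF h(1)] that] that by (simp add: h(2) T.post_def)
      then show "g \<in> T.post (T (n - 1)) S.\<iota> ` mod_hom A (T (n - 1)) N" using lift[OF g] by auto
    next
      fix g assume "g \<in> T.post (T (n - 1)) S.\<iota> ` mod_hom A (T (n - 1)) N"
      then obtain f where f: "f \<in> mod_hom A (T (n - 1)) N" "g = T.post (T (n - 1)) S.\<iota> f" by auto
      have g: "g \<in> carrier (DD (n - 1) (-1))"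
        using linD(1)[OF T.post_lin[OF T.T S.M S.T S.\<iota>_lin], of f "n - 1"] f by simp
      moreover have "Dh (n - 1) (-1) g = \<zero>\<^bsub>DD (n - 1) (- 1 - 1)\<^esub>"
        using \<iota>z cl[OF f(1)] by (auto simp: f(2) T.post_def)
      ultimately have "g \<in> Dh (n - 1) (-1 + 1) ` carrier (DD (n - 1) (-1 + 1))"
        using D.hexact[of "n - 1" "-1"] by blast
      then show "g \<in> Dh (n - 1) 0 ` mod_hom A (T (n - 1)) (S 0)" by simp
    qed
    moreover have "D.B n (-1) = hom_map (T n) (d n) ` (Dh (n - 1) 0 ` mod_hom A (T (n - 1)) (S 0))"
      by (simp add: D.B_def image_image)
    ultimately have "D.B n (-1) = hom_map (T n) (d n) ` (T.post (T (n - 1)) S.\<iota> ` mod_hom A (T (n - 1)) N)"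
      by simp
    also have "\<dots> = ?f ` (hom_map (T n) (d n) ` mod_hom A (T (n - 1)) N)"
      by (simp add: image_image comm)
    finally show ?thesis .
  qed
  have Hz: "subm K (?H n) {x \<in> carrier (?H n). hom_map (T (n + 1)) (d (n + 1)) x = \<zero>\<^bsub>?H (n + 1)\<^esub>}"
    by (rule subm_ker[OF a' H H])
  have Hb: "subm K (?H n) (hom_map (T n) (d n) ` carrier (?H (n - 1)))"
    by (rule subm_range[OF a H H])
  have Hbz: "hom_map (T n) (d n) ` carrier (?H (n - 1)) \<subseteq> {x \<in> carrier (?H n). hom_map (T (n + 1)) (d (n + 1)) x = \<zero>\<^bsub>?H (n + 1)\<^esub>}"
  proof (intro image_subsetI CollectI conjI)
    fix f assume f: "f \<in> carrier (?H (n - 1))"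
    show "hom_map (T n) (d n) f \<in> carrier (?H n)" using linD(1)[OF a f] .
    have "f \<zero>\<^bsub>T (n - 1)\<^esub> = \<zero>\<^bsub>N\<^esub>" using lin_zero[OF mod_hom_lin T.T S.M] f by simp
    then show "hom_map (T (n + 1)) (d (n + 1)) (hom_map (T n) (d n) f) = \<zero>\<^bsub>?H (n + 1)\<^esub>"
      using T.dd linD(1)[OF T.d'] by (auto simp: hom_map_def)
  qed
  have zero_iff: "hom_map (T (n + 1)) (d (n + 1)) (?f g) = \<zero>\<^bsub>DD (n + 1) (-1)\<^esub> \<longleftrightarrow> hom_map (T (n + 1)) (d (n + 1)) g = \<zero>\<^bsub>?H (n + 1)\<^esub>"
    if g: "g \<in> mod_hom A (T n) N" for g
    using cl[OF g] \<iota>0 linD(1)[OF T.d'] by (auto simp: hom_map_def T.post_def fun_eq_iff restrict_def)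
  show ?thesis unfolding homology_at_subquot D.E_def
  proof (rule subquot_iso[OF H D.mod Hz Hb Hbz D.Z_subm D.B_subm D.B_sub_Z, where f = ?f])
    fix g assume g: "g \<in> {x \<in> carrier (?H n). hom_map (T (n + 1)) (d (n + 1)) x = \<zero>\<^bsub>?H (n + 1)\<^esub>}"
    then have g': "g \<in> mod_hom A (T n) N" by simp
    have "Dh n (-1) (?f g) = \<zero>\<^bsub>DD n (-1 - 1)\<^esub>" using \<iota>z cl[OF g'] by (auto simp: T.post_def)
    then show "?f g \<in> D.Z n (-1)" using linD(1)[OF f, of g] zero_iff[OF g'] g by (simp add: D.Z_def)
    show "?f g \<in> D.B n (-1) \<longleftrightarrow> g \<in> hom_map (T n) (d n) ` carrier (?H (n - 1))"
    proof
      assume "?f g \<in> D.B n (-1)"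
      then obtain h where h: "h \<in> mod_hom A (T (n - 1)) N" "?f g = ?f (hom_map (T n) (d n) h)" unfolding B_eq by auto
      have "hom_map (T n) (d n) h \<in> mod_hom A (T n) N" using linD(1)[OF a, of h n] h by simp
      then show "g \<in> hom_map (T n) (d n) ` carrier (?H (n - 1))" using post_inj[OF g' _ h(2)] h(1) by auto
    qed (auto simp: B_eq)
  next
    fix y assume y: "y \<in> D.Z n (-1)"
    then have y': "y \<in> mod_hom A (T n) (S (-1))" by (simp add: D.Z_def)
    have "dS (-1) (y x) = \<zero>\<^bsub>S (-2)\<^esub>" if "x \<in> carrier (T n)" for x
      using y that by (auto simp: D.Z_def T.post_def fun_eq_iff restrict_def split: if_splits)
    then obtain g where g: "g \<in> mod_hom A (T n) N" "y = ?f g" using lift[OF y'] by blast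
    then show "\<exists>x\<in>{x \<in> carrier (?H n). hom_map (T (n + 1)) (d (n + 1)) x = \<zero>\<^bsub>?H (n + 1)\<^esub>}. \<exists>w\<in>D.B n (-1). y = ?f x \<oplus>\<^bsub>DD n (-1)\<^esub> w"
      using zero_iff[OF g(1)] y submD(3)[OF D.B_subm[of n "-1"]] left_module.axioms(2)[OF D.mod[of n "-1"]]
        abelian_monoid.r_zero[OF abelian_group.axioms(1)[OF left_module.axioms(2)[OF D.mod[of n "-1"]]], of y]
      by (intro bexI[of _ g] bexI[of _ "\<zero>\<^bsub>DD n (-1)\<^esub>"]) (auto simp: D.Z_def)
  qed (use linD[OF f] in auto)
qed

text \<open>Precomposition with \<open>\<eta>\<close> identifies \<open>Hom(M, S j)\<close> with the
  kernel of \<open>Dv 0 j\<close>, since \<open>M\<close> is the cokernel of \<open>d 1\<close>. By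
  exactness this kernel is also the image of \<open>Dv (-1) j\<close>, which identifies the
  boundaries. The first index is \<open>0\<close> because \<open>\<eta>\<close> is defined on
  \<open>T 0\<close>.\<close>

lemma right_iso:
  "mod_iso K
     (homology_at (hom_space A M (S (j + 1))) (T.post M (dS (j + 1))) (hom_space A M (S j))
        (T.post M (dS j)) (hom_space A M (S (j - 1))))
     (D.E 0 j)"
proof -
  let ?H = "\<lambda>j. hom_space A M (S j)"
  have H: "left_module K (?H j)" for j by (rule T.hom_space_left_module[OF T.M S.T])
  have a: "lin K (?H j) (?H (j - 1)) (T.post M (dS j))" for j
    by (rule T.post_lin[OF T.M S.T S.T S.d])
  have a': "lin K (?H (j + 1)) (?H j) (T.post M (dS (j + 1)))"
    by (rule T.post_lin[OF T.M S.T S.T S.d'])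
  let ?f = "hom_map (T 0) \<eta>"
  have f: "lin K (?H j) (DD 0 j) ?f" for j by (rule T.hom_map_lin[OF T.T T.M S.T T.\<eta>])
  have lift: "\<exists>f\<in>mod_hom A M (S j). g = ?f f"
    if g: "g \<in> mod_hom A (T 0) (S j)" and z: "\<And>x. x \<in> carrier (T 1) \<Longrightarrow> g (d 1 x) = \<zero>\<^bsub>S j\<^esub>" for g j
  proof -
    have "g x = \<zero>\<^bsub>S j\<^esub>" if "x \<in> carrier (T 0)" "\<eta> x = \<zero>\<^bsub>M\<^esub>" for x
      using T.\<eta>_ker that z by (metis (mono_tags, lifting) imageE mem_Collect_eq)
    then obtain f where f: "lin A M (S j) f" "\<And>x. x \<in> carrier (T 0) \<Longrightarrow> f (\<eta> x) = g x"
      using lin_factor[OF T.\<eta> T.T T.M S.T T.\<eta>_surj mod_hom_lin[OF g]] by blast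
    have "g = ?f (restrict f (carrier M))"
      by (rule extensionalityI[of _ "carrier (T 0)"])
        (use g f(2) linD(1)[OF T.\<eta>] in \<open>auto simp: mod_hom_iff hom_map_def\<close>)
    then show ?thesis using lin_restrict[OF f(1) T.M] by blast
  qed
  have hom_inj: "f = g" if "f \<in> mod_hom A M (S j)" "g \<in> mod_hom A M (S j)" "?f f = ?f g" for f g j
  proof (rule mod_hom_ext[OF that(1,2)])
    fix x assume "x \<in> carrier M"
    then obtain t where "t \<in> carrier (T 0)" "x = \<eta> t" using T.\<eta>_ex by blast
    then show "f x = g x" using fun_cong[OF that(3), of t] by (simp add: hom_map_def)
  qed
  have comm: "T.post (T 0) (dS j) (?f g) = ?f (T.post M (dS j) g)" for g j
    using linD(1)[OF T.\<eta>] by (auto simp: hom_map_def T.post_def)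
  have ker: "Dv 0 j (?f g) = \<zero>\<^bsub>DD 1 j\<^esub>" if "g \<in> mod_hom A M (S j)" for g j
    using T.\<eta>_d linD(1)[OF T.d[of 1]] lin_zero[OF mod_hom_lin[OF that] T.M S.T] by (auto simp: hom_map_def)
  have im: "Dv (-1) j ` carrier (DD (-1) j) = ?f ` mod_hom A M (S j)" for j
  proof -
    have "{f \<in> carrier (DD 0 j). Dv 0 j f = \<zero>\<^bsub>DD 1 j\<^esub>} = ?f ` mod_hom A M (S j)"
    proof (intro equalityI subsetI)
      fix g assume g: "g \<in> {f \<in> carrier (DD 0 j). Dv 0 j f = \<zero>\<^bsub>DD 1 j\<^esub>}"
      have "g (d 1 x) = \<zero>\<^bsub>S j\<^esub>" if "x \<in> carrier (T 1)" for x
        using g that by (auto simp: hom_map_def fun_eq_iff restrict_def split: if_splits)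
      then show "g \<in> ?f ` mod_hom A M (S j)" using lift[of g j] g by auto
    qed (use linD(1)[OF f] ker in auto)
    then show ?thesis using D.vexact[of 0 j] by simp
  qed
  have B_eq: "D.B 0 j = ?f ` (T.post M (dS (j + 1)) ` mod_hom A M (S (j + 1)))"
  proof -
    \<comment> \<open>In \<open>D.B\<close> the vertical map is applied last. Exchanging the two
      maps by commutativity exposes the vertical image that \<open>im\<close> computes.\<close>
    have "D.B 0 j = (\<lambda>k. Dh 0 (j + 1) (Dv (-1) (j + 1) k)) ` carrier (DD (-1) (j + 1))"
      unfolding D.B_def by (rule image_cong) (use D.comm[of _ "-1" "j + 1"] in auto)
    also have "\<dots> = Dh 0 (j + 1) ` (Dv (-1) (j + 1) ` carrier (DD (-1) (j + 1)))" by (simp add: image_image)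
    also have "\<dots> = ?f ` (T.post M (dS (j + 1)) ` mod_hom A M (S (j + 1)))"
      unfolding im by (simp add: image_image comm)
    finally show ?thesis .
  qed
  have Hz: "subm K (?H j) {x \<in> carrier (?H j). T.post M (dS j) x = \<zero>\<^bsub>?H (j - 1)\<^esub>}"
    by (rule subm_ker[OF a H H])
  have Hb: "subm K (?H j) (T.post M (dS (j + 1)) ` carrier (?H (j + 1)))"
    by (rule subm_range[OF a' H H])
  have Hbz: "T.post M (dS (j + 1)) ` carrier (?H (j + 1)) \<subseteq> {x \<in> carrier (?H j). T.post M (dS j) x = \<zero>\<^bsub>?H (j - 1)\<^esub>}"
  proof (intro image_subsetI CollectI conjI)
    fix f assume f: "f \<in> carrier (?H (j + 1))"
    show "T.post M (dS (j + 1)) f \<in> carrier (?H j)" using linD(1)[OF a' f] .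
    have "f x \<in> carrier (S (j + 1))" if "x \<in> carrier M" for x
      using linD(1)[OF mod_hom_lin that] f by simp
    then show "T.post M (dS j) (T.post M (dS (j + 1)) f) = \<zero>\<^bsub>?H (j - 1)\<^esub>"
      using S.dd by (auto simp: T.post_def)
  qed
  have zero_iff: "T.post (T 0) (dS j) (?f g) = \<zero>\<^bsub>DD 0 (j - 1)\<^esub> \<longleftrightarrow> T.post M (dS j) g = \<zero>\<^bsub>?H (j - 1)\<^esub>"
    if g: "g \<in> mod_hom A M (S j)" for g
  proof -
    have z: "\<zero>\<^bsub>DD 0 (j - 1)\<^esub> = ?f \<zero>\<^bsub>?H (j - 1)\<^esub>" using linD(1)[OF T.\<eta>] by (auto simp: hom_map_def)
    have "T.post M (dS j) g \<in> mod_hom A M (S (j - 1))" "\<zero>\<^bsub>?H (j - 1)\<^esub> \<in> mod_hom A M (S (j - 1))"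
      using linD(1)[OF a, of g j] g left_module.subm_zero[OF H, of "j - 1", THEN submD(1)] by auto
    note inj = hom_inj[OF this]
    show ?thesis unfolding comm z by (rule iffI[OF inj]) simp_all
  qed
  show ?thesis unfolding homology_at_subquot D.E_def
  proof (rule subquot_iso[OF H D.mod Hz Hb Hbz D.Z_subm D.B_subm D.B_sub_Z, where f = ?f])
    fix g assume g: "g \<in> {x \<in> carrier (?H j). T.post M (dS j) x = \<zero>\<^bsub>?H (j - 1)\<^esub>}"
    then have g': "g \<in> mod_hom A M (S j)" by simp
    show "?f g \<in> D.Z 0 j" using linD(1)[OF f, of g] zero_iff[OF g'] ker[OF g'] g by (simp add: D.Z_def)
    show "?f g \<in> D.B 0 j \<longleftrightarrow> g \<in> T.post M (dS (j + 1)) ` carrier (?H (j + 1))"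
    proof
      assume "?f g \<in> D.B 0 j"
      then obtain h where h: "h \<in> mod_hom A M (S (j + 1))" "?f g = ?f (T.post M (dS (j + 1)) h)" unfolding B_eq by auto
      have "T.post M (dS (j + 1)) h \<in> mod_hom A M (S j)" using linD(1)[OF a', of h] h by simp
      then show "g \<in> T.post M (dS (j + 1)) ` carrier (?H (j + 1))" using hom_inj[OF g' _ h(2)] h(1) by auto
    qed (auto simp: B_eq)
  next
    fix y assume y: "y \<in> D.Z 0 j"
    then have y': "y \<in> mod_hom A (T 0) (S j)" by (simp add: D.Z_def)
    have Dy: "Dv 0 j y = \<zero>\<^bsub>DD (0 + 1) j\<^esub>" using y by (simp add: D.Z_def)
    have "y (d 1 x) = \<zero>\<^bsub>S j\<^esub>" if "x \<in> carrier (T 1)" for x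
      using fun_cong[OF Dy, of x] that by (simp add: hom_map_def)
    then obtain g where g: "g \<in> mod_hom A M (S j)" "y = ?f g" using lift[OF y'] by blast
    then show "\<exists>x\<in>{x \<in> carrier (?H j). T.post M (dS j) x = \<zero>\<^bsub>?H (j - 1)\<^esub>}. \<exists>w\<in>D.B 0 j. y = ?f x \<oplus>\<^bsub>DD 0 j\<^esub> w"
      using zero_iff[OF g(1)] y submD(3)[OF D.B_subm[of 0 j]]
        abelian_monoid.r_zero[OF abelian_group.axioms(1)[OF left_module.axioms(2)[OF D.mod[of 0 j]]], of y]
      by (intro bexI[of _ g] bexI[of _ "\<zero>\<^bsub>DD 0 j\<^esub>"]) (auto simp: D.Z_def)
  qed (use linD[OF f] in auto)
qed

text \<open>The two sides are \<open>E n (-1)\<close> and \<open>E 0 (-(n + 1))\<close>, joined by a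
  diagonal shift by \<open>-n\<close>. The extra \<open>1\<close> in the degree is the offset
  between \<open>\<iota>\<close>, which ends in degree \<open>-1\<close>, and \<open>\<eta>\<close>,
  which starts in degree \<open>0\<close>.\<close>

theorem tate_balance:
  "mod_iso K
     (homology_at (hom_space A (T (n - 1)) N) (hom_map (T n) (d n)) (hom_space A (T n) N)
        (hom_map (T (n + 1)) (d (n + 1))) (hom_space A (T (n + 1)) N))
     (homology_at (hom_space A M (S (- (n + 1) + 1))) (T.post M (dS (- (n + 1) + 1))) (hom_space A M (S (- (n + 1))))
        (T.post M (dS (- (n + 1)))) (hom_space A M (S (- (n + 1) - 1))))"
  using left_iso[of n] D.E_shift[of n "-1" "- n"] right_iso[of "- (n + 1)"]
  by (simp add: algebra_simps) (meson mod_iso_sym mod_iso_trans)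

end

section \<open>Opposite algebras\<close>

lemma ring_opp: "ring R \<Longrightarrow> ring (opp R)"
proof -
  assume "ring R"
  then interpret ring R .
  show ?thesis
    by (intro ringI abelian_groupI monoidI) (auto simp: a_assoc m_assoc l_distr r_distr intro: a_comm l_neg)
qed

lemma opp_opp [simp]: "opp (opp R) = R"
  by (simp add: opp_def)

context fd_algebra
begin

lemma opp_fd: "fd_algebra K (opp A)"
proof (intro fd_algebra.intro k_algebra.intro k_algebra_axioms.intro K_field ring_opp A_ring)
  interpret o: ring "opp A" by (rule ring_opp[OF A_ring])
  show "module K (opp A)"
    by (rule moduleI) (auto simp: K.is_cring o.abelian_group_axioms A.smult_l_distr A.smult_r_distr A.smult_assoc1)
  have 1: "left_module K (opp A)"
    by (intro left_module.intro left_module_axioms.intro K.ring_axioms o.abelian_group_axioms)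
      (simp_all add: A.smult_l_distr A.smult_r_distr A.smult_assoc1)
  have "lin K A (opp A) (\<lambda>x. x)" by (rule linI) auto
  then show "fin_gen K (opp A)" by (rule fin_gen_surj[OF A_fg _ A_left_module 1]) auto
qed (auto simp: A.smult_mult_left A.smult_mult_right)

lemma scalars_opp [simp]: "scalars (opp A) M = scalars A M"
  by (simp add: scalars_def)

lemma right_scalars: "left_module (opp A) N \<Longrightarrow> left_module K (scalars A N)"
  using fd_algebra.scalars_left_module[OF opp_fd] by simp

end

section \<open>Tensor products\<close>

lemma free_module_simps [simp]:
  "zero (free_module K X) = (\<lambda>_. \<zero>\<^bsub>K\<^esub>)" "add (free_module K X) = (\<lambda>f g x. f x \<oplus>\<^bsub>K\<^esub> g x)"
  "smult (free_module K X) = (\<lambda>c f x. c \<otimes>\<^bsub>K\<^esub> f x)"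
  by (simp_all add: free_module_def)

lemma free_carrier: "f \<in> carrier (free_module K X) \<longleftrightarrow>
  (\<forall>x\<in>X. f x \<in> carrier K) \<and> (\<forall>x. x \<notin> X \<longrightarrow> f x = \<zero>\<^bsub>K\<^esub>) \<and> finite {x. f x \<noteq> \<zero>\<^bsub>K\<^esub>}"
  by (simp add: free_module_def)

lemma free_val: "ring K \<Longrightarrow> f \<in> carrier (free_module K X) \<Longrightarrow> f x \<in> carrier K"
  by (cases "x \<in> X") (auto simp: free_carrier ring.ring_simprules)

lemma free_left_module:
  assumes "cring K" shows "left_module K (free_module K X)"
proof -
  interpret cring K by fact
  note c = free_val[OF ring_axioms, of _ X]
  show ?thesis
  proof (rule left_moduleI, goal_cases)
    case (2 f g)
    have "{x. f x \<oplus>\<^bsub>K\<^esub> g x \<noteq> \<zero>\<^bsub>K\<^esub>} \<subseteq> {x. f x \<noteq> \<zero>\<^bsub>K\<^esub>} \<union> {x. g x \<noteq> \<zero>\<^bsub>K\<^esub>}" by auto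
    with 2 show ?case by (auto simp: free_carrier intro: finite_subset)
  next
    case 3 show ?case by (auto simp: free_carrier)
  next
    case (7 f)
    have "{x. \<ominus>\<^bsub>K\<^esub> f x \<noteq> \<zero>\<^bsub>K\<^esub>} \<subseteq> {x. f x \<noteq> \<zero>\<^bsub>K\<^esub>}" by auto
    with 7 have "(\<lambda>x. \<ominus>\<^bsub>K\<^esub> f x) \<in> carrier (free_module K X)"
      by (auto simp: free_carrier intro: finite_subset)
    then show ?case using c[OF 7] by (intro bexI[of _ "\<lambda>x. \<ominus>\<^bsub>K\<^esub> f x"]) (auto simp: l_neg)
  next
    case (8 a f)
    have "{x. a \<otimes>\<^bsub>K\<^esub> f x \<noteq> \<zero>\<^bsub>K\<^esub>} \<subseteq> {x. f x \<noteq> \<zero>\<^bsub>K\<^esub>}" using 8 by auto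
    with 8 show ?case by (auto simp: free_carrier intro: finite_subset)
  qed (auto simp: c ring_axioms a_assoc l_distr r_distr m_assoc intro!: ext intro: a_comm)
qed

lemma free_gen_carrier: "cring K \<Longrightarrow> x \<in> X \<Longrightarrow> free_gen K x \<in> carrier (free_module K X)"
proof -
  assume "cring K" "x \<in> X"
  then interpret cring K by simp
  have "{y. (if y = x then \<one>\<^bsub>K\<^esub> else \<zero>\<^bsub>K\<^esub>) \<noteq> \<zero>\<^bsub>K\<^esub>} \<subseteq> {x}" by auto
  then show ?thesis using \<open>x \<in> X\<close> by (auto simp: free_carrier free_gen_def intro: finite_subset)
qed

lemma free_generated:
  assumes "cring K" "subm K (free_module K X) W" "\<And>x. x \<in> X \<Longrightarrow> free_gen K x \<in> W"
  shows "carrier (free_module K X) \<subseteq> W"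
proof
  interpret cring K by fact
  fix f assume f: "f \<in> carrier (free_module K X)"
  have "(\<lambda>x. if x \<in> I then f x else \<zero>\<^bsub>K\<^esub>) \<in> W" if "finite I" "I \<subseteq> X" for I
    using that
  proof (induction I)
    case empty then show ?case using submD(3)[OF assms(2)] by simp
  next
    case (insert y I)
    have fy: "f y \<in> carrier K" "\<And>x. f x \<in> carrier K" using free_val[OF ring_axioms f] by auto
    have "(\<lambda>x. if x \<in> insert y I then f x else \<zero>\<^bsub>K\<^esub>) =
      (\<lambda>x. if x \<in> I then f x else \<zero>\<^bsub>K\<^esub>) \<oplus>\<^bsub>free_module K X\<^esub> (f y \<odot>\<^bsub>free_module K X\<^esub> free_gen K y)"
      using insert.hyps fy by (auto simp: free_gen_def)
    then show ?case
      using submD(4)[OF assms(2) insert.IH submD(5)[OF assms(2) fy(1) assms(3)]] insert.prems by auto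
  qed
  moreover have "(\<lambda>x. if x \<in> {x. f x \<noteq> \<zero>\<^bsub>K\<^esub>} then f x else \<zero>\<^bsub>K\<^esub>) = f" by auto
  moreover have "finite {x. f x \<noteq> \<zero>\<^bsub>K\<^esub>}" "{x. f x \<noteq> \<zero>\<^bsub>K\<^esub>} \<subseteq> X" using f by (auto simp: free_carrier)
  ultimately show "f \<in> W" by metis
qed

definition free_lift :: "('k, 'z) ring_scheme \<Rightarrow> ('k, 'v) module \<Rightarrow> ('x \<Rightarrow> 'v) \<Rightarrow> ('x \<Rightarrow> 'k) \<Rightarrow> 'v" where
  "free_lift K V g f = (\<Oplus>\<^bsub>V\<^esub>p\<in>{p. f p \<noteq> \<zero>\<^bsub>K\<^esub>}. f p \<odot>\<^bsub>V\<^esub> g p)"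

text \<open>Two functions and their sum have different supports. Summing over any finite set that
  contains the support gives the same value and makes additivity accessible.\<close>

lemma free_lift_eq:
  assumes "cring K" "left_module K V" "g \<in> X \<rightarrow> carrier V" "f \<in> carrier (free_module K X)"
    and I: "finite I" "{p. f p \<noteq> \<zero>\<^bsub>K\<^esub>} \<subseteq> I" "I \<subseteq> X"
  shows "free_lift K V g f = (\<Oplus>\<^bsub>V\<^esub>p\<in>I. f p \<odot>\<^bsub>V\<^esub> g p)"
proof -
  interpret cring K by fact
  interpret V: left_module K V by fact
  show ?thesis unfolding free_lift_def
    by (rule V.add.finprod_mono_neutral_cong_left)
      (use I assms(3) free_val[OF ring_axioms assms(4)] in \<open>auto simp: Pi_def subset_iff\<close>)
qed

lemma free_lift_lin:
  assumes "cring K" "left_module K V" "g \<in> X \<rightarrow> carrier V"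
  shows "lin K (free_module K X) V (free_lift K V g)"
proof -
  interpret cring K by fact
  interpret V: left_module K V by fact
  note val = free_val[OF ring_axioms, of _ X]
  note eq = free_lift_eq[OF assms]
  have sup: "finite {p. f p \<noteq> \<zero>\<^bsub>K\<^esub>}" "{p. f p \<noteq> \<zero>\<^bsub>K\<^esub>} \<subseteq> X" if "f \<in> carrier (free_module K X)" for f
    using that by (auto simp: free_carrier)
  interpret F: left_module K "free_module K X" by (rule free_left_module[OF assms(1)])
  show ?thesis
  proof (rule linI)
    fix f assume f: "f \<in> carrier (free_module K X)"
    show "free_lift K V g f \<in> carrier V"
      unfolding free_lift_def by (rule V.lc_closed) (use val[OF f] assms(3) sup[OF f] in auto)
  next
    fix f h assume f: "f \<in> carrier (free_module K X)" and h: "h \<in> carrier (free_module K X)"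
    let ?I = "{p. f p \<noteq> \<zero>\<^bsub>K\<^esub>} \<union> {p. h p \<noteq> \<zero>\<^bsub>K\<^esub>}"
    have I: "finite ?I" "?I \<subseteq> X" using sup f h by auto
    have gI: "g \<in> ?I \<rightarrow> carrier V" using assms(3) I by auto
    have fh: "f \<oplus>\<^bsub>free_module K X\<^esub> h \<in> carrier (free_module K X)" using f h by (rule F.M.a_closed)
    have "{p. (f \<oplus>\<^bsub>free_module K X\<^esub> h) p \<noteq> \<zero>\<^bsub>K\<^esub>} \<subseteq> ?I" by auto
    from eq[OF fh I(1) this I(2)]
    have "free_lift K V g (f \<oplus>\<^bsub>free_module K X\<^esub> h) = (\<Oplus>\<^bsub>V\<^esub>p\<in>?I. (f p \<oplus>\<^bsub>K\<^esub> h p) \<odot>\<^bsub>V\<^esub> g p)" by simp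
    also have "\<dots> = free_lift K V g f \<oplus>\<^bsub>V\<^esub> free_lift K V g h"
      using V.lc_add[OF _ _ gI, of f h] val[OF f] val[OF h] eq[OF f I(1) _ I(2)] eq[OF h I(1) _ I(2)] by auto
    finally show "free_lift K V g (f \<oplus>\<^bsub>free_module K X\<^esub> h) = free_lift K V g f \<oplus>\<^bsub>V\<^esub> free_lift K V g h" .
  next
    fix r f assume r: "r \<in> carrier K" and f: "f \<in> carrier (free_module K X)"
    let ?I = "{p. f p \<noteq> \<zero>\<^bsub>K\<^esub>}"
    have gI: "g \<in> ?I \<rightarrow> carrier V" using assms(3) sup[OF f] by auto
    have rf: "r \<odot>\<^bsub>free_module K X\<^esub> f \<in> carrier (free_module K X)" using r f by (rule F.smult_closed)
    have "{p. (r \<odot>\<^bsub>free_module K X\<^esub> f) p \<noteq> \<zero>\<^bsub>K\<^esub>} \<subseteq> ?I" using r by auto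
    from eq[OF rf sup(1)[OF f] this sup(2)[OF f]]
    have "free_lift K V g (r \<odot>\<^bsub>free_module K X\<^esub> f) = (\<Oplus>\<^bsub>V\<^esub>p\<in>?I. (r \<otimes>\<^bsub>K\<^esub> f p) \<odot>\<^bsub>V\<^esub> g p)" by simp
    also have "\<dots> = r \<odot>\<^bsub>V\<^esub> free_lift K V g f" unfolding free_lift_def
      by (rule V.lc_smult[OF sup(1)[OF f] r _ gI]) (use val[OF f] in auto)
    finally show "free_lift K V g (r \<odot>\<^bsub>free_module K X\<^esub> f) = r \<odot>\<^bsub>V\<^esub> free_lift K V g f" .
  qed
qed

lemma free_lift_gen:
  assumes "cring K" "left_module K V" "g \<in> X \<rightarrow> carrier V" "x \<in> X"
  shows "free_lift K V g (free_gen K x) = g x"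
proof -
  interpret cring K by fact
  interpret V: left_module K V by fact
  have "free_lift K V g (free_gen K x) = (\<Oplus>\<^bsub>V\<^esub>p\<in>{x}. free_gen K x p \<odot>\<^bsub>V\<^esub> g p)"
    by (rule free_lift_eq[OF assms(1-3) free_gen_carrier[OF assms(1,4)]]) (use assms(4) in \<open>auto simp: free_gen_def\<close>)
  also have "\<dots> = (\<Oplus>\<^bsub>V\<^esub>p\<in>{x}. if x = p then g p else \<zero>\<^bsub>V\<^esub>)"
    by (rule V.finsum_cong') (use assms(3,4) in \<open>auto simp: free_gen_def V.smult_one Pi_def\<close>)
  also have "\<dots> = g x" by (rule V.finsum_singleton) (use assms(3,4) in auto)
  finally show ?thesis .
qed

lemma (in lmod) mod_span:
  assumes "S \<subseteq> carrier M"
  shows mod_span_subm: "subm R M (mod_span R M S)" and mod_span_incl: "S \<subseteq> mod_span R M S"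
    and mod_span_least: "subm R M W \<Longrightarrow> S \<subseteq> W \<Longrightarrow> mod_span R M S \<subseteq> W"
proof -
  have eq: "mod_span R M S = \<Inter>{W. subm R M W \<and> S \<subseteq> W}"
    by (simp add: mod_span_def subm_iff_submodule)
  show "subm R M (mod_span R M S)" unfolding eq
    using subm_carrier assms by (intro submI) (auto simp: subm_def)
  show "S \<subseteq> mod_span R M S" "subm R M W \<Longrightarrow> S \<subseteq> W \<Longrightarrow> mod_span R M S \<subseteq> W" unfolding eq by auto
qed

section \<open>Pure tensors and the universal property of the tensor product\<close>

locale tensor_pair = fd_algebra K A
  for K :: "('k, 'z) ring_scheme" and A :: "('k, 'a) module" +
  fixes N :: "('a, 'n) module" and M :: "('a, 'm) module"
  assumes N: "left_module (opp A) N" and M: "left_module A M"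
begin

abbreviation "F \<equiv> free_module K (carrier N \<times> carrier M)"
abbreviation "null \<equiv> tensor_null K A N M"
abbreviation "TT \<equiv> tensor K A N M"
abbreviation "pt \<equiv> pure_tensor K A N M"

interpretation N: left_module "opp A" N by (rule N)
interpretation M: left_module A M by (rule M)
interpretation F: lmod K F unfolding lmod_def by (rule free_left_module[OF K.is_cring])

lemma gen: "x \<in> carrier N \<Longrightarrow> y \<in> carrier M \<Longrightarrow> free_gen K (x, y) \<in> carrier F"
  by (rule free_gen_carrier[OF K.is_cring]) simp

lemma Nsm: "a \<in> carrier A \<Longrightarrow> x \<in> carrier N \<Longrightarrow> a \<odot>\<^bsub>N\<^esub> x \<in> carrier N"
  using N.smult_closed by simp

lemma rels: "tensor_rels K A N M \<subseteq> carrier F"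
proof -
  have "free_gen K (x, y) \<in> carrier F" if "x \<in> carrier N" "y \<in> carrier M" for x y using gen that .
  then show ?thesis unfolding tensor_rels_def Let_def
    by (safe; intro F.M.minus_closed F.M.a_closed F.smult_closed; simp add: Nsm del: free_module_simps)
qed

lemma null_subm: "subm K F null"
  unfolding tensor_null_def by (rule F.mod_span_subm[OF rels])

lemma TT_left_module: "left_module K TT"
  unfolding tensor_def by (rule F.quot_left_module[OF null_subm])

lemma pt_closed: "x \<in> carrier N \<Longrightarrow> y \<in> carrier M \<Longrightarrow> pt x y \<in> carrier TT"
  by (simp add: pure_tensor_def tensor_def F.quot_carrier gen)

lemma rels_null: "r \<in> tensor_rels K A N M \<Longrightarrow> r \<in> null"
  unfolding tensor_null_def using F.mod_span_incl[OF rels] by blast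

lemma pt_add_l:
  assumes "x \<in> carrier N" "x' \<in> carrier N" "y \<in> carrier M"
  shows "pt (x \<oplus>\<^bsub>N\<^esub> x') y = pt x y \<oplus>\<^bsub>TT\<^esub> pt x' y"
proof -
  have "free_gen K (x \<oplus>\<^bsub>N\<^esub> x', y) \<ominus>\<^bsub>F\<^esub> (free_gen K (x, y) \<oplus>\<^bsub>F\<^esub> free_gen K (x', y)) \<in> null"
    by (rule rels_null) (unfold tensor_rels_def Let_def, use assms in blast)
  moreover have "pt x y \<oplus>\<^bsub>TT\<^esub> pt x' y = null +>\<^bsub>F\<^esub> (free_gen K (x, y) \<oplus>\<^bsub>F\<^esub> free_gen K (x', y))"
    unfolding tensor_def pure_tensor_def by (rule F.quot_ops(1)[OF null_subm gen gen]) (use assms in auto)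
  ultimately show ?thesis unfolding pure_tensor_def
    using F.coset_eq_iff[OF null_subm gen F.M.a_closed[OF gen gen]] assms by simp
qed

lemma pt_add_r:
  assumes "x \<in> carrier N" "y \<in> carrier M" "y' \<in> carrier M"
  shows "pt x (y \<oplus>\<^bsub>M\<^esub> y') = pt x y \<oplus>\<^bsub>TT\<^esub> pt x y'"
proof -
  have "free_gen K (x, y \<oplus>\<^bsub>M\<^esub> y') \<ominus>\<^bsub>F\<^esub> (free_gen K (x, y) \<oplus>\<^bsub>F\<^esub> free_gen K (x, y')) \<in> null"
    by (rule rels_null) (unfold tensor_rels_def Let_def, use assms in blast)
  moreover have "pt x y \<oplus>\<^bsub>TT\<^esub> pt x y' = null +>\<^bsub>F\<^esub> (free_gen K (x, y) \<oplus>\<^bsub>F\<^esub> free_gen K (x, y'))"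
    unfolding tensor_def pure_tensor_def by (rule F.quot_ops(1)[OF null_subm gen gen]) (use assms in auto)
  ultimately show ?thesis unfolding pure_tensor_def
    using F.coset_eq_iff[OF null_subm gen F.M.a_closed[OF gen gen]] assms by simp
qed

lemma pt_balanced:
  assumes "a \<in> carrier A" "x \<in> carrier N" "y \<in> carrier M"
  shows "pt (a \<odot>\<^bsub>N\<^esub> x) y = pt x (a \<odot>\<^bsub>M\<^esub> y)"
proof -
  have "free_gen K (a \<odot>\<^bsub>N\<^esub> x, y) \<ominus>\<^bsub>F\<^esub> free_gen K (x, a \<odot>\<^bsub>M\<^esub> y) \<in> null"
    by (rule rels_null) (unfold tensor_rels_def Let_def, use assms in blast)
  then show ?thesis unfolding pure_tensor_def
    using F.coset_eq_iff[OF null_subm gen gen] assms Nsm by simp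
qed

lemma pt_smult_l:
  assumes "c \<in> carrier K" "x \<in> carrier N" "y \<in> carrier M"
  shows "pt (sc c \<odot>\<^bsub>N\<^esub> x) y = c \<odot>\<^bsub>TT\<^esub> pt x y"
proof -
  have "free_gen K (c \<odot>\<^bsub>scalars A N\<^esub> x, y) \<ominus>\<^bsub>F\<^esub> (c \<odot>\<^bsub>F\<^esub> free_gen K (x, y)) \<in> null"
    by (rule rels_null) (unfold tensor_rels_def Let_def, use assms in blast)
  then have "free_gen K (sc c \<odot>\<^bsub>N\<^esub> x, y) \<ominus>\<^bsub>F\<^esub> (c \<odot>\<^bsub>F\<^esub> free_gen K (x, y)) \<in> null" by simp
  moreover have "c \<odot>\<^bsub>TT\<^esub> pt x y = null +>\<^bsub>F\<^esub> (c \<odot>\<^bsub>F\<^esub> free_gen K (x, y))"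
    unfolding tensor_def pure_tensor_def by (rule F.quot_ops(2)[OF null_subm _ gen]) (use assms in auto)
  ultimately show ?thesis unfolding pure_tensor_def
    using F.coset_eq_iff[OF null_subm gen F.smult_closed[OF _ gen]] assms Nsm by simp
qed

lemma pt_smult_r:
  assumes "c \<in> carrier K" "x \<in> carrier N" "y \<in> carrier M"
  shows "pt x (sc c \<odot>\<^bsub>M\<^esub> y) = c \<odot>\<^bsub>TT\<^esub> pt x y"
  using pt_smult_l[OF assms] pt_balanced[of "sc c" x y] assms by simp

lemma TT_generated:
  assumes "subm K TT W" "\<And>x y. \<lbrakk>x \<in> carrier N; y \<in> carrier M\<rbrakk> \<Longrightarrow> pt x y \<in> W"
  shows "carrier TT \<subseteq> W"
proof -
  have q: "lin K F TT (\<lambda>f. null +>\<^bsub>F\<^esub> f)" unfolding tensor_def by (rule F.quot_lin[OF null_subm])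
  have "carrier F \<subseteq> {f \<in> carrier F. null +>\<^bsub>F\<^esub> f \<in> W}"
  proof (rule free_generated[OF K.is_cring subm_preimage[OF q F.left_module_axioms TT_left_module assms(1)]])
    fix p assume "p \<in> carrier N \<times> carrier M"
    then show "free_gen K p \<in> {f \<in> carrier F. null +>\<^bsub>F\<^esub> f \<in> W}"
      using gen assms(2) by (auto simp: pure_tensor_def)
  qed
  then show ?thesis unfolding tensor_def F.quot_carrier by auto
qed

text \<open>The equaliser of two linear maps is a subspace, and pure tensors generate. Almost every
  identity on tensor products below is checked in this way, without touching
  representatives.\<close>

lemma lin_eq_on_pt:
  assumes "left_module K V" "lin K TT V f" "lin K TT V g"
    and "\<And>x y. \<lbrakk>x \<in> carrier N; y \<in> carrier M\<rbrakk> \<Longrightarrow> f (pt x y) = g (pt x y)" "t \<in> carrier TT"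
  shows "f t = g t"
proof -
  interpret V: left_module K V by fact
  have "carrier TT \<subseteq> {t \<in> carrier TT. f t = g t}"
  proof (rule TT_generated)
    interpret T: left_module K TT by (rule TT_left_module)
    show "subm K TT {t \<in> carrier TT. f t = g t}"
      by (rule submI) (auto simp: linD[OF assms(2)] linD[OF assms(3)] lin_zero[OF assms(2) TT_left_module assms(1)]
        lin_zero[OF assms(3) TT_left_module assms(1)])
  qed (use assms(4) pt_closed in auto)
  then show ?thesis using assms(5) by auto
qed

text \<open>Apart from closedness, the conditions mirror the four families in
  \<open>tensor_rels\<close>. Homogeneity in the second argument follows by moving the scalar across
  with the balance condition.\<close>

definition balanced :: "('k, 'v) module \<Rightarrow> ('n \<Rightarrow> 'm \<Rightarrow> 'v) \<Rightarrow> bool" where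
  "balanced V \<phi> \<longleftrightarrow>
    (\<forall>x\<in>carrier N. \<forall>y\<in>carrier M. \<phi> x y \<in> carrier V) \<and>
    (\<forall>x\<in>carrier N. \<forall>x'\<in>carrier N. \<forall>y\<in>carrier M. \<phi> (x \<oplus>\<^bsub>N\<^esub> x') y = \<phi> x y \<oplus>\<^bsub>V\<^esub> \<phi> x' y) \<and>
    (\<forall>x\<in>carrier N. \<forall>y\<in>carrier M. \<forall>y'\<in>carrier M. \<phi> x (y \<oplus>\<^bsub>M\<^esub> y') = \<phi> x y \<oplus>\<^bsub>V\<^esub> \<phi> x y') \<and>
    (\<forall>a\<in>carrier A. \<forall>x\<in>carrier N. \<forall>y\<in>carrier M. \<phi> (a \<odot>\<^bsub>N\<^esub> x) y = \<phi> x (a \<odot>\<^bsub>M\<^esub> y)) \<and>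
    (\<forall>c\<in>carrier K. \<forall>x\<in>carrier N. \<forall>y\<in>carrier M. \<phi> (sc c \<odot>\<^bsub>N\<^esub> x) y = c \<odot>\<^bsub>V\<^esub> \<phi> x y)"

text \<open>The linear extension of \<open>\<phi>\<close> to the free vector space kills the four
  families of relations, hence all of \<open>null\<close>. It is therefore constant on cosets, and
  the representative picked inside \<open>tensor_lift\<close> is immaterial.\<close>

lemma tensor_lift_lin:
  assumes V: "left_module K V" and \<phi>: "balanced V \<phi>"
  shows "lin K TT V (tensor_lift K V \<phi>)"
    and "x \<in> carrier N \<Longrightarrow> y \<in> carrier M \<Longrightarrow> tensor_lift K V \<phi> (pt x y) = \<phi> x y"
proof -
  interpret V: left_module K V by fact
  let ?g = "\<lambda>p. \<phi> (fst p) (snd p)"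
  have g: "?g \<in> carrier N \<times> carrier M \<rightarrow> carrier V" using \<phi> by (auto simp: balanced_def)
  note L = free_lift_lin[OF K.is_cring V g]
  have Lg: "free_lift K V ?g (free_gen K (x, y)) = \<phi> x y" if "x \<in> carrier N" "y \<in> carrier M" for x y
    using free_lift_gen[OF K.is_cring V g, of "(x, y)"] that by simp
  let ?k = "{f \<in> carrier F. free_lift K V ?g f = \<zero>\<^bsub>V\<^esub>}"
  have k: "subm K F ?k" by (rule subm_ker[OF L F.left_module_axioms V])
  have d: "f \<ominus>\<^bsub>F\<^esub> h \<in> ?k" if "f \<in> carrier F" "h \<in> carrier F" "free_lift K V ?g f = free_lift K V ?g h" for f h
    using lin_diff[OF L F.left_module_axioms V that(1,2)] that linD(1)[OF L] by (simp add: V.diff_eq_zero_iff)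
  have La: "free_lift K V ?g (f \<oplus>\<^bsub>F\<^esub> h) = free_lift K V ?g f \<oplus>\<^bsub>V\<^esub> free_lift K V ?g h"
    if "f \<in> carrier F" "h \<in> carrier F" for f h using linD(2)[OF L that] .
  have "tensor_rels K A N M \<subseteq> ?k"
  proof
    fix r assume "r \<in> tensor_rels K A N M"
    then consider
      x x' y where "r = free_gen K (x \<oplus>\<^bsub>N\<^esub> x', y) \<ominus>\<^bsub>F\<^esub> (free_gen K (x, y) \<oplus>\<^bsub>F\<^esub> free_gen K (x', y))"
        "x \<in> carrier N" "x' \<in> carrier N" "y \<in> carrier M"
      | x y y' where "r = free_gen K (x, y \<oplus>\<^bsub>M\<^esub> y') \<ominus>\<^bsub>F\<^esub> (free_gen K (x, y) \<oplus>\<^bsub>F\<^esub> free_gen K (x, y'))"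
        "x \<in> carrier N" "y \<in> carrier M" "y' \<in> carrier M"
      | a x y where "r = free_gen K (a \<odot>\<^bsub>N\<^esub> x, y) \<ominus>\<^bsub>F\<^esub> free_gen K (x, a \<odot>\<^bsub>M\<^esub> y)"
        "a \<in> carrier A" "x \<in> carrier N" "y \<in> carrier M"
      | c x y where "r = free_gen K (c \<odot>\<^bsub>scalars A N\<^esub> x, y) \<ominus>\<^bsub>F\<^esub> (c \<odot>\<^bsub>F\<^esub> free_gen K (x, y))"
        "c \<in> carrier K" "x \<in> carrier N" "y \<in> carrier M"
      unfolding tensor_rels_def Let_def by blast
    then show "r \<in> ?k"
    proof cases
      case 1
      show ?thesis unfolding 1(1)
        by (rule d[OF gen F.M.a_closed[OF gen gen]])
          (use 1(2-) \<phi> in \<open>simp_all add: La gen Lg balanced_def del: free_module_simps\<close>)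
    next
      case 2
      show ?thesis unfolding 2(1)
        by (rule d[OF gen F.M.a_closed[OF gen gen]])
          (use 2(2-) \<phi> in \<open>simp_all add: La gen Lg balanced_def del: free_module_simps\<close>)
    next
      case 3
      show ?thesis unfolding 3(1)
        by (rule d[OF gen gen]) (use 3(2-) \<phi> Nsm in \<open>simp_all add: Lg balanced_def\<close>)
    next
      case 4
      have "\<phi> (sc c \<odot>\<^bsub>N\<^esub> x) y = c \<odot>\<^bsub>V\<^esub> \<phi> x y" using \<phi> 4(2-) unfolding balanced_def by blast
      then show ?thesis unfolding 4(1)
        by (intro d[OF gen F.smult_closed[OF _ gen]])
          (use 4(2-) Nsm linD(3)[OF L _ gen] in \<open>simp_all add: Lg del: free_module_simps\<close>)
    qed
  qed
  then have null: "null \<subseteq> ?k" unfolding tensor_null_def by (rule F.mod_span_least[OF rels k])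
  have val: "tensor_lift K V \<phi> (null +>\<^bsub>F\<^esub> f) = free_lift K V ?g f" if f: "f \<in> carrier F" for f
  proof -
    define h where "h = (SOME h. h \<in> null +>\<^bsub>F\<^esub> f)"
    have "h \<in> null +>\<^bsub>F\<^esub> f" unfolding h_def
      by (rule someI[where P = "\<lambda>h. h \<in> null +>\<^bsub>F\<^esub> f", OF F.coset_self[OF null_subm f]])
    then have h: "h \<in> carrier F" "h \<ominus>\<^bsub>F\<^esub> f \<in> ?k" using F.mem_coset_iff[OF null_subm f] null by blast+
    then have "free_lift K V ?g h = free_lift K V ?g f"
      using lin_diff[OF L F.left_module_axioms V h(1) f] linD(1)[OF L] f by (simp add: V.diff_eq_zero_iff)
    then show ?thesis unfolding tensor_lift_def Let_def h_def[symmetric] by (simp add: free_lift_def)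
  qed
  show "tensor_lift K V \<phi> (pt x y) = \<phi> x y" if "x \<in> carrier N" "y \<in> carrier M"
    using val[OF gen] Lg that by (simp add: pure_tensor_def)
  show "lin K TT V (tensor_lift K V \<phi>)"
  proof (rule linI)
    fix X assume "X \<in> carrier TT"
    then show "tensor_lift K V \<phi> X \<in> carrier V"
      using val linD(1)[OF L] by (auto simp: tensor_def F.quot_carrier)
  next
    fix X Y assume "X \<in> carrier TT" "Y \<in> carrier TT"
    then obtain f h where "f \<in> carrier F" "X = null +>\<^bsub>F\<^esub> f" "h \<in> carrier F" "Y = null +>\<^bsub>F\<^esub> h"
      by (auto simp: tensor_def F.quot_carrier)
    then show "tensor_lift K V \<phi> (X \<oplus>\<^bsub>TT\<^esub> Y) = tensor_lift K V \<phi> X \<oplus>\<^bsub>V\<^esub> tensor_lift K V \<phi> Y"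
      using F.quot_ops(1)[OF null_subm, of f h] val F.M.a_closed[of f h] La
      by (simp add: tensor_def del: free_module_simps)
  next
    fix c X assume "c \<in> carrier K" "X \<in> carrier TT"
    then obtain f where "c \<in> carrier K" "f \<in> carrier F" "X = null +>\<^bsub>F\<^esub> f"
      by (auto simp: tensor_def F.quot_carrier)
    then show "tensor_lift K V \<phi> (c \<odot>\<^bsub>TT\<^esub> X) = c \<odot>\<^bsub>V\<^esub> tensor_lift K V \<phi> X"
      using F.quot_ops(2)[OF null_subm, of c f] val F.smult_closed[of c f] linD(3)[OF L, of c f]
      by (simp add: tensor_def del: free_module_simps)
  qed
qed

lemma N_scalars: "left_module K (scalars A N)"
  by (rule right_scalars[OF N])

text \<open>Pure tensors of spanning vectors span. One entry is released at a time: first the right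
  one, with the left one still in \<open>S\<close>, then the left one.\<close>

lemma TT_fin_gen:
  assumes "fin_gen K (scalars A N)" "fin_gen K (scalars A M)"
  shows "fin_gen K TT"
proof -
  obtain S where S: "finite S" "S \<subseteq> carrier (scalars A N)" "\<And>W. subm K (scalars A N) W \<Longrightarrow> S \<subseteq> W \<Longrightarrow> carrier (scalars A N) \<subseteq> W"
    using fin_genE[OF assms(1) N_scalars] by blast
  obtain U where U: "finite U" "U \<subseteq> carrier (scalars A M)" "\<And>W. subm K (scalars A M) W \<Longrightarrow> U \<subseteq> W \<Longrightarrow> carrier (scalars A M) \<subseteq> W"
    using fin_genE[OF assms(2) scalars_left_module[OF M]] by blast
  show ?thesis
  proof (rule fin_genI[OF TT_left_module])
    show "finite ((\<lambda>(x, y). pt x y) ` (S \<times> U))" using S U by auto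
    show "(\<lambda>(x, y). pt x y) ` (S \<times> U) \<subseteq> carrier TT" using S(2) U(2) by (auto intro!: pt_closed)
    fix W assume W: "subm K TT W" "(\<lambda>(x, y). pt x y) ` (S \<times> U) \<subseteq> W"
    have 1: "pt x y \<in> W" if x: "x \<in> S" and y: "y \<in> carrier M" for x y
    proof -
      have xN: "x \<in> carrier N" using x S(2) by auto
      have l: "lin K (scalars A M) TT (pt x)"
        by (rule linI) (use xN pt_closed pt_add_r pt_smult_r in auto)
      have "carrier (scalars A M) \<subseteq> {y \<in> carrier (scalars A M). pt x y \<in> W}"
        by (rule U(3)[OF subm_preimage[OF l scalars_left_module[OF M] TT_left_module W(1)]]) (use x U(2) W(2) in auto)
      then show ?thesis using y by auto
    qed
    show "carrier TT \<subseteq> W"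
    proof (rule TT_generated[OF W(1)])
      fix x y assume x: "x \<in> carrier N" and y: "y \<in> carrier M"
      have l: "lin K (scalars A N) TT (\<lambda>x. pt x y)"
        by (rule linI) (use y pt_closed pt_add_l pt_smult_l in auto)
      have "carrier (scalars A N) \<subseteq> {x \<in> carrier (scalars A N). pt x y \<in> W}"
        by (rule S(3)[OF subm_preimage[OF l N_scalars TT_left_module W(1)]]) (use y S(2) 1 in auto)
      then show "pt x y \<in> W" using x by auto
    qed
  qed
qed

end

section \<open>Duals\<close>

lemma left_module_self_iff: "ring K \<Longrightarrow> left_module (self_module K) V \<longleftrightarrow> left_module K V"
proof -
  assume "ring K"
  then interpret K: ring K .
  have "ring (self_module K)"
    by (intro ringI abelian_groupI monoidI)
      (auto simp: self_module_def K.a_assoc K.m_assoc K.l_distr K.r_distr intro: K.a_comm K.l_neg)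
  then show ?thesis using \<open>ring K\<close>
    by (simp add: left_module_def left_module_axioms_def self_module_def)
qed

lemma mod_hom_self_module: "mod_hom (self_module K) V W = mod_hom K V W"
  by (simp add: mod_hom_def)

context fd_algebra
begin

text \<open>With the field as an algebra over itself, the results on Hom spaces and tensor products
  specialise to plain linear maps and to the tensor product over the ground field.\<close>

lemma K_fd: "fd_algebra K (self_module K)"
proof (intro fd_algebra.intro k_algebra.intro k_algebra_axioms.intro K_field)
  have eq: "carrier (self_module K) = carrier K" "mult (self_module K) = mult K" "one (self_module K) = one K"
    "zero (self_module K) = zero K" "add (self_module K) = add K" "smult (self_module K) = mult K"
    by (simp_all add: self_module_def)
  show r: "ring (self_module K)"
    by (intro ringI abelian_groupI monoidI)
      (auto simp: eq K.a_assoc K.m_assoc K.l_distr K.r_distr intro: K.a_comm K.l_neg)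
  show "module K (self_module K)"
    by (rule moduleI) (auto simp: eq K.is_cring ring.is_abelian_group[OF r] K.l_distr K.r_distr K.m_assoc)
  show "fin_gen K (self_module K)" by (rule self_fin_gen[OF K.ring_axioms])
qed (auto simp: self_module_def K.m_assoc K.m_lcomm)

lemma k_dual_simps [simp]:
  "carrier (k_dual K A N) = mod_hom K (scalars A N) (self_module K)"
  "zero (k_dual K A N) = (\<lambda>x\<in>carrier N. \<zero>\<^bsub>K\<^esub>)"
  "add (k_dual K A N) = (\<lambda>f g. \<lambda>x\<in>carrier N. f x \<oplus>\<^bsub>K\<^esub> g x)"
  "smult (k_dual K A N) = (\<lambda>a f. \<lambda>x\<in>carrier N. f (a \<odot>\<^bsub>N\<^esub> x))"
  by (simp_all add: k_dual_def)

lemma ring_dual_simps [simp]: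
  "carrier (ring_dual A M) = mod_hom A M (self_module A)"
  "zero (ring_dual A M) = (\<lambda>x\<in>carrier M. \<zero>\<^bsub>A\<^esub>)"
  "add (ring_dual A M) = (\<lambda>f g. \<lambda>x\<in>carrier M. f x \<oplus>\<^bsub>A\<^esub> g x)"
  "smult (ring_dual A M) = (\<lambda>a f. \<lambda>x\<in>carrier M. f x \<otimes>\<^bsub>A\<^esub> a)"
  by (simp_all add: ring_dual_def)

lemma right_smult_lin:
  assumes "left_module (opp A) N" "a \<in> carrier A"
  shows "lin K (scalars A N) (scalars A N) (\<lambda>x. a \<odot>\<^bsub>N\<^esub> x)"
proof -
  interpret N: left_module "opp A" N by fact
  show ?thesis
  proof (rule linI)
    fix r x assume "r \<in> carrier K" "x \<in> carrier (scalars A N)"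
    then show "a \<odot>\<^bsub>N\<^esub> (r \<odot>\<^bsub>scalars A N\<^esub> x) = r \<odot>\<^bsub>scalars A N\<^esub> (a \<odot>\<^bsub>N\<^esub> x)"
      using N.smult_assoc1[of a "sc r" x] N.smult_assoc1[of "sc r" a x] assms(2) sc_central[of r a] by simp
  qed (use assms(2) N.smult_closed N.smult_r_distr in auto)
qed

lemma k_dual_left_module:
  assumes "left_module (opp A) N"
  shows "left_module A (k_dual K A N)"
proof -
  interpret N: left_module "opp A" N by fact
  have sN: "left_module K (scalars A N)" by (rule right_scalars) fact
  have cl: "f x \<in> carrier K" if "f \<in> mod_hom K (scalars A N) (self_module K)" "x \<in> carrier N" for f x
    using linD(1)[OF mod_hom_lin[OF that(1)]] that(2) by simp
  have ad: "f (x \<oplus>\<^bsub>N\<^esub> y) = f x \<oplus>\<^bsub>K\<^esub> f y" if "f \<in> mod_hom K (scalars A N) (self_module K)" "x \<in> carrier N" "y \<in> carrier N" for f x y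
    using linD(2)[OF mod_hom_lin[OF that(1)]] that(2,3) by simp
  have ex: "f x = undefined" if "f \<in> mod_hom K (scalars A N) (self_module K)" "x \<notin> carrier N" for f x
    using that by (auto simp: mod_hom_iff extensional_def)
  have sm: "a \<odot>\<^bsub>N\<^esub> x \<in> carrier N" if "a \<in> carrier A" "x \<in> carrier N" for a x using N.smult_closed that by simp
  show ?thesis
  proof (rule left_moduleI, goal_cases)
    case (2 f g)
    then have "functional K (scalars A N) f" "functional K (scalars A N) g" using mod_hom_lin by auto
    from lin_restrict[OF lin_add[OF this K_self] sN] show ?case by simp
  next
    case 3
    show ?case using lin_restrict[OF lin_const_zero[OF K_self] sN] by simp
  next
    case (7 f)
    then have "functional K (scalars A N) f" using mod_hom_lin by auto
    note f = linD[OF this]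
    have "functional K (scalars A N) (\<lambda>x. \<ominus>\<^bsub>K\<^esub> f x)"
      by (rule linI) (use f in \<open>auto simp: K.minus_add K.r_minus\<close>)
    from lin_restrict[OF this sN] show ?case
      by (intro bexI[of _ "\<lambda>x\<in>carrier N. \<ominus>\<^bsub>K\<^esub> f x"]) (use 7 cl in \<open>auto simp: K.l_neg\<close>)
  next
    case (8 a f)
    then have "functional K (scalars A N) f" using mod_hom_lin by auto
    from lin_restrict[OF lin_comp[OF right_smult_lin[OF assms 8(1)] this] sN] show ?case by simp
  next
    case (9 a b f)
    then show ?case using N.smult_l_distr[of a b] sm ad by (auto intro!: ext simp: restrict_def)
  next
    case (11 a b f)
    then show ?case using N.smult_assoc1[of b a] sm by (auto intro!: ext simp: restrict_def)
  next
    case (12 f)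
    then show ?case using N.smult_one ex[of f] by (auto intro!: ext simp: restrict_def)
  qed (auto simp: cl sm ex A_ring K.a_ac intro!: ext simp: restrict_def)
qed

lemma ring_dual_left_module:
  assumes "left_module A M"
  shows "left_module (opp A) (ring_dual A M)"
proof -
  interpret M: left_module A M by fact
  have cl: "f x \<in> carrier A" if "f \<in> mod_hom A M (self_module A)" "x \<in> carrier M" for f x
    using linD(1)[OF mod_hom_lin[OF that(1)]] that(2) by simp
  have ex: "f x = undefined" if "f \<in> mod_hom A M (self_module A)" "x \<notin> carrier M" for f x
    using that by (auto simp: mod_hom_iff extensional_def)
  show ?thesis
  proof (rule left_moduleI, goal_cases)
    case (2 f g)
    then have "lin A M (self_module A) f" "lin A M (self_module A) g" using mod_hom_lin by auto
    from lin_restrict[OF lin_add[OF this A_self] assms] show ?case by simp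
  next
    case 3
    show ?case using lin_restrict[OF lin_const_zero[OF A_self] assms] by simp
  next
    case (7 f)
    then have "lin A M (self_module A) f" using mod_hom_lin by auto
    note f = linD[OF this]
    have "lin A M (self_module A) (\<lambda>x. \<ominus>\<^bsub>A\<^esub> f x)"
      by (rule linI) (use f in \<open>auto simp: A.minus_add A.r_minus\<close>)
    from lin_restrict[OF this assms] show ?case
      by (intro bexI[of _ "\<lambda>x\<in>carrier M. \<ominus>\<^bsub>A\<^esub> f x"]) (use 7 cl in \<open>auto simp: A.l_neg\<close>)
  next
    case (8 a f)
    then have "lin A M (self_module A) f" using mod_hom_lin by auto
    note f = linD[OF this]
    have "lin A M (self_module A) (\<lambda>x. f x \<otimes>\<^bsub>A\<^esub> a)"
      by (rule linI) (use f 8(1) in \<open>auto simp: A.l_distr A.m_assoc\<close>)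
    from lin_restrict[OF this assms] show ?case by simp
  next
    case 1 show ?case by (rule ring_opp[OF A_ring])
  qed (auto simp: cl ex A.a_ac A.l_distr A.r_distr A.m_assoc intro!: ext simp: restrict_def)
qed

text \<open>As a vector space this is \<open>Hom(M, A)\<close>. Scalars act on
  \<open>ring_dual\<close> by right multiplication and on the Hom space by left multiplication, and
  the two agree because scalars are central.\<close>

lemma ring_dual_fin_gen:
  assumes "left_module A M" "fin_gen A M"
  shows "fin_gen K (scalars A (ring_dual A M))"
proof -
  have "lin K (hom_space A M (self_module A)) (scalars A (ring_dual A M)) (\<lambda>f. f)"
  proof (rule linI)
    fix c f assume c: "c \<in> carrier K" and "f \<in> carrier (hom_space A M (self_module A))"
    then have f: "f \<in> mod_hom A M (self_module A)" by simp
    have "f x \<in> carrier A" if "x \<in> carrier M" for x using linD(1)[OF mod_hom_lin[OF f] that] by simp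
    then show "c \<odot>\<^bsub>hom_space A M (self_module A)\<^esub> f = c \<odot>\<^bsub>scalars A (ring_dual A M)\<^esub> f"
      using sc_central[OF c] by auto
  qed auto
  then show ?thesis
    by (rule fin_gen_surj[OF hom_space_fin_gen[OF assms(1) A_self assms(2) self_fin_gen[OF A_ring]]])
      (auto simp: hom_space_left_module[OF assms(1) A_self] right_scalars ring_dual_left_module assms)
qed

lemma functional_zero: "left_module K V \<Longrightarrow> functional K V u \<Longrightarrow> u \<zero>\<^bsub>V\<^esub> = \<zero>\<^bsub>K\<^esub>"
  using lin_zero[OF _ _ K_self] by fastforce

lemma k_dual_scalars_smult:
  assumes "left_module (opp A) N" "c \<in> carrier K" "f \<in> mod_hom K (scalars A N) (self_module K)"
  shows "sc c \<odot>\<^bsub>k_dual K A N\<^esub> f = (\<lambda>x\<in>carrier N. c \<otimes>\<^bsub>K\<^esub> f x)"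
  using linD(3)[OF mod_hom_lin[OF assms(3)]] assms(2) by auto

text \<open>The dual is a Hom space over the algebra \<open>self_module K\<close>, to which
  \<open>hom_space_fin_gen\<close> applies; \<open>k_dual_scalars_smult\<close> matches the two
  scalar actions.\<close>

lemma k_dual_fin_gen:
  assumes "left_module (opp A) N" "fin_gen K (scalars A N)"
  shows "fin_gen K (scalars A (k_dual K A N))"
proof -
  interpret KK: fd_algebra K "self_module K" by (rule K_fd)
  let ?V = "scalars A N" and ?K = "self_module K"
  have V: "left_module K ?V" by (rule right_scalars[OF assms(1)])
  have V': "left_module ?K ?V" and K': "left_module ?K ?K"
    using V K_self by (simp_all add: left_module_self_iff[OF K.ring_axioms])
  have "fin_gen ?K ?V" "fin_gen ?K ?K"
    using assms(2) self_fin_gen[OF K.ring_axioms] by (simp_all add: fin_gen_def)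
  then have fg: "fin_gen K (hom_space ?K ?V ?K)" by (intro KK.hom_space_fin_gen V' K')
  have sc1: "KK.sc c = c" if "c \<in> carrier K" for c
    using that by (simp add: KK.sc_def) (simp add: self_module_def)
  have "lin K (hom_space ?K ?V ?K) (scalars A (k_dual K A N)) (\<lambda>f. f)"
  proof (rule linI)
    fix c f assume c: "c \<in> carrier K" and "f \<in> carrier (hom_space ?K ?V ?K)"
    then have f: "f \<in> mod_hom K ?V ?K" by (simp add: mod_hom_self_module)
    show "c \<odot>\<^bsub>hom_space ?K ?V ?K\<^esub> f = c \<odot>\<^bsub>scalars A (k_dual K A N)\<^esub> f"
      using k_dual_scalars_smult[OF assms(1) c f] sc1[OF c] by simp
  qed (auto simp: mod_hom_self_module)
  then show ?thesis
    by (rule fin_gen_surj[OF fg])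
      (auto simp: KK.hom_space_left_module[OF V' K'] scalars_left_module k_dual_left_module assms mod_hom_self_module)
qed

section \<open>The pairing of \<open>Hom(P, D(M\<^sup>*))\<close> with \<open>Hom(M, P)\<close>\<close>

text \<open>The image of \<open>ms \<otimes> p\<close> under the canonical map from the tensor
  product of \<open>ring_dual A M\<close> and \<open>P\<close> to \<open>Hom(M, P)\<close>: the rank
  one maps.\<close>

definition el :: "('a, 'm) module \<Rightarrow> ('a, 'p) module \<Rightarrow> ('m \<Rightarrow> 'a) \<Rightarrow> 'p \<Rightarrow> 'm \<Rightarrow> 'p" where
  "el M P ms p = (\<lambda>m\<in>carrier M. ms m \<odot>\<^bsub>P\<^esub> p)"

lemma el_closed:
  assumes "left_module A M" "left_module A P" "ms \<in> mod_hom A M (self_module A)" "p \<in> carrier P"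
  shows "el M P ms p \<in> mod_hom A M P"
  unfolding el_def using lin_restrict[OF lin_smult_const[OF assms(2) mod_hom_lin[OF assms(3)] assms(4)] assms(1)] .

text \<open>Since \<open>p \<circ> s\<close> is the identity, \<open>f\<close> equals
  \<open>p \<circ> s \<circ> f\<close>, and expanding \<open>s \<circ> f\<close> in coordinates
  writes \<open>f\<close> as a sum of rank one maps, the functional of the \<open>k\<close>-th being
  the \<open>k\<close>-th coordinate of \<open>s \<circ> f\<close> and its vector the image of the
  \<open>k\<close>-th unit vector. The induction admits one coordinate after the other.\<close>

lemma el_span:
  fixes P :: "('a, nat \<Rightarrow> 'a) module"
  assumes M: "left_module A M" and P: "projective A P" "fin_gen A P"
    and W: "subm K (hom_space A M P) W"
    and el: "\<And>ms p. \<lbrakk>ms \<in> mod_hom A M (self_module A); p \<in> carrier P\<rbrakk> \<Longrightarrow> el M P ms p \<in> W"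
  shows "mod_hom A M P \<subseteq> W"
proof
  have lP: "left_module A P" using P(1) by (simp add: projective_def)
  interpret M: left_module A M by fact
  interpret P: left_module A P by fact
  obtain r p s where p: "lin A (pow_module (self_module A) r) P p"
    and s: "lin A P (pow_module (self_module A) r) s" and ps: "\<And>x. x \<in> carrier P \<Longrightarrow> p (s x) = x"
    using projective_split[OF P] by blast
  let ?F = "pow_module (self_module A) r"
  have F: "left_module A ?F" by (rule pow_left_module[OF A_self])
  let ?e = "\<lambda>k i. if i = k then \<one>\<^bsub>A\<^esub> else \<zero>\<^bsub>A\<^esub>"
  have e: "?e k \<in> carrier ?F" if "k < r" for k using that by (auto simp: pow_carrier)
  fix f assume f: "f \<in> mod_hom A M P"
  have sf: "s (f m) \<in> carrier ?F" if "m \<in> carrier M" for m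
    using linD(1)[OF s linD(1)[OF mod_hom_lin[OF f] that]] .
  have sfi: "s (f m) i \<in> carrier A" if "m \<in> carrier M" for m i
    using pow_comp[OF A_self sf[OF that]] by simp
  have cut: "(\<lambda>i. if i < k then s (f m) i else \<zero>\<^bsub>A\<^esub>) \<in> carrier ?F" if "m \<in> carrier M" for m k
    using sf[OF that] by (auto simp: pow_carrier)
  have "(\<lambda>m\<in>carrier M. p (\<lambda>i. if i < k then s (f m) i else \<zero>\<^bsub>A\<^esub>)) \<in> W" if "k \<le> r" for k
    using that
  proof (induction k)
    case 0
    have "p (\<lambda>i. \<zero>\<^bsub>A\<^esub>) = \<zero>\<^bsub>P\<^esub>" using lin_zero[OF p F lP] by simp
    then show ?case using submD(3)[OF W] by (simp only: not_less_zero if_False hom_space_simps)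
  next
    case (Suc k)
    let ?ms = "\<lambda>m\<in>carrier M. s (f m) k"
    have ms: "?ms \<in> mod_hom A M (self_module A)"
      by (rule lin_restrict[OF lin_comp[OF lin_comp[OF mod_hom_lin[OF f] s] pow_proj[OF A_self]] M])
    have pe: "p (?e k) \<in> carrier P" using linD(1)[OF p e] Suc.prems by simp
    have "p (\<lambda>i. if i < Suc k then s (f m) i else \<zero>\<^bsub>A\<^esub>) =
       p (\<lambda>i. if i < k then s (f m) i else \<zero>\<^bsub>A\<^esub>) \<oplus>\<^bsub>P\<^esub> s (f m) k \<odot>\<^bsub>P\<^esub> p (?e k)" if m: "m \<in> carrier M" for m
    proof -
      have "(\<lambda>i. if i < Suc k then s (f m) i else \<zero>\<^bsub>A\<^esub>) =
        (\<lambda>i. if i < k then s (f m) i else \<zero>\<^bsub>A\<^esub>) \<oplus>\<^bsub>?F\<^esub> (s (f m) k \<odot>\<^bsub>?F\<^esub> ?e k)"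
        using sfi[OF m] by (auto simp: less_Suc_eq)
      then show ?thesis
        using linD(2)[OF p cut[OF m] left_module.smult_closed[OF F sfi[OF m] e]] linD(3)[OF p sfi[OF m] e] Suc.prems
        by simp
    qed
    then have "(\<lambda>m\<in>carrier M. p (\<lambda>i. if i < Suc k then s (f m) i else \<zero>\<^bsub>A\<^esub>)) =
      (\<lambda>m\<in>carrier M. p (\<lambda>i. if i < k then s (f m) i else \<zero>\<^bsub>A\<^esub>)) \<oplus>\<^bsub>hom_space A M P\<^esub> el M P ?ms (p (?e k))"
      by (auto simp: el_def)
    then show ?case using submD(4)[OF W Suc.IH[OF Suc_leD[OF Suc.prems]] el[OF ms pe]] by (simp only:)
  qed
  from this[of r] have "(\<lambda>m\<in>carrier M. p (\<lambda>i. if i < r then s (f m) i else \<zero>\<^bsub>A\<^esub>)) \<in> W" by simp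
  moreover have "(\<lambda>m\<in>carrier M. p (\<lambda>i. if i < r then s (f m) i else \<zero>\<^bsub>A\<^esub>)) = f"
  proof (rule extensionalityI[of _ "carrier M"])
    fix m assume m: "m \<in> carrier M"
    have "(\<lambda>i. if i < r then s (f m) i else \<zero>\<^bsub>A\<^esub>) = s (f m)" using sf[OF m] by (auto simp: pow_carrier)
    then show "(\<lambda>m\<in>carrier M. p (\<lambda>i. if i < r then s (f m) i else \<zero>\<^bsub>A\<^esub>)) m = f m"
      using ps linD(1)[OF mod_hom_lin[OF f] m] m by simp
  qed (use f in \<open>auto simp: mod_hom_iff\<close>)
  ultimately show "f \<in> W" by simp
qed

lemma functional_eq_on_el:
  fixes P :: "('a, nat \<Rightarrow> 'a) module"
  assumes M: "left_module A M" and P: "projective A P" "fin_gen A P"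
    and u: "functional K (hom_space A M P) u" and v: "functional K (hom_space A M P) v"
    and eq: "\<And>ms p. \<lbrakk>ms \<in> mod_hom A M (self_module A); p \<in> carrier P\<rbrakk> \<Longrightarrow> u (el M P ms p) = v (el M P ms p)"
    and f: "f \<in> mod_hom A M P"
  shows "u f = v f"
proof -
  have lP: "left_module A P" using P(1) by (simp add: projective_def)
  have H: "left_module K (hom_space A M P)" by (rule hom_space_left_module[OF M lP])
  interpret H: left_module K "hom_space A M P" by (rule H)
  have "mod_hom A M P \<subseteq> {f \<in> carrier (hom_space A M P). u f = v f}"
  proof (rule el_span[OF M P])
    show "subm K (hom_space A M P) {f \<in> carrier (hom_space A M P). u f = v f}"
    proof (rule submI)
      show "\<zero>\<^bsub>hom_space A M P\<^esub> \<in> {f \<in> carrier (hom_space A M P). u f = v f}"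
        using functional_zero[OF H u] functional_zero[OF H v] H.M.zero_closed by simp
    next
      fix x y assume "x \<in> {f \<in> carrier (hom_space A M P). u f = v f}" "y \<in> {f \<in> carrier (hom_space A M P). u f = v f}"
      then show "x \<oplus>\<^bsub>hom_space A M P\<^esub> y \<in> {f \<in> carrier (hom_space A M P). u f = v f}"
        using linD(2)[OF u, of x y] linD(2)[OF v, of x y] H.M.a_closed[of x y] by simp
    next
      fix c x assume "c \<in> carrier K" "x \<in> {f \<in> carrier (hom_space A M P). u f = v f}"
      then show "c \<odot>\<^bsub>hom_space A M P\<^esub> x \<in> {f \<in> carrier (hom_space A M P). u f = v f}"
        using linD(3)[OF u, of c x] linD(3)[OF v, of c x] H.smult_closed[of c x] by simp
    qed auto
  qed (use eq el_closed[OF M lP] in auto)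
  then show ?thesis using f by auto
qed

text \<open>
  The functional \<open>hpair M P \<phi>\<close> is unique because the maps \<open>el M P ms p\<close> span \<open>Hom(M, P)\<close>; its existence
  is where the dual basis of \<open>P\<close> enters.
\<close>

definition hpair :: "('a, 'm) module \<Rightarrow> ('a, nat \<Rightarrow> 'a) module \<Rightarrow>
    ((nat \<Rightarrow> 'a) \<Rightarrow> ('m \<Rightarrow> 'a) \<Rightarrow> 'k) \<Rightarrow> ('m \<Rightarrow> nat \<Rightarrow> 'a) \<Rightarrow> 'k" where
  "hpair M P \<phi> = (SOME u. functional K (hom_space A M P) u \<and>
     (\<forall>p\<in>carrier P. \<forall>ms\<in>mod_hom A M (self_module A). u (el M P ms p) = \<phi> p ms))"

abbreviation "Dst M \<equiv> k_dual K A (ring_dual A M)"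

lemma Dst: "left_module A M \<Longrightarrow> left_module A (Dst M)"
  by (intro k_dual_left_module ring_dual_left_module)

lemma hpair:
  fixes P :: "('a, nat \<Rightarrow> 'a) module"
  assumes M: "left_module A M" and P: "projective A P" "fin_gen A P" and \<phi>: "\<phi> \<in> mod_hom A P (Dst M)"
  shows "functional K (hom_space A M P) (hpair M P \<phi>)"
    and "\<lbrakk>q \<in> carrier P; ms \<in> mod_hom A M (self_module A)\<rbrakk> \<Longrightarrow> hpair M P \<phi> (el M P ms q) = \<phi> q ms"
proof -
  have lP: "left_module A P" using P(1) by (simp add: projective_def)
  interpret M: left_module A M by fact
  interpret P: left_module A P by fact
  interpret D: left_module A "Dst M" by (rule Dst[OF M])
  obtain r p s where p: "lin A (pow_module (self_module A) r) P p"
    and s: "lin A P (pow_module (self_module A) r) s" and ps: "\<And>x. x \<in> carrier P \<Longrightarrow> p (s x) = x"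
    using projective_split[OF P] by blast
  let ?F = "pow_module (self_module A) r"
  have F: "left_module A ?F" by (rule pow_left_module[OF A_self])
  let ?e = "\<lambda>k i. if i = k then \<one>\<^bsub>A\<^esub> else \<zero>\<^bsub>A\<^esub>"
  have e: "?e k \<in> carrier ?F" if "k < r" for k using that by (auto simp: pow_carrier)
  note \<phi>l = mod_hom_lin[OF \<phi>]
  have \<phi>p: "\<phi> (p (?e k)) \<in> mod_hom K (scalars A (ring_dual A M)) (self_module K)" if "k < r" for k
    using linD(1)[OF \<phi>l linD(1)[OF p e[OF that]]] by simp
  have H: "left_module K (hom_space A M P)" by (rule hom_space_left_module[OF M lP])
  \<comment> \<open>The dual basis formula: the \<open>k\<close>-th coordinate of
    \<open>s \<circ> f\<close> is an element of \<open>ring_dual A M\<close>, and the value of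
    \<open>\<phi>\<close> at the \<open>k\<close>-th generator is applied to it.\<close>
  define u where "u f = (\<Oplus>\<^bsub>self_module K\<^esub>k\<in>{..<r}. \<phi> (p (?e k)) (\<lambda>m\<in>carrier M. s (f m) k))" for f
  have u: "functional K (hom_space A M P) u" unfolding u_def
  proof (rule lin_sum[OF _ _ H K_self])
    fix k assume "k \<in> {..<r}"
    then have k: "k < r" by simp
    have sk: "lin A P (self_module A) (\<lambda>x. s x k)" by (rule lin_comp[OF s pow_proj[OF A_self]])
    have 1: "lin K (hom_space A M P) (scalars A (ring_dual A M)) (\<lambda>f. \<lambda>m\<in>carrier M. s (f m) k)"
    proof (rule lin_cong[OF _ H])
      have 2: "lin K (hom_space A M P) (hom_space A M (self_module A)) (post M (\<lambda>x. s x k))"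
        by (rule post_lin[OF M lP A_self sk])
      show "lin K (hom_space A M P) (scalars A (ring_dual A M)) (post M (\<lambda>x. s x k))"
      proof (rule linI)
        fix c f assume c: "c \<in> carrier K" and f: "f \<in> carrier (hom_space A M P)"
        have pf: "post M (\<lambda>x. s x k) f \<in> mod_hom A M (self_module A)" using linD(1)[OF 2 f] by simp
        have "post M (\<lambda>x. s x k) f m \<in> carrier A" if "m \<in> carrier M" for m
          using linD(1)[OF mod_hom_lin[OF pf] that] by simp
        then show "post M (\<lambda>x. s x k) (c \<odot>\<^bsub>hom_space A M P\<^esub> f) = c \<odot>\<^bsub>scalars A (ring_dual A M)\<^esub> post M (\<lambda>x. s x k) f"
          unfolding linD(3)[OF 2 c f] using sc_central[OF c] by auto
      qed (use linD(1,2)[OF 2] in simp_all)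
    qed (simp add: post_def)
    show "functional K (hom_space A M P) (\<lambda>f. \<phi> (p (?e k)) (\<lambda>m\<in>carrier M. s (f m) k))"
      by (rule lin_comp[OF 1 mod_hom_lin[OF \<phi>p[OF k]]])
  qed simp
  have uel: "u (el M P ms q) = \<phi> q ms" if q: "q \<in> carrier P" and ms: "ms \<in> mod_hom A M (self_module A)" for q ms
  proof -
    have sq: "s q \<in> carrier ?F" using linD(1)[OF s q] .
    have sqk: "s q k \<in> carrier A" for k using pow_comp[OF A_self sq] by simp
    have msm: "ms m \<in> carrier A" if "m \<in> carrier M" for m using linD(1)[OF mod_hom_lin[OF ms] that] by simp
    have pe: "(\<lambda>k. s q k \<odot>\<^bsub>P\<^esub> p (?e k)) \<in> {..<r} \<rightarrow> carrier P" using linD(1)[OF p e] sqk by auto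
    have qs: "q = (\<Oplus>\<^bsub>P\<^esub>k\<in>{..<r}. s q k \<odot>\<^bsub>P\<^esub> p (?e k))"
    proof -
      have ek: "(\<lambda>k. s q k \<odot>\<^bsub>?F\<^esub> ?e k) \<in> {..<r} \<rightarrow> carrier ?F"
        using left_module.smult_closed[OF F sqk e] by auto
      have mem: "(\<Oplus>\<^bsub>?F\<^esub>k\<in>{..<r}. s q k \<odot>\<^bsub>?F\<^esub> ?e k) i = s q i" for i
      proof -
        interpret F: left_module A ?F by (rule F)
        have "(\<Oplus>\<^bsub>?F\<^esub>k\<in>{..<r}. s q k \<odot>\<^bsub>?F\<^esub> ?e k) i = (\<Oplus>\<^bsub>self_module A\<^esub>k\<in>{..<r}. (s q k \<odot>\<^bsub>?F\<^esub> ?e k) i)"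
          using lin_finsum[OF pow_proj[OF A_self] F A_self _ ek, of i] by simp
        also have "\<dots> = (\<Oplus>\<^bsub>A\<^esub>k\<in>{..<r}. if i = k then s q k else \<zero>\<^bsub>A\<^esub>)"
          unfolding self_finsum[OF A_ring] by (rule A.finsum_cong') (use sqk in auto)
        also have "\<dots> = s q i"
        proof (cases "i < r")
          case True then show ?thesis using sqk by (subst A.finsum_singleton) auto
        next
          case False
          then have "(\<Oplus>\<^bsub>A\<^esub>k\<in>{..<r}. if i = k then s q k else \<zero>\<^bsub>A\<^esub>) = \<zero>\<^bsub>A\<^esub>"
            by (intro A.add.finprod_one_eqI) auto
          then show ?thesis using False sq by (auto simp: pow_carrier)
        qed
        finally show ?thesis .
      qed
      have "(\<Oplus>\<^bsub>?F\<^esub>k\<in>{..<r}. s q k \<odot>\<^bsub>?F\<^esub> ?e k) = s q" by (rule ext) (rule mem)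
      then have "q = p (\<Oplus>\<^bsub>?F\<^esub>k\<in>{..<r}. s q k \<odot>\<^bsub>?F\<^esub> ?e k)" using ps[OF q] by simp
      also have "\<dots> = (\<Oplus>\<^bsub>P\<^esub>k\<in>{..<r}. p (s q k \<odot>\<^bsub>?F\<^esub> ?e k))" by (rule lin_finsum[OF p F lP _ ek]) simp
      also have "\<dots> = (\<Oplus>\<^bsub>P\<^esub>k\<in>{..<r}. s q k \<odot>\<^bsub>P\<^esub> p (?e k))"
        by (rule P.finsum_cong') (use pe linD(3)[OF p sqk e] in auto)
      finally show ?thesis .
    qed
    \<comment> \<open>Evaluation at \<open>ms\<close> is linear on \<open>Dst M\<close>, so it
      passes through the expansion of \<open>\<phi> q\<close> along the generators. The coefficient
      \<open>s q k\<close> then moves onto \<open>ms\<close>, because the action on a dual is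
      transposed; this produces the coordinates of the rank one map.\<close>
    have evl: "lin K (scalars A (Dst M)) (self_module K) (\<lambda>f. f ms)"
    proof (rule linI)
      fix f assume "f \<in> carrier (scalars A (Dst M))"
      then show "f ms \<in> carrier (self_module K)" using linD(1)[OF mod_hom_lin] ms by fastforce
    next
      fix c f assume c: "c \<in> carrier K" "f \<in> carrier (scalars A (Dst M))"
      then have f: "f \<in> mod_hom K (scalars A (ring_dual A M)) (self_module K)" by simp
      show "(c \<odot>\<^bsub>scalars A (Dst M)\<^esub> f) ms = c \<odot>\<^bsub>self_module K\<^esub> f ms"
        using k_dual_scalars_smult[OF ring_dual_left_module[OF M] c(1) f] ms by simp
    qed (use ms in auto)
    have sD: "left_module K (scalars A (Dst M))" by (rule scalars_left_module[OF Dst[OF M]])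
    have \<phi>e: "(\<lambda>k. s q k \<odot>\<^bsub>Dst M\<^esub> \<phi> (p (?e k))) \<in> {..<r} \<rightarrow> carrier (scalars A (Dst M))"
      using D.smult_closed[OF sqk linD(1)[OF \<phi>l linD(1)[OF p e]]] by auto
    have fs: "finsum (scalars A (Dst M)) = finsum (Dst M)"
      by (simp add: finsum_def finprod_def fun_eq_iff)
    have "\<phi> q = (\<Oplus>\<^bsub>Dst M\<^esub>k\<in>{..<r}. \<phi> (s q k \<odot>\<^bsub>P\<^esub> p (?e k)))"
      by (subst qs, rule lin_finsum[OF \<phi>l lP Dst[OF M] _ pe]) simp
    also have "\<dots> = (\<Oplus>\<^bsub>scalars A (Dst M)\<^esub>k\<in>{..<r}. s q k \<odot>\<^bsub>Dst M\<^esub> \<phi> (p (?e k)))"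
      unfolding fs
      by (rule D.finsum_cong') (use \<phi>e linD(3)[OF \<phi>l sqk linD(1)[OF p e]] in auto)
    finally have "\<phi> q ms = (\<Oplus>\<^bsub>self_module K\<^esub>k\<in>{..<r}. (s q k \<odot>\<^bsub>Dst M\<^esub> \<phi> (p (?e k))) ms)"
      using lin_finsum[OF evl sD K_self _ \<phi>e] by simp
    also have "\<dots> = u (el M P ms q)" unfolding u_def self_finsum[OF K.ring_axioms]
    proof (rule K.finsum_cong')
      fix k assume "k \<in> {..<r}"
      then have k: "k < r" by simp
      have "(\<lambda>m\<in>carrier M. s (el M P ms q m) k) = s q k \<odot>\<^bsub>ring_dual A M\<^esub> ms"
        using linD(3)[OF s msm q] by (auto simp: el_def)
      then show "(s q k \<odot>\<^bsub>Dst M\<^esub> \<phi> (p (?e k))) ms = \<phi> (p (?e k)) (\<lambda>m\<in>carrier M. s (el M P ms q m) k)"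
        using ms by simp
    next
      have "s (el M P ms q m) k \<in> carrier A" if "m \<in> carrier M" for k m
        using linD(3)[OF s msm[OF that] q] msm[OF that] sqk that by (simp add: el_def)
      moreover have "(\<lambda>m\<in>carrier M. s (el M P ms q m) k) \<in> mod_hom A M (self_module A)" for k
        by (rule lin_restrict[OF lin_comp[OF lin_comp[OF mod_hom_lin[OF el_closed[OF M lP ms q]] s] pow_proj[OF A_self]] M])
      ultimately show "(\<lambda>k. \<phi> (p (?e k)) (\<lambda>m\<in>carrier M. s (el M P ms q m) k)) \<in> {..<r} \<rightarrow> carrier K"
        using linD(1)[OF mod_hom_lin[OF \<phi>p]] by fastforce
    qed simp
    finally show ?thesis by simp
  qed
  have "\<exists>u. functional K (hom_space A M P) u \<and>
     (\<forall>p\<in>carrier P. \<forall>ms\<in>mod_hom A M (self_module A). u (el M P ms p) = \<phi> p ms)" using u uel by blast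
  from someI_ex[OF this] show "functional K (hom_space A M P) (hpair M P \<phi>)"
    "\<lbrakk>q \<in> carrier P; ms \<in> mod_hom A M (self_module A)\<rbrakk> \<Longrightarrow> hpair M P \<phi> (el M P ms q) = \<phi> q ms"
    unfolding hpair_def by blast+
qed

text \<open>Linearity in both arguments is checked on rank one maps. A functional \<open>u\<close>
  is represented by the map that sends \<open>p\<close> to the functional with value
  \<open>u (el M P ms p)\<close> at \<open>ms\<close>; a \<open>\<phi>\<close> that pairs to zero
  with everything vanishes at every \<open>p\<close> and \<open>ms\<close>.\<close>

lemma hom_dual_pair:
  fixes P :: "('a, nat \<Rightarrow> 'a) module"
  assumes M: "left_module A M" and P: "projective A P" "fin_gen A P"
  shows "dual_pair K (hom_space A P (Dst M)) (hom_space A M P) (hpair M P)"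
proof -
  have lP: "left_module A P" using P(1) by (simp add: projective_def)
  interpret M: left_module A M by fact
  interpret P: left_module A P by fact
  interpret D: left_module A "Dst M" by (rule Dst[OF M])
  have H: "left_module K (hom_space A M P)" by (rule hom_space_left_module[OF M lP])
  have H': "left_module K (hom_space A P (Dst M))" by (rule hom_space_left_module[OF lP Dst[OF M]])
  interpret H': left_module K "hom_space A P (Dst M)" by (rule H')
  note eqI = functional_eq_on_el[OF M P]
  note h = hpair[OF M P]
  have \<phi>m: "\<phi> p \<in> mod_hom K (scalars A (ring_dual A M)) (self_module K)"
    if "\<phi> \<in> mod_hom A P (Dst M)" "p \<in> carrier P" for \<phi> p
    using linD(1)[OF mod_hom_lin[OF that(1)] that(2)] by simp
  show ?thesis unfolding dual_pair_def
  proof (intro conjI ballI allI impI H H')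
    fix \<phi> assume "\<phi> \<in> carrier (hom_space A P (Dst M))"
    then show "functional K (hom_space A M P) (hpair M P \<phi>)" using h by simp
  next
    fix f assume "f \<in> carrier (hom_space A M P)"
    then have f: "f \<in> mod_hom A M P" by simp
    show "functional K (hom_space A P (Dst M)) (\<lambda>\<phi>. hpair M P \<phi> f)"
    proof (rule linI)
      fix \<phi> assume "\<phi> \<in> carrier (hom_space A P (Dst M))"
      then show "hpair M P \<phi> f \<in> carrier (self_module K)" using linD(1)[OF h(1)] f by simp
    next
      fix \<phi> \<psi> assume "\<phi> \<in> carrier (hom_space A P (Dst M))" "\<psi> \<in> carrier (hom_space A P (Dst M))"
      then have \<phi>: "\<phi> \<in> mod_hom A P (Dst M)" and \<psi>: "\<psi> \<in> mod_hom A P (Dst M)"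
        and s: "\<phi> \<oplus>\<^bsub>hom_space A P (Dst M)\<^esub> \<psi> \<in> mod_hom A P (Dst M)"
        using H'.M.a_closed[of \<phi> \<psi>] by simp_all
      have "hpair M P (\<phi> \<oplus>\<^bsub>hom_space A P (Dst M)\<^esub> \<psi>) f = hpair M P \<phi> f \<oplus>\<^bsub>self_module K\<^esub> hpair M P \<psi> f"
        by (rule eqI[OF h(1)[OF s] lin_add[OF h(1)[OF \<phi>] h(1)[OF \<psi>] K_self] _ f])
          (simp only: h(2)[OF s] h(2)[OF \<phi>] h(2)[OF \<psi>], simp)
      then show "hpair M P (\<phi> \<oplus>\<^bsub>hom_space A P (Dst M)\<^esub> \<psi>) f = hpair M P \<phi> f \<oplus>\<^bsub>self_module K\<^esub> hpair M P \<psi> f" .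
    next
      fix c \<phi> assume c: "c \<in> carrier K" and "\<phi> \<in> carrier (hom_space A P (Dst M))"
      then have \<phi>: "\<phi> \<in> mod_hom A P (Dst M)" and s: "c \<odot>\<^bsub>hom_space A P (Dst M)\<^esub> \<phi> \<in> mod_hom A P (Dst M)"
        using H'.smult_closed[of c \<phi>] by simp_all
      have l: "functional K (hom_space A M P) (\<lambda>f. c \<otimes>\<^bsub>K\<^esub> hpair M P \<phi> f)"
        by (rule linI) (use linD[OF h(1)[OF \<phi>]] c in \<open>auto simp: K.r_distr K.m_lcomm\<close>)
      have "hpair M P (c \<odot>\<^bsub>hom_space A P (Dst M)\<^esub> \<phi>) f = c \<otimes>\<^bsub>K\<^esub> hpair M P \<phi> f"
      proof (rule eqI[OF h(1)[OF s] l _ f])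
        fix ms p assume ms: "ms \<in> mod_hom A M (self_module A)" and p: "p \<in> carrier P"
        have "(c \<odot>\<^bsub>hom_space A P (Dst M)\<^esub> \<phi>) p ms = (sc c \<odot>\<^bsub>Dst M\<^esub> \<phi> p) ms" using p by simp
        also have "\<dots> = c \<otimes>\<^bsub>K\<^esub> \<phi> p ms"
          unfolding k_dual_scalars_smult[OF ring_dual_left_module[OF M] c \<phi>m[OF \<phi> p]] using ms by simp
        finally show "hpair M P (c \<odot>\<^bsub>hom_space A P (Dst M)\<^esub> \<phi>) (el M P ms p) = c \<otimes>\<^bsub>K\<^esub> hpair M P \<phi> (el M P ms p)"
          by (simp only: h(2)[OF s p ms] h(2)[OF \<phi> p ms])
      qed
      then show "hpair M P (c \<odot>\<^bsub>hom_space A P (Dst M)\<^esub> \<phi>) f = c \<odot>\<^bsub>self_module K\<^esub> hpair M P \<phi> f" by simp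
    qed
  next
    fix u assume u: "functional K (hom_space A M P) u"
    define \<phi> where "\<phi> = (\<lambda>p\<in>carrier P. \<lambda>ms\<in>mod_hom A M (self_module A). u (el M P ms p))"
    have msc: "ms m \<in> carrier A" if "ms \<in> mod_hom A M (self_module A)" "m \<in> carrier M" for ms m
      using linD(1)[OF mod_hom_lin[OF that(1)] that(2)] by simp
    have elc: "el M P ms p \<in> carrier (hom_space A M P)" if "p \<in> carrier P" "ms \<in> mod_hom A M (self_module A)" for p ms
      using el_closed[OF M lP that(2,1)] by simp
    interpret R: left_module "opp A" "ring_dual A M" by (rule ring_dual_left_module[OF M])
    have \<phi>p: "(\<lambda>ms\<in>mod_hom A M (self_module A). u (el M P ms p)) \<in> carrier (Dst M)" if p: "p \<in> carrier P" for p
    proof -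
      have "functional K (scalars A (ring_dual A M)) (\<lambda>ms. u (el M P ms p))"
      proof (rule linI)
        fix ms assume "ms \<in> carrier (scalars A (ring_dual A M))"
        then show "u (el M P ms p) \<in> carrier (self_module K)" using linD(1)[OF u elc[OF p]] by simp
      next
        fix ms mt assume "ms \<in> carrier (scalars A (ring_dual A M))" "mt \<in> carrier (scalars A (ring_dual A M))"
        then have m: "ms \<in> mod_hom A M (self_module A)" "mt \<in> mod_hom A M (self_module A)" by simp_all
        have "el M P (ms \<oplus>\<^bsub>scalars A (ring_dual A M)\<^esub> mt) p = el M P ms p \<oplus>\<^bsub>hom_space A M P\<^esub> el M P mt p"
          using msc[OF m(1)] msc[OF m(2)] p by (auto simp: el_def P.smult_l_distr)
        then show "u (el M P (ms \<oplus>\<^bsub>scalars A (ring_dual A M)\<^esub> mt) p) = u (el M P ms p) \<oplus>\<^bsub>self_module K\<^esub> u (el M P mt p)"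
          using linD(2)[OF u elc[OF p m(1)] elc[OF p m(2)]] by simp
      next
        fix c ms assume c: "c \<in> carrier K" and "ms \<in> carrier (scalars A (ring_dual A M))"
        then have m: "ms \<in> mod_hom A M (self_module A)" by simp
        have "el M P (c \<odot>\<^bsub>scalars A (ring_dual A M)\<^esub> ms) p = c \<odot>\<^bsub>hom_space A M P\<^esub> el M P ms p"
          using msc[OF m] c p sc_central[OF c] by (auto simp: el_def P.smult_assoc1)
        then show "u (el M P (c \<odot>\<^bsub>scalars A (ring_dual A M)\<^esub> ms) p) = c \<odot>\<^bsub>self_module K\<^esub> u (el M P ms p)"
          using linD(3)[OF u c elc[OF p m]] by simp
      qed
      from lin_restrict[OF this right_scalars[OF ring_dual_left_module[OF M]]] show ?thesis by simp
    qed
    have "lin A P (Dst M) (\<lambda>p. \<lambda>ms\<in>mod_hom A M (self_module A). u (el M P ms p))"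
    proof (rule linI)
      fix p q assume pq: "p \<in> carrier P" "q \<in> carrier P"
      have "el M P ms (p \<oplus>\<^bsub>P\<^esub> q) = el M P ms p \<oplus>\<^bsub>hom_space A M P\<^esub> el M P ms q"
        if "ms \<in> mod_hom A M (self_module A)" for ms
        using msc[OF that] pq by (auto simp: el_def P.smult_r_distr)
      then show "(\<lambda>ms\<in>mod_hom A M (self_module A). u (el M P ms (p \<oplus>\<^bsub>P\<^esub> q))) =
        (\<lambda>ms\<in>mod_hom A M (self_module A). u (el M P ms p)) \<oplus>\<^bsub>Dst M\<^esub> (\<lambda>ms\<in>mod_hom A M (self_module A). u (el M P ms q))"
        using linD(2)[OF u elc[OF pq(1)] elc[OF pq(2)]] by (auto intro!: restrict_ext)
    next
      fix a p assume ap: "a \<in> carrier A" "p \<in> carrier P"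
      \<comment> \<open>A ring element acting on the vector of a rank one map can be moved to its
        functional. Transposed to the dual, this is linearity of the representing map over
        \<open>A\<close>, beyond linearity over the field.\<close>
      have "el M P ms (a \<odot>\<^bsub>P\<^esub> p) = el M P (a \<odot>\<^bsub>ring_dual A M\<^esub> ms) p"
        if "ms \<in> mod_hom A M (self_module A)" for ms
        using msc[OF that] ap by (auto simp: el_def P.smult_assoc1)
      moreover have "a \<odot>\<^bsub>ring_dual A M\<^esub> ms \<in> mod_hom A M (self_module A)" if "ms \<in> mod_hom A M (self_module A)" for ms
        using R.smult_closed[of a ms] that ap by simp
      ultimately show "(\<lambda>ms\<in>mod_hom A M (self_module A). u (el M P ms (a \<odot>\<^bsub>P\<^esub> p))) =
        a \<odot>\<^bsub>Dst M\<^esub> (\<lambda>ms\<in>mod_hom A M (self_module A). u (el M P ms p))"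
        by (auto intro!: restrict_ext)
    qed (use \<phi>p in simp)
    from lin_restrict[OF this lP] have \<phi>: "\<phi> \<in> mod_hom A P (Dst M)" by (simp add: \<phi>_def)
    have "hpair M P \<phi> f = u f" if "f \<in> mod_hom A M P" for f
      by (rule eqI[OF h(1)[OF \<phi>] u _ that]) (simp add: h(2)[OF \<phi>], simp add: \<phi>_def)
    then show "\<exists>\<phi>\<in>carrier (hom_space A P (Dst M)). \<forall>f\<in>carrier (hom_space A M P). hpair M P \<phi> f = u f"
      using \<phi> by auto
  next
    fix \<phi> assume "\<phi> \<in> carrier (hom_space A P (Dst M))" and z: "\<forall>f\<in>carrier (hom_space A M P). hpair M P \<phi> f = \<zero>\<^bsub>K\<^esub>"
    then have \<phi>: "\<phi> \<in> mod_hom A P (Dst M)" by simp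
    have "\<phi> p = \<zero>\<^bsub>Dst M\<^esub>" if p: "p \<in> carrier P" for p
    proof (rule extensionalityI[of _ "mod_hom A M (self_module A)"])
      fix ms assume ms: "ms \<in> mod_hom A M (self_module A)"
      have "\<phi> p ms = \<zero>\<^bsub>K\<^esub>" using h(2)[OF \<phi> p ms] z el_closed[OF M lP ms p] by simp
      then show "\<phi> p ms = \<zero>\<^bsub>Dst M\<^esub> ms" using ms by simp
    qed (use \<phi>m[OF \<phi> p] in \<open>auto simp: mod_hom_iff\<close>)
    then show "\<phi> = \<zero>\<^bsub>hom_space A P (Dst M)\<^esub>" using \<phi> by (auto simp: mod_hom_iff intro!: extensionalityI)
  qed
qed

text \<open>On rank one maps postcomposition with \<open>d\<close> replaces \<open>p\<close> by
  \<open>d p\<close>, and two functionals that agree on rank one maps are equal.\<close>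

lemma hpair_natural:
  fixes P Q :: "('a, nat \<Rightarrow> 'a) module"
  assumes M: "left_module A M" and P: "projective A P" "fin_gen A P" and Q: "projective A Q" "fin_gen A Q"
    and d: "lin A P Q d" and \<phi>: "\<phi> \<in> mod_hom A Q (Dst M)" and f: "f \<in> mod_hom A M P"
  shows "hpair M P (hom_map P d \<phi>) f = hpair M Q \<phi> (post M d f)"
proof -
  have lP: "left_module A P" and lQ: "left_module A Q" using P(1) Q(1) by (simp_all add: projective_def)
  have d\<phi>: "hom_map P d \<phi> \<in> mod_hom A P (Dst M)"
    using linD(1)[OF hom_map_lin[OF lP lQ Dst[OF M] d]] \<phi> by simp
  show ?thesis
  proof (rule functional_eq_on_el[OF M P hpair(1)[OF M P d\<phi>] lin_comp[OF post_lin[OF M lP lQ d] hpair(1)[OF M Q \<phi>]] _ f])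
    fix ms p assume ms: "ms \<in> mod_hom A M (self_module A)" and p: "p \<in> carrier P"
    have msc: "ms m \<in> carrier A" if "m \<in> carrier M" for m
      using linD(1)[OF mod_hom_lin[OF ms] that] by simp
    have "post M d (el M P ms p) = el M Q ms (d p)"
      using linD(3)[OF d msc p] by (auto simp: post_def el_def)
    then show "hpair M P (hom_map P d \<phi>) (el M P ms p) = hpair M Q \<phi> (post M d (el M P ms p))"
      using hpair(2)[OF M P d\<phi> p ms] hpair(2)[OF M Q \<phi> linD(1)[OF d p] ms] p by (simp add: hom_map_def)
  qed
qed

end

text \<open>Dualising reverses arrows, so cohomological degree \<open>j\<close> on the left faces
  homological degree \<open>j\<close> on the right and no shift occurs. Naturality of
  \<open>hpair\<close> makes the differentials adjoint.\<close>

lemma (in two_complete_res) ext_dual: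
  "mod_iso K
     (homology_at (hom_space A (S (j - 1)) (T.Dst M)) (hom_map (S j) (dS j)) (hom_space A (S j) (T.Dst M))
        (hom_map (S (j + 1)) (dS (j + 1))) (hom_space A (S (j + 1)) (T.Dst M)))
     (homology_at (hom_space A M (S (j + 1))) (T.post M (dS (j + 1))) (hom_space A M (S j))
        (T.post M (dS j)) (hom_space A M (S (j - 1))))"
proof (rule dual_homology[OF T.K_field _ _ T.hom_dual_pair[OF T.M S.T_proj S.T_fg]
      T.hom_dual_pair[OF T.M S.T_proj S.T_fg] T.hom_dual_pair[OF T.M S.T_proj S.T_fg]])
  show "fin_gen K (hom_space A M (S j))" "fin_gen K (hom_space A M (S (j - 1)))"
    by (rule T.hom_space_fin_gen[OF T.M S.T T.M_fg S.T_fg])+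
  show "lin K (hom_space A M (S (j + 1))) (hom_space A M (S j)) (T.post M (dS (j + 1)))"
    by (rule T.post_lin[OF T.M S.T S.T S.d'])
  show "lin K (hom_space A M (S j)) (hom_space A M (S (j - 1))) (T.post M (dS j))"
    by (rule T.post_lin[OF T.M S.T S.T S.d])
  show "lin K (hom_space A (S j) (T.Dst M)) (hom_space A (S (j + 1)) (T.Dst M)) (hom_map (S (j + 1)) (dS (j + 1)))"
    by (rule T.hom_map_lin[OF S.T S.T T.Dst[OF T.M] S.d'])
  show "lin K (hom_space A (S (j - 1)) (T.Dst M)) (hom_space A (S j) (T.Dst M)) (hom_map (S j) (dS j))"
    by (rule T.hom_map_lin[OF S.T S.T T.Dst[OF T.M] S.d])
  show "T.post M (dS j) (T.post M (dS (j + 1)) f) = \<zero>\<^bsub>hom_space A M (S (j - 1))\<^esub>"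
    if "f \<in> carrier (hom_space A M (S (j + 1)))" for f
  proof -
    have "f m \<in> carrier (S (j + 1))" if "m \<in> carrier M" for m
      using linD(1)[OF mod_hom_lin that] \<open>f \<in> _\<close> by simp
    then show ?thesis using S.dd by (auto simp: T.post_def)
  qed
  show "T.hpair M (S j) (hom_map (S j) (dS j) \<phi>) f = T.hpair M (S (j - 1)) \<phi> (T.post M (dS j) f)"
    if "\<phi> \<in> carrier (hom_space A (S (j - 1)) (T.Dst M))" "f \<in> carrier (hom_space A M (S j))" for \<phi> f
    by (rule T.hpair_natural[OF T.M S.T_proj S.T_fg S.T_proj S.T_fg S.d]) (use that in simp_all)
  show "T.hpair M (S (j + 1)) (hom_map (S (j + 1)) (dS (j + 1)) \<phi>) f = T.hpair M (S j) \<phi> (T.post M (dS (j + 1)) f)"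
    if "\<phi> \<in> carrier (hom_space A (S j) (T.Dst M))" "f \<in> carrier (hom_space A M (S (j + 1)))" for \<phi> f
    by (rule T.hpair_natural[OF T.M S.T_proj S.T_fg S.T_proj S.T_fg S.d']) (use that in simp_all)
qed

section \<open>Tor and Ext\<close>

context tensor_pair
begin

text \<open>Uncurrying: the adjunction between the tensor product and Hom, with values in the ground
  field.\<close>

definition tpair :: "('m \<Rightarrow> 'n \<Rightarrow> 'k) \<Rightarrow> ('n \<times> 'm \<Rightarrow> 'k) set \<Rightarrow> 'k" where
  "tpair \<phi> = tensor_lift K (self_module K) (\<lambda>x y. \<phi> y x)"

lemma dual_app:
  assumes "\<phi> \<in> mod_hom A M (k_dual K A N)" "y \<in> carrier M"
  shows "\<phi> y \<in> mod_hom K (scalars A N) (self_module K)"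
  using linD(1)[OF mod_hom_lin[OF assms(1)] assms(2)] by simp

lemma tpair:
  assumes \<phi>: "\<phi> \<in> mod_hom A M (k_dual K A N)"
  shows "functional K TT (tpair \<phi>)"
    and "x \<in> carrier N \<Longrightarrow> y \<in> carrier M \<Longrightarrow> tpair \<phi> (pt x y) = \<phi> y x"
proof -
  note \<phi>y = mod_hom_lin[OF dual_app[OF \<phi>]]
  have "balanced (self_module K) (\<lambda>x y. \<phi> y x)"
    unfolding balanced_def
    by (intro conjI ballI)
      (use linD[OF \<phi>y] linD[OF mod_hom_lin[OF \<phi>]] in simp_all)
  from tensor_lift_lin[OF K_self this]
  show "functional K TT (tpair \<phi>)" "x \<in> carrier N \<Longrightarrow> y \<in> carrier M \<Longrightarrow> tpair \<phi> (pt x y) = \<phi> y x"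
    by (simp_all add: tpair_def)
qed

text \<open>The inverse of \<open>tpair\<close> curries a functional on tensors. That the curried
  map is linear over \<open>A\<close> is the balance of pure tensors, and that it takes values in
  \<open>k_dual K A N\<close> is their linearity in the first entry.\<close>

lemma tensor_dual_pair: "dual_pair K (hom_space A M (k_dual K A N)) TT tpair"
proof -
  let ?D = "k_dual K A N"
  interpret N: left_module "opp A" N by (rule N)
  interpret M: left_module A M by (rule M)
  interpret D: left_module A ?D by (rule k_dual_left_module[OF N])
  have H: "left_module K (hom_space A M ?D)" by (rule hom_space_left_module[OF M D.left_module_axioms])
  interpret H: left_module K "hom_space A M ?D" by (rule H)
  note eqI = lin_eq_on_pt[OF K_self]
  show ?thesis unfolding dual_pair_def
  proof (intro conjI ballI allI impI H TT_left_module)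
    fix \<phi> assume "\<phi> \<in> carrier (hom_space A M ?D)"
    then show "functional K TT (tpair \<phi>)" using tpair by simp
  next
    fix t assume t: "t \<in> carrier TT"
    show "functional K (hom_space A M ?D) (\<lambda>\<phi>. tpair \<phi> t)"
    proof (rule linI)
      fix \<phi> assume "\<phi> \<in> carrier (hom_space A M ?D)"
      then show "tpair \<phi> t \<in> carrier (self_module K)" using linD(1)[OF tpair(1) t] by simp
    next
      fix \<phi> \<psi> assume "\<phi> \<in> carrier (hom_space A M ?D)" "\<psi> \<in> carrier (hom_space A M ?D)"
      then have \<phi>: "\<phi> \<in> mod_hom A M ?D" and \<psi>: "\<psi> \<in> mod_hom A M ?D"
        and s: "\<phi> \<oplus>\<^bsub>hom_space A M ?D\<^esub> \<psi> \<in> mod_hom A M ?D"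
        using H.M.a_closed[of \<phi> \<psi>] by simp_all
      show "tpair (\<phi> \<oplus>\<^bsub>hom_space A M ?D\<^esub> \<psi>) t = tpair \<phi> t \<oplus>\<^bsub>self_module K\<^esub> tpair \<psi> t"
        by (rule eqI[OF tpair(1)[OF s] lin_add[OF tpair(1)[OF \<phi>] tpair(1)[OF \<psi>] K_self] _ t])
          (simp only: tpair(2)[OF s] tpair(2)[OF \<phi>] tpair(2)[OF \<psi>], simp)
    next
      fix c \<phi> assume c: "c \<in> carrier K" and "\<phi> \<in> carrier (hom_space A M ?D)"
      then have \<phi>: "\<phi> \<in> mod_hom A M ?D" and s: "c \<odot>\<^bsub>hom_space A M ?D\<^esub> \<phi> \<in> mod_hom A M ?D"
        using H.smult_closed[of c \<phi>] by simp_all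
      have l: "functional K TT (\<lambda>t. c \<otimes>\<^bsub>K\<^esub> tpair \<phi> t)"
        by (rule linI) (use linD[OF tpair(1)[OF \<phi>]] c in \<open>auto simp: K.r_distr K.m_lcomm\<close>)
      have "tpair (c \<odot>\<^bsub>hom_space A M ?D\<^esub> \<phi>) t = c \<otimes>\<^bsub>K\<^esub> tpair \<phi> t"
      proof (rule eqI[OF tpair(1)[OF s] l _ t])
        fix x y assume x: "x \<in> carrier N" and y: "y \<in> carrier M"
        have "(c \<odot>\<^bsub>hom_space A M ?D\<^esub> \<phi>) y x = (sc c \<odot>\<^bsub>?D\<^esub> \<phi> y) x" using y by simp
        also have "\<dots> = c \<otimes>\<^bsub>K\<^esub> \<phi> y x"
          unfolding k_dual_scalars_smult[OF N c dual_app[OF \<phi> y]] using x by simp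
        finally show "tpair (c \<odot>\<^bsub>hom_space A M ?D\<^esub> \<phi>) (pt x y) = c \<otimes>\<^bsub>K\<^esub> tpair \<phi> (pt x y)"
          by (simp only: tpair(2)[OF s x y] tpair(2)[OF \<phi> x y])
      qed
      then show "tpair (c \<odot>\<^bsub>hom_space A M ?D\<^esub> \<phi>) t = c \<odot>\<^bsub>self_module K\<^esub> tpair \<phi> t" by simp
    qed
  next
    fix u assume u: "functional K TT u"
    define \<phi> where "\<phi> = (\<lambda>y\<in>carrier M. \<lambda>x\<in>carrier N. u (pt x y))"
    have \<phi>y: "(\<lambda>x\<in>carrier N. u (pt x y)) \<in> carrier ?D" if y: "y \<in> carrier M" for y
    proof -
      have "lin K (scalars A N) TT (\<lambda>x. pt x y)"
        by (rule linI) (use y pt_closed pt_add_l pt_smult_l in auto)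
      from lin_restrict[OF lin_comp[OF this u] N_scalars] show ?thesis by simp
    qed
    have "lin A M ?D (\<lambda>y. \<lambda>x\<in>carrier N. u (pt x y))"
    proof (rule linI)
      fix y z assume "y \<in> carrier M" "z \<in> carrier M"
      then show "(\<lambda>x\<in>carrier N. u (pt x (y \<oplus>\<^bsub>M\<^esub> z))) =
        (\<lambda>x\<in>carrier N. u (pt x y)) \<oplus>\<^bsub>?D\<^esub> (\<lambda>x\<in>carrier N. u (pt x z))"
        using pt_add_r linD(2)[OF u pt_closed pt_closed] by (auto intro!: restrict_ext)
    next
      fix a y assume "a \<in> carrier A" "y \<in> carrier M"
      then show "(\<lambda>x\<in>carrier N. u (pt x (a \<odot>\<^bsub>M\<^esub> y))) = a \<odot>\<^bsub>?D\<^esub> (\<lambda>x\<in>carrier N. u (pt x y))"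
        using pt_balanced Nsm by (auto intro!: restrict_ext)
    qed (use \<phi>y in simp)
    from lin_restrict[OF this M] have \<phi>: "\<phi> \<in> mod_hom A M ?D" by (simp add: \<phi>_def)
    have "tpair \<phi> t = u t" if "t \<in> carrier TT" for t
      by (rule eqI[OF tpair(1)[OF \<phi>] u _ that]) (simp add: tpair(2)[OF \<phi>], simp add: \<phi>_def)
    then show "\<exists>\<phi>\<in>carrier (hom_space A M ?D). \<forall>t\<in>carrier TT. tpair \<phi> t = u t"
      using \<phi> by auto
  next
    fix \<phi> assume "\<phi> \<in> carrier (hom_space A M ?D)" and z: "\<forall>t\<in>carrier TT. tpair \<phi> t = \<zero>\<^bsub>K\<^esub>"
    then have \<phi>: "\<phi> \<in> mod_hom A M ?D" by simp
    have "\<phi> y = \<zero>\<^bsub>?D\<^esub>" if y: "y \<in> carrier M" for y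
    proof (rule extensionalityI[of _ "carrier N"])
      fix x assume x: "x \<in> carrier N"
      have "\<phi> y x = \<zero>\<^bsub>K\<^esub>" using tpair(2)[OF \<phi> x y] z pt_closed[OF x y] by simp
      then show "\<phi> y x = \<zero>\<^bsub>?D\<^esub> x" using x by simp
    qed (use dual_app[OF \<phi> y] in \<open>auto simp: mod_hom_iff\<close>)
    then show "\<phi> = \<zero>\<^bsub>hom_space A M ?D\<^esub>" using \<phi> by (auto simp: mod_hom_iff intro!: extensionalityI)
  qed
qed

end

context fd_algebra
begin

lemma tensor_map_lin:
  assumes N: "left_module (opp A) N" and P: "left_module A P" and Q: "left_module A Q" and d: "lin A P Q d"
  shows "lin K (tensor K A N P) (tensor K A N Q) (tensor_map K A N Q d)"
    and "\<lbrakk>x \<in> carrier N; y \<in> carrier P\<rbrakk> \<Longrightarrow>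
      tensor_map K A N Q d (pure_tensor K A N P x y) = pure_tensor K A N Q x (d y)"
proof -
  interpret P: tensor_pair K A N P by (intro tensor_pair.intro tensor_pair_axioms.intro fd_algebra_axioms N P)
  interpret Q: tensor_pair K A N Q by (intro tensor_pair.intro tensor_pair_axioms.intro fd_algebra_axioms N Q)
  have "P.balanced Q.TT (\<lambda>x y. Q.pt x (d y))"
    unfolding P.balanced_def
  proof (intro conjI ballI)
    fix c x y assume "c \<in> carrier K" "x \<in> carrier N" "y \<in> carrier P"
    then show "Q.pt (sc c \<odot>\<^bsub>N\<^esub> x) (d y) = c \<odot>\<^bsub>Q.TT\<^esub> Q.pt x (d y)"
      using Q.pt_smult_l linD(1)[OF d] by blast
  next
    fix a x y assume "a \<in> carrier A" "x \<in> carrier N" "y \<in> carrier P"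
    then show "Q.pt (a \<odot>\<^bsub>N\<^esub> x) (d y) = Q.pt x (d (a \<odot>\<^bsub>P\<^esub> y))"
      using Q.pt_balanced linD(1)[OF d] linD(3)[OF d] by metis
  qed (use linD(1,2)[OF d] in \<open>simp_all add: Q.pt_closed Q.pt_add_l Q.pt_add_r\<close>)
  from P.tensor_lift_lin[OF Q.TT_left_module this]
  show "lin K P.TT Q.TT (tensor_map K A N Q d)"
    "\<lbrakk>x \<in> carrier N; y \<in> carrier P\<rbrakk> \<Longrightarrow> tensor_map K A N Q d (P.pt x y) = Q.pt x (d y)"
    by (simp_all add: tensor_map_def)
qed

lemma tpair_natural:
  assumes N: "left_module (opp A) N" and P: "left_module A P" and Q: "left_module A Q" and d: "lin A P Q d"
    and \<phi>: "\<phi> \<in> mod_hom A Q (k_dual K A N)" and t: "t \<in> carrier (tensor K A N P)"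
  shows "tensor_pair.tpair K (hom_map P d \<phi>) t = tensor_pair.tpair K \<phi> (tensor_map K A N Q d t)"
proof -
  interpret P: tensor_pair K A N P by (intro tensor_pair.intro tensor_pair_axioms.intro fd_algebra_axioms N P)
  interpret Q: tensor_pair K A N Q by (intro tensor_pair.intro tensor_pair_axioms.intro fd_algebra_axioms N Q)
  have d\<phi>: "hom_map P d \<phi> \<in> mod_hom A P (k_dual K A N)"
    using linD(1)[OF hom_map_lin[OF P Q k_dual_left_module[OF N] d]] \<phi> by simp
  note tm = tensor_map_lin[OF N P Q d]
  show ?thesis
  proof (rule P.lin_eq_on_pt[OF K_self P.tpair(1)[OF d\<phi>] lin_comp[OF tm(1) Q.tpair(1)[OF \<phi>]] _ t])
    fix x y assume x: "x \<in> carrier N" and y: "y \<in> carrier P"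
    show "P.tpair (hom_map P d \<phi>) (P.pt x y) = Q.tpair \<phi> (tensor_map K A N Q d (P.pt x y))"
      by (simp only: tm(2)[OF x y] P.tpair(2)[OF d\<phi> x y] Q.tpair(2)[OF \<phi> x linD(1)[OF d y]])
        (simp add: hom_map_def y)
  qed
qed

end

text \<open>Finite dimension of \<open>N\<close> and of each \<open>T i\<close> makes the tensor
  products finite dimensional, as \<open>dual_homology\<close> requires;
  \<open>tpair_natural\<close> makes the differentials adjoint.\<close>

lemma (in complete_res) tor_ext:
  assumes N: "left_module (opp A) N" and fg: "fin_gen K (scalars A N)"
  shows "mod_iso K
    (homology_at (hom_space A (T (n - 1)) (k_dual K A N)) (hom_map (T n) (d n)) (hom_space A (T n) (k_dual K A N))
       (hom_map (T (n + 1)) (d (n + 1))) (hom_space A (T (n + 1)) (k_dual K A N)))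
    (homology_at (tensor K A N (T (n + 1))) (tensor_map K A N (T n) (d (n + 1))) (tensor K A N (T n))
       (tensor_map K A N (T (n - 1)) (d n)) (tensor K A N (T (n - 1))))"
proof -
  have tp: "tensor_pair K A N (T i)" for i by (intro tensor_pair.intro tensor_pair_axioms.intro fd_algebra_axioms N T)
  have D: "left_module A (k_dual K A N)" by (rule k_dual_left_module[OF N])
  have fT: "fin_gen K (scalars A (T i))" for i using fin_gen_scalars_iff[OF T] T_fg by blast
  note tm = tensor_map_lin[OF N T T d] and tm' = tensor_map_lin[OF N T T d']
  show ?thesis
  proof (rule dual_homology[OF K_field _ _ tensor_pair.tensor_dual_pair[OF tp]
        tensor_pair.tensor_dual_pair[OF tp] tensor_pair.tensor_dual_pair[OF tp]])
    show "fin_gen K (tensor K A N (T n))" "fin_gen K (tensor K A N (T (n - 1)))"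
      by (rule tensor_pair.TT_fin_gen[OF tp fg fT])+
    show "lin K (tensor K A N (T (n + 1))) (tensor K A N (T n)) (tensor_map K A N (T n) (d (n + 1)))" by (rule tm')
    show "lin K (tensor K A N (T n)) (tensor K A N (T (n - 1))) (tensor_map K A N (T (n - 1)) (d n))" by (rule tm)
    show "lin K (hom_space A (T n) (k_dual K A N)) (hom_space A (T (n + 1)) (k_dual K A N)) (hom_map (T (n + 1)) (d (n + 1)))"
      by (rule hom_map_lin[OF T T D d'])
    show "lin K (hom_space A (T (n - 1)) (k_dual K A N)) (hom_space A (T n) (k_dual K A N)) (hom_map (T n) (d n))"
      by (rule hom_map_lin[OF T T D d])
    show "tensor_map K A N (T (n - 1)) (d n) (tensor_map K A N (T n) (d (n + 1)) t) = \<zero>\<^bsub>tensor K A N (T (n - 1))\<^esub>"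
      if t: "t \<in> carrier (tensor K A N (T (n + 1)))" for t
    proof (rule tensor_pair.lin_eq_on_pt[OF tp tensor_pair.TT_left_module[OF tp] lin_comp[OF tm'(1) tm(1)]
          lin_const_zero[OF tensor_pair.TT_left_module[OF tp]] _ t])
      interpret S: tensor_pair K A N "T (n - 1)" by (rule tp)
      fix x y assume x: "x \<in> carrier N" and y: "y \<in> carrier (T (n + 1))"
      interpret Tn: left_module A "T (n - 1)" by (rule T)
      have "lin K (scalars A (T (n - 1))) S.TT (S.pt x)"
        by (rule linI) (use x S.pt_closed S.pt_add_r S.pt_smult_r in auto)
      from lin_zero[OF this scalars_left_module[OF T] S.TT_left_module]
      show "tensor_map K A N (T (n - 1)) (d n) (tensor_map K A N (T n) (d (n + 1)) (pure_tensor K A N (T (n + 1)) x y)) = \<zero>\<^bsub>S.TT\<^esub>"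
        unfolding tm'(2)[OF x y] tm(2)[OF x linD(1)[OF d' y]] dd[OF y] by simp
    qed
    show "tensor_pair.tpair K (hom_map (T n) (d n) \<phi>) t = tensor_pair.tpair K \<phi> (tensor_map K A N (T (n - 1)) (d n) t)"
      if "\<phi> \<in> carrier (hom_space A (T (n - 1)) (k_dual K A N))" "t \<in> carrier (tensor K A N (T n))" for \<phi> t
      by (rule tpair_natural[OF N T T d]) (use that in simp_all)
    show "tensor_pair.tpair K (hom_map (T (n + 1)) (d (n + 1)) \<phi>) t = tensor_pair.tpair K \<phi> (tensor_map K A N (T n) (d (n + 1)) t)"
      if "\<phi> \<in> carrier (hom_space A (T n) (k_dual K A N))" "t \<in> carrier (tensor K A N (T (n + 1)))" for \<phi> t
      by (rule tpair_natural[OF N T T d']) (use that in simp_all)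
  qed
qed

section \<open>Injectivity and averaging operators\<close>

text \<open>The test in \<open>injective\<close> admits only modules with carriers in
  \<open>nat \<Rightarrow> 'r\<close>. An inclusion of modules of any type can be copied there as
  soon as the larger one embeds as a set.\<close>

lemma injective_extend:
  fixes I :: "('r, 'i) module" and M :: "('r, 'm) module" and N :: "('r, 'n) module"
    and \<iota> :: "'n \<Rightarrow> nat \<Rightarrow> 'r"
  assumes I: "injective R I" and M: "left_module R M" and N: "left_module R N"
    and g: "lin R M N g" and inj: "inj_on g (carrier M)" and f: "lin R M I f"
    and \<iota>: "inj_on \<iota> (carrier N)"
  obtains h where "lin R N I h" "\<And>x. x \<in> carrier M \<Longrightarrow> h (g x) = f x"
proof -
  have lI: "left_module R I" using I by (simp add: injective_def)
  interpret M: left_module R M by fact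
  interpret N: left_module R N by fact
  let ?j = "inv_into (carrier N) \<iota>"
  \<comment> \<open>\<open>\<iota>\<close> is merely an injection of sets; the module structure of
    \<open>N\<close> is transported along it.\<close>
  define N' where "N' = mk_module (\<iota> ` carrier N) (\<iota> \<zero>\<^bsub>N\<^esub>)
     (\<lambda>u v. \<iota> (?j u \<oplus>\<^bsub>N\<^esub> ?j v)) (\<lambda>r u. \<iota> (r \<odot>\<^bsub>N\<^esub> ?j u))"
  have j [simp]: "?j (\<iota> x) = x" if "x \<in> carrier N" for x using \<iota> that by simp
  have N': "left_module R N'"
  proof (rule left_moduleI, goal_cases)
    case (5 u v)
    then obtain x y where "x \<in> carrier N" "u = \<iota> x" "y \<in> carrier N" "v = \<iota> y" by (auto simp: N'_def)
    then show ?case using N.a_comm[of x y] by (simp add: N'_def)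
  next
    case (7 u)
    then obtain x where "x \<in> carrier N" "u = \<iota> x" by (auto simp: N'_def)
    then show ?case by (intro bexI[of _ "\<iota> (\<ominus>\<^bsub>N\<^esub> x)"]) (auto simp: N'_def N.l_neg)
  qed (auto simp: N'_def left_module.axioms(1)[OF N] N.a_assoc N.smult_l_distr N.smult_r_distr N.smult_assoc1 N.smult_one)
  have \<iota>l: "lin R N N' \<iota>" by (rule linI) (auto simp: N'_def)
  \<comment> \<open>The copy of \<open>M\<close> is taken inside the copy of \<open>N\<close>, so
    one injection provides both test modules, with the inclusion between them.\<close>
  let ?M' = "N'\<lparr>carrier := \<iota> ` g ` carrier M\<rparr>"
  have eg: "lin R M N' (\<lambda>x. \<iota> (g x))" by (rule lin_comp[OF g \<iota>l])
  have im: "(\<lambda>x. \<iota> (g x)) ` carrier M = \<iota> ` g ` carrier M" by (simp add: image_image)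
  have M': "left_module R ?M'"
    using left_module.subm_left_module[OF N' subm_range[OF eg M N']] by (simp add: im)
  have e: "lin R M ?M' (\<lambda>x. \<iota> (g x))" by (rule lin_upd_cod[OF eg]) (simp add: im)
  have ker: "x = \<zero>\<^bsub>M\<^esub>" if x: "x \<in> carrier M" and z: "\<iota> (g x) = \<zero>\<^bsub>?M'\<^esub>" for x
  proof -
    have "\<iota> (g x) = \<iota> \<zero>\<^bsub>N\<^esub>" using z by (simp add: N'_def)
    then have "g x = g \<zero>\<^bsub>M\<^esub>" using \<iota> linD(1)[OF g x] lin_zero[OF g M N] by (simp add: inj_on_eq_iff[OF \<iota>])
    then show ?thesis using inj x by (simp add: inj_on_eq_iff)
  qed
  obtain f' where f': "lin R ?M' I f'" "\<And>x. x \<in> carrier M \<Longrightarrow> f' (\<iota> (g x)) = f x"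
    using lin_factor[OF e M M' lI _ f] ker lin_zero[OF f M lI] by (auto simp: im)
  have inc: "lin R ?M' N' (\<lambda>x. x)" by (rule linI) (use linD(1)[OF eg] in auto)
  have "inj_on (restrict (\<lambda>x. x) (carrier ?M')) (carrier ?M')" by (auto simp: inj_on_def)
  then obtain h where h: "h \<in> mod_hom R N' I" "\<forall>x\<in>carrier ?M'. h (restrict (\<lambda>x. x) (carrier ?M') x) = restrict f' (carrier ?M') x"
    using I lin_restrict[OF inc M'] lin_restrict[OF f'(1) M'] M' N' unfolding injective_def by blast
  show ?thesis
  proof (rule that[OF lin_comp[OF \<iota>l mod_hom_lin[OF h(1)]]])
    show "h (\<iota> (g x)) = f x" if "x \<in> carrier M" for x using h(2) f'(2) that by auto
  qed
qed

section \<open>Averaging operators: existence and extension of maps\<close>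

context fd_algebra
begin

text \<open>The left action on \<open>mod_hom K A A\<close> that appears in the third condition is
  the one of the coinduced module \<open>Hom\<^sub>k(A, A)\<close>. Linearity over the field is
  contained in that condition, see \<open>avg_scale\<close>.\<close>

definition avg :: "(('a \<Rightarrow> 'a) \<Rightarrow> 'a) \<Rightarrow> bool" where
  "avg \<rho> \<longleftrightarrow> (\<forall>f\<in>mod_hom K A A. \<rho> f \<in> carrier A) \<and>
     (\<forall>f\<in>mod_hom K A A. \<forall>g\<in>mod_hom K A A. \<rho> (\<lambda>x\<in>carrier A. f x \<oplus>\<^bsub>A\<^esub> g x) = \<rho> f \<oplus>\<^bsub>A\<^esub> \<rho> g) \<and>
     (\<forall>f\<in>mod_hom K A A. \<forall>a\<in>carrier A. \<rho> (\<lambda>x\<in>carrier A. f (x \<otimes>\<^bsub>A\<^esub> a)) = a \<otimes>\<^bsub>A\<^esub> \<rho> f) \<and>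
     \<rho> (\<lambda>x\<in>carrier A. x) = \<one>\<^bsub>A\<^esub>"

lemma avgD:
  assumes "avg \<rho>"
  shows "f \<in> mod_hom K A A \<Longrightarrow> \<rho> f \<in> carrier A"
    and "\<lbrakk>f \<in> mod_hom K A A; g \<in> mod_hom K A A\<rbrakk> \<Longrightarrow> \<rho> (\<lambda>x\<in>carrier A. f x \<oplus>\<^bsub>A\<^esub> g x) = \<rho> f \<oplus>\<^bsub>A\<^esub> \<rho> g"
    and "\<lbrakk>f \<in> mod_hom K A A; a \<in> carrier A\<rbrakk> \<Longrightarrow> \<rho> (\<lambda>x\<in>carrier A. f (x \<otimes>\<^bsub>A\<^esub> a)) = a \<otimes>\<^bsub>A\<^esub> \<rho> f"
    and "\<rho> (\<lambda>x\<in>carrier A. x) = \<one>\<^bsub>A\<^esub>"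
  using assms unfolding avg_def by blast+

text \<open>Scaling a linear map by \<open>c\<close> is the same as precomposing it with right
  multiplication by \<open>sc c\<close>.\<close>

lemma avg_scale:
  assumes "avg \<rho>" "f \<in> mod_hom K A A" "c \<in> carrier K"
  shows "\<rho> (\<lambda>x\<in>carrier A. c \<odot>\<^bsub>A\<^esub> f x) = c \<odot>\<^bsub>A\<^esub> \<rho> f"
proof -
  have "(\<lambda>x\<in>carrier A. c \<odot>\<^bsub>A\<^esub> f x) = (\<lambda>x\<in>carrier A. f (x \<otimes>\<^bsub>A\<^esub> sc c))"
    using linD(3)[OF mod_hom_lin[OF assms(2)] assms(3)] sc_smult' assms(3) by (auto intro!: restrict_ext)
  then show ?thesis using avgD(3)[OF assms(1,2), of "sc c"] avgD(1)[OF assms(1,2)] assms(3) sc_smult by simp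
qed

lemma right_mult_hom:
  assumes "f \<in> mod_hom K A A" "a \<in> carrier A"
  shows "(\<lambda>x\<in>carrier A. f (x \<otimes>\<^bsub>A\<^esub> a)) \<in> mod_hom K A A"
proof (rule lin_restrict[OF _ A_left_module])
  have "lin K A A (\<lambda>x. x \<otimes>\<^bsub>A\<^esub> a)"
    by (rule linI) (use assms(2) in \<open>auto simp: A.l_distr A.smult_mult_left\<close>)
  from lin_comp[OF this mod_hom_lin[OF assms(1)]] show "lin K A A (\<lambda>x. f (x \<otimes>\<^bsub>A\<^esub> a))" .
qed

lemma avg_exists:
  assumes inj: "injective A (self_module A)"
  shows "\<exists>\<rho>. avg \<rho>"
proof -
  define E where "E = mk_module (mod_hom K A A) (\<lambda>x\<in>carrier A. \<zero>\<^bsub>A\<^esub>)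
    (\<lambda>f g. \<lambda>x\<in>carrier A. f x \<oplus>\<^bsub>A\<^esub> g x) (\<lambda>a f. \<lambda>x\<in>carrier A. f (x \<otimes>\<^bsub>A\<^esub> a))"
  have cl: "f x \<in> carrier A" if "f \<in> mod_hom K A A" "x \<in> carrier A" for f x
    using linD(1)[OF mod_hom_lin[OF that(1)] that(2)] .
  have ad: "f (x \<oplus>\<^bsub>A\<^esub> y) = f x \<oplus>\<^bsub>A\<^esub> f y" if "f \<in> mod_hom K A A" "x \<in> carrier A" "y \<in> carrier A" for f x y
    using linD(2)[OF mod_hom_lin[OF that(1)] that(2,3)] .
  have ex: "f x = undefined" if "f \<in> mod_hom K A A" "x \<notin> carrier A" for f x
    using that by (auto simp: mod_hom_iff extensional_def)
  have E: "left_module A E"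
  proof (rule left_moduleI, goal_cases)
    case (2 f g)
    then have "lin K A A f" "lin K A A g" by (simp_all add: E_def mod_hom_lin)
    from lin_restrict[OF lin_add[OF this A_left_module] A_left_module] show ?case by (simp add: E_def)
  next
    case 3
    show ?case using lin_restrict[OF lin_const_zero[OF A_left_module] A_left_module] by (simp add: E_def)
  next
    case (7 f)
    then have f: "f \<in> mod_hom K A A" by (simp add: E_def)
    have "lin K A A (\<lambda>x. \<ominus>\<^bsub>A\<^esub> f x)"
      by (rule linI) (use linD[OF mod_hom_lin[OF f]] in \<open>auto simp: A.minus_add A.smult_r_minus\<close>)
    from lin_restrict[OF this A_left_module] show ?case
      by (intro bexI[of _ "\<lambda>x\<in>carrier A. \<ominus>\<^bsub>A\<^esub> f x"]) (use cl[OF f] in \<open>auto simp: E_def A.l_neg\<close>)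
  next
    case (8 a f)
    then show ?case using right_mult_hom by (simp add: E_def)
  next
    case (9 a b f)
    then have "f \<in> mod_hom K A A" by (simp add: E_def)
    with 9 show ?case using ad[of f] by (auto simp: E_def A.r_distr)
  next
    case (12 f)
    then show ?case using ex[of f] by (auto simp: E_def restrict_def)
  next
    case (6 f)
    then show ?case using ex[of f] cl[of f] by (auto simp: E_def restrict_def)
  qed (auto simp: E_def cl A_ring A.a_ac A.m_assoc intro!: ext simp: restrict_def)
  have "lin K A A (\<lambda>x. x \<otimes>\<^bsub>A\<^esub> a)" if "a \<in> carrier A" for a
    by (rule linI) (use that in \<open>auto simp: A.l_distr A.smult_mult_left\<close>)
  note Ra = lin_restrict[OF this A_left_module]
  have R: "lin A (self_module A) E (\<lambda>a. \<lambda>x\<in>carrier A. x \<otimes>\<^bsub>A\<^esub> a)"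
    by (rule linI) (use Ra in \<open>auto simp: E_def A.r_distr A.m_assoc\<close>)
  have Rinj: "inj_on (\<lambda>a. \<lambda>x\<in>carrier A. x \<otimes>\<^bsub>A\<^esub> a) (carrier (self_module A))"
  proof (rule inj_onI)
    fix a b assume ab: "a \<in> carrier (self_module A)" "b \<in> carrier (self_module A)"
      and eq: "(\<lambda>x\<in>carrier A. x \<otimes>\<^bsub>A\<^esub> a) = (\<lambda>x\<in>carrier A. x \<otimes>\<^bsub>A\<^esub> b)"
    from fun_cong[OF eq, of "\<one>\<^bsub>A\<^esub>"] show "a = b" using ab by simp
  qed
  obtain S where S: "finite S" "S \<subseteq> carrier A" "\<And>W. subm K A W \<Longrightarrow> S \<subseteq> W \<Longrightarrow> carrier A \<subseteq> W"
    using fin_genE[OF A_fg A_left_module] by blast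
  obtain m where m: "bij_betw m {..<card S} S"
    using ex_bij_betw_nat_finite[OF S(1)] by (auto simp: atLeast0LessThan)
  \<comment> \<open>A linear endomorphism is determined by its values on the spanning set
    \<open>S\<close>. Listing them embeds \<open>E\<close> into \<open>nat \<Rightarrow> 'a\<close>,
    which brings \<open>E\<close> within reach of the test in \<open>injective\<close>.\<close>
  let ?\<iota> = "\<lambda>f j. if j < card S then f (m j) else \<zero>\<^bsub>A\<^esub>"
  have "inj_on ?\<iota> (carrier E)"
  proof (rule inj_onI)
    fix f g assume "f \<in> carrier E" "g \<in> carrier E" and eq: "?\<iota> f = ?\<iota> g"
    then have f: "f \<in> mod_hom K A A" and g: "g \<in> mod_hom K A A" by (simp_all add: E_def)
    have fgm: "f (m j) = g (m j)" if "j < card S" for j using fun_cong[OF eq, of j] that by simp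
    have "carrier A \<subseteq> {x \<in> carrier A. f x = g x}"
    proof (rule S(3))
      interpret AA: left_module K A by (rule A_left_module)
      show "subm K A {x \<in> carrier A. f x = g x}"
        by (rule submI) (auto simp: linD[OF mod_hom_lin[OF f]] linD[OF mod_hom_lin[OF g]]
            lin_zero[OF mod_hom_lin[OF f] A_left_module A_left_module]
            lin_zero[OF mod_hom_lin[OF g] A_left_module A_left_module])
      show "S \<subseteq> {x \<in> carrier A. f x = g x}"
      proof
        fix x assume "x \<in> S"
        then obtain j where "j < card S" "x = m j" using m by (auto simp: bij_betw_def)
        then show "x \<in> {x \<in> carrier A. f x = g x}" using fgm S(2) \<open>x \<in> S\<close> by auto
      qed
    qed
    then show "f = g" by (intro mod_hom_ext[OF f g]) auto
  qed
  then obtain \<rho> where \<rho>: "lin A E (self_module A) \<rho>"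
    "\<And>a. a \<in> carrier (self_module A) \<Longrightarrow> \<rho> (\<lambda>x\<in>carrier A. x \<otimes>\<^bsub>A\<^esub> a) = a"
    using injective_extend[OF inj A_self E R Rinj lin_id] by blast
  have "(\<lambda>x\<in>carrier A. x \<otimes>\<^bsub>A\<^esub> \<one>\<^bsub>A\<^esub>) = (\<lambda>x\<in>carrier A. x)" by (rule restrict_ext) simp
  then have "avg \<rho>" unfolding avg_def using linD[OF \<rho>(1)] \<rho>(2)[of "\<one>\<^bsub>A\<^esub>"] by (simp add: E_def)
  then show "\<exists>\<rho>. avg \<rho>" by (rule exI[where x = \<rho>])
qed

text \<open>\<open>f\<close> is first extended to a map \<open>F\<close> that is linear over the
  field only. Averaging the maps \<open>x \<mapsto> F (x y)\<close> restores linearity over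
  \<open>A\<close>, by equivariance of \<open>\<rho>\<close>, and leaves the values on
  \<open>X\<close> unchanged.\<close>

lemma avg_extend:
  assumes av: "avg \<rho>" and Y: "left_module A Y" "fin_gen A Y" and X: "subm A Y X"
    and f: "lin A (Y\<lparr>carrier := X\<rparr>) (self_module A) f"
  obtains F where "lin A Y (self_module A) F" "\<And>x. x \<in> X \<Longrightarrow> F x = f x"
proof -
  interpret Y: left_module A Y by fact
  have sY: "left_module K (scalars A Y)" by (rule scalars_left_module[OF Y(1)])
  have "fin_gen K (scalars A Y)" using fin_gen_scalars_iff[OF Y(1)] Y(2) by simp
  moreover have "lin K ((scalars A Y)\<lparr>carrier := X\<rparr>) A f"
    by (rule linI) (use linD[OF f] submD[OF X] in \<open>auto simp: sc_smult\<close>)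
  ultimately obtain F where F: "lin K (scalars A Y) A F" "\<And>x. x \<in> X \<Longrightarrow> F x = f x"
    using lin_extend[OF K_field sY _ scalars_subm[OF X]] by blast
  note Fl = linD[OF F(1), simplified]
  let ?g = "\<lambda>y. \<lambda>x\<in>carrier A. F (x \<odot>\<^bsub>Y\<^esub> y)"
  have g: "?g y \<in> mod_hom K A A" if y: "y \<in> carrier Y" for y
  proof (rule lin_restrict[OF _ A_left_module], rule linI)
    fix c x assume "c \<in> carrier K" "x \<in> carrier A"
    then show "F ((c \<odot>\<^bsub>A\<^esub> x) \<odot>\<^bsub>Y\<^esub> y) = c \<odot>\<^bsub>A\<^esub> F (x \<odot>\<^bsub>Y\<^esub> y)"
      using Fl(3)[of c "x \<odot>\<^bsub>Y\<^esub> y"] Y.smult_assoc1[of "sc c" x y] y by (simp add: sc_smult)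
  qed (use Fl y in \<open>auto simp: Y.smult_l_distr\<close>)
  show ?thesis
  proof (rule that[of "\<lambda>y. \<rho> (?g y)"])
    show "lin A Y (self_module A) (\<lambda>y. \<rho> (?g y))"
    proof (rule linI)
      fix y z assume yz: "y \<in> carrier Y" "z \<in> carrier Y"
      then have "?g (y \<oplus>\<^bsub>Y\<^esub> z) = (\<lambda>x\<in>carrier A. ?g y x \<oplus>\<^bsub>A\<^esub> ?g z x)"
        using Fl by (auto simp: Y.smult_r_distr)
      then show "\<rho> (?g (y \<oplus>\<^bsub>Y\<^esub> z)) = \<rho> (?g y) \<oplus>\<^bsub>self_module A\<^esub> \<rho> (?g z)"
        using avgD(2)[OF av g[OF yz(1)] g[OF yz(2)]] by simp
    next
      fix a y assume ay: "a \<in> carrier A" "y \<in> carrier Y"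
      then have "?g (a \<odot>\<^bsub>Y\<^esub> y) = (\<lambda>x\<in>carrier A. ?g y (x \<otimes>\<^bsub>A\<^esub> a))"
        by (auto simp: Y.smult_assoc1)
      then show "\<rho> (?g (a \<odot>\<^bsub>Y\<^esub> y)) = a \<odot>\<^bsub>self_module A\<^esub> \<rho> (?g y)"
        using avgD(3)[OF av g[OF ay(2)] ay(1)] by simp
    qed (use avgD(1)[OF av g] in simp)
    fix y assume y: "y \<in> X"
    have fy: "f y \<in> carrier A" using linD(1)[OF f, of y] y by simp
    \<comment> \<open>For \<open>y\<close> in \<open>X\<close> the map to be averaged is right
      multiplication by \<open>f y\<close>, that is, the identity precomposed with that
      multiplication; its average is \<open>f y\<close> times the average of the identity.\<close>
    have "?g y = (\<lambda>x\<in>carrier A. (\<lambda>x\<in>carrier A. x) (x \<otimes>\<^bsub>A\<^esub> f y))"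
      using linD(3)[OF f, of _ y] y F(2) submD(5)[OF X _ y] fy by auto
    then have "\<rho> (?g y) = f y \<otimes>\<^bsub>A\<^esub> \<rho> (\<lambda>x\<in>carrier A. x)"
      using avgD(3)[OF av lin_restrict[OF lin_id A_left_module] fy] by (simp only:)
    then show "\<rho> (?g y) = f y" using avgD(4)[OF av] fy by simp
  qed
qed

text \<open>A dual basis writes \<open>f\<close> as the sum of the rank one maps
  \<open>x \<mapsto> co s x \<odot> f s\<close>, and a linear \<open>\<Theta>\<close> is applied
  termwise. \<open>\<Theta>\<close> is described by its behaviour on restricted functions because in
  the applications it is an average or a composite with one.\<close>

lemma rank_one_sum:
  assumes V: "left_module K V" and W: "left_module K W" and U: "left_module K U"
    and S: "finite S" "S \<subseteq> carrier V" "\<And>s. s \<in> S \<Longrightarrow> functional K V (co s)"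
      "\<And>v. v \<in> carrier V \<Longrightarrow> (\<Oplus>\<^bsub>V\<^esub>s\<in>S. co s v \<odot>\<^bsub>V\<^esub> s) = v"
    and f: "f \<in> mod_hom K V W"
    and \<Theta>: "\<And>g. g \<in> mod_hom K V W \<Longrightarrow> \<Theta> g \<in> carrier U"
      "\<And>g h. \<lbrakk>g \<in> mod_hom K V W; h \<in> mod_hom K V W\<rbrakk> \<Longrightarrow> \<Theta> (\<lambda>x\<in>carrier V. g x \<oplus>\<^bsub>W\<^esub> h x) = \<Theta> g \<oplus>\<^bsub>U\<^esub> \<Theta> h"
      "\<And>c g. \<lbrakk>c \<in> carrier K; g \<in> mod_hom K V W\<rbrakk> \<Longrightarrow> \<Theta> (\<lambda>x\<in>carrier V. c \<odot>\<^bsub>W\<^esub> g x) = c \<odot>\<^bsub>U\<^esub> \<Theta> g"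
  shows "\<Theta> f = (\<Oplus>\<^bsub>U\<^esub>s\<in>S. \<Theta> (\<lambda>x\<in>carrier V. co s x \<odot>\<^bsub>W\<^esub> f s))"
proof -
  interpret KK: fd_algebra K "self_module K" by (rule K_fd)
  interpret W: left_module K W by fact
  let ?H = "hom_space (self_module K) V W"
  have sc1: "KK.sc c = c" if "c \<in> carrier K" for c
    using that by (simp add: KK.sc_def) (simp add: self_module_def)
  have H: "left_module K ?H"
    using V W by (intro KK.hom_space_left_module) (simp_all add: left_module_self_iff[OF K.ring_axioms])
  have Hc: "carrier ?H = mod_hom K V W" by (simp add: mod_hom_self_module)
  have \<Theta>l: "lin K ?H U \<Theta>"
    by (rule linI) (use \<Theta> sc1 in \<open>auto simp: mod_hom_self_module\<close>)
  have sV: "s \<in> carrier V" if "s \<in> S" for s using S(2) that by auto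
  have fs: "f s \<in> carrier W" if "s \<in> S" for s using linD(1)[OF mod_hom_lin[OF f] sV[OF that]] .
  let ?E = "\<lambda>s. \<lambda>x\<in>carrier V. co s x \<odot>\<^bsub>W\<^esub> f s"
  have E: "?E s \<in> carrier ?H" if "s \<in> S" for s
    unfolding Hc by (rule lin_restrict[OF lin_smult_const[OF W S(3)[OF that] fs[OF that]] V])
  have "(\<Oplus>\<^bsub>?H\<^esub>s\<in>S. ?E s) = f"
  proof (rule mod_hom_ext[of _ K V W _ W])
    have "(\<Oplus>\<^bsub>?H\<^esub>s\<in>S. ?E s) \<in> carrier ?H"
      using abelian_monoid.finsum_closed[OF abelian_group.axioms(1)[OF left_module.axioms(2)[OF H]], of ?E S] E by auto
    then show "(\<Oplus>\<^bsub>?H\<^esub>s\<in>S. ?E s) \<in> mod_hom K V W" by (simp only: Hc)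
    fix x assume x: "x \<in> carrier V"
    have ev: "lin K ?H W (\<lambda>g. g x)"
      by (rule linI) (use x sc1 linD(1)[OF mod_hom_lin] in \<open>auto simp: mod_hom_self_module\<close>)
    have cs: "co s x \<in> carrier K" if "s \<in> S" for s using linD(1)[OF S(3)[OF that] x] by simp
    have "(\<Oplus>\<^bsub>?H\<^esub>s\<in>S. ?E s) x = (\<Oplus>\<^bsub>W\<^esub>s\<in>S. ?E s x)"
      by (rule lin_finsum[OF ev H W S(1)]) (use E in blast)
    also have "\<dots> = (\<Oplus>\<^bsub>W\<^esub>s\<in>S. f (co s x \<odot>\<^bsub>V\<^esub> s))"
      by (rule W.finsum_cong') (use x cs fs linD(3)[OF mod_hom_lin[OF f] _ sV] in auto)
    also have "\<dots> = f (\<Oplus>\<^bsub>V\<^esub>s\<in>S. co s x \<odot>\<^bsub>V\<^esub> s)"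
      by (rule lin_finsum[OF mod_hom_lin[OF f] V W S(1), symmetric])
        (use cs sV left_module.smult_closed[OF V] in auto)
    finally show "(\<Oplus>\<^bsub>?H\<^esub>s\<in>S. ?E s) x = f x" using S(4)[OF x] by simp
  qed (rule f)
  then have "\<Theta> f = \<Theta> (\<Oplus>\<^bsub>?H\<^esub>s\<in>S. ?E s)" by simp
  also have "\<dots> = (\<Oplus>\<^bsub>U\<^esub>s\<in>S. \<Theta> (?E s))"
    by (rule lin_finsum[OF \<Theta>l H U S(1)]) (use E in blast)
  finally show ?thesis .
qed

text \<open>Evaluation into the double dual is onto in finite dimension. The witness has the values
  of \<open>\<Psi>\<close> on the coordinate functionals as its coordinates.\<close>

lemma double_dual:
  assumes V: "left_module K V" "fin_gen K V"
    and \<Psi>: "\<And>g. g \<in> mod_hom K V (self_module K) \<Longrightarrow> \<Psi> g \<in> carrier K"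
      "\<And>g h. \<lbrakk>g \<in> mod_hom K V (self_module K); h \<in> mod_hom K V (self_module K)\<rbrakk> \<Longrightarrow>
        \<Psi> (\<lambda>x\<in>carrier V. g x \<oplus>\<^bsub>K\<^esub> h x) = \<Psi> g \<oplus>\<^bsub>K\<^esub> \<Psi> h"
      "\<And>c g. \<lbrakk>c \<in> carrier K; g \<in> mod_hom K V (self_module K)\<rbrakk> \<Longrightarrow> \<Psi> (\<lambda>x\<in>carrier V. c \<otimes>\<^bsub>K\<^esub> g x) = c \<otimes>\<^bsub>K\<^esub> \<Psi> g"
  shows "\<exists>z\<in>carrier V. \<forall>w\<in>mod_hom K V (self_module K). w z = \<Psi> w"
proof -
  interpret V: left_module K V by fact
  obtain S co where S: "finite S" "S \<subseteq> carrier V" "\<And>s. s \<in> S \<Longrightarrow> functional K V (co s)"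
      "\<And>v. v \<in> carrier V \<Longrightarrow> (\<Oplus>\<^bsub>V\<^esub>s\<in>S. co s v \<odot>\<^bsub>V\<^esub> s) = v"
    using dual_basis[OF K_field V] by blast
  let ?c = "\<lambda>s. restrict (co s) (carrier V)"
  have c: "?c s \<in> mod_hom K V (self_module K)" if "s \<in> S" for s by (rule lin_restrict[OF S(3)[OF that] V(1)])
  have fn: "(\<lambda>s. \<Psi> (?c s) \<odot>\<^bsub>V\<^esub> s) \<in> S \<rightarrow> carrier V" using \<Psi>(1)[OF c] S(2) by auto
  have "w (\<Oplus>\<^bsub>V\<^esub>s\<in>S. \<Psi> (?c s) \<odot>\<^bsub>V\<^esub> s) = \<Psi> w" if w: "w \<in> mod_hom K V (self_module K)" for w
  proof -
    have sV: "s \<in> carrier V" if "s \<in> S" for s using S(2) that by auto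
    have ws: "w s \<in> carrier K" if "s \<in> S" for s using linD(1)[OF mod_hom_lin[OF w] sV[OF that]] by simp
    have cs: "co s x \<in> carrier K" if "s \<in> S" "x \<in> carrier V" for s x using linD(1)[OF S(3)[OF that(1)] that(2)] by simp
    have "w (\<Oplus>\<^bsub>V\<^esub>s\<in>S. \<Psi> (?c s) \<odot>\<^bsub>V\<^esub> s) = (\<Oplus>\<^bsub>self_module K\<^esub>s\<in>S. w (\<Psi> (?c s) \<odot>\<^bsub>V\<^esub> s))"
      by (rule lin_finsum[OF mod_hom_lin[OF w] V(1) K_self S(1) fn])
    also have "\<dots> = (\<Oplus>\<^bsub>K\<^esub>s\<in>S. \<Psi> (\<lambda>x\<in>carrier V. co s x \<odot>\<^bsub>self_module K\<^esub> w s))"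
      unfolding self_finsum[OF K.ring_axioms]
    proof (rule K.finsum_cong')
      fix s assume s: "s \<in> S"
      have "(\<lambda>x\<in>carrier V. co s x \<odot>\<^bsub>self_module K\<^esub> w s) = (\<lambda>x\<in>carrier V. w s \<otimes>\<^bsub>K\<^esub> ?c s x)"
        using ws[OF s] cs[OF s] by (auto simp: K.m_comm intro!: restrict_ext)
      then have "\<Psi> (\<lambda>x\<in>carrier V. co s x \<odot>\<^bsub>self_module K\<^esub> w s) = w s \<otimes>\<^bsub>K\<^esub> \<Psi> (?c s)"
        using \<Psi>(3)[OF ws[OF s] c[OF s]] by simp
      then show "w (\<Psi> (?c s) \<odot>\<^bsub>V\<^esub> s) = \<Psi> (\<lambda>x\<in>carrier V. co s x \<odot>\<^bsub>self_module K\<^esub> w s)"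
        using linD(3)[OF mod_hom_lin[OF w] \<Psi>(1)[OF c[OF s]] sV[OF s]] ws[OF s] \<Psi>(1)[OF c[OF s]] by (simp add: K.m_comm)
    next
      have "(\<lambda>x\<in>carrier V. co s x \<odot>\<^bsub>self_module K\<^esub> w s) \<in> mod_hom K V (self_module K)" if "s \<in> S" for s
        by (rule lin_restrict[OF lin_smult_const[OF K_self S(3)[OF that]] V(1)]) (use ws that in simp)
      then show "(\<lambda>s. \<Psi> (\<lambda>x\<in>carrier V. co s x \<odot>\<^bsub>self_module K\<^esub> w s)) \<in> S \<rightarrow> carrier K" using \<Psi>(1) by blast
    qed simp
    also have "\<dots> = \<Psi> w" unfolding self_finsum[OF K.ring_axioms, symmetric]
      by (rule rank_one_sum[OF V(1) K_self K_self S w, symmetric]) (use \<Psi> in \<open>simp_all only: self_module_simps\<close>)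
    finally show ?thesis .
  qed
  then show ?thesis using V.finsum_closed[OF fn] by blast
qed

section \<open>Detecting submodules by maps into free modules\<close>

lemma functionals_separate:
  assumes "left_module K V" "fin_gen K V" "x \<in> carrier V" "y \<in> carrier V"
    and "\<And>w. w \<in> mod_hom K V (self_module K) \<Longrightarrow> w x = w y"
  shows "x = y"
proof (rule ccontr)
  interpret V: left_module K V by fact
  assume "x \<noteq> y"
  then have "x \<ominus>\<^bsub>V\<^esub> y \<notin> {\<zero>\<^bsub>V\<^esub>}" using assms(3,4) by (simp add: V.diff_eq_zero_iff)
  then obtain u where u: "functional K V u" "u (x \<ominus>\<^bsub>V\<^esub> y) \<noteq> \<zero>\<^bsub>K\<^esub>"
    using separating_functional[OF K_field assms(1,2) V.subm_zero V.M.minus_closed[OF assms(3,4)]] by blast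
  have "u x = u y" using assms(5)[OF lin_restrict[OF u(1) assms(1)]] assms(3,4) by simp
  then show False using u(2) lin_diff[OF u(1) assms(1) K_self assms(3,4)] linD(1)[OF u(1)] assms(3,4)
    by (simp add: a_inv_cong[of "self_module K" K] K.diff_eq_zero_iff)
qed

lemma left_mult_functional:
  assumes "w \<in> mod_hom K A (self_module K)" "a \<in> carrier A"
  shows "(\<lambda>x\<in>carrier A. w (a \<otimes>\<^bsub>A\<^esub> x)) \<in> mod_hom K A (self_module K)"
proof (rule lin_restrict[OF _ A_left_module])
  have "lin K A A (\<lambda>x. a \<otimes>\<^bsub>A\<^esub> x)"
    by (rule linI) (use assms(2) in \<open>auto simp: A.r_distr A.smult_mult_right\<close>)
  from lin_comp[OF this mod_hom_lin[OF assms(1)]] show "functional K A (\<lambda>x. w (a \<otimes>\<^bsub>A\<^esub> x))" .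
qed

text \<open>
  An averaging operator on the right makes every functional on a left module visible through
  homomorphisms into the algebra; the homomorphisms \<open>z k\<close> are adjoint to
  \<open>w \<mapsto> \<rho> (w(-) k)\<close>.
\<close>

lemma avg_torsionless:
  assumes av: "fd_algebra.avg K (opp A) \<rho>" and Y: "left_module A Y" "fin_gen A Y" and W: "subm A Y W"
    and u: "functional K (scalars A Y) u" and uW: "\<And>w. w \<in> W \<Longrightarrow> u w = \<zero>\<^bsub>K\<^esub>"
  obtains m g where "lin A Y (pow_module (self_module A) m) g" "\<And>w. w \<in> W \<Longrightarrow> g w = (\<lambda>_. \<zero>\<^bsub>A\<^esub>)"
    "\<And>y. \<lbrakk>y \<in> carrier Y; g y = (\<lambda>_. \<zero>\<^bsub>A\<^esub>)\<rbrakk> \<Longrightarrow> u y = \<zero>\<^bsub>K\<^esub>"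
proof -
  interpret O: fd_algebra K "opp A" by (rule opp_fd)
  interpret Y: left_module A Y by fact
  have mh: "mod_hom K (opp A) (opp A) = mod_hom K A A" by (simp add: mod_hom_def)
  note av = O.avgD[OF av, unfolded mh, simplified]
  note avs = O.avg_scale[OF assms(1), unfolded mh, simplified]
  have sY: "left_module K (scalars A Y)" by (rule scalars_left_module[OF Y(1)])
  note ul = linD[OF u, simplified]
  let ?DA = "mod_hom K A (self_module K)"
  let ?w = "\<lambda>w k. \<lambda>x\<in>carrier A. w x \<odot>\<^bsub>A\<^esub> k"
  have wk: "?w w k \<in> mod_hom K A A" if "w \<in> ?DA" "k \<in> carrier A" for w k
    by (rule lin_restrict[OF lin_smult_const[OF A_left_module mod_hom_lin[OF that(1)] that(2)] A_left_module])
  have wc: "w x \<in> carrier K" if "w \<in> ?DA" "x \<in> carrier A" for w x using linD(1)[OF mod_hom_lin[OF that(1)] that(2)] by simp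
  have ad: "u (\<rho> (\<lambda>x\<in>carrier A. f x \<oplus>\<^bsub>A\<^esub> g x) \<odot>\<^bsub>Y\<^esub> y) = u (\<rho> f \<odot>\<^bsub>Y\<^esub> y) \<oplus>\<^bsub>K\<^esub> u (\<rho> g \<odot>\<^bsub>Y\<^esub> y)"
    if "f \<in> mod_hom K A A" "g \<in> mod_hom K A A" "y \<in> carrier Y" for f g y
    using that av(1,2) ul(2) by (simp add: Y.smult_l_distr)
  have hg: "u (\<rho> (\<lambda>x\<in>carrier A. c \<odot>\<^bsub>A\<^esub> f x) \<odot>\<^bsub>Y\<^esub> y) = c \<otimes>\<^bsub>K\<^esub> u (\<rho> f \<odot>\<^bsub>Y\<^esub> y)"
    if "c \<in> carrier K" "f \<in> mod_hom K A A" "y \<in> carrier Y" for c f y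
    using that av(1) avs ul(3)[of c "\<rho> f \<odot>\<^bsub>Y\<^esub> y"] Y.smult_assoc1[of "sc c" "\<rho> f" y] by (simp add: sc_smult)
  have cl: "u (\<rho> f \<odot>\<^bsub>Y\<^esub> y) \<in> carrier K" if "f \<in> mod_hom K A A" "y \<in> carrier Y" for f y
    using ul(1) av(1) that by simp
  \<comment> \<open>For fixed \<open>k\<close> and \<open>y\<close> the right-hand side is linear in
    \<open>w\<close>, hence a functional on the dual of \<open>A\<close>; by finite dimension it is
    evaluation at some element of \<open>A\<close>, called \<open>z k y\<close> below.\<close>
  have ex: "\<exists>z\<in>carrier A. \<forall>w\<in>?DA. w z = u (\<rho> (?w w k) \<odot>\<^bsub>Y\<^esub> y)" if k: "k \<in> carrier A" and y: "y \<in> carrier Y" for k y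
  proof (rule double_dual[OF A_left_module A_fg])
    show "u (\<rho> (?w g k) \<odot>\<^bsub>Y\<^esub> y) \<in> carrier K" if "g \<in> ?DA" for g using cl[OF wk[OF that k] y] .
  next
    fix g h assume g: "g \<in> ?DA" and h: "h \<in> ?DA"
    have "?w (\<lambda>x\<in>carrier A. g x \<oplus>\<^bsub>K\<^esub> h x) k = (\<lambda>x\<in>carrier A. ?w g k x \<oplus>\<^bsub>A\<^esub> ?w h k x)"
      using wc[OF g] wc[OF h] k by (auto simp: A.smult_l_distr)
    then show "u (\<rho> (?w (\<lambda>x\<in>carrier A. g x \<oplus>\<^bsub>K\<^esub> h x) k) \<odot>\<^bsub>Y\<^esub> y) = u (\<rho> (?w g k) \<odot>\<^bsub>Y\<^esub> y) \<oplus>\<^bsub>K\<^esub> u (\<rho> (?w h k) \<odot>\<^bsub>Y\<^esub> y)"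
      using ad[OF wk[OF g k] wk[OF h k] y] by simp
  next
    fix c g assume c: "c \<in> carrier K" and g: "g \<in> ?DA"
    have "?w (\<lambda>x\<in>carrier A. c \<otimes>\<^bsub>K\<^esub> g x) k = (\<lambda>x\<in>carrier A. c \<odot>\<^bsub>A\<^esub> ?w g k x)"
      using wc[OF g] k c by (auto simp: A.smult_assoc1)
    then show "u (\<rho> (?w (\<lambda>x\<in>carrier A. c \<otimes>\<^bsub>K\<^esub> g x) k) \<odot>\<^bsub>Y\<^esub> y) = c \<otimes>\<^bsub>K\<^esub> u (\<rho> (?w g k) \<odot>\<^bsub>Y\<^esub> y)"
      using hg[OF c wk[OF g k] y] by simp
  qed
  define z where "z k y = (SOME z. z \<in> carrier A \<and> (\<forall>w\<in>?DA. w z = u (\<rho> (?w w k) \<odot>\<^bsub>Y\<^esub> y)))" for k y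
  have z: "z k y \<in> carrier A" "\<And>w. w \<in> ?DA \<Longrightarrow> w (z k y) = u (\<rho> (?w w k) \<odot>\<^bsub>Y\<^esub> y)"
    if "k \<in> carrier A" "y \<in> carrier Y" for k y
  proof -
    have "\<exists>z. z \<in> carrier A \<and> (\<forall>w\<in>?DA. w z = u (\<rho> (?w w k) \<odot>\<^bsub>Y\<^esub> y))" using ex[OF that] by blast
    from someI_ex[OF this] show "z k y \<in> carrier A" "\<And>w. w \<in> ?DA \<Longrightarrow> w (z k y) = u (\<rho> (?w w k) \<odot>\<^bsub>Y\<^esub> y)"
      unfolding z_def by blast+
  qed
  note sepA = functionals_separate[OF A_left_module A_fg]
  have zl: "lin A Y (self_module A) (z k)" if k: "k \<in> carrier A" for k
  proof (rule linI)
    fix x y assume xy: "x \<in> carrier Y" "y \<in> carrier Y"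
    have "z k (x \<oplus>\<^bsub>Y\<^esub> y) = z k x \<oplus>\<^bsub>A\<^esub> z k y"
    proof (rule sepA)
      fix w assume w: "w \<in> ?DA"
      show "w (z k (x \<oplus>\<^bsub>Y\<^esub> y)) = w (z k x \<oplus>\<^bsub>A\<^esub> z k y)"
        using z(1)[OF k] z(2)[OF k _ w] xy linD(2)[OF mod_hom_lin[OF w]] av(1)[OF wk[OF w k]] ul(2)
        by (simp add: Y.smult_r_distr)
    qed (use z k xy in auto)
    then show "z k (x \<oplus>\<^bsub>Y\<^esub> y) = z k x \<oplus>\<^bsub>self_module A\<^esub> z k y" by simp
  next
    fix a y assume ay: "a \<in> carrier A" "y \<in> carrier Y"
    have "z k (a \<odot>\<^bsub>Y\<^esub> y) = a \<otimes>\<^bsub>A\<^esub> z k y"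
    proof (rule sepA)
      fix w assume w: "w \<in> ?DA"
      \<comment> \<open>An averaging operator of the opposite algebra satisfies
        \<open>\<rho> (f(a -)) = \<rho> f \<otimes> a\<close>. This takes \<open>a\<close> from the
        argument \<open>y\<close> to the functional \<open>w\<close>, and the defining property of
        \<open>z\<close> returns it as a left factor of \<open>z k y\<close>.\<close>
      let ?v = "\<lambda>x\<in>carrier A. w (a \<otimes>\<^bsub>A\<^esub> x)"
      have v: "?v \<in> ?DA" by (rule left_mult_functional[OF w ay(1)])
      have "w (z k (a \<odot>\<^bsub>Y\<^esub> y)) = u (\<rho> (?w w k) \<odot>\<^bsub>Y\<^esub> (a \<odot>\<^bsub>Y\<^esub> y))" using z(2)[OF k _ w] ay by simp
      also have "\<rho> (?w w k) \<odot>\<^bsub>Y\<^esub> (a \<odot>\<^bsub>Y\<^esub> y) = (\<rho> (?w w k) \<otimes>\<^bsub>A\<^esub> a) \<odot>\<^bsub>Y\<^esub> y"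
        using Y.smult_assoc1 av(1)[OF wk[OF w k]] ay by simp
      also have "\<rho> (?w w k) \<otimes>\<^bsub>A\<^esub> a = \<rho> (\<lambda>x\<in>carrier A. ?w w k (a \<otimes>\<^bsub>A\<^esub> x))"
        using av(3)[OF wk[OF w k] ay(1)] by simp
      also have "(\<lambda>x\<in>carrier A. ?w w k (a \<otimes>\<^bsub>A\<^esub> x)) = ?w ?v k" using ay by auto
      also have "u (\<rho> (?w ?v k) \<odot>\<^bsub>Y\<^esub> y) = ?v (z k y)" using z(2)[OF k ay(2) v] by simp
      also have "\<dots> = w (a \<otimes>\<^bsub>A\<^esub> z k y)" using z(1)[OF k ay(2)] by simp
      finally show "w (z k (a \<odot>\<^bsub>Y\<^esub> y)) = w (a \<otimes>\<^bsub>A\<^esub> z k y)" .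
    qed (use z k ay in auto)
    then show "z k (a \<odot>\<^bsub>Y\<^esub> y) = a \<odot>\<^bsub>self_module A\<^esub> z k y" by simp
  qed (use z k in simp)
  obtain S co where S: "finite S" "S \<subseteq> carrier A" "\<And>s. s \<in> S \<Longrightarrow> functional K A (co s)"
      "\<And>v. v \<in> carrier A \<Longrightarrow> (\<Oplus>\<^bsub>A\<^esub>s\<in>S. co s v \<odot>\<^bsub>A\<^esub> s) = v"
    using dual_basis[OF K_field A_left_module A_fg] by blast
  obtain e where e: "bij_betw e {..<card S} S"
    using ex_bij_betw_nat_finite[OF S(1)] by (auto simp: atLeast0LessThan)
  have eS: "e i \<in> carrier A" if "i < card S" for i using e S(2) that by (auto simp: bij_betw_def)
  let ?g = "\<lambda>y i. if i < card S then z (e i) y else \<zero>\<^bsub>self_module A\<^esub>"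
  show ?thesis
  proof (rule that[of "card S" ?g])
    show "lin A Y (pow_module (self_module A) (card S)) ?g" by (rule pow_tuple[OF zl[OF eS] A_self])
  next
    fix w assume w: "w \<in> W"
    have wY: "w \<in> carrier Y" using submD(2)[OF W w] .
    have "z k w = \<zero>\<^bsub>A\<^esub>" if k: "k \<in> carrier A" for k
    proof (rule sepA[OF z(1)[OF k wY]])
      fix v assume v: "v \<in> ?DA"
      have "\<rho> (?w v k) \<odot>\<^bsub>Y\<^esub> w \<in> W" using submD(5)[OF W av(1)[OF wk[OF v k]] w] .
      then show "v (z k w) = v \<zero>\<^bsub>A\<^esub>"
        using z(2)[OF k wY v] uW functional_zero[OF A_left_module mod_hom_lin[OF v]] by simp
    qed simp
    then show "?g w = (\<lambda>_. \<zero>\<^bsub>A\<^esub>)" using eS by auto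
  next
    fix y assume y: "y \<in> carrier Y" and gy: "?g y = (\<lambda>_. \<zero>\<^bsub>A\<^esub>)"
    have zs: "z s y = \<zero>\<^bsub>A\<^esub>" if "s \<in> S" for s
    proof -
      have "s \<in> e ` {..<card S}" using bij_betw_imp_surj_on[OF e] that by simp
      then obtain i where "i < card S" "s = e i" by auto
      then show ?thesis using fun_cong[OF gy, of i] by simp
    qed
    have i: "(\<lambda>x\<in>carrier A. x) \<in> mod_hom K A A" by (rule lin_restrict[OF lin_id A_left_module])
    \<comment> \<open>The identity is the sum of the maps
      \<open>x \<mapsto> co s x \<odot> s\<close>, so \<open>u y\<close> is the sum of the values
      \<open>co s (z s y)\<close>. All of these vanish, as \<open>?g y\<close> lists the elements
      \<open>z s y\<close>.\<close>
    have "u (\<rho> (\<lambda>x\<in>carrier A. x) \<odot>\<^bsub>Y\<^esub> y) = (\<Oplus>\<^bsub>K\<^esub>s\<in>S. u (\<rho> (\<lambda>x\<in>carrier A. co s x \<odot>\<^bsub>A\<^esub> (\<lambda>x\<in>carrier A. x) s) \<odot>\<^bsub>Y\<^esub> y))"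
      unfolding self_finsum[OF K.ring_axioms, symmetric]
      by (rule rank_one_sum[OF A_left_module A_left_module K_self S i])
        (simp_all only: self_module_simps ad[OF _ _ y] hg[OF _ _ y] cl[OF _ y])
    also have "\<dots> = \<zero>\<^bsub>K\<^esub>"
    proof (rule K.add.finprod_one_eqI)
      fix s assume s: "s \<in> S"
      then have sA: "s \<in> carrier A" using S(2) by auto
      let ?c = "restrict (co s) (carrier A)"
      have c: "?c \<in> ?DA" by (rule lin_restrict[OF S(3)[OF s] A_left_module])
      have eq: "(\<lambda>x\<in>carrier A. co s x \<odot>\<^bsub>A\<^esub> (\<lambda>x\<in>carrier A. x) s) = ?w ?c s" using sA by auto
      show "u (\<rho> (\<lambda>x\<in>carrier A. co s x \<odot>\<^bsub>A\<^esub> (\<lambda>x\<in>carrier A. x) s) \<odot>\<^bsub>Y\<^esub> y) = \<zero>\<^bsub>K\<^esub>"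
        unfolding eq z(2)[OF sA y c, symmetric] zs[OF s]
        by (rule functional_zero[OF A_left_module mod_hom_lin[OF c]])
    qed
    finally show "u y = \<zero>\<^bsub>K\<^esub>" using av(4) y by (simp add: Y.smult_one)
  qed
qed

text \<open>\<open>W\<close> is cut out of \<open>Y\<close> by finitely many coordinates along a
  complement, and each coordinate is visible through homomorphisms into \<open>A\<close> that vanish
  on \<open>W\<close>. Collecting these homomorphisms gives a map to a free module with kernel
  \<open>W\<close>, in effect an embedding of the quotient.\<close>

lemma avg_kernel:
  assumes av: "fd_algebra.avg K (opp A) \<rho>" and Y: "left_module A Y" "fin_gen A Y" and W: "subm A Y W"
  obtains m g where "lin A Y (pow_module (self_module A) m) g" "{y \<in> carrier Y. g y = (\<lambda>_. \<zero>\<^bsub>A\<^esub>)} = W"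
proof -
  interpret Y: left_module A Y by fact
  have sY: "left_module K (scalars A Y)" by (rule scalars_left_module[OF Y(1)])
  interpret sY: left_module K "scalars A Y" by (rule sY)
  have fY: "fin_gen K (scalars A Y)" using fin_gen_scalars_iff[OF Y(1)] Y(2) by simp
  obtain S co where S: "finite S" "S \<subseteq> carrier (scalars A Y)" "\<And>s. s \<in> S \<Longrightarrow> functional K (scalars A Y) (co s)"
    "\<And>s x. \<lbrakk>s \<in> S; x \<in> W\<rbrakk> \<Longrightarrow> co s x = \<zero>\<^bsub>K\<^esub>"
    "\<And>v. v \<in> carrier (scalars A Y) \<Longrightarrow> v \<ominus>\<^bsub>scalars A Y\<^esub> (\<Oplus>\<^bsub>scalars A Y\<^esub>s\<in>S. co s v \<odot>\<^bsub>scalars A Y\<^esub> s) \<in> W"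
    by (rule rel_basis[OF K_field sY fY scalars_subm[OF W]]) blast
  have "\<exists>m g. lin A Y (pow_module (self_module A) m) g \<and> (\<forall>w\<in>W. g w = (\<lambda>_. \<zero>\<^bsub>A\<^esub>)) \<and>
      (\<forall>y\<in>carrier Y. g y = (\<lambda>_. \<zero>\<^bsub>A\<^esub>) \<longrightarrow> (\<forall>s\<in>S'. co s y = \<zero>\<^bsub>K\<^esub>))" if "S' \<subseteq> S" for S'
    using finite_subset[OF that S(1)] that
  proof (induction S')
    case empty
    show ?case
    proof (intro exI conjI)
      show "lin A Y (pow_module (self_module A) 0) (\<lambda>_ _. \<zero>\<^bsub>A\<^esub>)" by (rule linI) (auto simp: pow_carrier)
    qed auto
  next
    case (insert s S')
    then obtain m g where g: "lin A Y (pow_module (self_module A) m) g" "\<forall>w\<in>W. g w = (\<lambda>_. \<zero>\<^bsub>A\<^esub>)"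
      "\<forall>y\<in>carrier Y. g y = (\<lambda>_. \<zero>\<^bsub>A\<^esub>) \<longrightarrow> (\<forall>s\<in>S'. co s y = \<zero>\<^bsub>K\<^esub>)" by auto
    have s: "s \<in> S" using insert.prems by auto
    obtain n h where h: "lin A Y (pow_module (self_module A) n) h" "\<And>w. w \<in> W \<Longrightarrow> h w = (\<lambda>_. \<zero>\<^bsub>A\<^esub>)"
      "\<And>y. \<lbrakk>y \<in> carrier Y; h y = (\<lambda>_. \<zero>\<^bsub>A\<^esub>)\<rbrakk> \<Longrightarrow> co s y = \<zero>\<^bsub>K\<^esub>"
      using avg_torsionless[OF av Y W S(3)[OF s] S(4)[OF s]] by blast
    \<comment> \<open>The two families of coordinates are concatenated: \<open>g\<close> fills the
      first \<open>m\<close> places, \<open>h\<close> the next \<open>n\<close>.\<close>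
    let ?f = "\<lambda>y i. if i < m + n then (if i < m then g y i else h y (i - m)) else \<zero>\<^bsub>self_module A\<^esub>"
    have 1: "lin A Y (self_module A) (\<lambda>y. if i < m then g y i else h y (i - m))" for i
      using lin_comp[OF g(1) pow_proj[OF A_self], of i] lin_comp[OF h(1) pow_proj[OF A_self], of "i - m"]
      by (cases "i < m") simp_all
    have f: "lin A Y (pow_module (self_module A) (m + n)) ?f" by (rule pow_tuple[OF 1 A_self])
    moreover have "\<forall>w\<in>W. ?f w = (\<lambda>_. \<zero>\<^bsub>A\<^esub>)" using g(2) h(2) by auto
    moreover have "g y = (\<lambda>_. \<zero>\<^bsub>A\<^esub>) \<and> h y = (\<lambda>_. \<zero>\<^bsub>A\<^esub>)" if y: "y \<in> carrier Y" and z: "?f y = (\<lambda>_. \<zero>\<^bsub>A\<^esub>)" for y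
    proof (intro conjI ext)
      fix i
      show "g y i = \<zero>\<^bsub>A\<^esub>" using linD(1)[OF g(1) y] fun_cong[OF z, of i] by (cases "i < m") (auto simp: pow_carrier)
      show "h y i = \<zero>\<^bsub>A\<^esub>" using linD(1)[OF h(1) y] fun_cong[OF z, of "i + m"] by (cases "i < n") (auto simp: pow_carrier)
    qed
    ultimately show ?case using g(3) h(3) by (intro exI[of _ "m + n"] exI[of _ ?f]) blast
  qed
  from this[OF order_refl] obtain m g where g: "lin A Y (pow_module (self_module A) m) g" "\<forall>w\<in>W. g w = (\<lambda>_. \<zero>\<^bsub>A\<^esub>)"
      "\<forall>y\<in>carrier Y. g y = (\<lambda>_. \<zero>\<^bsub>A\<^esub>) \<longrightarrow> (\<forall>s\<in>S. co s y = \<zero>\<^bsub>K\<^esub>)" by blast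
  have "y \<in> W" if y: "y \<in> carrier Y" "g y = (\<lambda>_. \<zero>\<^bsub>A\<^esub>)" for y
  proof -
    have "(\<Oplus>\<^bsub>scalars A Y\<^esub>s\<in>S. co s y \<odot>\<^bsub>scalars A Y\<^esub> s) = \<zero>\<^bsub>scalars A Y\<^esub>"
      by (rule sY.add.finprod_one_eqI) (use g(3) y S(2) sY.sm_l_null in \<open>auto simp del: scalars_smult\<close>)
    then show ?thesis using S(5)[of y] y sY.minus_zero_eq by (simp add: a_minus_def del: scalars_smult)
  qed
  then have "{y \<in> carrier Y. g y = (\<lambda>_. \<zero>\<^bsub>A\<^esub>)} = W" using g(2) submD(2)[OF W] by auto
  then show ?thesis using that g(1) by blast
qed

end

section \<open>Complete resolutions\<close>

context fd_algebra
begin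

abbreviation "Fr \<equiv> pow_module (self_module A)"

lemma Fr: "left_module A (Fr r)" by (rule pow_left_module[OF A_self])
lemma Fr_fg: "fin_gen A (Fr r)" by (rule pow_fin_gen[OF A_self self_fin_gen[OF A_ring]])

text \<open>The kernel of \<open>f\<close> is finitely generated by \<open>fin_gen_sub\<close>, and
  a free cover of it is the next map on the left.\<close>

lemma left_step:
  assumes "lin A (Fr r) N f" "left_module A N"
  shows "\<exists>r' f'. lin A (Fr r') (Fr r) f' \<and> f' ` carrier (Fr r') = {x \<in> carrier (Fr r). f x = \<zero>\<^bsub>N\<^esub>}"
proof -
  let ?W = "{x \<in> carrier (Fr r). f x = \<zero>\<^bsub>N\<^esub>}"
  have W: "subm A (Fr r) ?W" by (rule subm_ker[OF assms(1) Fr assms(2)])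
  obtain r' p where p: "lin A (Fr r') ((Fr r)\<lparr>carrier := ?W\<rparr>) p" "p ` carrier (Fr r') = carrier ((Fr r)\<lparr>carrier := ?W\<rparr>)"
    using free_cover[OF left_module.subm_left_module[OF Fr W] fin_gen_sub[OF Fr Fr_fg W]] by blast
  have "lin A (Fr r') (Fr r) p" by (rule lin_upd_cod_weaken[OF p(1)]) auto
  then show ?thesis using p(2) by auto
qed

text \<open>The cokernel of \<open>f\<close> embeds into a free module; expressed as a map on
  \<open>Fr s\<close> with prescribed kernel, this needs no quotient.\<close>

lemma right_step:
  assumes "fd_algebra.avg K (opp A) \<rho>" "lin A (Fr r) (Fr s) f"
  shows "\<exists>s' f'. lin A (Fr s) (Fr s') f' \<and> {x \<in> carrier (Fr s). f' x = (\<lambda>_. \<zero>\<^bsub>A\<^esub>)} = f ` carrier (Fr r)"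
  by (rule avg_kernel[OF assms(1) Fr Fr_fg subm_range[OF assms(2) Fr Fr]]) (intro exI conjI)

text \<open>The two halves meet in \<open>f0\<close>, which amounts to the cover
  \<open>\<eta>\<close> of \<open>M\<close> followed by an embedding of \<open>M\<close> into a free
  module: it has the kernel of \<open>\<eta>\<close>, where the left half starts, and an image from
  which the right half continues. Dependent choice is used since each step depends on the map chosen
  before it.\<close>

lemma free_resolution:
  assumes av: "fd_algebra.avg K (opp A) \<rho>" and M: "left_module A M" and fg: "fin_gen A M"
  shows "\<exists>(r :: int \<Rightarrow> nat) \<delta> \<eta>.
    (\<forall>n. lin A (Fr (r n)) (Fr (r (n - 1))) (\<delta> n)) \<and>
    (\<forall>n. \<delta> (n + 1) ` carrier (Fr (r (n + 1))) = {x \<in> carrier (Fr (r n)). \<delta> n x = (\<lambda>_. \<zero>\<^bsub>A\<^esub>)}) \<and>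
    lin A (Fr (r 0)) M \<eta> \<and> \<eta> ` carrier (Fr (r 0)) = carrier M \<and>
    {x \<in> carrier (Fr (r 0)). \<eta> x = \<zero>\<^bsub>M\<^esub>} = \<delta> 1 ` carrier (Fr (r 1))"
proof -
  obtain r0 \<eta> where \<eta>: "lin A (Fr r0) M \<eta>" "\<eta> ` carrier (Fr r0) = carrier M" using free_cover[OF M fg] .
  have sk: "subm A (Fr r0) {x \<in> carrier (Fr r0). \<eta> x = \<zero>\<^bsub>M\<^esub>}" by (rule subm_ker[OF \<eta>(1) Fr M])
  obtain s0 f0 where f0: "lin A (Fr r0) (Fr s0) f0"
    "{x \<in> carrier (Fr r0). f0 x = (\<lambda>_. \<zero>\<^bsub>A\<^esub>)} = {x \<in> carrier (Fr r0). \<eta> x = \<zero>\<^bsub>M\<^esub>}"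
    by (rule avg_kernel[OF av Fr Fr_fg sk])
  \<comment> \<open>A triple stands for a map from \<open>Fr r\<close> to \<open>Fr s\<close>;
    carrying the ranks along lets the recursion run in a single type.\<close>
  define ok where "ok x \<longleftrightarrow> (case x of (r, s, f) \<Rightarrow> lin A (Fr r) (Fr s) f)" for x :: "nat \<times> nat \<times> ((nat \<Rightarrow> 'a) \<Rightarrow> nat \<Rightarrow> 'a)"
  define im where "im x = (case x of (r, s, f) \<Rightarrow> f ` carrier (Fr r))" for x :: "nat \<times> nat \<times> ((nat \<Rightarrow> 'a) \<Rightarrow> nat \<Rightarrow> 'a)"
  define ker where "ker x = (case x of (r, s, f) \<Rightarrow> {v \<in> carrier (Fr r). f v = (\<lambda>_. \<zero>\<^bsub>A\<^esub>)})" for x :: "nat \<times> nat \<times> ((nat \<Rightarrow> 'a) \<Rightarrow> nat \<Rightarrow> 'a)"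
  let ?x0 = "(r0, s0, f0)"
  have ok0: "ok ?x0" using f0(1) by (simp add: ok_def)
  have "\<exists>L. \<forall>n. (ok (L n) \<and> (n = 0 \<longrightarrow> L n = ?x0)) \<and> (fst (snd (L (Suc n))) = fst (L n) \<and> im (L (Suc n)) = ker (L n))"
  proof (rule dependent_nat_choice)
    show "\<exists>x. ok x \<and> (0 = 0 \<longrightarrow> x = ?x0)" using ok0 by blast
    fix x and n :: nat
    assume "ok x \<and> (n = 0 \<longrightarrow> x = ?x0)"
    then obtain r s f where x: "x = (r, s, f)" "lin A (Fr r) (Fr s) f" by (cases x) (auto simp: ok_def)
    obtain r' f' where "lin A (Fr r') (Fr r) f'" "f' ` carrier (Fr r') = {x \<in> carrier (Fr r). f x = \<zero>\<^bsub>Fr s\<^esub>}"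
      using left_step[OF x(2) Fr] by blast
    then show "\<exists>y. (ok y \<and> (Suc n = 0 \<longrightarrow> y = ?x0)) \<and> fst (snd y) = fst x \<and> im y = ker x"
      by (intro exI[of _ "(r', r, f')"]) (simp add: ok_def im_def ker_def x)
  qed
  then obtain L where L: "\<And>n. ok (L n)" "L 0 = ?x0" "\<And>n. fst (snd (L (Suc n))) = fst (L n)" "\<And>n. im (L (Suc n)) = ker (L n)"
    by blast
  have "\<exists>R. \<forall>n. (ok (R n) \<and> (n = 0 \<longrightarrow> R n = ?x0)) \<and> (fst (R (Suc n)) = fst (snd (R n)) \<and> ker (R (Suc n)) = im (R n))"
  proof (rule dependent_nat_choice)
    show "\<exists>x. ok x \<and> (0 = 0 \<longrightarrow> x = ?x0)" using ok0 by blast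
    fix x and n :: nat
    assume "ok x \<and> (n = 0 \<longrightarrow> x = ?x0)"
    then obtain r s f where x: "x = (r, s, f)" "lin A (Fr r) (Fr s) f" by (cases x) (auto simp: ok_def)
    obtain s' f' where "lin A (Fr s) (Fr s') f'" "{x \<in> carrier (Fr s). f' x = (\<lambda>_. \<zero>\<^bsub>A\<^esub>)} = f ` carrier (Fr r)"
      using right_step[OF av x(2)] by blast
    then show "\<exists>y. (ok y \<and> (Suc n = 0 \<longrightarrow> y = ?x0)) \<and> fst y = fst (snd x) \<and> ker y = im x"
      by (intro exI[of _ "(s, s', f')"]) (simp add: ok_def im_def ker_def x)
  qed
  then obtain R where R: "\<And>n. ok (R n)" "R 0 = ?x0" "\<And>n. fst (R (Suc n)) = fst (snd (R n))" "\<And>n. ker (R (Suc n)) = im (R n)"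
    by blast
  \<comment> \<open>\<open>X n\<close> is the differential that leaves degree \<open>n\<close>.
    \<open>L\<close> supplies the degrees from \<open>0\<close> upwards and \<open>R\<close> those
    from \<open>0\<close> downwards; they agree in degree \<open>0\<close>, where both are
    \<open>f0\<close>.\<close>
  define X where "X n = (if n \<ge> 0 then L (nat n) else R (nat (- n)))" for n :: int
  have X_R: "X n = R (nat (- n))" if "n \<le> 0" for n using that L(2) R(2) by (cases "n = 0") (auto simp: X_def)
  have okX: "ok (X n)" for n using L(1) R(1) by (simp add: X_def)
  have X_src: "fst (snd (X (n + 1))) = fst (X n)" and X_ex: "im (X (n + 1)) = ker (X n)" for n
  proof -
    have *: "fst (snd (X (n + 1))) = fst (X n) \<and> im (X (n + 1)) = ker (X n)"
    proof (cases "n \<ge> 0")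
      case True
      then have "nat (n + 1) = Suc (nat n)" by simp
      then show ?thesis using L(3,4)[of "nat n"] True by (simp add: X_def)
    next
      case False
      then have "nat (- n) = Suc (nat (- (n + 1)))" by simp
      then show ?thesis using R(3,4)[of "nat (- (n + 1))"] False by (simp add: X_R)
    qed
    then show "fst (snd (X (n + 1))) = fst (X n)" "im (X (n + 1)) = ker (X n)" by blast+
  qed
  have tgt: "fst (snd (X n)) = fst (X (n - 1))" for n using X_src[of "n - 1"] by simp
  show ?thesis
  proof (intro exI[of _ "\<lambda>n. fst (X n)"] exI[of _ "\<lambda>n. snd (snd (X n))"] exI[of _ \<eta>] conjI allI)
    show "lin A (Fr (fst (X n))) (Fr (fst (X (n - 1)))) (snd (snd (X n)))" for n
      using okX[of n] tgt[of n] by (simp add: ok_def case_prod_unfold)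
    show e: "snd (snd (X (n + 1))) ` carrier (Fr (fst (X (n + 1)))) = {x \<in> carrier (Fr (fst (X n))). snd (snd (X n)) x = (\<lambda>_. \<zero>\<^bsub>A\<^esub>)}" for n
      using X_ex[of n] by (simp add: im_def ker_def case_prod_unfold)
    have X0: "X 0 = ?x0" using L(2) by (simp add: X_def)
    show "lin A (Fr (fst (X 0))) M \<eta>" "\<eta> ` carrier (Fr (fst (X 0))) = carrier M" using \<eta> by (simp_all add: X0)
    show "{x \<in> carrier (Fr (fst (X 0))). \<eta> x = \<zero>\<^bsub>M\<^esub>} = snd (snd (X 1)) ` carrier (Fr (fst (X 1)))"
      using e[of 0] f0(2) by (simp add: X0)
  qed
qed

text \<open>\<open>\<rho>'\<close> builds the complex of free modules and \<open>\<rho>\<close>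
  makes its dual acyclic. The projective resolution that the definition demands is the truncation of
  \<open>T\<close> to degrees at least \<open>0\<close>, with zero modules below and the identity as
  comparison map.\<close>

lemma complete_resolution_exists:
  assumes av: "avg \<rho>" and av': "fd_algebra.avg K (opp A) \<rho>'" and M: "left_module A M" and fg: "fin_gen A M"
  shows "\<exists>(T :: int \<Rightarrow> ('a, nat \<Rightarrow> 'a) module) d. complete_resolution A M T d"
proof -
  define Q where "Q r \<delta> \<eta> \<longleftrightarrow> (\<forall>n. lin A (Fr (r n)) (Fr (r (n - 1))) (\<delta> n)) \<and>
    (\<forall>n. \<delta> (n + 1) ` carrier (Fr (r (n + 1))) = {x \<in> carrier (Fr (r n)). \<delta> n x = (\<lambda>_. \<zero>\<^bsub>A\<^esub>)}) \<and>
    lin A (Fr (r 0)) M \<eta> \<and> \<eta> ` carrier (Fr (r 0)) = carrier M \<and>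
    {x \<in> carrier (Fr (r 0)). \<eta> x = \<zero>\<^bsub>M\<^esub>} = \<delta> 1 ` carrier (Fr (r 1))" for r :: "int \<Rightarrow> nat" and \<delta> \<eta>
  have "\<exists>r \<delta> \<eta>. Q r \<delta> \<eta>" unfolding Q_def by (rule free_resolution[OF av' M fg])
  then obtain r \<delta> \<eta> where "Q r \<delta> \<eta>" by blast
  then have \<delta>: "\<And>n. lin A (Fr (r n)) (Fr (r (n - 1))) (\<delta> n)"
    and ex: "\<And>n. \<delta> (n + 1) ` carrier (Fr (r (n + 1))) = {x \<in> carrier (Fr (r n)). \<delta> n x = (\<lambda>_. \<zero>\<^bsub>A\<^esub>)}"
    and \<eta>: "lin A (Fr (r 0)) M \<eta>" "\<eta> ` carrier (Fr (r 0)) = carrier M"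
    "{x \<in> carrier (Fr (r 0)). \<eta> x = \<zero>\<^bsub>M\<^esub>} = \<delta> 1 ` carrier (Fr (r 1))"
    unfolding Q_def by simp_all
  define T where "T n = Fr (r n)" for n
  define d where "d n = restrict (\<delta> n) (carrier (T n))" for n
  have T: "left_module A (T n)" "fin_gen A (T n)" "projective A (T n)" for n
    using Fr Fr_fg free_projective[OF A_ring] by (simp_all add: T_def)
  have d: "d n \<in> mod_hom A (T n) (T (n - 1))" for n
    unfolding d_def using lin_restrict[OF \<delta> Fr] by (simp add: T_def)
  note dl = mod_hom_lin[OF d]
  have d1: "lin A (T (n + 1)) (T n) (d (n + 1))" for n using dl[of "n + 1"] by simp
  have exact: "d (n + 1) ` carrier (T (n + 1)) = {x \<in> carrier (T n). d n x = \<zero>\<^bsub>T (n - 1)\<^esub>}" for n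
    using ex[of n] by (auto simp: d_def T_def)
  let ?H = "\<lambda>n. hom_space A (T n) (self_module A)"
  have dual: "exact_at (?H (n - 1)) (hom_map (T n) (d n)) (?H n) (hom_map (T (n + 1)) (d (n + 1))) (?H (n + 1))" for n
    unfolding exact_at_def
  proof (intro equalityI subsetI)
    fix f assume "f \<in> hom_map (T n) (d n) ` carrier (?H (n - 1))"
    then obtain g where g: "g \<in> mod_hom A (T (n - 1)) (self_module A)" "f = hom_map (T n) (d n) g" by auto
    have f: "f \<in> carrier (?H n)"
      using linD(1)[OF hom_map_lin[OF T(1) T(1) A_self dl], of g n] g by simp
    have "d n (d (n + 1) x) = \<zero>\<^bsub>T (n - 1)\<^esub>" if "x \<in> carrier (T (n + 1))" for x using exact[of n] that by blast
    then show "f \<in> {x \<in> carrier (?H n). hom_map (T (n + 1)) (d (n + 1)) x = \<zero>\<^bsub>?H (n + 1)\<^esub>}"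
      using f lin_zero[OF mod_hom_lin[OF g(1)] T(1) A_self] linD(1)[OF d1] by (auto simp: g(2) hom_map_def)
  next
    fix f assume f: "f \<in> {x \<in> carrier (?H n). hom_map (T (n + 1)) (d (n + 1)) x = \<zero>\<^bsub>?H (n + 1)\<^esub>}"
    then have f': "f \<in> mod_hom A (T n) (self_module A)" and fz: "hom_map (T (n + 1)) (d (n + 1)) f = (\<lambda>x\<in>carrier (T (n + 1)). \<zero>\<^bsub>A\<^esub>)"
      by simp_all
    have z: "f (d (n + 1) x) = \<zero>\<^bsub>A\<^esub>" if "x \<in> carrier (T (n + 1))" for x
      using fun_cong[OF fz, of x] that by (simp add: hom_map_def)
    \<comment> \<open>A cocycle vanishes on the kernel of \<open>d n\<close>, so it factors through
      the image of \<open>d n\<close>; \<open>avg_extend\<close> extends the factor from that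
      submodule to all of \<open>T (n - 1)\<close>.\<close>
    let ?X = "d n ` carrier (T n)"
    have X: "subm A (T (n - 1)) ?X" by (rule subm_range[OF dl T(1) T(1)])
    have XM: "left_module A ((T (n - 1))\<lparr>carrier := ?X\<rparr>)" by (rule left_module.subm_left_module[OF T(1) X])
    have e: "lin A (T n) ((T (n - 1))\<lparr>carrier := ?X\<rparr>) (d n)" by (rule lin_upd_cod[OF dl]) simp
    have "f x = \<zero>\<^bsub>self_module A\<^esub>" if "x \<in> carrier (T n)" "d n x = \<zero>\<^bsub>(T (n - 1))\<lparr>carrier := ?X\<rparr>\<^esub>" for x
    proof -
      have "x \<in> d (n + 1) ` carrier (T (n + 1))" using that by (simp add: exact)
      then show ?thesis using z by auto
    qed
    then obtain h where h: "lin A ((T (n - 1))\<lparr>carrier := ?X\<rparr>) (self_module A) h" "\<And>x. x \<in> carrier (T n) \<Longrightarrow> h (d n x) = f x"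
      using lin_factor[OF e T(1) XM A_self _ mod_hom_lin[OF f']] by auto
    obtain g where g: "lin A (T (n - 1)) (self_module A) g" "\<And>x. x \<in> ?X \<Longrightarrow> g x = h x"
      using avg_extend[OF av T(1,2) X h(1)] by blast
    have "f = hom_map (T n) (d n) (restrict g (carrier (T (n - 1))))"
      by (rule extensionalityI[of _ "carrier (T n)"])
        (use f' g(2) h(2) linD(1)[OF dl] in \<open>auto simp: mod_hom_iff hom_map_def\<close>)
    then show "f \<in> hom_map (T n) (d n) ` carrier (?H (n - 1))"
      using lin_restrict[OF g(1) T(1)] by auto
  qed
  define P where "P n = (if n \<ge> 0 then T n else Fr 0)" for n :: int
  \<comment> \<open>From degree \<open>0\<close> downwards the differential becomes zero: its target
    is then the zero module \<open>Fr 0\<close>.\<close>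
  define e where "e n = (if n \<ge> 1 then d n else (\<lambda>x\<in>carrier (P n). (\<lambda>_. \<zero>\<^bsub>A\<^esub>)))" for n :: int
  define f where "f n = (if n \<ge> 0 then (\<lambda>x\<in>carrier (T n). x) else (\<lambda>x\<in>carrier (T n). (\<lambda>_. \<zero>\<^bsub>A\<^esub>)))" for n :: int
  have Tz: "\<zero>\<^bsub>T n\<^esub> = (\<lambda>_. \<zero>\<^bsub>A\<^esub>)" for n by (simp add: T_def)
  have Pl: "left_module A (P n)" for n using T(1) Fr by (simp add: P_def)
  have Pz: "\<zero>\<^bsub>P n\<^esub> = (\<lambda>_. \<zero>\<^bsub>A\<^esub>)" for n by (simp add: P_def Tz)
  have zero_hom: "(\<lambda>x\<in>carrier N. (\<lambda>_. \<zero>\<^bsub>A\<^esub>)) \<in> mod_hom A N (P n)" if "left_module A N" for N :: "('a, nat \<Rightarrow> 'a) module" and n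
    using lin_restrict[OF lin_const_zero[OF Pl] that, of n] by (simp add: Pz)
  have F0: "carrier (Fr 0) = {\<zero>\<^bsub>Fr 0\<^esub>}" by (auto simp: pow_carrier)
  have PR: "proj_resolution A M P e"
    unfolding proj_resolution_def
  proof (intro conjI allI impI)
    show "projective A (P n)" for n using T(3) free_projective[OF A_ring] by (simp add: P_def)
    show "e n \<in> mod_hom A (P n) (P (n - 1))" for n
    proof (cases "n \<ge> 1")
      case True then show ?thesis using d[of n] by (simp add: e_def P_def)
    next
      case False then show ?thesis using zero_hom[OF Pl] by (simp add: e_def)
    qed
    show "carrier (P n) = {\<zero>\<^bsub>P n\<^esub>}" if "n < 0" for n using that F0 by (simp add: P_def)
    show "exact_at (P (n + 1)) (e (n + 1)) (P n) (e n) (P (n - 1))" if "n \<ge> 1" for n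
      using exact[of n] that by (simp add: exact_at_def e_def P_def)
    show "\<exists>\<epsilon>\<in>mod_hom A (P 0) M. exact_at (P 1) (e 1) (P 0) \<epsilon> M \<and> \<epsilon> ` carrier (P 0) = carrier M"
    proof (intro bexI conjI)
      show "restrict \<eta> (carrier (T 0)) \<in> mod_hom A (P 0) M"
        using lin_restrict[OF \<eta>(1) Fr] by (simp add: P_def T_def)
      show "exact_at (P 1) (e 1) (P 0) (restrict \<eta> (carrier (T 0))) M"
        using \<eta>(3) by (auto simp: exact_at_def P_def e_def d_def T_def)
      show "restrict \<eta> (carrier (T 0)) ` carrier (P 0) = carrier M" using \<eta>(2) by (simp add: P_def T_def)
    qed
  qed
  have fP: "f n \<in> mod_hom A (T n) (P n)" for n
  proof (cases "n \<ge> 0")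
    case True then show ?thesis using lin_restrict[OF lin_id T(1), of n] by (simp add: f_def P_def)
  next
    case False then show ?thesis using zero_hom[OF T(1)] by (simp add: f_def)
  qed
  have cm: "f (n - 1) (d n x) = e n (f n x)" if x: "x \<in> carrier (T n)" for n x
  proof -
    have dx: "d n x \<in> carrier (T (n - 1))" using linD(1)[OF dl x] .
    consider "n \<ge> 1" | "n = 0" | "n < 0" by linarith
    then show ?thesis
    proof cases
      case 3
      then have "(\<lambda>_. \<zero>\<^bsub>A\<^esub>) \<in> carrier (P n)" using F0 by (simp add: P_def)
      then show ?thesis using 3 x dx by (simp add: f_def e_def)
    qed (use x dx in \<open>auto simp: f_def e_def P_def\<close>)
  qed
  have bj: "bij_betw (f n) (carrier (T n)) (carrier (P n))" if "n \<ge> 0" for n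
    using that by (auto simp: f_def P_def bij_betw_def inj_on_def)
  have "\<exists>(P :: int \<Rightarrow> ('a, nat \<Rightarrow> 'a) module) e f. proj_resolution A M P e \<and> (\<forall>n. f n \<in> mod_hom A (T n) (P n)) \<and>
      (\<forall>n. \<forall>x\<in>carrier (T n). f (n - 1) (d n x) = e n (f n x)) \<and>
      (\<forall>n\<ge>0. bij_betw (f n) (carrier (T n)) (carrier (P n)))"
    by (rule exI[of _ P], rule exI[of _ e], rule exI[of _ f]) (use PR fP cm bj in simp)
  then have "complete_resolution A M T d"
    unfolding complete_resolution_def using T(2,3) d exact dual by (simp add: exact_at_def)
  then show ?thesis by blast
qed

text \<open>The augmentation is \<open>\<epsilon>\<close> after \<open>f 0\<close>. Bijectivity of
  \<open>f\<close> in degrees \<open>0\<close> and \<open>1\<close>, with the commuting square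
  between them, carries exactness at \<open>P 0\<close> over to \<open>T 0\<close>.\<close>

lemma complete_resolution_complete_res:
  fixes T :: "int \<Rightarrow> ('a, nat \<Rightarrow> 'a) module"
  assumes cr: "complete_resolution A M T d" and M: "left_module A M"
  shows "\<exists>\<eta>. complete_res K A M T d \<eta>"
proof -
  have Tp: "projective A (T n)" and Tf: "fin_gen A (T n)" and d: "d n \<in> mod_hom A (T n) (T (n - 1))"
    and exact: "d (n + 1) ` carrier (T (n + 1)) = {x \<in> carrier (T n). d n x = \<zero>\<^bsub>T (n - 1)\<^esub>}"
    and dual: "exact_at (hom_space A (T (n - 1)) (self_module A)) (hom_map (T n) (d n))
      (hom_space A (T n) (self_module A)) (hom_map (T (n + 1)) (d (n + 1))) (hom_space A (T (n + 1)) (self_module A))" for n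
    using cr unfolding complete_resolution_def exact_at_def by blast+
  have T: "left_module A (T n)" for n using Tp[of n] by (simp add: projective_def)
  define Q where "Q P e f \<longleftrightarrow> proj_resolution A M P e \<and> (\<forall>n. f n \<in> mod_hom A (T n) (P n)) \<and>
      (\<forall>n. \<forall>x\<in>carrier (T n). f (n - 1) (d n x) = e n (f n x)) \<and>
      (\<forall>n\<ge>0. bij_betw (f n) (carrier (T n)) (carrier (P n)))" for P :: "int \<Rightarrow> ('a, nat \<Rightarrow> 'a) module" and e f
  have "\<exists>P e f. Q P e f"
    using cr unfolding complete_resolution_def Q_def by (elim conjE)
  then obtain P e f where "Q P e f" by blast
  then have P: "proj_resolution A M P e" and f: "\<And>n. f n \<in> mod_hom A (T n) (P n)"
    and comm: "\<And>n x. x \<in> carrier (T n) \<Longrightarrow> f (n - 1) (d n x) = e n (f n x)"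
    and bij: "\<And>n. n \<ge> 0 \<Longrightarrow> bij_betw (f n) (carrier (T n)) (carrier (P n))"
    unfolding Q_def by simp_all
  have "\<exists>\<epsilon>\<in>mod_hom A (P 0) M. e 1 ` carrier (P 1) = {x \<in> carrier (P 0). \<epsilon> x = \<zero>\<^bsub>M\<^esub>} \<and> \<epsilon> ` carrier (P 0) = carrier M"
    using P unfolding proj_resolution_def exact_at_def by (elim conjE)
  then obtain \<epsilon> where \<epsilon>: "\<epsilon> \<in> mod_hom A (P 0) M" "e 1 ` carrier (P 1) = {x \<in> carrier (P 0). \<epsilon> x = \<zero>\<^bsub>M\<^esub>}"
      "\<epsilon> ` carrier (P 0) = carrier M"
    by auto
  have im: "f n ` carrier (T n) = carrier (P n)" if "n \<ge> 0" for n using bij[OF that] by (simp add: bij_betw_def)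
  let ?\<eta> = "\<lambda>x. \<epsilon> (f 0 x)"
  have \<eta>: "lin A (T 0) M ?\<eta>" by (rule lin_comp[OF mod_hom_lin[OF f] mod_hom_lin[OF \<epsilon>(1)]])
  have "complete_res K A M T d ?\<eta>"
  proof (intro complete_res.intro complete_res_axioms.intro fd_algebra_axioms M Tp Tf mod_hom_lin[OF d] exact \<eta>)
    show "?\<eta> ` carrier (T 0) = carrier M" using im[of 0] \<epsilon>(3) by (metis image_image order_refl)
    show "{x \<in> carrier (T 0). ?\<eta> x = \<zero>\<^bsub>M\<^esub>} = d 1 ` carrier (T 1)"
    proof (intro equalityI subsetI)
      fix x assume "x \<in> d 1 ` carrier (T 1)"
      then obtain y where y: "y \<in> carrier (T 1)" "x = d 1 y" by auto
      have "f 1 y \<in> carrier (P 1)" using im[of 1] y by auto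
      then have "\<epsilon> (e 1 (f 1 y)) = \<zero>\<^bsub>M\<^esub>" using \<epsilon>(2) by blast
      then show "x \<in> {x \<in> carrier (T 0). ?\<eta> x = \<zero>\<^bsub>M\<^esub>}"
        using comm[of y 1] y linD(1)[OF mod_hom_lin[OF d[of 1]]] by simp
    next
      fix x assume "x \<in> {x \<in> carrier (T 0). ?\<eta> x = \<zero>\<^bsub>M\<^esub>}"
      then have x: "x \<in> carrier (T 0)" "\<epsilon> (f 0 x) = \<zero>\<^bsub>M\<^esub>" by simp_all
      then have "f 0 x \<in> e 1 ` carrier (P 1)" using \<epsilon>(2) im[of 0] by auto
      then have "f 0 x \<in> e 1 ` (f 1 ` carrier (T 1))" using im[of 1] by simp
      then obtain y where y: "y \<in> carrier (T 1)" "f 0 x = e 1 (f 1 y)" by auto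
      then have "f 0 x = f 0 (d 1 y)" using comm[of y 1] by simp
      moreover have "d 1 y \<in> carrier (T 0)" using linD(1)[OF mod_hom_lin[OF d[of 1]]] y by simp
      ultimately have "x = d 1 y" using bij[of 0] x(1) by (auto simp: bij_betw_def inj_on_def)
      then show "x \<in> d 1 ` carrier (T 1)" using y by simp
    qed
    fix n g assume g: "lin A (T n) (self_module A) g" and z: "\<And>x. x \<in> carrier (T (n + 1)) \<Longrightarrow> g (d (n + 1) x) = \<zero>\<^bsub>A\<^esub>"
    have d1: "d (n + 1) x \<in> carrier (T n)" if "x \<in> carrier (T (n + 1))" for x
      using linD(1)[OF mod_hom_lin[OF d[of "n + 1"]]] that by simp
    have "restrict g (carrier (T n)) \<in> {x \<in> carrier (hom_space A (T n) (self_module A)).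
       hom_map (T (n + 1)) (d (n + 1)) x = \<zero>\<^bsub>hom_space A (T (n + 1)) (self_module A)\<^esub>}"
      using lin_restrict[OF g T] z d1 by (auto simp: hom_map_def)
    then have "restrict g (carrier (T n)) \<in> hom_map (T n) (d n) ` carrier (hom_space A (T (n - 1)) (self_module A))"
      using dual[of n] by (simp add: exact_at_def)
    then obtain h where h: "h \<in> mod_hom A (T (n - 1)) (self_module A)" "restrict g (carrier (T n)) = hom_map (T n) (d n) h" by auto
    have "g x = h (d n x)" if "x \<in> carrier (T n)" for x
      using fun_cong[OF h(2), of x] that by (simp add: hom_map_def)
    then show "\<exists>h. lin A (T (n - 1)) (self_module A) h \<and> (\<forall>x\<in>carrier (T n). g x = h (d n x))"
      using mod_hom_lin[OF h(1)] by blast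
  qed
  then show ?thesis by blast
qed

subsection \<open>Isomorphisms between the Tate groups\<close>

text \<open>Existence validates the choice made by \<open>chosen_resolution\<close>. The equation
  with a pair matches the \<open>let\<close> in the definitions of the Tate groups.\<close>

lemma chosen_resolution:
  assumes "avg \<rho>" "fd_algebra.avg K (opp A) \<rho>'" "left_module A M" "fin_gen A M"
    and "chosen_resolution A M = (T, d)"
  obtains \<eta> where "complete_res K A M T d \<eta>"
proof -
  have "\<exists>C :: (int \<Rightarrow> ('a, nat \<Rightarrow> 'a) module) \<times> (int \<Rightarrow> (nat \<Rightarrow> 'a) \<Rightarrow> nat \<Rightarrow> 'a).
      complete_resolution A M (fst C) (snd C)" using complete_resolution_exists[OF assms(1-4)] by simp
  from someI_ex[OF this] have "complete_resolution A M T d"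
    using assms(5) unfolding chosen_resolution_def by simp
  from complete_resolution_complete_res[OF this assms(3)] show ?thesis using that by blast
qed

text \<open>With \<open>S\<close> the chosen resolution of \<open>N\<close>, both sides are
  isomorphic to the homology of \<open>Hom(M, S)\<close> in degree \<open>-(n + 1)\<close>: the
  first by balance, the second by duality.\<close>

theorem tate_Ext_dual:
  assumes av: "avg \<rho>" "fd_algebra.avg K (opp A) \<rho>'"
    and M: "left_module A M" "fin_gen A M" and N: "left_module A N" "fin_gen A N"
  shows "mod_iso K (tate_Ext A n M N) (tate_Ext A (- (n + 1)) N (Dst M))"
proof -
  obtain T d where T: "chosen_resolution A M = (T, d)" by (cases "chosen_resolution A M")
  obtain S dS where S: "chosen_resolution A N = (S, dS)" by (cases "chosen_resolution A N")
  obtain \<eta> where cT: "complete_res K A M T d \<eta>" using chosen_resolution[OF av M T] .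
  obtain \<eta>S where cS: "complete_res K A N S dS \<eta>S" using chosen_resolution[OF av N S] .
  interpret two_complete_res K A M T d \<eta> N S dS \<eta>S using cT cS by (rule two_complete_res.intro)
  show ?thesis unfolding tate_Ext_def T S Let_def prod.case
    by (rule mod_iso_trans[OF tate_balance mod_iso_sym[OF ext_dual]])
qed

theorem tate_Tor_Ext:
  assumes av: "avg \<rho>" "fd_algebra.avg K (opp A) \<rho>'"
    and M: "left_module A M" "fin_gen A M" and N: "left_module (opp A) N" "fin_gen K (scalars A N)"
  shows "mod_iso K (tate_Tor K A n N M) (tate_Ext A n M (k_dual K A N))"
proof -
  obtain T d where T: "chosen_resolution A M = (T, d)" by (cases "chosen_resolution A M")
  obtain \<eta> where cT: "complete_res K A M T d \<eta>" using chosen_resolution[OF av M T] .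
  show ?thesis unfolding tate_Ext_def tate_Tor_def T Let_def prod.case
    by (rule mod_iso_sym[OF complete_res.tor_ext[OF cT N]])
qed

text \<open>With \<open>D(N)\<close> for \<open>k_dual K A N\<close>, the chain runs from
  \<open>Tor\<^sub>n(N, M)\<close> to \<open>Ext\<close> in degree \<open>n\<close> of
  \<open>M\<close> with values in \<open>D(N)\<close>, then by \<open>tate_Ext_dual\<close> to
  \<open>Ext\<close> in degree \<open>-(n + 1)\<close> of \<open>D(N)\<close> with values in
  \<open>Dst M\<close>, and back to \<open>Tor\<close>, because \<open>Dst M\<close> is the dual of
  the right module \<open>ring_dual A M\<close>.\<close>

theorem tate_Tor_dual:
  assumes av: "avg \<rho>" "fd_algebra.avg K (opp A) \<rho>'"
    and M: "left_module A M" "fin_gen A M" and N: "left_module (opp A) N" "fin_gen K (scalars A N)"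
  shows "mod_iso K (tate_Tor K A n N M) (tate_Tor K A (- (n + 1)) (ring_dual A M) (k_dual K A N))"
proof -
  have D: "left_module A (k_dual K A N)" by (rule k_dual_left_module[OF N(1)])
  have Df: "fin_gen A (k_dual K A N)" using fin_gen_scalars_iff[OF D] k_dual_fin_gen[OF N] by simp
  show ?thesis
    by (rule mod_iso_trans[OF tate_Tor_Ext[OF av M N] mod_iso_trans[OF tate_Ext_dual[OF av M D Df]
          mod_iso_sym[OF tate_Tor_Ext[OF av D Df ring_dual_left_module[OF M(1)] ring_dual_fin_gen[OF M]]]]])
qed

text \<open>Records that agree on carriers may have different actions elsewhere, so the Hom spaces
  need not be equal as records. The identity map is an isomorphism nonetheless. This is what allows
  a module over the enveloping algebra to be replaced by one rebuilt from its bimodule.\<close>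

lemma tate_Ext_cong:
  assumes av: "avg \<rho>" "fd_algebra.avg K (opp A) \<rho>'"
    and M: "left_module A M" "fin_gen A M" and N: "left_module A N"
    and eq: "carrier N' = carrier N" "zero N' = zero N" "add N' = add N"
      "\<And>a x. \<lbrakk>a \<in> carrier A; x \<in> carrier N\<rbrakk> \<Longrightarrow> a \<odot>\<^bsub>N'\<^esub> x = a \<odot>\<^bsub>N\<^esub> x"
  shows "mod_iso K (tate_Ext A n M N) (tate_Ext A n M N')"
proof -
  obtain T d where TT: "chosen_resolution A M = (T, d)" by (cases "chosen_resolution A M")
  obtain \<eta> where "complete_res K A M T d \<eta>" using chosen_resolution[OF av M TT] .
  then interpret complete_res K A M T d \<eta> .
  interpret N: left_module A N by (rule N)
  have N': "left_module A N'" by (rule left_module_cong[OF N eq])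
  let ?H = "\<lambda>m N. hom_space A (T m) N"
  have H: "left_module K (?H m N)" "left_module K (?H m N')" for m
    by (rule hom_space_left_module[OF T N] hom_space_left_module[OF T N'])+
  have mh: "mod_hom A (T m) N' = mod_hom A (T m) N" for m
    by (auto simp: mod_hom_def eq PiE_def Pi_def)
  have cl: "f x \<in> carrier N" if "f \<in> mod_hom A (T m) N" "x \<in> carrier (T m)" for f m x
    using linD(1)[OF mod_hom_lin[OF that(1)] that(2)] .
  let ?Z = "\<lambda>N. {x \<in> carrier (?H n N). hom_map (T (n + 1)) (d (n + 1)) x = \<zero>\<^bsub>?H (n + 1) N\<^esub>}"
  let ?B = "\<lambda>N. hom_map (T n) (d n) ` carrier (?H (n - 1) N)"
  have Z: "subm K (?H n N) (?Z N)" "subm K (?H n N') (?Z N')"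
    by (rule subm_ker[OF hom_map_lin[OF T T N d'] H(1) H(1)] subm_ker[OF hom_map_lin[OF T T N' d'] H(2) H(2)])+
  have B: "subm K (?H n N) (?B N)" "subm K (?H n N') (?B N')"
    by (rule subm_range[OF hom_map_lin[OF T T N d] H(1) H(1)] subm_range[OF hom_map_lin[OF T T N' d] H(2) H(2)])+
  have ZZ: "?Z N' = ?Z N" and BB: "?B N' = ?B N" by (simp_all add: mh eq)
  have BZ: "?B N \<subseteq> ?Z N"
  proof (intro image_subsetI CollectI conjI)
    fix f assume f: "f \<in> carrier (?H (n - 1) N)"
    show "hom_map (T n) (d n) f \<in> carrier (?H n N)" using linD(1)[OF hom_map_lin[OF T T N d] f] .
    have "f \<zero>\<^bsub>T (n - 1)\<^esub> = \<zero>\<^bsub>N\<^esub>" using lin_zero[OF mod_hom_lin T N] f by simp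
    then show "hom_map (T (n + 1)) (d (n + 1)) (hom_map (T n) (d n) f) = \<zero>\<^bsub>?H (n + 1) N\<^esub>"
      using dd linD(1)[OF d'] by (auto simp: hom_map_def)
  qed
  show ?thesis unfolding tate_Ext_def TT Let_def prod.case homology_at_subquot
  proof (rule subquot_iso[OF H Z(1) B(1) BZ Z(2) B(2), where f = "\<lambda>x. x"])
    show "?B N' \<subseteq> ?Z N'" using BZ by (simp only: ZZ BB)
    fix y assume y: "y \<in> ?Z N'"
    then have "y = y \<oplus>\<^bsub>?H n N'\<^esub> \<zero>\<^bsub>?H n N'\<^esub>"
      using abelian_monoid.r_zero[OF abelian_group.axioms(1)[OF left_module.axioms(2)[OF H(2)]], of y n] by simp
    then show "\<exists>x\<in>?Z N. \<exists>w\<in>?B N'. y = x \<oplus>\<^bsub>?H n N'\<^esub> w" using y submD(3)[OF B(2)] unfolding ZZ by blast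
  next
    fix f assume "f \<in> ?Z N"
    then show "f \<in> ?Z N'" by (simp only: ZZ)
  next
    fix f assume "f \<in> ?Z N"
    show "f \<in> ?B N' \<longleftrightarrow> f \<in> ?B N" by (simp only: BB)
  next
    fix f g show "f \<oplus>\<^bsub>?H n N\<^esub> g = f \<oplus>\<^bsub>?H n N'\<^esub> g" by (simp add: eq)
  next
    fix c f assume "c \<in> carrier K" "f \<in> ?Z N"
    then show "c \<odot>\<^bsub>?H n N\<^esub> f = c \<odot>\<^bsub>?H n N'\<^esub> f" using eq(4) cl[of f n] by (auto intro!: restrict_ext)
  qed
qed

end

section \<open>Tensor products of algebras\<close>

context fd_algebra
begin

text \<open>\<open>G\<close> stands for \<open>V \<otimes> A\<close>, with \<open>q v x\<close> as
  pure tensor and \<open>bar w\<close> as the slice map \<open>w \<otimes> id\<close>. Then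
  \<open>g\<close> is in effect an element of \<open>V \<otimes> Hom\<^sub>k(A, A)\<close>, and
  \<open>z\<close> is its image under \<open>id \<otimes> \<rho>\<close>: a dual basis of
  \<open>V\<close> assembles it from the averages of the slices. The abstract form covers both
  orders of the factors.\<close>

lemma slice_avg:
  assumes av: "avg \<rho>" and V: "left_module K V" "fin_gen K V" and G: "left_module K G"
    and q: "\<And>v x. \<lbrakk>v \<in> carrier V; x \<in> carrier A\<rbrakk> \<Longrightarrow> q v x \<in> carrier G"
    and bar: "\<And>w. w \<in> mod_hom K V (self_module K) \<Longrightarrow> lin K G A (bar w)"
    and bar_q: "\<And>w v x. \<lbrakk>w \<in> mod_hom K V (self_module K); v \<in> carrier V; x \<in> carrier A\<rbrakk> \<Longrightarrow> bar w (q v x) = w v \<odot>\<^bsub>A\<^esub> x"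
    and bar_add: "\<And>w w' z. \<lbrakk>w \<in> mod_hom K V (self_module K); w' \<in> mod_hom K V (self_module K); z \<in> carrier G\<rbrakk> \<Longrightarrow>
        bar (\<lambda>v\<in>carrier V. w v \<oplus>\<^bsub>K\<^esub> w' v) z = bar w z \<oplus>\<^bsub>A\<^esub> bar w' z"
    and bar_smult: "\<And>c w z. \<lbrakk>c \<in> carrier K; w \<in> mod_hom K V (self_module K); z \<in> carrier G\<rbrakk> \<Longrightarrow>
        bar (\<lambda>v\<in>carrier V. c \<otimes>\<^bsub>K\<^esub> w v) z = c \<odot>\<^bsub>A\<^esub> bar w z"
    and g: "lin K A G g"
  shows "\<exists>z\<in>carrier G. \<forall>w\<in>mod_hom K V (self_module K). bar w z = \<rho> (\<lambda>x\<in>carrier A. bar w (g x))"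
proof -
  interpret G: left_module K G by fact
  interpret AA: left_module K A by (rule A_left_module)
  let ?D = "mod_hom K V (self_module K)"
  obtain S co where S: "finite S" "S \<subseteq> carrier V" "\<And>s. s \<in> S \<Longrightarrow> functional K V (co s)"
      "\<And>v. v \<in> carrier V \<Longrightarrow> (\<Oplus>\<^bsub>V\<^esub>s\<in>S. co s v \<odot>\<^bsub>V\<^esub> s) = v"
    using dual_basis[OF K_field V] by blast
  let ?c = "\<lambda>s. restrict (co s) (carrier V)"
  have c: "?c s \<in> ?D" if "s \<in> S" for s by (rule lin_restrict[OF S(3)[OF that] V(1)])
  have sV: "s \<in> carrier V" if "s \<in> S" for s using S(2) that by auto
  have wv: "w v \<in> carrier K" if "w \<in> ?D" "v \<in> carrier V" for w v
    using linD(1)[OF mod_hom_lin[OF that(1)] that(2)] by simp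
  define \<Theta> where "\<Theta> w = \<rho> (\<lambda>x\<in>carrier A. bar w (g x))" for w
  have bg: "(\<lambda>x\<in>carrier A. bar w (g x)) \<in> mod_hom K A A" if "w \<in> ?D" for w
    by (rule lin_restrict[OF lin_comp[OF g bar[OF that]] A_left_module])
  have \<Theta>: "\<Theta> w \<in> carrier A" if "w \<in> ?D" for w unfolding \<Theta>_def by (rule avgD(1)[OF av bg[OF that]])
  have \<Theta>_add: "\<Theta> (\<lambda>v\<in>carrier V. w v \<oplus>\<^bsub>K\<^esub> w' v) = \<Theta> w \<oplus>\<^bsub>A\<^esub> \<Theta> w'" if "w \<in> ?D" "w' \<in> ?D" for w w'
  proof -
    have "(\<lambda>x\<in>carrier A. bar (\<lambda>v\<in>carrier V. w v \<oplus>\<^bsub>K\<^esub> w' v) (g x)) =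
      (\<lambda>x\<in>carrier A. (\<lambda>x\<in>carrier A. bar w (g x)) x \<oplus>\<^bsub>A\<^esub> (\<lambda>x\<in>carrier A. bar w' (g x)) x)"
      using bar_add[OF that] linD(1)[OF g] by (intro restrict_ext) simp
    then show ?thesis unfolding \<Theta>_def using avgD(2)[OF av bg[OF that(1)] bg[OF that(2)]] by (simp only:)
  qed
  have \<Theta>_smult: "\<Theta> (\<lambda>v\<in>carrier V. r \<otimes>\<^bsub>K\<^esub> w v) = r \<odot>\<^bsub>A\<^esub> \<Theta> w" if "r \<in> carrier K" "w \<in> ?D" for r w
  proof -
    have "(\<lambda>x\<in>carrier A. bar (\<lambda>v\<in>carrier V. r \<otimes>\<^bsub>K\<^esub> w v) (g x)) =
      (\<lambda>x\<in>carrier A. r \<odot>\<^bsub>A\<^esub> (\<lambda>x\<in>carrier A. bar w (g x)) x)"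
      using bar_smult[OF that] linD(1)[OF g] by (intro restrict_ext) simp
    then show ?thesis unfolding \<Theta>_def using avg_scale[OF av bg[OF that(2)] that(1)] by (simp only:)
  qed
  have fn: "(\<lambda>s. q s (\<Theta> (?c s))) \<in> S \<rightarrow> carrier G" using q sV \<Theta> c by auto
  have "bar w (\<Oplus>\<^bsub>G\<^esub>s\<in>S. q s (\<Theta> (?c s))) = \<Theta> w" if w: "w \<in> ?D" for w
  proof -
    have "bar w (\<Oplus>\<^bsub>G\<^esub>s\<in>S. q s (\<Theta> (?c s))) = (\<Oplus>\<^bsub>A\<^esub>s\<in>S. bar w (q s (\<Theta> (?c s))))"
      by (rule lin_finsum[OF bar[OF w] G A_left_module S(1) fn])
    also have "\<dots> = (\<Oplus>\<^bsub>A\<^esub>s\<in>S. \<Theta> (\<lambda>v\<in>carrier V. co s v \<odot>\<^bsub>self_module K\<^esub> w s))"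
    proof (rule A.finsum_cong')
      fix s assume s: "s \<in> S"
      have "(\<lambda>v\<in>carrier V. co s v \<odot>\<^bsub>self_module K\<^esub> w s) = (\<lambda>v\<in>carrier V. w s \<otimes>\<^bsub>K\<^esub> ?c s v)"
        using wv[OF c[OF s]] wv[OF w sV[OF s]] by (intro restrict_ext) (simp add: K.m_comm)
      then show "bar w (q s (\<Theta> (?c s))) = \<Theta> (\<lambda>v\<in>carrier V. co s v \<odot>\<^bsub>self_module K\<^esub> w s)"
        using bar_q[OF w sV[OF s] \<Theta>[OF c[OF s]]] \<Theta>_smult[OF wv[OF w sV[OF s]] c[OF s]] by (simp only:)
    next
      have "(\<lambda>v\<in>carrier V. co s v \<odot>\<^bsub>self_module K\<^esub> w s) \<in> ?D" if "s \<in> S" for s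
        by (rule lin_restrict[OF lin_smult_const[OF K_self S(3)[OF that]] V(1)]) (use wv[OF w sV[OF that]] in simp)
      then show "(\<lambda>s. \<Theta> (\<lambda>v\<in>carrier V. co s v \<odot>\<^bsub>self_module K\<^esub> w s)) \<in> S \<rightarrow> carrier A" using \<Theta> by blast
    qed simp
    also have "\<dots> = \<Theta> w"
      by (rule rank_one_sum[OF V(1) K_self A_left_module S w, symmetric])
        (simp_all only: \<Theta> \<Theta>_add \<Theta>_smult self_module_simps)
    finally show ?thesis .
  qed
  then show ?thesis unfolding \<Theta>_def[symmetric] using G.finsum_closed[OF fn] by blast
qed

end

section \<open>The tensor product of two algebras\<close>

locale alg_pair = A: fd_algebra K A + B: fd_algebra K B
  for K :: "('k, 'z) ring_scheme" and A :: "('k, 'a) module" and B :: "('k, 'b) module"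
begin

text \<open>The field is commutative, so a left module over it also serves as the right module that
  \<open>tensor\<close> expects as its first argument.\<close>

lemma A_right: "left_module (opp (self_module K)) A"
proof -
  interpret KK: fd_algebra K "self_module K" by (rule A.K_fd)
  interpret AA: left_module K A by (rule A.A_left_module)
  show ?thesis
  proof (rule left_moduleI, goal_cases)
    case 1 show ?case by (rule ring_opp[OF KK.A_ring])
  next
    case (11 a b x)
    then have "b \<otimes>\<^bsub>self_module K\<^esub> a = a \<otimes>\<^bsub>K\<^esub> b" by (simp add: self_module_def A.K.m_comm)
    with 11 show ?case by (simp add: AA.smult_assoc1)
  next
    case (12 x)
    then show ?case using AA.smult_one by (simp add: self_module_def)
  qed (auto simp: A.A.a_assoc A.A.smult_l_distr A.A.smult_r_distr intro: A.A.a_comm A.A.l_neg)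
qed

sublocale t: tensor_pair K "self_module K" A B
  by (intro tensor_pair.intro tensor_pair_axioms.intro A.K_fd A_right)
    (simp add: left_module_self_iff[OF A.K.ring_axioms] B.A_left_module)

lemma tsc: "c \<in> carrier K \<Longrightarrow> t.sc c = c"
  by (simp add: t.sc_def) (simp add: self_module_def)

abbreviation "G \<equiv> alg_tensor K A B"
abbreviation "pt \<equiv> t.pt"

lemma pt_smult_l: "\<lbrakk>c \<in> carrier K; x \<in> carrier A; y \<in> carrier B\<rbrakk> \<Longrightarrow> pt (c \<odot>\<^bsub>A\<^esub> x) y = c \<odot>\<^bsub>t.TT\<^esub> pt x y"
  using t.pt_smult_l[of c x y] tsc[of c] by simp

lemma pt_smult_r: "\<lbrakk>c \<in> carrier K; x \<in> carrier A; y \<in> carrier B\<rbrakk> \<Longrightarrow> pt x (c \<odot>\<^bsub>B\<^esub> y) = c \<odot>\<^bsub>t.TT\<^esub> pt x y"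
  using t.pt_smult_r[of c x y] tsc[of c] by simp

lemma pt_lin_l: "y \<in> carrier B \<Longrightarrow> lin K A t.TT (\<lambda>x. pt x y)"
  by (rule linI) (simp_all add: t.pt_closed t.pt_add_l pt_smult_l)

lemma pt_lin_r: "x \<in> carrier A \<Longrightarrow> lin K B t.TT (\<lambda>y. pt x y)"
  by (rule linI) (simp_all add: t.pt_closed t.pt_add_r pt_smult_r)

lemma lift:
  assumes V: "left_module K V" and l: "\<And>y. y \<in> carrier B \<Longrightarrow> lin K A V (\<lambda>x. \<phi> x y)"
    and r: "\<And>x. x \<in> carrier A \<Longrightarrow> lin K B V (\<phi> x)"
  shows "lin K t.TT V (tensor_lift K V \<phi>)"
    and "\<lbrakk>x \<in> carrier A; y \<in> carrier B\<rbrakk> \<Longrightarrow> tensor_lift K V \<phi> (pt x y) = \<phi> x y"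
proof -
  have "t.balanced V \<phi>"
    unfolding t.balanced_def
    by (intro conjI ballI) (simp_all add: linD[OF l] linD[OF r] tsc)
  from t.tensor_lift_lin[OF V this]
  show "lin K t.TT V (tensor_lift K V \<phi>)"
    "\<lbrakk>x \<in> carrier A; y \<in> carrier B\<rbrakk> \<Longrightarrow> tensor_lift K V \<phi> (pt x y) = \<phi> x y" .
qed

lemma G_simps [simp]:
  "carrier G = carrier t.TT" "zero G = zero t.TT" "add G = add t.TT" "smult G = smult t.TT"
  "one G = pt \<one>\<^bsub>A\<^esub> \<one>\<^bsub>B\<^esub>"
  by (simp_all add: alg_tensor_def Let_def)

text \<open>Left multiplication by \<open>a \<otimes> b\<close>. The product of
  \<open>alg_tensor\<close> is a nested lift, and this is its inner layer.\<close>

definition Lm where "Lm a b = tensor_lift K t.TT (\<lambda>a' b'. pt (a \<otimes>\<^bsub>A\<^esub> a') (b \<otimes>\<^bsub>B\<^esub> b'))"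

lemma G_mult: "s \<otimes>\<^bsub>G\<^esub> u = tensor_lift K t.TT (\<lambda>a b. Lm a b u) s"
  by (simp add: alg_tensor_def Let_def Lm_def)

lemma A_mult_lin: "a \<in> carrier A \<Longrightarrow> lin K A A (\<lambda>x. a \<otimes>\<^bsub>A\<^esub> x)" "a \<in> carrier A \<Longrightarrow> lin K A A (\<lambda>x. x \<otimes>\<^bsub>A\<^esub> a)"
  by (rule linI; simp add: A.A.r_distr A.A.smult_mult_right A.A.l_distr A.A.smult_mult_left)+

lemma B_mult_lin: "a \<in> carrier B \<Longrightarrow> lin K B B (\<lambda>x. a \<otimes>\<^bsub>B\<^esub> x)" "a \<in> carrier B \<Longrightarrow> lin K B B (\<lambda>x. x \<otimes>\<^bsub>B\<^esub> a)"
  by (rule linI; simp add: B.A.r_distr B.A.smult_mult_right B.A.l_distr B.A.smult_mult_left)+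

lemma Lm:
  assumes "a \<in> carrier A" "b \<in> carrier B"
  shows Lm_lin: "lin K t.TT t.TT (Lm a b)"
    and Lm_pt: "\<lbrakk>a' \<in> carrier A; b' \<in> carrier B\<rbrakk> \<Longrightarrow> Lm a b (pt a' b') = pt (a \<otimes>\<^bsub>A\<^esub> a') (b \<otimes>\<^bsub>B\<^esub> b')"
proof -
  have l: "lin K A t.TT (\<lambda>a'. pt (a \<otimes>\<^bsub>A\<^esub> a') (b \<otimes>\<^bsub>B\<^esub> b'))" if "b' \<in> carrier B" for b'
    using lin_comp[OF A_mult_lin(1)[OF assms(1)] pt_lin_l[of "b \<otimes>\<^bsub>B\<^esub> b'"]] assms that by simp
  have r: "lin K B t.TT (\<lambda>b'. pt (a \<otimes>\<^bsub>A\<^esub> a') (b \<otimes>\<^bsub>B\<^esub> b'))" if "a' \<in> carrier A" for a'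
    using lin_comp[OF B_mult_lin(1)[OF assms(2)] pt_lin_r[of "a \<otimes>\<^bsub>A\<^esub> a'"]] assms that by simp
  show "lin K t.TT t.TT (Lm a b)" unfolding Lm_def by (rule lift(1)[OF t.TT_left_module l r])
  show "Lm a b (pt a' b') = pt (a \<otimes>\<^bsub>A\<^esub> a') (b \<otimes>\<^bsub>B\<^esub> b')" if "a' \<in> carrier A" "b' \<in> carrier B"
    unfolding Lm_def by (rule lift(2)[OF t.TT_left_module l r that])
qed

text \<open>For the outer lift to make sense, \<open>Lm a b u\<close> has to be linear in
  \<open>a\<close> and in \<open>b\<close> for arbitrary \<open>u\<close>; as it is linear in
  \<open>u\<close> as well, pure tensors suffice.\<close>

lemma mult_lin:
  assumes u: "u \<in> carrier t.TT"
  shows mult_lin_l: "lin K t.TT t.TT (\<lambda>s. s \<otimes>\<^bsub>G\<^esub> u)"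
    and mult_pt_l: "\<lbrakk>a \<in> carrier A; b \<in> carrier B\<rbrakk> \<Longrightarrow> pt a b \<otimes>\<^bsub>G\<^esub> u = Lm a b u"
proof -
  interpret T: left_module K t.TT by (rule t.TT_left_module)
  note TT = t.TT_left_module
  have scale: "lin K t.TT t.TT (\<lambda>v. c \<odot>\<^bsub>t.TT\<^esub> f v)" if "c \<in> carrier K" "lin K t.TT t.TT f" for c f
    by (rule linI) (use linD[OF that(2)] that(1) in \<open>simp_all add: T.smult_r_distr T.smult_assoc1[symmetric] A.K.m_comm\<close>)
  have l: "lin K A t.TT (\<lambda>a. Lm a b u)" if b: "b \<in> carrier B" for b
  proof (rule linI)
    fix a assume a: "a \<in> carrier A"
    then show "Lm a b u \<in> carrier t.TT" using linD(1)[OF Lm_lin u] b by simp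
  next
    fix a a' assume a: "a \<in> carrier A" "a' \<in> carrier A"
    then have "a \<oplus>\<^bsub>A\<^esub> a' \<in> carrier A" by simp
    note L = Lm[OF this b] Lm[OF a(1) b] Lm[OF a(2) b]
    show "Lm (a \<oplus>\<^bsub>A\<^esub> a') b u = Lm a b u \<oplus>\<^bsub>t.TT\<^esub> Lm a' b u"
      by (rule t.lin_eq_on_pt[OF TT L(1) lin_add[OF L(3,5) TT] _ u])
        (use a b in \<open>simp add: L A.A.l_distr t.pt_add_l\<close>)
  next
    fix c a assume c: "c \<in> carrier K" and a: "a \<in> carrier A"
    then have "c \<odot>\<^bsub>A\<^esub> a \<in> carrier A" by simp
    note L = Lm[OF this b] Lm[OF a b]
    show "Lm (c \<odot>\<^bsub>A\<^esub> a) b u = c \<odot>\<^bsub>t.TT\<^esub> Lm a b u"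
      by (rule t.lin_eq_on_pt[OF TT L(1) scale[OF c L(3)] _ u])
        (use a b c in \<open>simp add: L A.A.smult_mult_left pt_smult_l\<close>)
  qed
  have r: "lin K B t.TT (\<lambda>b. Lm a b u)" if a: "a \<in> carrier A" for a
  proof (rule linI)
    fix b assume b: "b \<in> carrier B"
    then show "Lm a b u \<in> carrier t.TT" using linD(1)[OF Lm_lin u] a by simp
  next
    fix b b' assume b: "b \<in> carrier B" "b' \<in> carrier B"
    then have "b \<oplus>\<^bsub>B\<^esub> b' \<in> carrier B" by simp
    note L = Lm[OF a this] Lm[OF a b(1)] Lm[OF a b(2)]
    show "Lm a (b \<oplus>\<^bsub>B\<^esub> b') u = Lm a b u \<oplus>\<^bsub>t.TT\<^esub> Lm a b' u"
      by (rule t.lin_eq_on_pt[OF TT L(1) lin_add[OF L(3,5) TT] _ u])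
        (use a b in \<open>simp add: L B.A.l_distr t.pt_add_r\<close>)
  next
    fix c b assume c: "c \<in> carrier K" and b: "b \<in> carrier B"
    then have "c \<odot>\<^bsub>B\<^esub> b \<in> carrier B" by simp
    note L = Lm[OF a this] Lm[OF a b]
    show "Lm a (c \<odot>\<^bsub>B\<^esub> b) u = c \<odot>\<^bsub>t.TT\<^esub> Lm a b u"
      by (rule t.lin_eq_on_pt[OF TT L(1) scale[OF c L(3)] _ u])
        (use a b c in \<open>simp add: L B.A.smult_mult_left pt_smult_r\<close>)
  qed
  show "lin K t.TT t.TT (\<lambda>s. s \<otimes>\<^bsub>G\<^esub> u)" unfolding G_mult by (rule lift(1)[OF TT l r])
  show "pt a b \<otimes>\<^bsub>G\<^esub> u = Lm a b u" if "a \<in> carrier A" "b \<in> carrier B"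
    unfolding G_mult by (rule lift(2)[OF TT l r that])
qed

lemma mult_pt:
  "\<lbrakk>a \<in> carrier A; b \<in> carrier B; a' \<in> carrier A; b' \<in> carrier B\<rbrakk> \<Longrightarrow>
    pt a b \<otimes>\<^bsub>G\<^esub> pt a' b' = pt (a \<otimes>\<^bsub>A\<^esub> a') (b \<otimes>\<^bsub>B\<^esub> b')"
  by (simp add: mult_pt_l t.pt_closed Lm_pt)

lemma mult_closed: "\<lbrakk>s \<in> carrier t.TT; u \<in> carrier t.TT\<rbrakk> \<Longrightarrow> s \<otimes>\<^bsub>G\<^esub> u \<in> carrier t.TT"
  using linD(1)[OF mult_lin_l] .

lemma mult_lin_r:
  assumes s: "s \<in> carrier t.TT" shows "lin K t.TT t.TT (\<lambda>u. s \<otimes>\<^bsub>G\<^esub> u)"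
proof -
  interpret T: left_module K t.TT by (rule t.TT_left_module)
  note TT = t.TT_left_module
  show ?thesis
  proof (rule linI)
    fix u v assume u: "u \<in> carrier t.TT" and v: "v \<in> carrier t.TT"
    then have uv: "u \<oplus>\<^bsub>t.TT\<^esub> v \<in> carrier t.TT" by simp
    show "s \<otimes>\<^bsub>G\<^esub> (u \<oplus>\<^bsub>t.TT\<^esub> v) = s \<otimes>\<^bsub>G\<^esub> u \<oplus>\<^bsub>t.TT\<^esub> s \<otimes>\<^bsub>G\<^esub> v"
      by (rule t.lin_eq_on_pt[OF TT mult_lin_l[OF uv] lin_add[OF mult_lin_l[OF u] mult_lin_l[OF v] TT] _ s])
        (simp add: mult_pt_l u v uv linD(2)[OF Lm_lin])
  next
    fix c u assume c: "c \<in> carrier K" and u: "u \<in> carrier t.TT"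
    then have cu: "c \<odot>\<^bsub>t.TT\<^esub> u \<in> carrier t.TT" by simp
    have scale: "lin K t.TT t.TT (\<lambda>s. c \<odot>\<^bsub>t.TT\<^esub> (s \<otimes>\<^bsub>G\<^esub> u))"
      by (rule linI) (use linD[OF mult_lin_l[OF u]] c in \<open>simp_all add: T.smult_r_distr T.smult_assoc1[symmetric] A.K.m_comm\<close>)
    show "s \<otimes>\<^bsub>G\<^esub> (c \<odot>\<^bsub>t.TT\<^esub> u) = c \<odot>\<^bsub>t.TT\<^esub> (s \<otimes>\<^bsub>G\<^esub> u)"
      by (rule t.lin_eq_on_pt[OF TT mult_lin_l[OF cu] scale _ s])
        (simp add: mult_pt_l u c cu linD(3)[OF Lm_lin])
  qed (rule mult_closed[OF s])
qed

text \<open>Both sides are linear in each of the three factors, which are reduced to pure tensors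
  one after the other.\<close>

lemma mult_assoc:
  assumes s: "s \<in> carrier t.TT" and u: "u \<in> carrier t.TT" and v: "v \<in> carrier t.TT"
  shows "(s \<otimes>\<^bsub>G\<^esub> u) \<otimes>\<^bsub>G\<^esub> v = s \<otimes>\<^bsub>G\<^esub> (u \<otimes>\<^bsub>G\<^esub> v)"
proof (rule t.lin_eq_on_pt[OF t.TT_left_module lin_comp[OF mult_lin_l[OF u] mult_lin_l[OF v]] mult_lin_l[OF mult_closed[OF u v]] _ s])
  fix a b assume a: "a \<in> carrier A" and b: "b \<in> carrier B"
  then have ab: "pt a b \<in> carrier t.TT" by (rule t.pt_closed)
  show "(pt a b \<otimes>\<^bsub>G\<^esub> u) \<otimes>\<^bsub>G\<^esub> v = pt a b \<otimes>\<^bsub>G\<^esub> (u \<otimes>\<^bsub>G\<^esub> v)"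
  proof (rule t.lin_eq_on_pt[OF t.TT_left_module lin_comp[OF mult_lin_r[OF ab] mult_lin_l[OF v]]
        lin_comp[OF mult_lin_l[OF v] mult_lin_r[OF ab]] _ u])
    fix a' b' assume a': "a' \<in> carrier A" and b': "b' \<in> carrier B"
    then have ab': "pt a' b' \<in> carrier t.TT" by (rule t.pt_closed)
    show "(pt a b \<otimes>\<^bsub>G\<^esub> pt a' b') \<otimes>\<^bsub>G\<^esub> v = pt a b \<otimes>\<^bsub>G\<^esub> (pt a' b' \<otimes>\<^bsub>G\<^esub> v)"
    proof (rule t.lin_eq_on_pt[OF t.TT_left_module mult_lin_r[OF mult_closed[OF ab ab']]
          lin_comp[OF mult_lin_r[OF ab'] mult_lin_r[OF ab]] _ v])
      fix a'' b'' assume "a'' \<in> carrier A" "b'' \<in> carrier B"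
      then show "(pt a b \<otimes>\<^bsub>G\<^esub> pt a' b') \<otimes>\<^bsub>G\<^esub> pt a'' b'' = pt a b \<otimes>\<^bsub>G\<^esub> (pt a' b' \<otimes>\<^bsub>G\<^esub> pt a'' b'')"
        using a b a' b' by (simp add: mult_pt A.A.m_assoc B.A.m_assoc)
    qed
  qed
qed

lemma G_ring: "ring G"
proof -
  interpret T: left_module K t.TT by (rule t.TT_left_module)
  have 1: "pt \<one>\<^bsub>A\<^esub> \<one>\<^bsub>B\<^esub> \<in> carrier t.TT" by (simp add: t.pt_closed)
  show ?thesis
  proof (intro ringI abelian_groupI monoidI, goal_cases)
    case (6 s)
    then show ?case by (intro bexI[of _ "\<ominus>\<^bsub>t.TT\<^esub> s"]) (simp_all add: T.l_neg)
  next
    case (7 s u) then show ?case using mult_closed by simp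
  next
    case (9 s u v) then show ?case using mult_assoc by simp
  next
    case (10 s)
    then have s: "s \<in> carrier t.TT" by simp
    show ?case unfolding G_simps
      by (rule t.lin_eq_on_pt[OF t.TT_left_module mult_lin_r[OF 1] lin_id _ s]) (simp add: mult_pt)
  next
    case (11 s)
    then have s: "s \<in> carrier t.TT" by simp
    show ?case unfolding G_simps
      by (rule t.lin_eq_on_pt[OF t.TT_left_module mult_lin_l[OF 1] lin_id _ s]) (simp add: mult_pt)
  next
    case (12 s u v) then show ?case using linD(2)[OF mult_lin_l] by simp
  next
    case (13 s u v) then show ?case using linD(2)[OF mult_lin_r] by simp
  qed (simp_all add: T.a_ac 1)
qed

lemma TT_fg: "fin_gen K t.TT"
proof (rule t.TT_fin_gen)
  have "lin K A (scalars (self_module K) A) (\<lambda>x. x)" by (rule linI) (simp_all add: tsc)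
  then show "fin_gen K (scalars (self_module K) A)"
    by (rule fin_gen_surj[OF A.A_fg _ A.A_left_module t.N_scalars]) simp
  have "lin K B (scalars (self_module K) B) (\<lambda>x. x)" by (rule linI) (simp_all add: tsc)
  then show "fin_gen K (scalars (self_module K) B)"
    by (rule fin_gen_surj[OF B.A_fg _ B.A_left_module t.scalars_left_module[OF t.M]]) simp
qed

lemma G_fd: "fd_algebra K G"
proof (intro fd_algebra.intro A.K_field k_algebra.intro k_algebra_axioms.intro G_ring)
  interpret T: left_module K t.TT by (rule t.TT_left_module)
  interpret G: ring G by (rule G_ring)
  have lm: "left_module K G"
    by (intro left_module.intro left_module_axioms.intro A.K.ring_axioms G.abelian_group_axioms)
      (simp_all add: T.smult_l_distr T.smult_r_distr T.smult_assoc1 T.smult_one)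
  show "module K G"
    by (rule moduleI) (simp_all add: A.K.is_cring G.abelian_group_axioms T.smult_l_distr T.smult_r_distr T.smult_assoc1 T.smult_one)
  have "lin K t.TT G (\<lambda>x. x)" by (rule linI) simp_all
  then show "fin_gen K G" by (rule fin_gen_surj[OF TT_fg _ t.TT_left_module lm]) simp
qed (use linD(3)[OF mult_lin_l] linD(3)[OF mult_lin_r] in simp_all)

sublocale G: fd_algebra K G by (rule G_fd)

text \<open>The slice maps \<open>w \<otimes> id\<close>, with values in \<open>B\<close>, and
  \<open>id \<otimes> v\<close>, with values in \<open>A\<close>. They act as coordinates on the
  tensor product with values in the other factor.\<close>

definition barA where "barA w = tensor_lift K B (\<lambda>x y. w x \<odot>\<^bsub>B\<^esub> y)"
definition barB where "barB v = tensor_lift K A (\<lambda>x y. v y \<odot>\<^bsub>A\<^esub> x)"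

lemma barA:
  assumes w: "w \<in> mod_hom K A (self_module K)"
  shows barA_lin: "lin K t.TT B (barA w)"
    and barA_pt: "\<lbrakk>x \<in> carrier A; y \<in> carrier B\<rbrakk> \<Longrightarrow> barA w (pt x y) = w x \<odot>\<^bsub>B\<^esub> y"
proof -
  note wl = linD[OF mod_hom_lin[OF w], simplified]
  have l: "lin K A B (\<lambda>x. w x \<odot>\<^bsub>B\<^esub> y)" if "y \<in> carrier B" for y
    by (rule lin_smult_const[OF B.A_left_module mod_hom_lin[OF w] that])
  have r: "lin K B B (\<lambda>y. w x \<odot>\<^bsub>B\<^esub> y)" if "x \<in> carrier A" for x
    by (rule linI) (use wl(1)[OF that] in \<open>simp_all add: B.A.smult_r_distr B.A.smult_assoc1[symmetric] A.K.m_comm\<close>)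
  show "lin K t.TT B (barA w)" unfolding barA_def by (rule lift(1)[OF B.A_left_module l r])
  show "barA w (pt x y) = w x \<odot>\<^bsub>B\<^esub> y" if "x \<in> carrier A" "y \<in> carrier B"
    unfolding barA_def by (rule lift(2)[OF B.A_left_module l r that])
qed

lemma barB:
  assumes v: "v \<in> mod_hom K B (self_module K)"
  shows barB_lin: "lin K t.TT A (barB v)"
    and barB_pt: "\<lbrakk>x \<in> carrier A; y \<in> carrier B\<rbrakk> \<Longrightarrow> barB v (pt x y) = v y \<odot>\<^bsub>A\<^esub> x"
proof -
  note vl = linD[OF mod_hom_lin[OF v], simplified]
  have r: "lin K B A (\<lambda>y. v y \<odot>\<^bsub>A\<^esub> x)" if "x \<in> carrier A" for x
    by (rule lin_smult_const[OF A.A_left_module mod_hom_lin[OF v] that])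
  have l: "lin K A A (\<lambda>x. v y \<odot>\<^bsub>A\<^esub> x)" if "y \<in> carrier B" for y
    by (rule linI) (use vl(1)[OF that] in \<open>simp_all add: A.A.smult_r_distr A.A.smult_assoc1[symmetric] A.K.m_comm\<close>)
  show "lin K t.TT A (barB v)" unfolding barB_def by (rule lift(1)[OF A.A_left_module l r])
  show "barB v (pt x y) = v y \<odot>\<^bsub>A\<^esub> x" if "x \<in> carrier A" "y \<in> carrier B"
    unfolding barB_def by (rule lift(2)[OF A.A_left_module l r that])
qed

text \<open>With a dual basis of \<open>A\<close>, every tensor \<open>z\<close> is the sum of the
  tensors \<open>pt s (barA (co s) z)\<close>, so it is determined by its slices. The formula is
  linear in \<open>z\<close> and is verified on pure tensors.\<close>

lemma barA_separates:
  assumes z: "z \<in> carrier t.TT" and z': "z' \<in> carrier t.TT"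
    and eq: "\<And>w. w \<in> mod_hom K A (self_module K) \<Longrightarrow> barA w z = barA w z'"
  shows "z = z'"
proof -
  interpret T: left_module K t.TT by (rule t.TT_left_module)
  obtain S co where S: "finite S" "S \<subseteq> carrier A" "\<And>s. s \<in> S \<Longrightarrow> functional K A (co s)"
      "\<And>v. v \<in> carrier A \<Longrightarrow> (\<Oplus>\<^bsub>A\<^esub>s\<in>S. co s v \<odot>\<^bsub>A\<^esub> s) = v"
    using dual_basis[OF A.K_field A.A_left_module A.A_fg] by blast
  let ?c = "\<lambda>s. restrict (co s) (carrier A)"
  have c: "?c s \<in> mod_hom K A (self_module K)" if "s \<in> S" for s by (rule lin_restrict[OF S(3)[OF that] A.A_left_module])
  have sA: "s \<in> carrier A" if "s \<in> S" for s using S(2) that by auto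
  have cx: "co s x \<in> carrier K" if "s \<in> S" "x \<in> carrier A" for s x using linD(1)[OF S(3)[OF that(1)] that(2)] by simp
  have ex: "(\<Oplus>\<^bsub>t.TT\<^esub>s\<in>S. pt s (barA (?c s) z)) = z" if z: "z \<in> carrier t.TT" for z
  proof (rule t.lin_eq_on_pt[OF t.TT_left_module _ lin_id _ z])
    show "lin K t.TT t.TT (\<lambda>z. \<Oplus>\<^bsub>t.TT\<^esub>s\<in>S. pt s (barA (?c s) z))"
      by (rule lin_sum[OF S(1) lin_comp[OF barA_lin[OF c] pt_lin_r[OF sA]] t.TT_left_module t.TT_left_module])
    fix x y assume x: "x \<in> carrier A" and y: "y \<in> carrier B"
    have "(\<Oplus>\<^bsub>t.TT\<^esub>s\<in>S. pt s (barA (?c s) (pt x y))) = (\<Oplus>\<^bsub>t.TT\<^esub>s\<in>S. pt (co s x \<odot>\<^bsub>A\<^esub> s) y)"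
      by (rule T.finsum_cong') (use x y sA cx in \<open>simp_all add: barA_pt[OF c] pt_smult_l pt_smult_r t.pt_closed\<close>)
    also have "\<dots> = pt (\<Oplus>\<^bsub>A\<^esub>s\<in>S. co s x \<odot>\<^bsub>A\<^esub> s) y"
      by (rule lin_finsum[OF pt_lin_l[OF y] A.A_left_module t.TT_left_module S(1), symmetric]) (use sA cx x in auto)
    finally show "(\<Oplus>\<^bsub>t.TT\<^esub>s\<in>S. pt s (barA (?c s) (pt x y))) = pt x y" using S(4)[OF x] by simp
  qed
  have "(\<Oplus>\<^bsub>t.TT\<^esub>s\<in>S. pt s (barA (?c s) z)) = (\<Oplus>\<^bsub>t.TT\<^esub>s\<in>S. pt s (barA (?c s) z'))"
    by (rule T.finsum_cong') (use eq c linD(1)[OF barA_lin[OF c] z'] sA in \<open>auto intro!: t.pt_closed\<close>)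
  then show ?thesis unfolding ex[OF z] ex[OF z'] .
qed

lemma barB_separates:
  assumes z: "z \<in> carrier t.TT" and z': "z' \<in> carrier t.TT"
    and eq: "\<And>v. v \<in> mod_hom K B (self_module K) \<Longrightarrow> barB v z = barB v z'"
  shows "z = z'"
proof -
  interpret T: left_module K t.TT by (rule t.TT_left_module)
  obtain S co where S: "finite S" "S \<subseteq> carrier B" "\<And>s. s \<in> S \<Longrightarrow> functional K B (co s)"
      "\<And>v. v \<in> carrier B \<Longrightarrow> (\<Oplus>\<^bsub>B\<^esub>s\<in>S. co s v \<odot>\<^bsub>B\<^esub> s) = v"
    using dual_basis[OF A.K_field B.A_left_module B.A_fg] by blast
  let ?c = "\<lambda>s. restrict (co s) (carrier B)"
  have c: "?c s \<in> mod_hom K B (self_module K)" if "s \<in> S" for s by (rule lin_restrict[OF S(3)[OF that] B.A_left_module])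
  have sB: "s \<in> carrier B" if "s \<in> S" for s using S(2) that by auto
  have cy: "co s y \<in> carrier K" if "s \<in> S" "y \<in> carrier B" for s y using linD(1)[OF S(3)[OF that(1)] that(2)] by simp
  have ex: "(\<Oplus>\<^bsub>t.TT\<^esub>s\<in>S. pt (barB (?c s) z) s) = z" if z: "z \<in> carrier t.TT" for z
  proof (rule t.lin_eq_on_pt[OF t.TT_left_module _ lin_id _ z])
    show "lin K t.TT t.TT (\<lambda>z. \<Oplus>\<^bsub>t.TT\<^esub>s\<in>S. pt (barB (?c s) z) s)"
      by (rule lin_sum[OF S(1) lin_comp[OF barB_lin[OF c] pt_lin_l[OF sB]] t.TT_left_module t.TT_left_module])
    fix x y assume x: "x \<in> carrier A" and y: "y \<in> carrier B"
    have "(\<Oplus>\<^bsub>t.TT\<^esub>s\<in>S. pt (barB (?c s) (pt x y)) s) = (\<Oplus>\<^bsub>t.TT\<^esub>s\<in>S. pt x (co s y \<odot>\<^bsub>B\<^esub> s))"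
      by (rule T.finsum_cong') (use x y sB cy in \<open>simp_all add: barB_pt[OF c] pt_smult_l pt_smult_r t.pt_closed\<close>)
    also have "\<dots> = pt x (\<Oplus>\<^bsub>B\<^esub>s\<in>S. co s y \<odot>\<^bsub>B\<^esub> s)"
      by (rule lin_finsum[OF pt_lin_r[OF x] B.A_left_module t.TT_left_module S(1), symmetric]) (use sB cy y in auto)
    finally show "(\<Oplus>\<^bsub>t.TT\<^esub>s\<in>S. pt (barB (?c s) (pt x y)) s) = pt x y" using S(4)[OF y] by simp
  qed
  have "(\<Oplus>\<^bsub>t.TT\<^esub>s\<in>S. pt (barB (?c s) z) s) = (\<Oplus>\<^bsub>t.TT\<^esub>s\<in>S. pt (barB (?c s) z') s)"
    by (rule T.finsum_cong') (use eq c linD(1)[OF barB_lin[OF c] z'] sB in \<open>auto intro!: t.pt_closed\<close>)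
  then show ?thesis unfolding ex[OF z] ex[OF z'] .
qed

lemma scale_lin:
  assumes "left_module K V" "lin K U V f" "c \<in> carrier K"
  shows "lin K U V (\<lambda>x. c \<odot>\<^bsub>V\<^esub> f x)"
proof -
  interpret V: left_module K V by fact
  show ?thesis by (rule linI) (use linD[OF assms(2)] assms(3) in \<open>simp_all add: V.smult_r_distr V.smult_assoc1[symmetric] A.K.m_comm\<close>)
qed

lemma dual_add: "\<lbrakk>left_module K V; w \<in> mod_hom K V (self_module K); w' \<in> mod_hom K V (self_module K)\<rbrakk> \<Longrightarrow>
    (\<lambda>v\<in>carrier V. w v \<oplus>\<^bsub>K\<^esub> w' v) \<in> mod_hom K V (self_module K)"
  using lin_restrict[OF lin_add[OF mod_hom_lin mod_hom_lin A.K_self]] by fastforce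

lemma dual_scale: "\<lbrakk>left_module K V; c \<in> carrier K; w \<in> mod_hom K V (self_module K)\<rbrakk> \<Longrightarrow>
    (\<lambda>v\<in>carrier V. c \<otimes>\<^bsub>K\<^esub> w v) \<in> mod_hom K V (self_module K)"
  using lin_restrict[OF scale_lin[OF A.K_self mod_hom_lin]] by fastforce

text \<open>The value at \<open>g\<close> of \<open>id \<otimes> \<rho>\<close>, averaging in the
  second factor; its counterpart \<open>r1_exists\<close> averages in the first. Characterising the
  value by slices is what later makes it unique.\<close>

lemma r2_exists:
  assumes av: "B.avg \<rho>" and g: "lin K B t.TT g"
  shows "\<exists>z\<in>carrier t.TT. \<forall>w\<in>mod_hom K A (self_module K). barA w z = \<rho> (\<lambda>y\<in>carrier B. barA w (g y))"
proof (rule B.slice_avg[where q = pt, OF av A.A_left_module A.A_fg t.TT_left_module t.pt_closed barA_lin barA_pt _ _ g])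
  fix w w' z assume w: "w \<in> mod_hom K A (self_module K)" and w': "w' \<in> mod_hom K A (self_module K)" and z: "z \<in> carrier t.TT"
  note s = dual_add[OF A.A_left_module w w']
  show "barA (\<lambda>v\<in>carrier A. w v \<oplus>\<^bsub>K\<^esub> w' v) z = barA w z \<oplus>\<^bsub>B\<^esub> barA w' z"
    by (rule t.lin_eq_on_pt[OF B.A_left_module barA_lin[OF s] lin_add[OF barA_lin[OF w] barA_lin[OF w'] B.A_left_module] _ z])
      (use linD(1)[OF mod_hom_lin[OF w]] linD(1)[OF mod_hom_lin[OF w']] in
        \<open>simp add: barA_pt[OF s] barA_pt[OF w] barA_pt[OF w'] B.A.smult_l_distr\<close>)
next
  fix c w z assume c: "c \<in> carrier K" and w: "w \<in> mod_hom K A (self_module K)" and z: "z \<in> carrier t.TT"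
  note s = dual_scale[OF A.A_left_module c w]
  show "barA (\<lambda>v\<in>carrier A. c \<otimes>\<^bsub>K\<^esub> w v) z = c \<odot>\<^bsub>B\<^esub> barA w z"
    by (rule t.lin_eq_on_pt[OF B.A_left_module barA_lin[OF s] scale_lin[OF B.A_left_module barA_lin[OF w] c] _ z])
      (use linD(1)[OF mod_hom_lin[OF w]] c in \<open>simp add: barA_pt[OF s] barA_pt[OF w] B.A.smult_assoc1\<close>)
qed

lemma r1_exists:
  assumes av: "A.avg \<rho>" and g: "lin K A t.TT g"
  shows "\<exists>z\<in>carrier t.TT. \<forall>v\<in>mod_hom K B (self_module K). barB v z = \<rho> (\<lambda>x\<in>carrier A. barB v (g x))"
proof (rule A.slice_avg[where q = "\<lambda>y x. pt x y", OF av B.A_left_module B.A_fg t.TT_left_module t.pt_closed barB_lin barB_pt _ _ g])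
  fix w w' z assume w: "w \<in> mod_hom K B (self_module K)" and w': "w' \<in> mod_hom K B (self_module K)" and z: "z \<in> carrier t.TT"
  note s = dual_add[OF B.A_left_module w w']
  show "barB (\<lambda>v\<in>carrier B. w v \<oplus>\<^bsub>K\<^esub> w' v) z = barB w z \<oplus>\<^bsub>A\<^esub> barB w' z"
    by (rule t.lin_eq_on_pt[OF A.A_left_module barB_lin[OF s] lin_add[OF barB_lin[OF w] barB_lin[OF w'] A.A_left_module] _ z])
      (use linD(1)[OF mod_hom_lin[OF w]] linD(1)[OF mod_hom_lin[OF w']] in
        \<open>simp add: barB_pt[OF s] barB_pt[OF w] barB_pt[OF w'] A.A.smult_l_distr\<close>)
next
  fix c w z assume c: "c \<in> carrier K" and w: "w \<in> mod_hom K B (self_module K)" and z: "z \<in> carrier t.TT"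
  note s = dual_scale[OF B.A_left_module c w]
  show "barB (\<lambda>v\<in>carrier B. c \<otimes>\<^bsub>K\<^esub> w v) z = c \<odot>\<^bsub>A\<^esub> barB w z"
    by (rule t.lin_eq_on_pt[OF A.A_left_module barB_lin[OF s] scale_lin[OF A.A_left_module barB_lin[OF w] c] _ z])
      (use linD(1)[OF mod_hom_lin[OF w]] c in \<open>simp add: barB_pt[OF s] barB_pt[OF w] A.A.smult_assoc1\<close>)
qed

end

section \<open>Slices of products\<close>

context alg_pair
begin

lemma barB_mult:
  assumes v: "v \<in> mod_hom K B (self_module K)" and a: "a \<in> carrier A" and z: "z \<in> carrier t.TT"
  shows "barB v (pt a \<one>\<^bsub>B\<^esub> \<otimes>\<^bsub>G\<^esub> z) = a \<otimes>\<^bsub>A\<^esub> barB v z"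
proof -
  have a1: "pt a \<one>\<^bsub>B\<^esub> \<in> carrier t.TT" using a by (simp add: t.pt_closed)
  have vy: "v y \<in> carrier K" if "y \<in> carrier B" for y using linD(1)[OF mod_hom_lin[OF v] that] by simp
  show ?thesis
    by (rule t.lin_eq_on_pt[OF A.A_left_module lin_comp[OF mult_lin_r[OF a1] barB_lin[OF v]]
          lin_comp[OF barB_lin[OF v] A_mult_lin(1)[OF a]] _ z])
      (use a vy in \<open>simp add: mult_pt barB_pt[OF v] A.A.smult_mult_right\<close>)
qed

lemma barA_mult_r:
  assumes w: "w \<in> mod_hom K A (self_module K)" and b: "b \<in> carrier B" and z: "z \<in> carrier t.TT"
  shows "barA w (pt \<one>\<^bsub>A\<^esub> b \<otimes>\<^bsub>G\<^esub> z) = b \<otimes>\<^bsub>B\<^esub> barA w z"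
proof -
  have b1: "pt \<one>\<^bsub>A\<^esub> b \<in> carrier t.TT" using b by (simp add: t.pt_closed)
  have wx: "w x \<in> carrier K" if "x \<in> carrier A" for x using linD(1)[OF mod_hom_lin[OF w] that] by simp
  show ?thesis
    by (rule t.lin_eq_on_pt[OF B.A_left_module lin_comp[OF mult_lin_r[OF b1] barA_lin[OF w]]
          lin_comp[OF barA_lin[OF w] B_mult_lin(1)[OF b]] _ z])
      (use b wx in \<open>simp add: mult_pt barA_pt[OF w] B.A.smult_mult_right\<close>)
qed

text \<open>A multiplier in the factor that is sliced away is absorbed by the functional, whereas
  one in the remaining factor comes out of the slice, as in \<open>barA_mult_r\<close>.\<close>

lemma barA_mult_l:
  assumes w: "w \<in> mod_hom K A (self_module K)" and a: "a \<in> carrier A" and z: "z \<in> carrier t.TT"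
  shows "barA w (pt a \<one>\<^bsub>B\<^esub> \<otimes>\<^bsub>G\<^esub> z) = barA (\<lambda>x\<in>carrier A. w (a \<otimes>\<^bsub>A\<^esub> x)) z"
proof -
  have a1: "pt a \<one>\<^bsub>B\<^esub> \<in> carrier t.TT" using a by (simp add: t.pt_closed)
  note w' = A.left_mult_functional[OF w a]
  show ?thesis
    by (rule t.lin_eq_on_pt[OF B.A_left_module lin_comp[OF mult_lin_r[OF a1] barA_lin[OF w]] barA_lin[OF w'] _ z])
      (use a in \<open>simp add: mult_pt barA_pt[OF w] barA_pt[OF w']\<close>)
qed

end

text \<open>\<open>avg\<close> speaks of extensional functions. This lemma and the next two restate
  its conditions for maps given by an unrestricted formula.\<close>

lemma (in fd_algebra) avg_lin_add:
  assumes "avg \<rho>" "lin K A A f" "lin K A A g"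
  shows "\<rho> (\<lambda>x\<in>carrier A. f x \<oplus>\<^bsub>A\<^esub> g x) = \<rho> (\<lambda>x\<in>carrier A. f x) \<oplus>\<^bsub>A\<^esub> \<rho> (\<lambda>x\<in>carrier A. g x)"
proof -
  have "(\<lambda>x\<in>carrier A. f x \<oplus>\<^bsub>A\<^esub> g x) = (\<lambda>x\<in>carrier A. (\<lambda>x\<in>carrier A. f x) x \<oplus>\<^bsub>A\<^esub> (\<lambda>x\<in>carrier A. g x) x)"
    by (rule restrict_ext) simp
  then show ?thesis
    using avgD(2)[OF assms(1) lin_restrict[OF assms(2) A_left_module] lin_restrict[OF assms(3) A_left_module]]
    by (simp only:)
qed

lemma (in fd_algebra) avg_lin_scale:
  assumes "avg \<rho>" "lin K A A f" "c \<in> carrier K"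
  shows "\<rho> (\<lambda>x\<in>carrier A. c \<odot>\<^bsub>A\<^esub> f x) = c \<odot>\<^bsub>A\<^esub> \<rho> (\<lambda>x\<in>carrier A. f x)"
proof -
  have "(\<lambda>x\<in>carrier A. c \<odot>\<^bsub>A\<^esub> f x) = (\<lambda>x\<in>carrier A. c \<odot>\<^bsub>A\<^esub> (\<lambda>x\<in>carrier A. f x) x)"
    by (rule restrict_ext) simp
  then show ?thesis
    using avg_scale[OF assms(1) lin_restrict[OF assms(2) A_left_module] assms(3)] by (simp only:)
qed

lemma (in fd_algebra) avg_lin_mult:
  assumes "avg \<rho>" "lin K A A f" "a \<in> carrier A"
  shows "\<rho> (\<lambda>x\<in>carrier A. f (x \<otimes>\<^bsub>A\<^esub> a)) = a \<otimes>\<^bsub>A\<^esub> \<rho> (\<lambda>x\<in>carrier A. f x)"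
proof -
  have "(\<lambda>x\<in>carrier A. f (x \<otimes>\<^bsub>A\<^esub> a)) = (\<lambda>x\<in>carrier A. (\<lambda>x\<in>carrier A. f x) (x \<otimes>\<^bsub>A\<^esub> a))"
    by (rule restrict_ext) (use assms(3) in simp)
  then show ?thesis
    using avgD(3)[OF assms(1) lin_restrict[OF assms(2) A_left_module] assms(3)] by (simp only:)
qed

section \<open>The averaging operator of a tensor product\<close>

context alg_pair
begin

text \<open>Equivariance splits along \<open>a \<otimes> b\<close>: \<open>r1\<close> turns right
  multiplication of its argument by \<open>a\<close> into left multiplication by
  \<open>a \<otimes> 1\<close>, which \<open>r2\<close> lets pass, and \<open>r2\<close> does the
  same for \<open>b\<close>, giving \<open>1 \<otimes> b\<close>. The identity is averaged to
  \<open>y \<mapsto> 1 \<otimes> y\<close> and then to \<open>1 \<otimes> 1\<close>.\<close>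

theorem G_avg:
  assumes avA: "A.avg \<rho>A" and avB: "B.avg \<rho>B"
  shows "\<exists>\<rho>. G.avg \<rho>"
proof -
  interpret T: left_module K t.TT by (rule t.TT_left_module)
  note TT = t.TT_left_module
  let ?DA = "mod_hom K A (self_module K)" and ?DB = "mod_hom K B (self_module K)"
  define r1 where "r1 g = (SOME z. z \<in> carrier t.TT \<and> (\<forall>v\<in>?DB. barB v z = \<rho>A (\<lambda>x\<in>carrier A. barB v (g x))))" for g
  define r2 where "r2 g = (SOME z. z \<in> carrier t.TT \<and> (\<forall>w\<in>?DA. barA w z = \<rho>B (\<lambda>y\<in>carrier B. barA w (g y))))" for g
  have r1: "r1 g \<in> carrier t.TT" "\<And>v. v \<in> ?DB \<Longrightarrow> barB v (r1 g) = \<rho>A (\<lambda>x\<in>carrier A. barB v (g x))"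
    if "lin K A t.TT g" for g
  proof -
    have "\<exists>z. z \<in> carrier t.TT \<and> (\<forall>v\<in>?DB. barB v z = \<rho>A (\<lambda>x\<in>carrier A. barB v (g x)))"
      using r1_exists[OF avA that] by blast
    from someI_ex[OF this] show "r1 g \<in> carrier t.TT" "\<And>v. v \<in> ?DB \<Longrightarrow> barB v (r1 g) = \<rho>A (\<lambda>x\<in>carrier A. barB v (g x))"
      unfolding r1_def by blast+
  qed
  have r2: "r2 g \<in> carrier t.TT" "\<And>w. w \<in> ?DA \<Longrightarrow> barA w (r2 g) = \<rho>B (\<lambda>y\<in>carrier B. barA w (g y))"
    if "lin K B t.TT g" for g
  proof -
    have "\<exists>z. z \<in> carrier t.TT \<and> (\<forall>w\<in>?DA. barA w z = \<rho>B (\<lambda>y\<in>carrier B. barA w (g y)))"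
      using r2_exists[OF avB that] by blast
    from someI_ex[OF this] show "r2 g \<in> carrier t.TT" "\<And>w. w \<in> ?DA \<Longrightarrow> barA w (r2 g) = \<rho>B (\<lambda>y\<in>carrier B. barA w (g y))"
      unfolding r2_def by blast+
  qed
  \<comment> \<open>Slices determine a tensor, so a value of \<open>r1\<close> is recognised by
    exhibiting an element with the prescribed slices. The identities for \<open>r1\<close> and
    \<open>r2\<close> below are all obtained in this way.\<close>
  have r1_eq: "r1 g = z" if "lin K A t.TT g" "z \<in> carrier t.TT"
    "\<And>v. v \<in> ?DB \<Longrightarrow> barB v z = \<rho>A (\<lambda>x\<in>carrier A. barB v (g x))" for g z
    by (rule barB_separates[OF r1(1)[OF that(1)] that(2)]) (simp add: r1(2)[OF that(1)] that(3))
  have r2_eq: "r2 g = z" if "lin K B t.TT g" "z \<in> carrier t.TT"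
    "\<And>w. w \<in> ?DA \<Longrightarrow> barA w z = \<rho>B (\<lambda>y\<in>carrier B. barA w (g y))" for g z
    by (rule barA_separates[OF r2(1)[OF that(1)] that(2)]) (simp add: r2(2)[OF that(1)] that(3))
  have r1_cong: "r1 g = r1 g'" if "lin K A t.TT g" "\<And>x. x \<in> carrier A \<Longrightarrow> g' x = g x" for g g'
  proof (rule r1_eq[OF that(1) r1(1)[OF lin_cong[OF that(1) A.A_left_module that(2)]]])
    fix v assume v: "v \<in> ?DB"
    have "(\<lambda>x\<in>carrier A. barB v (g' x)) = (\<lambda>x\<in>carrier A. barB v (g x))" by (rule restrict_ext) (simp add: that(2))
    then show "barB v (r1 g') = \<rho>A (\<lambda>x\<in>carrier A. barB v (g x))"
      using r1(2)[OF lin_cong[OF that(1) A.A_left_module that(2)] v] by simp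
  qed
  have r2_cong: "r2 g = r2 g'" if "lin K B t.TT g" "\<And>x. x \<in> carrier B \<Longrightarrow> g' x = g x" for g g'
  proof (rule r2_eq[OF that(1) r2(1)[OF lin_cong[OF that(1) B.A_left_module that(2)]]])
    fix w assume w: "w \<in> ?DA"
    have "(\<lambda>x\<in>carrier B. barA w (g' x)) = (\<lambda>x\<in>carrier B. barA w (g x))" by (rule restrict_ext) (simp add: that(2))
    then show "barA w (r2 g') = \<rho>B (\<lambda>x\<in>carrier B. barA w (g x))"
      using r2(2)[OF lin_cong[OF that(1) B.A_left_module that(2)] w] by simp
  qed
  have r1_add: "r1 (\<lambda>x. g x \<oplus>\<^bsub>t.TT\<^esub> h x) = r1 g \<oplus>\<^bsub>t.TT\<^esub> r1 h" if g: "lin K A t.TT g" and h: "lin K A t.TT h" for g h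
  proof (rule r1_eq[OF lin_add[OF g h TT]])
    fix v assume v: "v \<in> ?DB"
    have "(\<lambda>x\<in>carrier A. barB v (g x \<oplus>\<^bsub>t.TT\<^esub> h x)) = (\<lambda>x\<in>carrier A. barB v (g x) \<oplus>\<^bsub>A\<^esub> barB v (h x))"
      by (rule restrict_ext) (simp add: linD(2)[OF barB_lin[OF v]] linD(1)[OF g] linD(1)[OF h])
    then show "barB v (r1 g \<oplus>\<^bsub>t.TT\<^esub> r1 h) = \<rho>A (\<lambda>x\<in>carrier A. barB v (g x \<oplus>\<^bsub>t.TT\<^esub> h x))"
      using A.avg_lin_add[OF avA lin_comp[OF g barB_lin[OF v]] lin_comp[OF h barB_lin[OF v]]]
        linD(2)[OF barB_lin[OF v] r1(1)[OF g] r1(1)[OF h]] r1(2)[OF g v] r1(2)[OF h v] by (simp only:)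
  qed (simp add: r1 g h)
  have r2_add: "r2 (\<lambda>x. g x \<oplus>\<^bsub>t.TT\<^esub> h x) = r2 g \<oplus>\<^bsub>t.TT\<^esub> r2 h" if g: "lin K B t.TT g" and h: "lin K B t.TT h" for g h
  proof (rule r2_eq[OF lin_add[OF g h TT]])
    fix v assume v: "v \<in> ?DA"
    have "(\<lambda>x\<in>carrier B. barA v (g x \<oplus>\<^bsub>t.TT\<^esub> h x)) = (\<lambda>x\<in>carrier B. barA v (g x) \<oplus>\<^bsub>B\<^esub> barA v (h x))"
      by (rule restrict_ext) (simp add: linD(2)[OF barA_lin[OF v]] linD(1)[OF g] linD(1)[OF h])
    then show "barA v (r2 g \<oplus>\<^bsub>t.TT\<^esub> r2 h) = \<rho>B (\<lambda>x\<in>carrier B. barA v (g x \<oplus>\<^bsub>t.TT\<^esub> h x))"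
      using B.avg_lin_add[OF avB lin_comp[OF g barA_lin[OF v]] lin_comp[OF h barA_lin[OF v]]]
        linD(2)[OF barA_lin[OF v] r2(1)[OF g] r2(1)[OF h]] r2(2)[OF g v] r2(2)[OF h v] by (simp only:)
  qed (simp add: r2 g h)
  have r1_scale: "r1 (\<lambda>x. c \<odot>\<^bsub>t.TT\<^esub> g x) = c \<odot>\<^bsub>t.TT\<^esub> r1 g" if c: "c \<in> carrier K" and g: "lin K A t.TT g" for c g
  proof (rule r1_eq[OF scale_lin[OF TT g c]])
    fix v assume v: "v \<in> ?DB"
    have "(\<lambda>x\<in>carrier A. barB v (c \<odot>\<^bsub>t.TT\<^esub> g x)) = (\<lambda>x\<in>carrier A. c \<odot>\<^bsub>A\<^esub> barB v (g x))"
      by (rule restrict_ext) (simp add: linD(3)[OF barB_lin[OF v]] linD(1)[OF g] c)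
    then show "barB v (c \<odot>\<^bsub>t.TT\<^esub> r1 g) = \<rho>A (\<lambda>x\<in>carrier A. barB v (c \<odot>\<^bsub>t.TT\<^esub> g x))"
      using A.avg_lin_scale[OF avA lin_comp[OF g barB_lin[OF v]] c]
        linD(3)[OF barB_lin[OF v] c r1(1)[OF g]] r1(2)[OF g v] by (simp only:)
  qed (simp add: r1 g c)
  have r2_scale: "r2 (\<lambda>x. c \<odot>\<^bsub>t.TT\<^esub> g x) = c \<odot>\<^bsub>t.TT\<^esub> r2 g" if c: "c \<in> carrier K" and g: "lin K B t.TT g" for c g
  proof (rule r2_eq[OF scale_lin[OF TT g c]])
    fix v assume v: "v \<in> ?DA"
    have "(\<lambda>x\<in>carrier B. barA v (c \<odot>\<^bsub>t.TT\<^esub> g x)) = (\<lambda>x\<in>carrier B. c \<odot>\<^bsub>B\<^esub> barA v (g x))"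
      by (rule restrict_ext) (simp add: linD(3)[OF barA_lin[OF v]] linD(1)[OF g] c)
    then show "barA v (c \<odot>\<^bsub>t.TT\<^esub> r2 g) = \<rho>B (\<lambda>x\<in>carrier B. barA v (c \<odot>\<^bsub>t.TT\<^esub> g x))"
      using B.avg_lin_scale[OF avB lin_comp[OF g barA_lin[OF v]] c]
        linD(3)[OF barA_lin[OF v] c r2(1)[OF g]] r2(2)[OF g v] by (simp only:)
  qed (simp add: r2 g c)
  have r1_mult: "r1 (\<lambda>x. g (x \<otimes>\<^bsub>A\<^esub> a)) = pt a \<one>\<^bsub>B\<^esub> \<otimes>\<^bsub>G\<^esub> r1 g" if a: "a \<in> carrier A" and g: "lin K A t.TT g" for a g
  proof (rule r1_eq[OF lin_comp[OF A_mult_lin(2)[OF a] g]])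
    fix v assume v: "v \<in> ?DB"
    show "barB v (pt a \<one>\<^bsub>B\<^esub> \<otimes>\<^bsub>G\<^esub> r1 g) = \<rho>A (\<lambda>x\<in>carrier A. barB v (g (x \<otimes>\<^bsub>A\<^esub> a)))"
      using A.avg_lin_mult[OF avA lin_comp[OF g barB_lin[OF v]] a] barB_mult[OF v a r1(1)[OF g]] r1(2)[OF g v]
      by (simp only:)
  qed (use a g r1 in \<open>auto intro!: mult_closed t.pt_closed\<close>)
  have r2_mult: "r2 (\<lambda>x. g (x \<otimes>\<^bsub>B\<^esub> b)) = pt \<one>\<^bsub>A\<^esub> b \<otimes>\<^bsub>G\<^esub> r2 g" if b: "b \<in> carrier B" and g: "lin K B t.TT g" for b g
  proof (rule r2_eq[OF lin_comp[OF B_mult_lin(2)[OF b] g]])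
    fix v assume v: "v \<in> ?DA"
    show "barA v (pt \<one>\<^bsub>A\<^esub> b \<otimes>\<^bsub>G\<^esub> r2 g) = \<rho>B (\<lambda>x\<in>carrier B. barA v (g (x \<otimes>\<^bsub>B\<^esub> b)))"
      using B.avg_lin_mult[OF avB lin_comp[OF g barA_lin[OF v]] b] barA_mult_r[OF v b r2(1)[OF g]] r2(2)[OF g v]
      by (simp only:)
  qed (use b g r2 in \<open>auto intro!: mult_closed t.pt_closed\<close>)
  \<comment> \<open>In slices over \<open>A\<close>, left multiplication by
    \<open>a \<otimes> 1\<close> only changes the functional, to which the averaging in
    \<open>B\<close> is indifferent.\<close>
  have r2_comm: "r2 (\<lambda>y. pt a \<one>\<^bsub>B\<^esub> \<otimes>\<^bsub>G\<^esub> g y) = pt a \<one>\<^bsub>B\<^esub> \<otimes>\<^bsub>G\<^esub> r2 g" if a: "a \<in> carrier A" and g: "lin K B t.TT g" for a g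
  proof -
    have a1: "pt a \<one>\<^bsub>B\<^esub> \<in> carrier t.TT" using a by (simp add: t.pt_closed)
    show ?thesis
    proof (rule r2_eq[OF lin_comp[OF g mult_lin_r[OF a1]] mult_closed[OF a1 r2(1)[OF g]]])
      fix w assume w: "w \<in> ?DA"
      have "(\<lambda>y\<in>carrier B. barA w (pt a \<one>\<^bsub>B\<^esub> \<otimes>\<^bsub>G\<^esub> g y)) = (\<lambda>y\<in>carrier B. barA (\<lambda>x\<in>carrier A. w (a \<otimes>\<^bsub>A\<^esub> x)) (g y))"
        by (rule restrict_ext) (rule barA_mult_l[OF w a linD(1)[OF g]])
      then show "barA w (pt a \<one>\<^bsub>B\<^esub> \<otimes>\<^bsub>G\<^esub> r2 g) = \<rho>B (\<lambda>y\<in>carrier B. barA w (pt a \<one>\<^bsub>B\<^esub> \<otimes>\<^bsub>G\<^esub> g y))"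
        using barA_mult_l[OF w a r2(1)[OF g]] r2(2)[OF g A.left_mult_functional[OF w a]] by (simp only:)
    qed
  qed
  have r1_pt: "r1 (\<lambda>x. pt x y) = pt \<one>\<^bsub>A\<^esub> y" if y: "y \<in> carrier B" for y
  proof (rule r1_eq[OF pt_lin_l[OF y]])
    fix v assume v: "v \<in> ?DB"
    have vy: "v y \<in> carrier K" using linD(1)[OF mod_hom_lin[OF v] y] by simp
    have "(\<lambda>x\<in>carrier A. barB v (pt x y)) = (\<lambda>x\<in>carrier A. v y \<odot>\<^bsub>A\<^esub> x)"
      by (rule restrict_ext) (simp add: barB_pt[OF v] y)
    then show "barB v (pt \<one>\<^bsub>A\<^esub> y) = \<rho>A (\<lambda>x\<in>carrier A. barB v (pt x y))"
      using A.avg_lin_scale[OF avA lin_id vy] A.avgD(4)[OF avA] barB_pt[OF v _ y] by simp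
  qed (simp add: t.pt_closed y)
  have r2_pt: "r2 (\<lambda>y. pt x y) = pt x \<one>\<^bsub>B\<^esub>" if x: "x \<in> carrier A" for x
  proof (rule r2_eq[OF pt_lin_r[OF x]])
    fix w assume w: "w \<in> ?DA"
    have wx: "w x \<in> carrier K" using linD(1)[OF mod_hom_lin[OF w] x] by simp
    have "(\<lambda>y\<in>carrier B. barA w (pt x y)) = (\<lambda>y\<in>carrier B. w x \<odot>\<^bsub>B\<^esub> y)"
      by (rule restrict_ext) (simp add: barA_pt[OF w] x)
    then show "barA w (pt x \<one>\<^bsub>B\<^esub>) = \<rho>B (\<lambda>y\<in>carrier B. barA w (pt x y))"
      using B.avg_lin_scale[OF avB lin_id wx] B.avgD(4)[OF avB] barA_pt[OF w x] by simp
  qed (simp add: t.pt_closed x)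
  \<comment> \<open>The average of \<open>f\<close> over the first factor, with \<open>y\<close>
    held fixed. Its linearity in \<open>y\<close> is what admits the second average.\<close>
  define h where "h f y = r1 (\<lambda>x. f (pt x y))" for f y
  have in1: "lin K A t.TT (\<lambda>x. f (pt x y))" if "lin K t.TT t.TT f" "y \<in> carrier B" for f y
    by (rule lin_comp[OF pt_lin_l[OF that(2)] that(1)])
  have h: "lin K B t.TT (h f)" if f: "lin K t.TT t.TT f" for f
  proof (rule linI)
    fix y assume "y \<in> carrier B"
    then show "h f y \<in> carrier t.TT" unfolding h_def by (intro r1(1) in1 f)
  next
    fix y y' assume y: "y \<in> carrier B" "y' \<in> carrier B"
    have "h f (y \<oplus>\<^bsub>B\<^esub> y') = r1 (\<lambda>x. f (pt x y) \<oplus>\<^bsub>t.TT\<^esub> f (pt x y'))" unfolding h_def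
      by (rule r1_cong[symmetric, OF lin_add[OF in1[OF f y(1)] in1[OF f y(2)] TT]])
        (simp add: t.pt_add_r y linD(2)[OF f] t.pt_closed)
    then show "h f (y \<oplus>\<^bsub>B\<^esub> y') = h f y \<oplus>\<^bsub>t.TT\<^esub> h f y'"
      unfolding h_def using r1_add[OF in1[OF f y(1)] in1[OF f y(2)]] by simp
  next
    fix c y assume c: "c \<in> carrier K" and y: "y \<in> carrier B"
    have "h f (c \<odot>\<^bsub>B\<^esub> y) = r1 (\<lambda>x. c \<odot>\<^bsub>t.TT\<^esub> f (pt x y))" unfolding h_def
      by (rule r1_cong[symmetric, OF scale_lin[OF TT in1[OF f y] c]])
        (simp add: pt_smult_r y c linD(3)[OF f] t.pt_closed)
    then show "h f (c \<odot>\<^bsub>B\<^esub> y) = c \<odot>\<^bsub>t.TT\<^esub> h f y"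
      unfolding h_def using r1_scale[OF c in1[OF f y]] by simp
  qed
  define \<rho> where "\<rho> f = r2 (h f)" for f
  have \<rho>_closed: "\<rho> f \<in> carrier t.TT" if "lin K t.TT t.TT f" for f unfolding \<rho>_def by (rule r2(1)[OF h[OF that]])
  have \<rho>_cong: "\<rho> f = \<rho> g" if f: "lin K t.TT t.TT f" and eq: "\<And>z. z \<in> carrier t.TT \<Longrightarrow> g z = f z" for f g
    unfolding \<rho>_def
  proof (rule r2_cong[OF h[OF f]])
    fix y assume y: "y \<in> carrier B"
    show "h g y = h f y" unfolding h_def
      by (rule r1_cong[symmetric, OF in1[OF f y]]) (simp add: eq t.pt_closed y)
  qed
  have \<rho>_add: "\<rho> (\<lambda>z. f z \<oplus>\<^bsub>t.TT\<^esub> g z) = \<rho> f \<oplus>\<^bsub>t.TT\<^esub> \<rho> g" if f: "lin K t.TT t.TT f" and g: "lin K t.TT t.TT g" for f g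
  proof -
    have "\<rho> (\<lambda>z. f z \<oplus>\<^bsub>t.TT\<^esub> g z) = r2 (\<lambda>y. h f y \<oplus>\<^bsub>t.TT\<^esub> h g y)" unfolding \<rho>_def
      by (rule r2_cong[symmetric, OF lin_add[OF h[OF f] h[OF g] TT]])
        (simp add: h_def r1_add in1 f g)
    then show ?thesis unfolding \<rho>_def using r2_add[OF h[OF f] h[OF g]] by simp
  qed
  have \<rho>_scale: "\<rho> (\<lambda>z. c \<odot>\<^bsub>t.TT\<^esub> f z) = c \<odot>\<^bsub>t.TT\<^esub> \<rho> f" if f: "lin K t.TT t.TT f" and c: "c \<in> carrier K" for c f
  proof -
    have "\<rho> (\<lambda>z. c \<odot>\<^bsub>t.TT\<^esub> f z) = r2 (\<lambda>y. c \<odot>\<^bsub>t.TT\<^esub> h f y)" unfolding \<rho>_def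
      by (rule r2_cong[symmetric, OF scale_lin[OF TT h[OF f] c]])
        (simp add: h_def r1_scale in1 f c)
    then show ?thesis unfolding \<rho>_def using r2_scale[OF c h[OF f]] by simp
  qed
  have \<rho>_mult: "\<rho> (\<lambda>z. f (z \<otimes>\<^bsub>G\<^esub> u)) = u \<otimes>\<^bsub>G\<^esub> \<rho> f" if f: "lin K t.TT t.TT f" and u: "u \<in> carrier t.TT" for f u
  \<comment> \<open>Both sides are linear in \<open>u\<close>, the left one by
    \<open>\<rho>_add\<close> and \<open>\<rho>_scale\<close>, so \<open>u\<close> may be taken to
    be a pure tensor.\<close>
  proof (rule t.lin_eq_on_pt[OF TT _ mult_lin_l[OF \<rho>_closed[OF f]] _ u])
    have fu: "lin K t.TT t.TT (\<lambda>z. f (z \<otimes>\<^bsub>G\<^esub> u))" if "u \<in> carrier t.TT" for u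
      by (rule lin_comp[OF mult_lin_l[OF that] f])
    show "lin K t.TT t.TT (\<lambda>u. \<rho> (\<lambda>z. f (z \<otimes>\<^bsub>G\<^esub> u)))"
    proof (rule linI)
      fix u assume "u \<in> carrier t.TT"
      then show "\<rho> (\<lambda>z. f (z \<otimes>\<^bsub>G\<^esub> u)) \<in> carrier t.TT" by (intro \<rho>_closed fu)
    next
      fix u v assume u: "u \<in> carrier t.TT" and v: "v \<in> carrier t.TT"
      have "\<rho> (\<lambda>z. f (z \<otimes>\<^bsub>G\<^esub> (u \<oplus>\<^bsub>t.TT\<^esub> v))) = \<rho> (\<lambda>z. f (z \<otimes>\<^bsub>G\<^esub> u) \<oplus>\<^bsub>t.TT\<^esub> f (z \<otimes>\<^bsub>G\<^esub> v))"
        by (rule \<rho>_cong[symmetric, OF lin_add[OF fu[OF u] fu[OF v] TT]])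
          (simp add: linD(2)[OF mult_lin_r] linD(2)[OF f] mult_closed u v)
      then show "\<rho> (\<lambda>z. f (z \<otimes>\<^bsub>G\<^esub> (u \<oplus>\<^bsub>t.TT\<^esub> v))) = \<rho> (\<lambda>z. f (z \<otimes>\<^bsub>G\<^esub> u)) \<oplus>\<^bsub>t.TT\<^esub> \<rho> (\<lambda>z. f (z \<otimes>\<^bsub>G\<^esub> v))"
        using \<rho>_add[OF fu[OF u] fu[OF v]] by simp
    next
      fix c u assume c: "c \<in> carrier K" and u: "u \<in> carrier t.TT"
      have "\<rho> (\<lambda>z. f (z \<otimes>\<^bsub>G\<^esub> (c \<odot>\<^bsub>t.TT\<^esub> u))) = \<rho> (\<lambda>z. c \<odot>\<^bsub>t.TT\<^esub> f (z \<otimes>\<^bsub>G\<^esub> u))"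
        by (rule \<rho>_cong[symmetric, OF scale_lin[OF TT fu[OF u] c]])
          (simp add: linD(3)[OF mult_lin_r] linD(3)[OF f] mult_closed u c)
      then show "\<rho> (\<lambda>z. f (z \<otimes>\<^bsub>G\<^esub> (c \<odot>\<^bsub>t.TT\<^esub> u))) = c \<odot>\<^bsub>t.TT\<^esub> \<rho> (\<lambda>z. f (z \<otimes>\<^bsub>G\<^esub> u))"
        using \<rho>_scale[OF fu[OF u] c] by simp
    qed
    fix a b assume a: "a \<in> carrier A" and b: "b \<in> carrier B"
    have a1: "pt a \<one>\<^bsub>B\<^esub> \<in> carrier t.TT" and b1: "pt \<one>\<^bsub>A\<^esub> b \<in> carrier t.TT" using a b by (simp_all add: t.pt_closed)
    note hb = lin_comp[OF B_mult_lin(2)[OF b] h[OF f]]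
    have hy: "h (\<lambda>z. f (z \<otimes>\<^bsub>G\<^esub> pt a b)) y = pt a \<one>\<^bsub>B\<^esub> \<otimes>\<^bsub>G\<^esub> h f (y \<otimes>\<^bsub>B\<^esub> b)" if y: "y \<in> carrier B" for y
    proof -
      have yb: "y \<otimes>\<^bsub>B\<^esub> b \<in> carrier B" using y b by simp
      have "h (\<lambda>z. f (z \<otimes>\<^bsub>G\<^esub> pt a b)) y = r1 (\<lambda>x. f (pt (x \<otimes>\<^bsub>A\<^esub> a) (y \<otimes>\<^bsub>B\<^esub> b)))" unfolding h_def
        by (rule r1_cong[symmetric, OF lin_comp[OF A_mult_lin(2)[OF a] in1[OF f yb]]])
          (simp add: mult_pt a b y)
      then show ?thesis unfolding h_def using r1_mult[OF a in1[OF f yb]] by simp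
    qed
    have "\<rho> (\<lambda>z. f (z \<otimes>\<^bsub>G\<^esub> pt a b)) = r2 (\<lambda>y. pt a \<one>\<^bsub>B\<^esub> \<otimes>\<^bsub>G\<^esub> h f (y \<otimes>\<^bsub>B\<^esub> b))" unfolding \<rho>_def
      by (rule r2_cong[symmetric, OF lin_comp[OF hb mult_lin_r[OF a1]] hy])
    also have "\<dots> = pt a \<one>\<^bsub>B\<^esub> \<otimes>\<^bsub>G\<^esub> (pt \<one>\<^bsub>A\<^esub> b \<otimes>\<^bsub>G\<^esub> \<rho> f)"
      using r2_comm[OF a hb] r2_mult[OF b h[OF f]] by (simp add: \<rho>_def)
    also have "\<dots> = pt a b \<otimes>\<^bsub>G\<^esub> \<rho> f"
      using mult_assoc[OF a1 b1 \<rho>_closed[OF f]] mult_pt[of a "\<one>\<^bsub>B\<^esub>" "\<one>\<^bsub>A\<^esub>" b] a b by simp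
    finally show "\<rho> (\<lambda>z. f (z \<otimes>\<^bsub>G\<^esub> pt a b)) = pt a b \<otimes>\<^bsub>G\<^esub> \<rho> f" .
  qed
  have \<rho>_id: "\<rho> (\<lambda>z. z) = pt \<one>\<^bsub>A\<^esub> \<one>\<^bsub>B\<^esub>"
  proof -
    have "\<rho> (\<lambda>z. z) = r2 (\<lambda>y. pt \<one>\<^bsub>A\<^esub> y)" unfolding \<rho>_def
      by (rule r2_cong[symmetric, OF pt_lin_r]) (simp_all add: h_def r1_pt)
    then show ?thesis using r2_pt[of "\<one>\<^bsub>A\<^esub>"] by simp
  qed
  have gl: "lin K t.TT t.TT f" if "f \<in> mod_hom K G G" for f
    using mod_hom_lin[OF that] by (simp add: lin_def)
  have "G.avg \<rho>" unfolding G.avg_def G_simps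
  proof (intro conjI ballI)
    fix f assume "f \<in> mod_hom K G G"
    then show "\<rho> f \<in> carrier t.TT" using \<rho>_closed gl by blast
  next
    fix f g assume f: "f \<in> mod_hom K G G" and g: "g \<in> mod_hom K G G"
    have "\<rho> (\<lambda>z\<in>carrier t.TT. f z \<oplus>\<^bsub>t.TT\<^esub> g z) = \<rho> (\<lambda>z. f z \<oplus>\<^bsub>t.TT\<^esub> g z)"
      by (rule \<rho>_cong[symmetric, OF lin_add[OF gl[OF f] gl[OF g] TT]]) simp
    then show "\<rho> (\<lambda>z\<in>carrier t.TT. f z \<oplus>\<^bsub>t.TT\<^esub> g z) = \<rho> f \<oplus>\<^bsub>t.TT\<^esub> \<rho> g" using \<rho>_add[OF gl[OF f] gl[OF g]] by simp
  next
    fix f u assume f: "f \<in> mod_hom K G G" and u: "u \<in> carrier t.TT"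
    have "\<rho> (\<lambda>z\<in>carrier t.TT. f (z \<otimes>\<^bsub>G\<^esub> u)) = \<rho> (\<lambda>z. f (z \<otimes>\<^bsub>G\<^esub> u))"
      by (rule \<rho>_cong[symmetric, OF lin_comp[OF mult_lin_l[OF u] gl[OF f]]]) simp
    then show "\<rho> (\<lambda>z\<in>carrier t.TT. f (z \<otimes>\<^bsub>G\<^esub> u)) = u \<otimes>\<^bsub>G\<^esub> \<rho> f" using \<rho>_mult[OF gl[OF f] u] by simp
  next
    have "\<rho> (\<lambda>z\<in>carrier t.TT. z) = \<rho> (\<lambda>z. z)" by (rule \<rho>_cong[symmetric, OF lin_id]) simp
    then show "\<rho> (\<lambda>z\<in>carrier t.TT. z) = pt \<one>\<^bsub>A\<^esub> \<one>\<^bsub>B\<^esub>" using \<rho>_id by simp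
  qed
  then show "\<exists>\<rho>. G.avg \<rho>" by (rule exI[where x = \<rho>])
qed

lemma opp_pair: "alg_pair K (opp A) (opp B)"
  by (intro alg_pair.intro A.opp_fd B.opp_fd)

text \<open>The relations of the tensor product over the field involve addition and scalars only,
  and these are the same for an algebra and its opposite.\<close>

lemma tensor_opp: "tensor K (self_module K) (opp A) (opp B) = t.TT"
  "pure_tensor K (self_module K) (opp A) (opp B) = pt"
  by (simp_all add: fun_eq_iff tensor_def pure_tensor_def tensor_null_def tensor_rels_def scalars_def)

text \<open>On the common space the product of the opposite algebras is the reversed product of
  \<open>G\<close>. The two records may differ off the carrier, but an averaging operator sees only
  products of carrier elements, so it can be taken over.\<close>

theorem opp_G_avg:
  assumes "fd_algebra.avg K (opp A) \<rho>A" "fd_algebra.avg K (opp B) \<rho>B"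
  shows "\<exists>\<rho>. fd_algebra.avg K (opp G) \<rho>"
proof -
  interpret O: alg_pair K "opp A" "opp B" by (rule opp_pair)
  interpret OG: fd_algebra K "opp G" by (rule G.opp_fd)
  obtain \<rho> where \<rho>: "O.G.avg \<rho>" using O.G_avg[OF assms] by blast
  have mult: "s \<otimes>\<^bsub>O.G\<^esub> u = u \<otimes>\<^bsub>G\<^esub> s" if s: "s \<in> carrier t.TT" and u: "u \<in> carrier t.TT" for s u
  proof (rule t.lin_eq_on_pt[OF t.TT_left_module O.mult_lin_l[unfolded tensor_opp, OF u] mult_lin_r[OF u] _ s])
    fix a b assume a: "a \<in> carrier A" and b: "b \<in> carrier B"
    then have p: "pt a b \<in> carrier t.TT" by (rule t.pt_closed)
    show "pt a b \<otimes>\<^bsub>O.G\<^esub> u = u \<otimes>\<^bsub>G\<^esub> pt a b"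
    proof (rule t.lin_eq_on_pt[OF t.TT_left_module O.mult_lin_r[unfolded tensor_opp, OF p] mult_lin_l[OF p] _ u])
      fix a' b' assume "a' \<in> carrier A" "b' \<in> carrier B"
      then show "pt a b \<otimes>\<^bsub>O.G\<^esub> pt a' b' = pt a' b' \<otimes>\<^bsub>G\<^esub> pt a b"
        using O.mult_pt[unfolded tensor_opp, of a b a' b'] a b by (simp add: mult_pt)
    qed
  qed
  have eq: "mod_hom K O.G O.G = mod_hom K (opp G) (opp G)"
    by (simp add: mod_hom_def tensor_opp)
  have "OG.avg \<rho>"
    using \<rho> unfolding O.G.avg_def OG.avg_def eq O.G_simps opp_simps G_simps tensor_opp
    by (simp add: mult cong: restrict_cong)
  then show "\<exists>\<rho>. OG.avg \<rho>" by (rule exI[where x = \<rho>])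
qed

end

section \<open>Bimodules as modules over the enveloping algebra\<close>

text \<open>An action given on pure tensors extends to the whole algebra. \<open>R\<close> is left
  abstract so that \<open>G\<close> and its opposite are both covered; accordingly
  \<open>\<psi>m\<close> asks that the product of two pure tensors in \<open>R\<close> be some pure
  tensor that acts as the composite, which leaves the order of the factors open.\<close>

lemma (in alg_pair) action_left_module:
  assumes R: "ring R" "carrier R = carrier t.TT" "add R = add t.TT" "one R = pt \<one>\<^bsub>A\<^esub> \<one>\<^bsub>B\<^esub>"
    and Rl: "\<And>u. u \<in> carrier t.TT \<Longrightarrow> lin K t.TT t.TT (\<lambda>s. s \<otimes>\<^bsub>R\<^esub> u)"
    and Rr: "\<And>s. s \<in> carrier t.TT \<Longrightarrow> lin K t.TT t.TT (\<lambda>u. s \<otimes>\<^bsub>R\<^esub> u)"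
    and V: "left_module K V"
    and \<psi>l: "\<And>b x. \<lbrakk>b \<in> carrier B; x \<in> carrier V\<rbrakk> \<Longrightarrow> lin K A V (\<lambda>a. \<psi> a b x)"
    and \<psi>r: "\<And>a x. \<lbrakk>a \<in> carrier A; x \<in> carrier V\<rbrakk> \<Longrightarrow> lin K B V (\<lambda>b. \<psi> a b x)"
    and \<psi>x: "\<And>a b. \<lbrakk>a \<in> carrier A; b \<in> carrier B\<rbrakk> \<Longrightarrow> lin K V V (\<psi> a b)"
    and \<psi>1: "\<And>x. x \<in> carrier V \<Longrightarrow> \<psi> \<one>\<^bsub>A\<^esub> \<one>\<^bsub>B\<^esub> x = x"
    and \<psi>m: "\<And>a b a' b'. \<lbrakk>a \<in> carrier A; b \<in> carrier B; a' \<in> carrier A; b' \<in> carrier B\<rbrakk> \<Longrightarrow>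
        \<exists>c\<in>carrier A. \<exists>d\<in>carrier B. pt a b \<otimes>\<^bsub>R\<^esub> pt a' b' = pt c d \<and> (\<forall>x\<in>carrier V. \<psi> c d x = \<psi> a b (\<psi> a' b' x))"
  shows "left_module R (mk_module (carrier V) (zero V) (add V) (\<lambda>t x. tensor_lift K V (\<lambda>a b. \<psi> a b x) t))"
    and "\<lbrakk>a \<in> carrier A; b \<in> carrier B; x \<in> carrier V\<rbrakk> \<Longrightarrow> tensor_lift K V (\<lambda>a b. \<psi> a b x) (pt a b) = \<psi> a b x"
proof -
  interpret V: left_module K V by fact
  interpret R: ring R by fact
  let ?act = "\<lambda>t x. tensor_lift K V (\<lambda>a b. \<psi> a b x) t"
  have al: "lin K t.TT V (\<lambda>t. ?act t x)" if "x \<in> carrier V" for x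
    by (rule lift(1)[OF V \<psi>l \<psi>r]) (use that in auto)
  have apt: "?act (pt a b) x = \<psi> a b x" if "a \<in> carrier A" "b \<in> carrier B" "x \<in> carrier V" for a b x
    by (rule lift(2)[OF V \<psi>l \<psi>r]) (use that in auto)
  show "\<lbrakk>a \<in> carrier A; b \<in> carrier B; x \<in> carrier V\<rbrakk> \<Longrightarrow> ?act (pt a b) x = \<psi> a b x" by (rule apt)
  have acl: "?act t x \<in> carrier V" if "t \<in> carrier t.TT" "x \<in> carrier V" for t x
    using linD(1)[OF al[OF that(2)] that(1)] .
  have ax: "?act t (x \<oplus>\<^bsub>V\<^esub> y) = ?act t x \<oplus>\<^bsub>V\<^esub> ?act t y" if t: "t \<in> carrier t.TT" and x: "x \<in> carrier V" and y: "y \<in> carrier V" for t x y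
    by (rule t.lin_eq_on_pt[OF V al lin_add[OF al[OF x] al[OF y] V] _ t]) (simp_all add: x y apt linD(2)[OF \<psi>x])
  have assoc: "?act (s \<otimes>\<^bsub>R\<^esub> u) x = ?act s (?act u x)"
    if s: "s \<in> carrier t.TT" and u: "u \<in> carrier t.TT" and x: "x \<in> carrier V" for s u x
  proof (rule t.lin_eq_on_pt[OF V lin_comp[OF Rl[OF u] al[OF x]] al[OF acl[OF u x]] _ s])
    fix a b assume a: "a \<in> carrier A" and b: "b \<in> carrier B"
    then have p: "pt a b \<in> carrier t.TT" by (rule t.pt_closed)
    have "?act (pt a b \<otimes>\<^bsub>R\<^esub> u) x = \<psi> a b (?act u x)"
    proof (rule t.lin_eq_on_pt[OF V lin_comp[OF Rr[OF p] al[OF x]] lin_comp[OF al[OF x] \<psi>x[OF a b]] _ u])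
      fix a' b' assume a': "a' \<in> carrier A" and b': "b' \<in> carrier B"
      obtain c d where "c \<in> carrier A" "d \<in> carrier B" "pt a b \<otimes>\<^bsub>R\<^esub> pt a' b' = pt c d"
        "\<forall>x\<in>carrier V. \<psi> c d x = \<psi> a b (\<psi> a' b' x)" using \<psi>m[OF a b a' b'] by blast
      then show "?act (pt a b \<otimes>\<^bsub>R\<^esub> pt a' b') x = \<psi> a b (?act (pt a' b') x)"
        by (simp add: apt x a' b')
    qed
    then show "?act (pt a b \<otimes>\<^bsub>R\<^esub> u) x = ?act (pt a b) (?act u x)"
      using apt[OF a b acl[OF u x]] by simp
  qed
  show "left_module R (mk_module (carrier V) (zero V) (add V) ?act)"
  proof (rule left_moduleI, goal_cases)
    case (7 x) then show ?case using V.l_neg by auto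
  next
    case (9 s u x) then show ?case using linD(2)[OF al] by (simp add: R)
  next
    case (11 s u x) then show ?case using assoc by (simp add: R)
  qed (simp_all add: R V.a_ac acl ax apt \<psi>1)
qed

section \<open>Bimodules over the enveloping algebra\<close>

locale env_pair = alg_pair K A "opp A"
  for K :: "('k, 'z) ring_scheme" and A :: "('k, 'a) module" +
  assumes A_selfinj: "selfinjective A"
begin

lemma env_eq: "env_algebra K A = G" by (simp add: env_algebra_def)

lemma avg_A: "\<exists>\<rho>. A.avg \<rho>" "\<exists>\<rho>. B.avg \<rho>"
  using A.avg_exists B.avg_exists A_selfinj unfolding selfinjective_def by blast+

lemma avg_G: "\<exists>\<rho>. G.avg \<rho>" "\<exists>\<rho>. fd_algebra.avg K (opp G) \<rho>"
proof -
  obtain \<rho> \<rho>' where "A.avg \<rho>" "B.avg \<rho>'" using avg_A by blast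
  then show "\<exists>\<rho>. G.avg \<rho>" "\<exists>\<rho>. fd_algebra.avg K (opp G) \<rho>"
    \<comment> \<open>\<open>opp (opp A)\<close> is \<open>A\<close>, so for the opposite of the
      enveloping algebra the two operators exchange their places.\<close>
    using G_avg opp_G_avg[of \<rho>' \<rho>] by simp_all
qed

context
  fixes M :: "('a, 'b) bimodule"
  assumes M: "is_bimodule K A M"
begin

lemma L: "left_module A (bimod_l M)" and Rt: "left_module (opp A) (bimod_r M)"
  using M by (simp_all add: is_bimodule_def)

interpretation L: left_module A "bimod_l M" by (rule L)
interpretation Rt: left_module "opp A" "bimod_r M" by (rule Rt)

lemma bimod_simps [simp]:
  "carrier (bimod_l M) = carrier M" "zero (bimod_l M) = zero M" "add (bimod_l M) = add M"
  "smult (bimod_l M) = lact M"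
  "carrier (bimod_r M) = carrier M" "zero (bimod_r M) = zero M" "add (bimod_r M) = add M"
  "smult (bimod_r M) = (\<lambda>a x. ract M x a)"
  by (simp_all add: bimod_l_def bimod_r_def)

abbreviation "VM \<equiv> scalars A (bimod_l M)"

lemma VM: "left_module K VM" by (rule A.scalars_left_module[OF L])

lemma comm: "\<lbrakk>a \<in> carrier A; a' \<in> carrier A; x \<in> carrier M\<rbrakk> \<Longrightarrow> ract M (lact M a x) a' = lact M a (ract M x a')"
  using M by (simp add: is_bimodule_def)

lemma sc_comm: "\<lbrakk>c \<in> carrier K; x \<in> carrier M\<rbrakk> \<Longrightarrow> ract M x (A.sc c) = lact M (A.sc c) x"
  using M by (simp add: is_bimodule_def A.sc_def)

lemma lact_closed [simp]: "\<lbrakk>a \<in> carrier A; x \<in> carrier M\<rbrakk> \<Longrightarrow> lact M a x \<in> carrier M"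
  using L.smult_closed by simp

lemma ract_closed [simp]: "\<lbrakk>a \<in> carrier A; x \<in> carrier M\<rbrakk> \<Longrightarrow> ract M x a \<in> carrier M"
  using Rt.smult_closed[of a x] by simp

lemma lact_lin: "a \<in> carrier A \<Longrightarrow> lin K VM VM (lact M a)"
proof (rule linI)
  fix c x assume "a \<in> carrier A" "c \<in> carrier K" "x \<in> carrier VM"
  then show "lact M a (c \<odot>\<^bsub>VM\<^esub> x) = c \<odot>\<^bsub>VM\<^esub> lact M a x"
    using L.smult_assoc1[of a "A.sc c" x] L.smult_assoc1[of "A.sc c" a x] A.sc_central[of c a] by simp
qed (use L.smult_r_distr in auto)

lemma ract_lin: "a \<in> carrier A \<Longrightarrow> lin K VM VM (\<lambda>x. ract M x a)"
  by (rule linI) (use Rt.smult_r_distr[of a] comm in auto)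

lemma lact_lin': "x \<in> carrier M \<Longrightarrow> lin K A VM (\<lambda>a. lact M a x)"
proof (rule linI)
  fix c a assume "x \<in> carrier M" "c \<in> carrier K" "a \<in> carrier A"
  then show "lact M (c \<odot>\<^bsub>A\<^esub> a) x = c \<odot>\<^bsub>VM\<^esub> lact M a x"
    using L.smult_assoc1[of "A.sc c" a x] A.sc_smult[of c a] by simp
qed (use L.smult_l_distr in auto)

lemma ract_lin': "x \<in> carrier M \<Longrightarrow> lin K A VM (\<lambda>a. ract M x a)"
proof (rule linI)
  fix c a assume x: "x \<in> carrier M" and c: "c \<in> carrier K" and a: "a \<in> carrier A"
  have "ract M x (a \<otimes>\<^bsub>A\<^esub> A.sc c) = ract M (ract M x a) (A.sc c)"
    using Rt.smult_assoc1[of "A.sc c" a x] x c a by simp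
  then show "ract M x (c \<odot>\<^bsub>A\<^esub> a) = c \<odot>\<^bsub>VM\<^esub> ract M x a"
    using sc_comm[OF c, of "ract M x a"] A.sc_smult'[OF c a] x a by simp
qed (use Rt.smult_l_distr in auto)

lemma lact_assoc: "\<lbrakk>a \<in> carrier A; b \<in> carrier A; x \<in> carrier M\<rbrakk> \<Longrightarrow> lact M (a \<otimes>\<^bsub>A\<^esub> b) x = lact M a (lact M b x)"
  using L.smult_assoc1 by simp

lemma ract_assoc: "\<lbrakk>a \<in> carrier A; b \<in> carrier A; x \<in> carrier M\<rbrakk> \<Longrightarrow> ract M x (b \<otimes>\<^bsub>A\<^esub> a) = ract M (ract M x b) a"
  using Rt.smult_assoc1[of a b x] by simp

lemma unit_acts: "x \<in> carrier M \<Longrightarrow> lact M \<one>\<^bsub>A\<^esub> x = x" "x \<in> carrier M \<Longrightarrow> ract M x \<one>\<^bsub>A\<^esub> = x"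
  using L.smult_one[of x] Rt.smult_one[of x] by simp_all

lemma lin_opp: "lin K (opp A) V f \<longleftrightarrow> lin K A V f"
  by (simp add: lin_def)

lemma env_left_module: "left_module G (env_left K A M)"
  and env_left_pt: "\<lbrakk>a \<in> carrier A; a' \<in> carrier A; x \<in> carrier M\<rbrakk> \<Longrightarrow>
    pt a a' \<odot>\<^bsub>env_left K A M\<^esub> x = ract M (lact M a x) a'"
proof -
  note act = action_left_module[OF G_ring _ _ _ mult_lin_l mult_lin_r VM, where \<psi> = "\<lambda>a a' x. ract M (lact M a x) a'"]
  have 1: "lin K A VM (\<lambda>a. ract M (lact M a x) b)" if "b \<in> carrier (opp A)" "x \<in> carrier VM" for b x
    using lin_comp[OF lact_lin'[of x] ract_lin[of b]] that by simp
  have 2: "lin K (opp A) VM (\<lambda>b. ract M (lact M a x) b)" if "a \<in> carrier A" "x \<in> carrier VM" for a x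
    unfolding lin_opp using ract_lin'[of "lact M a x"] that by simp
  have 3: "lin K VM VM (\<lambda>x. ract M (lact M a x) b)" if "a \<in> carrier A" "b \<in> carrier (opp A)" for a b
    using lin_comp[OF lact_lin[of a] ract_lin[of b]] that by simp
  have 4: "ract M (lact M \<one>\<^bsub>A\<^esub> x) \<one>\<^bsub>opp A\<^esub> = x" if "x \<in> carrier VM" for x
    using that by (simp add: unit_acts)
  have 5: "\<exists>c\<in>carrier A. \<exists>d\<in>carrier (opp A). pt a b \<otimes>\<^bsub>G\<^esub> pt a' b' = pt c d \<and>
      (\<forall>x\<in>carrier VM. ract M (lact M c x) d = ract M (lact M a (ract M (lact M a' x) b')) b)"
    if "a \<in> carrier A" "b \<in> carrier (opp A)" "a' \<in> carrier A" "b' \<in> carrier (opp A)" for a b a' b'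
    by (intro bexI[of _ "a \<otimes>\<^bsub>A\<^esub> a'"] bexI[of _ "b \<otimes>\<^bsub>opp A\<^esub> b'"])
      (use that in \<open>auto simp: mult_pt lact_assoc ract_assoc comm\<close>)
  note act = act[OF _ _ _ _ _ 1 2 3 4 5]
  have eq: "env_left K A M = mk_module (carrier VM) (zero VM) (add VM)
      (\<lambda>t x. tensor_lift K VM (\<lambda>a a'. ract M (lact M a x) a') t)"
    by (simp add: env_left_def)
  show "left_module G (env_left K A M)" unfolding eq by (rule act(1)) simp_all
  show "pt a a' \<odot>\<^bsub>env_left K A M\<^esub> x = ract M (lact M a x) a'" if "a \<in> carrier A" "a' \<in> carrier A" "x \<in> carrier M"
    unfolding eq mk_module_simps by (rule act(2)) (use that in simp_all)
qed

lemma env_right_module: "left_module (opp G) (env_right K A M)"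
  and env_right_pt: "\<lbrakk>a \<in> carrier A; a' \<in> carrier A; x \<in> carrier M\<rbrakk> \<Longrightarrow>
    pt a a' \<odot>\<^bsub>env_right K A M\<^esub> x = ract M (lact M a' x) a"
proof -
  have ml: "lin K t.TT t.TT (\<lambda>s. s \<otimes>\<^bsub>opp G\<^esub> u)" "lin K t.TT t.TT (\<lambda>s. u \<otimes>\<^bsub>opp G\<^esub> s)" if "u \<in> carrier t.TT" for u
    using mult_lin_l[OF that] mult_lin_r[OF that] by simp_all
  note act = action_left_module[OF ring_opp[OF G_ring] _ _ _ ml VM, where \<psi> = "\<lambda>a a' x. ract M (lact M a' x) a"]
  have 1: "lin K A VM (\<lambda>a. ract M (lact M b x) a)" if "b \<in> carrier (opp A)" "x \<in> carrier VM" for b x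
    using ract_lin'[of "lact M b x"] that by simp
  have 2: "lin K (opp A) VM (\<lambda>b. ract M (lact M b x) a)" if "a \<in> carrier A" "x \<in> carrier VM" for a x
    unfolding lin_opp using lin_comp[OF lact_lin'[of x] ract_lin[of a]] that by simp
  have 3: "lin K VM VM (\<lambda>x. ract M (lact M b x) a)" if "a \<in> carrier A" "b \<in> carrier (opp A)" for a b
    using lin_comp[OF lact_lin[of b] ract_lin[of a]] that by simp
  have 4: "ract M (lact M \<one>\<^bsub>opp A\<^esub> x) \<one>\<^bsub>A\<^esub> = x" if "x \<in> carrier VM" for x
    using that by (simp add: unit_acts)
  have 5: "\<exists>c\<in>carrier A. \<exists>d\<in>carrier (opp A). pt a b \<otimes>\<^bsub>opp G\<^esub> pt a' b' = pt c d \<and>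
      (\<forall>x\<in>carrier VM. ract M (lact M d x) c = ract M (lact M b (ract M (lact M b' x) a')) a)"
    if "a \<in> carrier A" "b \<in> carrier (opp A)" "a' \<in> carrier A" "b' \<in> carrier (opp A)" for a b a' b'
    \<comment> \<open>The factors appear in reversed order because the product is taken in
      \<open>opp G\<close>.\<close>
    by (intro bexI[of _ "a' \<otimes>\<^bsub>A\<^esub> a"] bexI[of _ "b' \<otimes>\<^bsub>opp A\<^esub> b"])
      (use that in \<open>auto simp: mult_pt lact_assoc ract_assoc comm\<close>)
  note act = act[OF _ _ _ _ _ 1 2 3 4 5]
  have eq: "env_right K A M = mk_module (carrier VM) (zero VM) (add VM)
      (\<lambda>t x. tensor_lift K VM (\<lambda>a a'. ract M (lact M a' x) a) t)"
    by (simp add: env_right_def)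
  show "left_module (opp G) (env_right K A M)" unfolding eq by (rule act(1)) simp_all
  show "pt a a' \<odot>\<^bsub>env_right K A M\<^esub> x = ract M (lact M a' x) a" if "a \<in> carrier A" "a' \<in> carrier A" "x \<in> carrier M"
    unfolding eq mk_module_simps by (rule act(2)) (use that in simp_all)
qed

lemma env_simps [simp]:
  "carrier (env_left K A M) = carrier M" "add (env_left K A M) = add M"
  "carrier (env_right K A M) = carrier M" "add (env_right K A M) = add M"
  by (simp_all add: env_left_def env_right_def)

lemma G_sc: "c \<in> carrier K \<Longrightarrow> G.sc c = pt (A.sc c) \<one>\<^bsub>A\<^esub>"
  using pt_smult_l[of c "\<one>\<^bsub>A\<^esub>" "\<one>\<^bsub>A\<^esub>"] by (simp add: G.sc_def A.sc_def)

lemma scalars_env_left: "lin K VM (scalars G (env_left K A M)) (\<lambda>x. x)"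
  by (rule linI) (simp_all add: G_sc env_left_pt unit_acts)

text \<open>A scalar acts in the same way from the left and from the right of a bimodule, so both
  enveloping modules have the same underlying vector space. This transfers finite dimension to the
  right module.\<close>

lemma scalars_env_right: "lin K (scalars G (env_left K A M)) (scalars G (env_right K A M)) (\<lambda>x. x)"
  by (rule linI) (simp_all add: G_sc env_left_pt env_right_pt unit_acts sc_comm)

lemma env_right_fin_gen:
  assumes "fin_gen G (env_left K A M)"
  shows "fin_gen K (scalars G (env_right K A M))"
proof -
  have "fin_gen K (scalars G (env_left K A M))" using assms G.fin_gen_scalars_iff[OF env_left_module] by simp
  then show ?thesis
    by (rule fin_gen_surj[OF _ scalars_env_right G.scalars_left_module[OF env_left_module] G.right_scalars[OF env_right_module]])
      simp
qed

end

lemma regular: "is_bimodule K A (regular_bimodule A)"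
proof -
  have "left_module A (bimod_l (regular_bimodule A))"
    by (rule left_module_cong[OF A.A_self]) (simp_all add: bimod_l_def regular_bimodule_def)
  moreover have "left_module (opp A) (bimod_r (regular_bimodule A))"
    by (rule left_module_cong[OF B.A_self]) (simp_all add: bimod_r_def regular_bimodule_def)
  ultimately show ?thesis
    unfolding is_bimodule_def
    by (auto simp: regular_bimodule_def A.A.m_assoc A.sc_def[symmetric] A.sc_smult A.sc_smult')
qed

text \<open>\<open>A\<close> is finite dimensional, and scalars of the enveloping algebra act on it
  as the usual ones.\<close>

lemma regular_fin_gen: "fin_gen G (env_left K A (regular_bimodule A))"
proof -
  have "lin K A (scalars A (bimod_l (regular_bimodule A))) (\<lambda>x. x)"
    by (rule linI) (simp_all add: bimod_l_def regular_bimodule_def A.sc_smult)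
  from lin_comp[OF this scalars_env_left[OF regular]]
  have "fin_gen K (scalars G (env_left K A (regular_bimodule A)))"
    by (rule fin_gen_surj[OF A.A_fg _ A.A_left_module G.scalars_left_module[OF env_left_module[OF regular]]])
      (simp add: regular_bimodule_def env_left_def)
  then show ?thesis using G.fin_gen_scalars_iff[OF env_left_module[OF regular]] by simp
qed

text \<open>\<open>a \<otimes> a'\<close> is the product of \<open>1 \<otimes> a'\<close> and
  \<open>a \<otimes> 1\<close>, so the action rebuilt from the two one-sided actions agrees with the
  original one on pure tensors, and by linearity everywhere.\<close>

lemma env_left_env_bimodule:
  assumes N: "left_module G N" and s: "s \<in> carrier G" and x: "x \<in> carrier N"
  shows "s \<odot>\<^bsub>env_left K A (env_bimodule K A N)\<^esub> x = s \<odot>\<^bsub>N\<^esub> x"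
proof -
  interpret N: left_module G N by (rule N)
  let ?V = "scalars A (bimod_l (env_bimodule K A N))"
  have V: "left_module K ?V"
    by (rule left_module_cong[OF G.scalars_left_module[OF N]])
      (simp_all add: bimod_l_def env_bimodule_def Let_def G_sc[OF regular])
  have ptG: "pt a b \<in> carrier G" if "a \<in> carrier A" "b \<in> carrier A" for a b
    using t.pt_closed[of a b] that by simp
  have act: "lin K t.TT ?V (\<lambda>s. s \<odot>\<^bsub>N\<^esub> x)"
  proof (rule linI)
    fix c s assume c: "c \<in> carrier K" and s: "s \<in> carrier t.TT"
    have "(c \<odot>\<^bsub>t.TT\<^esub> s) \<odot>\<^bsub>N\<^esub> x = G.sc c \<odot>\<^bsub>N\<^esub> (s \<odot>\<^bsub>N\<^esub> x)"
      using N.smult_assoc1[of "G.sc c" s x] G.sc_smult[OF c, of s] G.sc_closed[OF c] c s x by simp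
    then show "(c \<odot>\<^bsub>t.TT\<^esub> s) \<odot>\<^bsub>N\<^esub> x = c \<odot>\<^bsub>?V\<^esub> (s \<odot>\<^bsub>N\<^esub> x)"
      by (simp add: bimod_l_def env_bimodule_def Let_def G_sc[OF regular c])
  qed (use x N.smult_closed N.smult_l_distr in \<open>auto simp: bimod_l_def env_bimodule_def Let_def\<close>)
  let ?\<phi> = "\<lambda>a a'. pt \<one>\<^bsub>A\<^esub> a' \<odot>\<^bsub>N\<^esub> (pt a \<one>\<^bsub>A\<^esub> \<odot>\<^bsub>N\<^esub> x)"
  have \<phi>: "?\<phi> a a' = pt a a' \<odot>\<^bsub>N\<^esub> x" if "a \<in> carrier A" "a' \<in> carrier A" for a a'
    using N.smult_assoc1[of "pt \<one>\<^bsub>A\<^esub> a'" "pt a \<one>\<^bsub>A\<^esub>" x] ptG mult_pt[of "\<one>\<^bsub>A\<^esub>" a' a "\<one>\<^bsub>A\<^esub>"] that x by simp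
  have l: "lin K A ?V (\<lambda>a. ?\<phi> a a')" if "a' \<in> carrier (opp A)" for a'
    by (rule lin_cong[OF lin_comp[OF pt_lin_l[OF that] act] A.A_left_module]) (use \<phi> that in simp)
  have r: "lin K (opp A) ?V (?\<phi> a)" if "a \<in> carrier A" for a
    by (rule lin_cong[OF lin_comp[OF pt_lin_r[OF that] act] B.A_left_module]) (use \<phi> that in simp)
  have "tensor_lift K ?V ?\<phi> s = s \<odot>\<^bsub>N\<^esub> x"
    by (rule t.lin_eq_on_pt[OF V lift(1)[OF V l r] act]) (use lift(2)[OF V l r] \<phi> s in simp_all)
  then show ?thesis by (simp add: env_left_def env_bimodule_def Let_def)
qed

section \<open>The duality isomorphisms for Tate-Hochschild groups\<close>

theorem HH_homology_dual:
  assumes M: "is_bimodule K A M" and fg: "fin_gen G (env_left K A M)"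
  shows "mod_iso K (tate_HH_homology K A n M)
    (tate_Tor K G (- (n + 1)) (env_star K A) (k_dual K G (env_right K A M)))"
proof -
  obtain \<rho> \<rho>' where av: "G.avg \<rho>" "fd_algebra.avg K (opp G) \<rho>'" using avg_G by blast
  show ?thesis unfolding tate_HH_homology_def env_star_def env_eq
    by (rule G.tate_Tor_dual[OF av env_left_module[OF regular] regular_fin_gen env_right_module[OF M]
          env_right_fin_gen[OF M fg]])
qed

theorem HH_cohomology_dual:
  assumes M: "is_bimodule K A M" and fg: "fin_gen G (env_left K A M)"
  shows "mod_iso K (tate_HH_cohomology K A n M)
    (tate_Ext G (- (n + 1)) (env_left K A M) (k_dual K G (env_star K A)))"
proof -
  obtain \<rho> \<rho>' where av: "G.avg \<rho>" "fd_algebra.avg K (opp G) \<rho>'" using avg_G by blast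
  show ?thesis unfolding tate_HH_cohomology_def env_star_def env_eq
    by (rule G.tate_Ext_dual[OF av env_left_module[OF regular] regular_fin_gen env_left_module[OF M] fg])
qed

text \<open>For the regular bimodule the first argument of \<open>Ext\<close> in the cohomological
  duality is again the regular one, so the result is a Tate-Hochschild group once its coefficient
  module is written as the module of a bimodule. The two modules agree on carriers, which is where
  \<open>tate_Ext_cong\<close> applies.\<close>

theorem HH_cohomology_regular_dual:
  "mod_iso K (tate_HH_cohomology K A n (regular_bimodule A))
    (tate_HH_cohomology K A (- (n + 1)) (env_bimodule K A (k_dual K G (env_star K A))))"
proof -
  obtain \<rho> \<rho>' where av: "G.avg \<rho>" "fd_algebra.avg K (opp G) \<rho>'" using avg_G by blast
  let ?N = "k_dual K G (env_star K A)"
  have N: "left_module G ?N" unfolding env_star_def env_eq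
    by (rule G.Dst[OF env_left_module[OF regular]])
  have "mod_iso K (tate_Ext G (- (n + 1)) (env_left K A (regular_bimodule A)) ?N)
      (tate_Ext G (- (n + 1)) (env_left K A (regular_bimodule A)) (env_left K A (env_bimodule K A ?N)))"
    by (rule G.tate_Ext_cong[OF av env_left_module[OF regular] regular_fin_gen N])
      (simp_all add: env_left_env_bimodule[OF N], simp_all add: env_left_def env_bimodule_def Let_def)
  from mod_iso_trans[OF HH_cohomology_dual[OF regular regular_fin_gen] this]
  show ?thesis unfolding tate_HH_cohomology_def env_eq .
qed

end

theorem theorem2p6:
  fixes K :: "'k ring" and \<Lambda> :: "('k, 'a) module" and B :: "('a, 'b) bimodule"
  assumes "field K"
    and "k_algebra K \<Lambda>"
    and "fin_gen K \<Lambda>"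
    and "selfinjective \<Lambda>"
    and "is_bimodule K \<Lambda> B"
    and "fin_gen (env_algebra K \<Lambda>) (env_left K \<Lambda> B)"
  shows "(\<forall>n::int. mod_iso K
            (tate_HH_homology K \<Lambda> n B)
            (tate_Tor K (env_algebra K \<Lambda>) (- (n + 1)) (env_star K \<Lambda>)
              (k_dual K (env_algebra K \<Lambda>) (env_right K \<Lambda> B)))) \<and>
         (\<forall>n::int. mod_iso K
            (tate_HH_cohomology K \<Lambda> n B)
            (tate_Ext (env_algebra K \<Lambda>) (- (n + 1)) (env_left K \<Lambda> B)
              (k_dual K (env_algebra K \<Lambda>) (env_star K \<Lambda>)))) \<and>
         (\<forall>n::int. mod_iso K
            (tate_HH_homology K \<Lambda> n (regular_bimodule \<Lambda>))
            (tate_Tor K (env_algebra K \<Lambda>) (- (n + 1)) (env_star K \<Lambda>)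
              (k_dual K (env_algebra K \<Lambda>) (env_right K \<Lambda> (regular_bimodule \<Lambda>))))) \<and>
         (\<forall>n::int. mod_iso K
            (tate_HH_cohomology K \<Lambda> n (regular_bimodule \<Lambda>))
            (tate_HH_cohomology K \<Lambda> (- (n + 1))
              (env_bimodule K \<Lambda> (k_dual K (env_algebra K \<Lambda>) (env_star K \<Lambda>)))))"
proof -
  have fd: "fd_algebra K \<Lambda>" by (rule fd_algebra.intro) fact+
  interpret env_pair K \<Lambda>
    by (intro env_pair.intro alg_pair.intro env_pair_axioms.intro fd fd_algebra.opp_fd[OF fd]) fact
  \<comment> \<open>Within the locale the enveloping algebra is called \<open>G\<close>, so the
    generation hypothesis is rewritten to match.\<close>
  note B = assms(5) assms(6)[unfolded env_eq]
  show ?thesis unfolding env_eq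
    using HH_homology_dual[OF B] HH_cohomology_dual[OF B]
      HH_homology_dual[OF regular regular_fin_gen] HH_cohomology_regular_dual by blast
qed


end
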